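(* Let $\mathbb{K}$ be a field of characteristic $0$. The operad $\mathcal{FG}$ of forests of rooted Greg hypertrees, with partial compositions given by insertion, is isomorphic to the operad $\mathrm{ComGreg}$.
   Context: **ComGreg.** Operads are symmetric operads in $\mathbb{K}$-vector spaces; a transposition acts on an operation by exchanging the corresponding inputs; $\mathcal{T}\{\dots\}$ is the free operad on the given binary generators. $\mathrm{ComGreg}$ is the quotient of $\mathcal{T}\{x,y,c,g\}$, with $x.(1\;2)=y$, $c.(1\;2)=c$, $g.(1\;2)=g$, by the ideal generated by $(x\circ_1 x - x\circ_2 x) - (x\circ_1 x - x\circ_2 x).(2\;3)$; $\;x\circ_1 c - (c\circ_1 x).(2\;3) - c\circ_2 x$; $\;c\circ_1 c - c\circ_2 c$; and $(x\circ_1 g - (g\circ_1 x).(2\;3) - g\circ_2 x)-(x\circ_1 g - (g\circ_1 x).(2\;3) - g\circ_2 x).(2\;3)$. **Forests of rooted Greg hypertrees.** A hypergraph is a pair $(\mathcal V,\mathcal E)$ with $\mathcal V$ a finite set and $\mathcal E$ a set of subsets of $\mathcal V$ of cardinality at least $2$ (edges). A cycle consists of $n\ge 2$ distinct vertices $v_1,\dots,v_n$ and $n$ distinct edges $e_1,\dots,e_n$ with $v_{i-1},v_i\in e_i$ (indices mod $n$). A rooted hypertree is a nonempty connected hypergraph without cycles with a distinguished vertex, the root. Every edge $e$ has a unique vertex closest to the root, its parent vertex; the other vertices of $e$ are children of it via $e$; $e$ is called an incoming edge of its parent vertex. A forest of rooted hypertrees is a nonempty finite set of rooted hypertrees on disjoint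 vertex sets. A forest of rooted Greg hypertrees labeled by a finite set $L$ is a forest of rooted hypertrees whose vertices are each black or white, with a bijection from the white vertices to $L$, black vertices being unlabeled and having at least two incoming edges (considered up to isomorphism preserving roots, colours and labels). $\mathcal{FG}(L)$ is the $\mathbb{K}$-vector space with basis the set of such forests. **Insertion.** Let $S\in\mathcal{FG}(A\sqcup\{i\})$ and $T\in\mathcal{FG}(B)$ be forests, $v_i$ the white vertex of $S$ labeled $i$, and $I$ the set of incoming edges of $v_i$. Then $S\circ_i T=\sum_{f:I\to \mathcal V(T)} S\circ_i^f T$ (with $\mathcal V(T)$ the set of all black and white vertices of $T$), where $S\circ_i^f T$ has vertex set $(\mathcal V(S)\setminus\{v_i\})\sqcup\mathcal V(T)$ and edges: all edges of $T$; all edges of $S$ not containing $v_i$; the edge $(e\setminus\{v_i\})\cup\{f(e)\}$ for each $e\in I$ (with parent vertex $f(e)$); and, if $v_i$ is not a root of $S$, the edge $(e_0\setminus\{v_i\})\cup\mathrm{roots}(T)$, where $e_0$ is the edge of $S$ in which $v_i$ is a child. The roots are those of $S$ if $v_i$ is not a root, and $(\mathrm{roots}(S)\setminus\{v_i\})\cup\mathrm{roots}(T)$ otherwise. *)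

theory Defs
  imports
    "HOL-Algebra.Module"
    "HOL-Algebra.AbelCoset"
    "HOL-Library.Poly_Mapping"
    "HOL-Library.FuncSet"
    "HOL-Combinatorics.Transposition"
begin

section \<open>Vector spaces\<close>

text \<open>
  Vector spaces over the field \<open>'k\<close> are modules over the following ring.  The type of module
  records extends the type of ring records; the fields \<open>mult\<close> and \<open>one\<close> of a module record
  carry no meaning.
\<close>

definition scalars :: "'k::field ring" where
  "scalars = \<lparr>carrier = UNIV, mult = (*), one = 1, zero = 0, add = (+)\<rparr>"

definition linear_maps :: "('k, 'v) module \<Rightarrow> ('k, 'w) module \<Rightarrow> ('v \<Rightarrow> 'w) set" where
  "linear_maps M N =
    {f \<in> carrier M \<rightarrow> carrier N.
      (\<forall>u\<in>carrier M. \<forall>v\<in>carrier M. f (u \<oplus>\<^bsub>M\<^esub> v) = f u \<oplus>\<^bsub>N\<^esub> f v) \<and>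
      (\<forall>k. \<forall>u\<in>carrier M. f (k \<odot>\<^bsub>M\<^esub> u) = k \<odot>\<^bsub>N\<^esub> f u)}"

definition quotient_module :: "('k, 'v) module \<Rightarrow> 'v set \<Rightarrow> ('k, 'v set) module" where
  "quotient_module M N =
    \<lparr>carrier = a_rcosets\<^bsub>M\<^esub> N, mult = undefined, one = undefined,
     zero = N, add = set_add M, smult = (\<lambda>k X. \<Union>x\<in>X. N +>\<^bsub>M\<^esub> (k \<odot>\<^bsub>M\<^esub> x))\<rparr>"

definition pm_scale :: "'k::field \<Rightarrow> ('b \<Rightarrow>\<^sub>0 'k) \<Rightarrow> ('b \<Rightarrow>\<^sub>0 'k)" where
  "pm_scale k u = Poly_Mapping.map ((*) k) u"

definition free_space :: "'b set \<Rightarrow> ('k::field, 'b \<Rightarrow>\<^sub>0 'k) module" where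
  "free_space X =
    \<lparr>carrier = {u. Poly_Mapping.keys u \<subseteq> X}, mult = undefined, one = undefined,
     zero = 0, add = (+), smult = pm_scale\<rparr>"

abbreviation basis_vec :: "'b \<Rightarrow> ('b \<Rightarrow>\<^sub>0 'k::field)" where
  "basis_vec b \<equiv> Poly_Mapping.single b 1"

definition lin_ext :: "('b \<Rightarrow> ('c \<Rightarrow>\<^sub>0 'k)) \<Rightarrow> ('b \<Rightarrow>\<^sub>0 'k::field) \<Rightarrow> ('c \<Rightarrow>\<^sub>0 'k)" where
  "lin_ext f u = (\<Sum>b\<in>Poly_Mapping.keys u. pm_scale (Poly_Mapping.lookup u b) (f b))"

definition bilin_ext ::
  "('a \<Rightarrow> 'b \<Rightarrow> ('c \<Rightarrow>\<^sub>0 'k)) \<Rightarrow> ('a \<Rightarrow>\<^sub>0 'k::field) \<Rightarrow> ('b \<Rightarrow>\<^sub>0 'k) \<Rightarrow> ('c \<Rightarrow>\<^sub>0 'k)" where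
  "bilin_ext f u v = lin_ext (\<lambda>a. lin_ext (f a) v) u"


section \<open>Symmetric operads\<close>

text \<open>
  Symmetric operads are presented by partial compositions, with inputs labelled by the elements
  of an arbitrary finite set \<open>L\<close> of natural numbers:
  \<^item> \<open>op_space P L\<close> is the space \<open>P(L)\<close> of operations with set of inputs \<open>L\<close>;
  \<^item> \<open>op_relabel P L \<sigma>\<close> is the map \<open>P(L) \<rightarrow> P(\<sigma>(L))\<close> induced by an injection \<open>\<sigma>\<close> on \<open>L\<close>;
  \<^item> \<open>op_comp P A i B\<close> is \<open>\<circ>\<^sub>i\<close> from \<open>P(A \<squnion> {i}) \<times> P(B)\<close> to \<open>P(A \<squnion> B)\<close>;
  \<^item> \<open>op_unit P i\<close> is the identity operation in \<open>P({i})\<close>.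

  The set \<open>B\<close> may contain \<open>i\<close>; only \<open>i \<notin> A\<close> and \<open>A \<inter> B = {}\<close> are required.  Values outside the
  stated domains are irrelevant.
\<close>

record ('k, 'v) operad =
  op_space :: "nat set \<Rightarrow> ('k, 'v) module"
  op_relabel :: "nat set \<Rightarrow> (nat \<Rightarrow> nat) \<Rightarrow> 'v \<Rightarrow> 'v"
  op_comp :: "nat set \<Rightarrow> nat \<Rightarrow> nat set \<Rightarrow> 'v \<Rightarrow> 'v \<Rightarrow> 'v"
  op_unit :: "nat \<Rightarrow> 'v"

abbreviation op_carrier :: "('k, 'v) operad \<Rightarrow> nat set \<Rightarrow> 'v set" where
  "op_carrier P L \<equiv> carrier (op_space P L)"

locale symmetric_operad =
  fixes P :: "('k::field, 'v) operad"
  assumes space_module: "finite L \<Longrightarrow> Module.module scalars (op_space P L)"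
    and relabel_linear:
      "\<lbrakk>finite L; inj_on \<sigma> L\<rbrakk> \<Longrightarrow> op_relabel P L \<sigma> \<in> linear_maps (op_space P L) (op_space P (\<sigma> ` L))"
    and relabel_cong:
      "\<lbrakk>finite L; inj_on \<sigma> L; \<And>l. l \<in> L \<Longrightarrow> \<tau> l = \<sigma> l; p \<in> op_carrier P L\<rbrakk>
        \<Longrightarrow> op_relabel P L \<tau> p = op_relabel P L \<sigma> p"
    and relabel_id: "\<lbrakk>finite L; p \<in> op_carrier P L\<rbrakk> \<Longrightarrow> op_relabel P L id p = p"
    and relabel_compose:
      "\<lbrakk>finite L; inj_on \<sigma> L; inj_on \<tau> (\<sigma> ` L); p \<in> op_carrier P L\<rbrakk>
        \<Longrightarrow> op_relabel P L (\<tau> \<circ> \<sigma>) p = op_relabel P (\<sigma> ` L) \<tau> (op_relabel P L \<sigma> p)"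
    and comp_linear_left:
      "\<lbrakk>finite A; finite B; i \<notin> A; A \<inter> B = {}; q \<in> op_carrier P B\<rbrakk>
        \<Longrightarrow> (\<lambda>p. op_comp P A i B p q) \<in> linear_maps (op_space P (insert i A)) (op_space P (A \<union> B))"
    and comp_linear_right:
      "\<lbrakk>finite A; finite B; i \<notin> A; A \<inter> B = {}; p \<in> op_carrier P (insert i A)\<rbrakk>
        \<Longrightarrow> op_comp P A i B p \<in> linear_maps (op_space P B) (op_space P (A \<union> B))"
    and comp_equivariant:
      "\<lbrakk>finite A; finite B; i \<notin> A; A \<inter> B = {}; inj_on \<sigma> (A \<union> B); i' \<notin> \<sigma> ` A;
        p \<in> op_carrier P (insert i A); q \<in> op_carrier P B\<rbrakk>
        \<Longrightarrow> op_relabel P (A \<union> B) \<sigma> (op_comp P A i B p q) =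
            op_comp P (\<sigma> ` A) i' (\<sigma> ` B)
              (op_relabel P (insert i A) (\<sigma>(i := i')) p) (op_relabel P B \<sigma> q)"
    and comp_sequential:
      "\<lbrakk>finite A; finite B; finite C; i \<notin> A; j \<notin> A; j \<notin> B; A \<inter> B = {}; A \<inter> C = {}; B \<inter> C = {};
        p \<in> op_carrier P (insert i A); q \<in> op_carrier P (insert j B); r \<in> op_carrier P C\<rbrakk>
        \<Longrightarrow> op_comp P (A \<union> B) j C (op_comp P A i (insert j B) p q) r =
            op_comp P A i (B \<union> C) p (op_comp P B j C q r)"
    and comp_parallel:
      "\<lbrakk>finite A; finite B; finite C; i \<noteq> j; i \<notin> A; j \<notin> A; j \<notin> B; i \<notin> C;
        A \<inter> B = {}; A \<inter> C = {}; B \<inter> C = {};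
        p \<in> op_carrier P (insert i (insert j A)); q \<in> op_carrier P B; r \<in> op_carrier P C\<rbrakk>
        \<Longrightarrow> op_comp P (A \<union> B) j C (op_comp P (insert j A) i B p q) r =
            op_comp P (A \<union> C) i B (op_comp P (insert i A) j C p r) q"
    and unit_closed: "op_unit P i \<in> op_carrier P {i}"
    and unit_relabel: "op_relabel P {i} \<sigma> (op_unit P i) = op_unit P (\<sigma> i)"
    and unit_left: "\<lbrakk>finite B; q \<in> op_carrier P B\<rbrakk> \<Longrightarrow> op_comp P {} i B (op_unit P i) q = q"
    and unit_right:
      "\<lbrakk>finite A; i \<notin> A; j \<notin> A; p \<in> op_carrier P (insert i A)\<rbrakk>
        \<Longrightarrow> op_comp P A i {j} p (op_unit P j) = op_relabel P (insert i A) (id(i := j)) p"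

definition operad_isomorphic :: "('k::field, 'v) operad \<Rightarrow> ('k, 'w) operad \<Rightarrow> bool" where
  "operad_isomorphic P Q \<longleftrightarrow> (\<exists>\<phi>.
    (\<forall>L. finite L \<longrightarrow>
      \<phi> L \<in> linear_maps (op_space P L) (op_space Q L) \<and>
      bij_betw (\<phi> L) (op_carrier P L) (op_carrier Q L)) \<and>
    (\<forall>L \<sigma>. \<forall>p\<in>op_carrier P L. finite L \<and> inj_on \<sigma> L \<longrightarrow>
      \<phi> (\<sigma> ` L) (op_relabel P L \<sigma> p) = op_relabel Q L \<sigma> (\<phi> L p)) \<and>
    (\<forall>A i B. \<forall>p\<in>op_carrier P (insert i A). \<forall>q\<in>op_carrier P B.
      finite A \<and> finite B \<and> i \<notin> A \<and> A \<inter> B = {} \<longrightarrow>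
      \<phi> (A \<union> B) (op_comp P A i B p q) = op_comp Q A i B (\<phi> (insert i A) p) (\<phi> B q)) \<and>
    (\<forall>i. \<phi> {i} (op_unit P i) = op_unit Q i))"

definition operad_ideal :: "('k::field, 'v) operad \<Rightarrow> (nat set \<Rightarrow> 'v set) \<Rightarrow> bool" where
  "operad_ideal P I \<longleftrightarrow>
    (\<forall>L. finite L \<longrightarrow> submodule (I L) scalars (op_space P L)) \<and>
    (\<forall>L \<sigma>. \<forall>p\<in>I L. finite L \<and> inj_on \<sigma> L \<longrightarrow> op_relabel P L \<sigma> p \<in> I (\<sigma> ` L)) \<and>
    (\<forall>A i B. finite A \<and> finite B \<and> i \<notin> A \<and> A \<inter> B = {} \<longrightarrow>
      (\<forall>p\<in>I (insert i A). \<forall>q\<in>op_carrier P B. op_comp P A i B p q \<in> I (A \<union> B)) \<and>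
      (\<forall>p\<in>op_carrier P (insert i A). \<forall>q\<in>I B. op_comp P A i B p q \<in> I (A \<union> B)))"

definition ideal_generated ::
  "('k::field, 'v) operad \<Rightarrow> (nat set \<Rightarrow> 'v set) \<Rightarrow> nat set \<Rightarrow> 'v set" where
  "ideal_generated P X L = \<Inter> {I L | I. operad_ideal P I \<and> (\<forall>L'. X L' \<subseteq> I L')}"

text \<open>The operations of the quotient are induced on cosets in the same way as in
  \<open>HOL-Algebra.QuotRing\<close>.\<close>

definition operad_quotient ::
  "('k::field, 'v) operad \<Rightarrow> (nat set \<Rightarrow> 'v set) \<Rightarrow> ('k, 'v set) operad" where
  "operad_quotient P I =
    \<lparr>op_space = (\<lambda>L. quotient_module (op_space P L) (I L)),
     op_relabel = (\<lambda>L \<sigma> X. \<Union>p\<in>X. I (\<sigma> ` L) +>\<^bsub>op_space P (\<sigma> ` L)\<^esub> op_relabel P L \<sigma> p),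
     op_comp = (\<lambda>A i B X Y.
       \<Union>p\<in>X. \<Union>q\<in>Y. I (A \<union> B) +>\<^bsub>op_space P (A \<union> B)\<^esub> op_comp P A i B p q),
     op_unit = (\<lambda>i. I {i} +>\<^bsub>op_space P {i}\<^esub> op_unit P i)\<rparr>"

text \<open>
  The classical composition of \<open>p \<in> P(m) = P({1..m})\<close> with \<open>q \<in> P(n) = P({1..n})\<close> at input \<open>k\<close>
  of \<open>p\<close>: in the result, the inputs of \<open>q\<close> are numbered \<open>k, \<dots>, k+n-1\<close> and the inputs of \<open>p\<close>
  after \<open>k\<close> are shifted by \<open>n-1\<close>.
\<close>

definition circ ::
  "('k, 'v) operad \<Rightarrow> nat \<Rightarrow> nat \<Rightarrow> nat \<Rightarrow> 'v \<Rightarrow> 'v \<Rightarrow> 'v" where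
  "circ P m k n p q =
    op_comp P ({1..<k} \<union> {k + n..<m + n}) k {k..<k + n}
      (op_relabel P {1..m} (\<lambda>j. if j \<le> k then j else j + n - 1) p)
      (op_relabel P {1..n} (\<lambda>j. j + k - 1) q)"


section \<open>Free operads on binary generators\<close>

text \<open>
  The generators are the elements of \<open>'g\<close>; the transposition \<open>(1 2)\<close> acts on them by the
  involution \<open>sw\<close>.  A basis of the free operad consists of the binary trees whose vertices are
  decorated with generators and whose leaves are labelled bijectively by the inputs, where
  exchanging the two subtrees at a vertex is compensated by applying \<open>sw\<close> to its decoration.
\<close>

datatype 'g tree = Leaf nat | Node 'g "'g tree" "'g tree"

inductive tree_eq :: "('g \<Rightarrow> 'g) \<Rightarrow> 'g tree \<Rightarrow> 'g tree \<Rightarrow> bool" for sw where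
  refl: "tree_eq sw t t"
| sym: "tree_eq sw s t \<Longrightarrow> tree_eq sw t s"
| trans: "tree_eq sw s t \<Longrightarrow> tree_eq sw t u \<Longrightarrow> tree_eq sw s u"
| cong: "tree_eq sw s s' \<Longrightarrow> tree_eq sw t t' \<Longrightarrow> tree_eq sw (Node a s t) (Node a s' t')"
| swap: "tree_eq sw (Node a s t) (Node (sw a) t s)"

fun leaves :: "'g tree \<Rightarrow> nat list" where
  "leaves (Leaf l) = [l]"
| "leaves (Node a s t) = leaves s @ leaves t"

fun map_leaves :: "(nat \<Rightarrow> nat) \<Rightarrow> 'g tree \<Rightarrow> 'g tree" where
  "map_leaves \<sigma> (Leaf l) = Leaf (\<sigma> l)"
| "map_leaves \<sigma> (Node a s t) = Node a (map_leaves \<sigma> s) (map_leaves \<sigma> t)"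

fun graft :: "'g tree \<Rightarrow> nat \<Rightarrow> 'g tree \<Rightarrow> 'g tree" where
  "graft (Leaf l) i u = (if l = i then u else Leaf l)"
| "graft (Node a s t) i u = Node a (graft s i u) (graft t i u)"

definition tree_class :: "('g \<Rightarrow> 'g) \<Rightarrow> 'g tree \<Rightarrow> 'g tree set" where
  "tree_class sw t = {u. tree_eq sw t u}"

definition tree_basis :: "('g \<Rightarrow> 'g) \<Rightarrow> nat set \<Rightarrow> 'g tree set set" where
  "tree_basis sw L = {tree_class sw t | t. distinct (leaves t) \<and> set (leaves t) = L}"

definition free_operad :: "('g \<Rightarrow> 'g) \<Rightarrow> ('k::field, 'g tree set \<Rightarrow>\<^sub>0 'k) operad" where
  "free_operad sw =
    \<lparr>op_space = (\<lambda>L. free_space (tree_basis sw L)),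
     op_relabel = (\<lambda>L \<sigma>. lin_ext (\<lambda>s. basis_vec (\<Union>t\<in>s. tree_class sw (map_leaves \<sigma> t)))),
     op_comp = (\<lambda>A i B.
       bilin_ext (\<lambda>s t. basis_vec (\<Union>a\<in>s. \<Union>b\<in>t. tree_class sw (graft a i b)))),
     op_unit = (\<lambda>i. basis_vec (tree_class sw (Leaf i)))\<rparr>"

definition generator :: "('g \<Rightarrow> 'g) \<Rightarrow> 'g \<Rightarrow> ('g tree set \<Rightarrow>\<^sub>0 'k::field)" where
  "generator sw a = basis_vec (tree_class sw (Node a (Leaf 1) (Leaf 2)))"


section \<open>The operad ComGreg\<close>

datatype greg_gen = GenX | GenY | GenC | GenG

fun greg_swap :: "greg_gen \<Rightarrow> greg_gen" where
  "greg_swap GenX = GenY"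
| "greg_swap GenY = GenX"
| "greg_swap GenC = GenC"
| "greg_swap GenG = GenG"

definition comgreg_relators :: "(greg_gen tree set \<Rightarrow>\<^sub>0 'k::field) set" where
  "comgreg_relators =
    (let T = free_operad greg_swap;
         x = generator greg_swap GenX;
         c = generator greg_swap GenC;
         g = generator greg_swap GenG;
         comp1 = circ T 2 1 2;
         comp2 = circ T 2 2 2;
         act23 = op_relabel T {1..3} (transpose 2 3);
         pl = comp1 x x - comp2 x x;
         gr = comp1 x g - act23 (comp1 g x) - comp2 g x
     in {pl - act23 pl,
         comp1 x c - act23 (comp1 c x) - comp2 c x,
         comp1 c c - comp2 c c,
         gr - act23 gr})"

definition ComGreg :: "('k::field, (greg_gen tree set \<Rightarrow>\<^sub>0 'k) set) operad" where
  "ComGreg =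
    operad_quotient (free_operad greg_swap)
      (ideal_generated (free_operad greg_swap)
        (\<lambda>L. if L = {1..3} then comgreg_relators else {}))"


section \<open>Forests of rooted Greg hypertrees\<close>

definition hypergraph :: "'v set \<Rightarrow> 'v set set \<Rightarrow> bool" where
  "hypergraph V E \<longleftrightarrow> finite V \<and> (\<forall>e\<in>E. e \<subseteq> V \<and> 2 \<le> card e)"

definition hypergraph_cycle :: "'v set \<Rightarrow> 'v set set \<Rightarrow> 'v list \<Rightarrow> 'v set list \<Rightarrow> bool" where
  "hypergraph_cycle V E vs es \<longleftrightarrow>
    2 \<le> length vs \<and> length es = length vs \<and> distinct vs \<and> distinct es \<and>
    set vs \<subseteq> V \<and> set es \<subseteq> E \<and>
    (\<forall>j<length vs. let j' = Suc j mod length vs in vs ! j \<in> es ! j' \<and> vs ! j' \<in> es ! j')"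

definition adjacency :: "'v set set \<Rightarrow> ('v \<times> 'v) set" where
  "adjacency E = {(u, v). \<exists>e\<in>E. u \<in> e \<and> v \<in> e}"

definition rooted_hypertree :: "'v set \<Rightarrow> 'v set set \<Rightarrow> 'v \<Rightarrow> bool" where
  "rooted_hypertree V E r \<longleftrightarrow>
    hypergraph V E \<and> V \<noteq> {} \<and> (\<forall>u\<in>V. \<forall>v\<in>V. (u, v) \<in> (adjacency E)\<^sup>*) \<and>
    (\<nexists>vs es. hypergraph_cycle V E vs es) \<and> r \<in> V"

text \<open>A forest is stored as the union of its hypertrees, which are its connected components.\<close>

record 'v forest =
  verts :: "'v set"
  edges :: "'v set set"
  roots :: "'v set"

definition hypertree_forest :: "'v forest \<Rightarrow> bool" where
  "hypertree_forest F \<longleftrightarrow> (\<exists>\<T>.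
    finite \<T> \<and> \<T> \<noteq> {} \<and>
    (\<forall>(V, E, r)\<in>\<T>. rooted_hypertree V E r) \<and>
    (\<forall>t\<in>\<T>. \<forall>t'\<in>\<T>. t \<noteq> t' \<longrightarrow> fst t \<inter> fst t' = {}) \<and>
    verts F = (\<Union>(V, E, r)\<in>\<T>. V) \<and>
    edges F = (\<Union>(V, E, r)\<in>\<T>. E) \<and>
    roots F = (\<lambda>(V, E, r). r) ` \<T>)"

text \<open>Distance to the root of the component of \<open>v\<close>; it is the only root reachable from \<open>v\<close>.\<close>

definition depth :: "'v forest \<Rightarrow> 'v \<Rightarrow> nat" where
  "depth F v = (LEAST n. \<exists>r\<in>roots F. (r, v) \<in> adjacency (edges F) ^^ n)"

definition parent :: "'v forest \<Rightarrow> 'v set \<Rightarrow> 'v" where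
  "parent F e = (THE v. v \<in> e \<and> (\<forall>w\<in>e. w \<noteq> v \<longrightarrow> depth F v < depth F w))"

definition incoming :: "'v forest \<Rightarrow> 'v \<Rightarrow> 'v set set" where
  "incoming F v = {e \<in> edges F. v \<in> e \<and> parent F e = v}"

definition outgoing :: "'v forest \<Rightarrow> 'v \<Rightarrow> 'v set set" where
  "outgoing F v = {e \<in> edges F. v \<in> e \<and> parent F e \<noteq> v}"

text \<open>
  The white vertex labelled \<open>l\<close> is \<open>White l\<close>, so that an isomorphism preserves colours and labels
  iff it fixes the white vertices and sends black vertices to black vertices.
\<close>

datatype vertex = White nat | Black nat

definition greg_forest :: "nat set \<Rightarrow> vertex forest \<Rightarrow> bool" where
  "greg_forest L F \<longleftrightarrow>
    hypertree_forest F \<and> {l. White l \<in> verts F} = L \<and>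
    (\<forall>b. Black b \<in> verts F \<longrightarrow> 2 \<le> card (incoming F (Black b)))"

definition greg_iso :: "vertex forest \<Rightarrow> vertex forest \<Rightarrow> bool" where
  "greg_iso F G \<longleftrightarrow> (\<exists>h.
    bij_betw h (verts F) (verts G) \<and>
    (\<forall>l. White l \<in> verts F \<longrightarrow> h (White l) = White l) \<and>
    (\<forall>b. Black b \<in> verts F \<longrightarrow> h (Black b) \<in> range Black) \<and>
    edges G = (`) h ` edges F \<and> roots G = h ` roots F)"

definition greg_class :: "vertex forest \<Rightarrow> vertex forest set" where
  "greg_class F = {G. greg_iso F G}"

definition greg_basis :: "nat set \<Rightarrow> vertex forest set set" where
  "greg_basis L = {greg_class F | F. greg_forest L F}"

fun map_label :: "(nat \<Rightarrow> nat) \<Rightarrow> vertex \<Rightarrow> vertex" where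
  "map_label \<sigma> (White l) = White (\<sigma> l)"
| "map_label \<sigma> (Black b) = Black b"

definition relabel_forest :: "(nat \<Rightarrow> nat) \<Rightarrow> vertex forest \<Rightarrow> vertex forest" where
  "relabel_forest \<sigma> F =
    \<lparr>verts = map_label \<sigma> ` verts F,
     edges = (`) (map_label \<sigma>) ` edges F,
     roots = map_label \<sigma> ` roots F\<rparr>"

text \<open>
  The forest \<open>S \<circ>\<^sub>i\<^sup>f T\<close>, for \<open>v\<close> the white vertex labelled \<open>i\<close>.  There is no outgoing edge at \<open>v\<close>
  if \<open>v\<close> is a root and exactly one otherwise.
\<close>

definition insert_along ::
  "vertex forest \<Rightarrow> nat \<Rightarrow> vertex forest \<Rightarrow> (vertex set \<Rightarrow> vertex) \<Rightarrow> vertex forest" where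
  "insert_along S i T f = (let v = White i in
    \<lparr>verts = (verts S - {v}) \<union> verts T,
     edges = edges T \<union> {e \<in> edges S. v \<notin> e}
       \<union> (\<lambda>e. (e - {v}) \<union> {f e}) ` incoming S v
       \<union> (\<lambda>e. (e - {v}) \<union> roots T) ` outgoing S v,
     roots = (if v \<in> roots S then (roots S - {v}) \<union> roots T else roots S)\<rparr>)"

definition insertion :: "vertex forest \<Rightarrow> nat \<Rightarrow> vertex forest \<Rightarrow> (vertex forest set \<Rightarrow>\<^sub>0 'k::field)"
  where
  "insertion S i T =
    (\<Sum>f\<in>incoming S (White i) \<rightarrow>\<^sub>E verts T. basis_vec (greg_class (insert_along S i T f)))"

text \<open>Insertion of isomorphism classes, computed on representatives chosen so that the union of
  vertex sets is disjoint; the result does not depend on this choice.\<close>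

definition class_insertion ::
  "vertex forest set \<Rightarrow> nat \<Rightarrow> vertex forest set \<Rightarrow> (vertex forest set \<Rightarrow>\<^sub>0 'k::field)" where
  "class_insertion s i t =
    (let (S, T) = SOME (S, T). S \<in> s \<and> T \<in> t \<and> (verts S - {White i}) \<inter> verts T = {}
     in insertion S i T)"

definition FG :: "('k::field, vertex forest set \<Rightarrow>\<^sub>0 'k) operad" where
  "FG =
    \<lparr>op_space = (\<lambda>L. free_space (greg_basis L)),
     op_relabel = (\<lambda>L \<sigma>. lin_ext (\<lambda>s. basis_vec (\<Union>F\<in>s. greg_class (relabel_forest \<sigma> F)))),
     op_comp = (\<lambda>A i B. bilin_ext (\<lambda>s t. class_insertion s i t)),
     op_unit = (\<lambda>i. basis_vec (greg_class \<lparr>verts = {White i}, edges = {}, roots = {White i}\<rparr>))\<rparr>"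

end

theory Submission imports Defs
begin

text \<open>Evaluating tree monomials on forests, with \<open>x\<close> as the sum of all graftings of the second forest at
  a vertex of the first, \<open>c\<close> as disjoint union and \<open>g\<close> as the joining of two forests under a new
  black root, is compatible with insertion. Every forest is reached, so this is a surjective morphism
  \<open>phi\<close> from the free operad; hence \<open>FG\<close> inherits the operad axioms, and the relators are killed.

  For the kernel, cut a forest into smaller ones: split off a component, or an edge at the root (using
  \<open>g\<close> when the root is black with two edges, and otherwise \<open>x\<close>, corrected by the graftings
  away from the root, which have fewer edges at the root). The resulting preimage depends on the
  choice of the component or edge only up to the relations: two successive cuts can be exchanged by
  associativity of \<open>c\<close>, by the pre-Lie relation corrected by the compatibility of \<open>x\<close> with \<open>c\<close>, or,
  at a black root with three edges, by the relation for \<open>g\<close>. So the preimages define an inverse of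
  \<open>phi\<close> modulo the ideal.\<close>

section \<open>Linear algebra on free spaces\<close>

text \<open>The inverse is not given in advance as a function. It begins as the relation
  \<open>rep\<close> between forests and combinations of trees, which admits every order of cuts,
  and only uniqueness modulo the ideal turns it into the linear map \<open>Psi\<close>. Uniqueness
  at one forest requires expansions of products of normal forms of smaller forests, and these
  expansions in turn require uniqueness for the forests they produce. The expansion lemmas therefore
  carry uniqueness as a hypothesis, up to a bound on the number of vertices, and are used inside the
  induction that proves it.

  The obstacle is the condition on black vertices. At a black root with three edges, cutting two of
  them leaves a black vertex with one edge, which is not the root of any admissible forest, so there
  is no smaller forest in terms of which the exchange could be written as in the general case.

  A second difficulty is that black vertices have names while basis elements are isomorphism
  classes: every operation on classes needs disjoint representatives and a proof that the choice
  does not matter.\<close>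

lemma lookup_pm_scale [simp]: "Poly_Mapping.lookup (pm_scale k u) x = k * Poly_Mapping.lookup u x"
  unfolding pm_scale_def by (simp add: Poly_Mapping.map.rep_eq when_def)

lemma pm_scale_0_right [simp]: "pm_scale k 0 = 0"
  and pm_scale_0_left [simp]: "pm_scale 0 u = 0"
  and pm_scale_1 [simp]: "pm_scale 1 u = u"
  and pm_scale_pm_scale [simp]: "pm_scale k (pm_scale l u) = pm_scale (k * l) u"
  and pm_scale_add_right: "pm_scale k (u + v) = pm_scale k u + pm_scale k v"
  and pm_scale_add_left: "pm_scale (k + l) u = pm_scale k u + pm_scale l u"
  and pm_scale_uminus: "pm_scale (- 1) u = - u"
  by (rule poly_mapping_eqI; simp add: lookup_add algebra_simps)+

lemma pm_scale_sum: "pm_scale k (sum f A) = (\<Sum>a\<in>A. pm_scale k (f a))"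
  by (induction A rule: infinite_finite_induct) (simp_all add: pm_scale_add_right)

lemma keys_pm_scale: "Poly_Mapping.keys (pm_scale k u) \<subseteq> Poly_Mapping.keys u"
  by (auto simp: in_keys_iff)

text \<open>Linearity on the whole type instead of between carriers: the maps defined by
  \<open>lin_ext\<close> and \<open>bilin_ext\<close> are linear everywhere, so additivity can be
  applied without checking membership first.\<close>

definition pm_linear :: "(('b \<Rightarrow>\<^sub>0 'k::field) \<Rightarrow> ('c \<Rightarrow>\<^sub>0 'k)) \<Rightarrow> bool" where
  "pm_linear f \<longleftrightarrow> (\<forall>u v. f (u + v) = f u + f v) \<and> (\<forall>k u. f (pm_scale k u) = pm_scale k (f u))"

lemma pm_linear_add: "pm_linear f \<Longrightarrow> f (u + v) = f u + f v"
  and pm_linear_scale: "pm_linear f \<Longrightarrow> f (pm_scale k u) = pm_scale k (f u)"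
  by (auto simp: pm_linear_def)

lemma pm_linear_zero: "pm_linear f \<Longrightarrow> f 0 = 0"
  by (metis pm_linear_scale pm_scale_0_left)

lemma pm_linear_diff: "pm_linear f \<Longrightarrow> f (u - v) = f u - f v"
  by (metis add_diff_cancel diff_add_cancel pm_linear_add)

lemma pm_linear_sum: "pm_linear f \<Longrightarrow> f (sum g A) = (\<Sum>a\<in>A. f (g a))"
  by (induction A rule: infinite_finite_induct) (simp_all add: pm_linear_zero pm_linear_add)

lemma pm_linear_id: "pm_linear (\<lambda>u. u)"
  by (simp add: pm_linear_def)

lemma pm_linear_compose: "pm_linear f \<Longrightarrow> pm_linear g \<Longrightarrow> pm_linear (\<lambda>u. f (g u))"
  by (simp add: pm_linear_def)

lemma pm_linear_pm_scale: "pm_linear (pm_scale k)"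
  by (simp add: pm_linear_def pm_scale_add_right mult.commute)

lemma pm_linear_sum_fun:
  "(\<And>a. a \<in> A \<Longrightarrow> pm_linear (f a)) \<Longrightarrow> pm_linear (\<lambda>u. \<Sum>a\<in>A. f a u)"
  by (simp add: pm_linear_def sum.distrib pm_scale_sum)

text \<open>The sum defining \<open>lin_ext f u\<close> runs over the support of \<open>u\<close>.
  Extending it to a common finite set makes the values at different arguments comparable term by
  term.\<close>

lemma lin_ext_superset:
  assumes "finite X" "Poly_Mapping.keys u \<subseteq> X"
  shows "lin_ext f u = (\<Sum>b\<in>X. pm_scale (Poly_Mapping.lookup u b) (f b))"
  unfolding lin_ext_def
  by (rule sum.mono_neutral_left) (use assms in \<open>auto simp: in_keys_iff\<close>)

lemma pm_linear_lin_ext: "pm_linear (lin_ext f)"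
  unfolding pm_linear_def
proof (intro conjI allI)
  fix u v :: "'a \<Rightarrow>\<^sub>0 'b" and k
  let ?X = "Poly_Mapping.keys u \<union> Poly_Mapping.keys v"
  show "lin_ext f (u + v) = lin_ext f u + lin_ext f v"
    using keys_add[of u v]
    by (simp add: lin_ext_superset[of ?X] lookup_add pm_scale_add_left sum.distrib)
  show "lin_ext f (pm_scale k u) = pm_scale k (lin_ext f u)"
    using keys_pm_scale[of k u] by (simp add: lin_ext_superset[of "Poly_Mapping.keys u"] pm_scale_sum)
qed

lemma lin_ext_basis [simp]: "lin_ext f (basis_vec b) = f b"
  by (simp add: lin_ext_def)

lemma pm_expand: "u = (\<Sum>b\<in>Poly_Mapping.keys u. pm_scale (Poly_Mapping.lookup u b) (basis_vec b))"
  by (rule poly_mapping_eqI)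
    (simp add: lookup_sum lookup_single when_def in_keys_iff if_distrib[of "(*) _"] cong: if_cong)

section \<open>Carriers of free spaces and induction over a basis\<close>

lemma carrier_free_space: "u \<in> carrier (free_space X) \<longleftrightarrow> Poly_Mapping.keys u \<subseteq> X"
  by (simp add: free_space_def)

lemma free_space_simps [simp]:
  "zero (free_space X) = 0" "add (free_space X) = (+)" "smult (free_space X) = pm_scale"
  by (simp_all add: free_space_def)

lemma free_space_closed [simp]:
  "0 \<in> carrier (free_space X)"
  "u \<in> carrier (free_space X) \<Longrightarrow> v \<in> carrier (free_space X) \<Longrightarrow> u + v \<in> carrier (free_space X)"
  "u \<in> carrier (free_space X) \<Longrightarrow> v \<in> carrier (free_space X) \<Longrightarrow> u - v \<in> carrier (free_space X)"
  "u \<in> carrier (free_space X) \<Longrightarrow> pm_scale k u \<in> carrier (free_space X)"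
  "basis_vec b \<in> carrier (free_space X) \<longleftrightarrow> b \<in> X"
  using keys_add[of u v] keys_diff[of u v] keys_pm_scale[of k u]
  by (auto simp: carrier_free_space)

lemma free_space_sum:
  "(\<And>a. a \<in> A \<Longrightarrow> f a \<in> carrier (free_space X)) \<Longrightarrow> sum f A \<in> carrier (free_space X)"
  by (induction A rule: infinite_finite_induct) simp_all

lemma free_space_induct [consumes 1, case_names zero add scale basis]:
  assumes "u \<in> carrier (free_space X)"
    and "Q 0" and "\<And>u v. Q u \<Longrightarrow> Q v \<Longrightarrow> Q (u + v)" and "\<And>k u. Q u \<Longrightarrow> Q (pm_scale k u)"
    and "\<And>b. b \<in> X \<Longrightarrow> Q (basis_vec b)"
  shows "Q u"
proof -
  have "Q (\<Sum>b\<in>B. pm_scale (Poly_Mapping.lookup u b) (basis_vec b))" if "B \<subseteq> X" for B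
    using that by (induction B rule: infinite_finite_induct) (use assms in auto)
  then show ?thesis using assms(1) pm_expand[of u] by (metis carrier_free_space)
qed

lemma pm_linear_eqI:
  assumes "pm_linear f" "pm_linear g" "u \<in> carrier (free_space X)"
    and "\<And>b. b \<in> X \<Longrightarrow> f (basis_vec b) = g (basis_vec b)"
  shows "f u = g u"
  using assms(3) by (induction rule: free_space_induct)
    (use assms in \<open>simp_all add: pm_linear_zero pm_linear_add pm_linear_scale\<close>)

lemma pm_linear_mapsI:
  assumes "pm_linear f" "\<And>b. b \<in> X \<Longrightarrow> f (basis_vec b) \<in> carrier (free_space Y)"
  shows "f \<in> linear_maps (free_space X) (free_space Y)"
proof -
  have "f u \<in> carrier (free_space Y)" if "u \<in> carrier (free_space X)" for u
    using that by (induction rule: free_space_induct)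
      (use assms in \<open>simp_all add: pm_linear_zero pm_linear_add pm_linear_scale\<close>)
  then show ?thesis using assms(1) by (auto simp: linear_maps_def pm_linear_add pm_linear_scale)
qed

lemma pm_linear_bilin_left: "pm_linear (\<lambda>u. bilin_ext f u v)"
  unfolding bilin_ext_def by (rule pm_linear_lin_ext)

lemma pm_linear_bilin_right: "pm_linear (\<lambda>v. bilin_ext f u v)"
  \<comment> \<open>Only the outer extension is opened: for fixed \<open>u\<close> the map is then a
    finite sum of linear maps in \<open>v\<close>.\<close>
  unfolding bilin_ext_def lin_ext_def[of _ u]
  by (intro pm_linear_sum_fun pm_linear_compose[OF pm_linear_pm_scale pm_linear_lin_ext])

lemma bilin_ext_basis [simp]: "bilin_ext f (basis_vec a) (basis_vec b) = f a b"
  by (simp add: bilin_ext_def)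

section \<open>Modules over the ring of scalars\<close>

lemma cring_scalars: "cring (scalars :: 'k::field ring)"
proof (rule cringI)
  show "abelian_group (scalars :: 'k ring)"
  proof (rule abelian_groupI)
    fix x :: 'k
    show "\<exists>y\<in>carrier scalars. y \<oplus>\<^bsub>scalars\<^esub> x = \<zero>\<^bsub>scalars\<^esub>"
      by (rule bexI[of _ "- x"]) (simp_all add: scalars_def)
  qed (auto simp: scalars_def algebra_simps)
  show "comm_monoid (scalars :: 'k ring)"
    by (rule comm_monoidI) (auto simp: scalars_def algebra_simps)
qed (auto simp: scalars_def algebra_simps)

lemma scalars_simps [simp]:
  "carrier scalars = UNIV" "mult scalars = (*)" "one scalars = 1" "zero scalars = 0" "add scalars = (+)"
  by (simp_all add: scalars_def)

lemma module_free_space: "Module.module scalars (free_space X :: ('k::field, 'b \<Rightarrow>\<^sub>0 'k) module)"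
proof (rule moduleI[OF cring_scalars])
  show "abelian_group (free_space X :: ('k, 'b \<Rightarrow>\<^sub>0 'k) module)"
  proof (rule abelian_groupI)
    fix u :: "'b \<Rightarrow>\<^sub>0 'k" assume "u \<in> carrier (free_space X)"
    then show "\<exists>v\<in>carrier (free_space X). v \<oplus>\<^bsub>free_space X\<^esub> u = \<zero>\<^bsub>free_space X\<^esub>"
      by (intro bexI[of _ "- u"]) (simp_all add: carrier_free_space)
  qed (simp_all add: algebra_simps)
qed (simp_all add: pm_scale_add_right pm_scale_add_left)

section \<open>Surjective morphisms of operads\<close>

text \<open>Preservation of zero is a separate clause because the target is not yet known to consist
  of modules, so it cannot be derived from linearity.\<close>

definition operad_epi ::
  "('k::field, 'v) operad \<Rightarrow> ('k, 'w) operad \<Rightarrow> (nat set \<Rightarrow> 'v \<Rightarrow> 'w) \<Rightarrow> bool" where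
  "operad_epi P Q \<phi> \<longleftrightarrow>
    (\<forall>L. finite L \<longrightarrow> \<phi> L \<in> linear_maps (op_space P L) (op_space Q L) \<and>
      \<phi> L ` op_carrier P L = op_carrier Q L \<and> \<phi> L \<zero>\<^bsub>op_space P L\<^esub> = \<zero>\<^bsub>op_space Q L\<^esub>) \<and>
    (\<forall>L \<sigma>. \<forall>p\<in>op_carrier P L. finite L \<and> inj_on \<sigma> L \<longrightarrow>
      \<phi> (\<sigma> ` L) (op_relabel P L \<sigma> p) = op_relabel Q L \<sigma> (\<phi> L p)) \<and>
    (\<forall>A i B. \<forall>p\<in>op_carrier P (insert i A). \<forall>q\<in>op_carrier P B.
      finite A \<and> finite B \<and> i \<notin> A \<and> A \<inter> B = {} \<longrightarrow>
      \<phi> (A \<union> B) (op_comp P A i B p q) = op_comp Q A i B (\<phi> (insert i A) p) (\<phi> B q)) \<and>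
    (\<forall>i. \<phi> {i} (op_unit P i) = op_unit Q i)"

lemma linear_maps_mem: "f \<in> linear_maps M N \<Longrightarrow> u \<in> carrier M \<Longrightarrow> f u \<in> carrier N"
  and linear_maps_add: "f \<in> linear_maps M N \<Longrightarrow> u \<in> carrier M \<Longrightarrow> v \<in> carrier M \<Longrightarrow>
    f (u \<oplus>\<^bsub>M\<^esub> v) = f u \<oplus>\<^bsub>N\<^esub> f v"
  and linear_maps_smult: "f \<in> linear_maps M N \<Longrightarrow> u \<in> carrier M \<Longrightarrow> f (k \<odot>\<^bsub>M\<^esub> u) = k \<odot>\<^bsub>N\<^esub> f u"
  by (auto simp: linear_maps_def)

text \<open>The axioms are identities together with the existence of inverses, and both pass to the
  image of a map that respects the operations.\<close>

lemma module_epi: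
  fixes M :: "('k::field, 'v) module" and N :: "('k, 'w) module"
  assumes M: "Module.module scalars M" and f: "f \<in> linear_maps M N" and onto: "f ` carrier M = carrier N"
    and z: "f \<zero>\<^bsub>M\<^esub> = \<zero>\<^bsub>N\<^esub>"
  shows "Module.module scalars N"
proof -
  interpret M: Module.module scalars M by (rule M)
  note lm = linear_maps_mem[OF f] linear_maps_add[OF f, symmetric] linear_maps_smult[OF f, symmetric]
  have ex: "\<exists>x\<in>carrier M. y = f x" if "y \<in> carrier N" for y using that onto by auto
  show ?thesis
  proof (rule moduleI[OF cring_scalars])
    show "abelian_group N"
    proof (rule abelian_groupI)
      fix x assume "x \<in> carrier N"
      then obtain u where u: "u \<in> carrier M" "x = f u" using ex by blast
      show "\<exists>y\<in>carrier N. y \<oplus>\<^bsub>N\<^esub> x = \<zero>\<^bsub>N\<^esub>"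
        by (rule bexI[of _ "f (\<ominus>\<^bsub>M\<^esub> u)"]) (use u in \<open>simp_all add: lm z[symmetric] M.l_neg\<close>)
      show "\<zero>\<^bsub>N\<^esub> \<oplus>\<^bsub>N\<^esub> x = x" using u by (simp add: lm z[symmetric])
      fix y assume "y \<in> carrier N"
      then obtain v where v: "v \<in> carrier M" "y = f v" using ex by blast
      show "x \<oplus>\<^bsub>N\<^esub> y = y \<oplus>\<^bsub>N\<^esub> x" using u v by (simp add: lm M.a_comm)
      show "x \<oplus>\<^bsub>N\<^esub> y \<in> carrier N" using u v by (simp add: lm)
      fix w assume "w \<in> carrier N"
      then obtain t where t: "t \<in> carrier M" "w = f t" using ex by blast
      show "x \<oplus>\<^bsub>N\<^esub> y \<oplus>\<^bsub>N\<^esub> w = x \<oplus>\<^bsub>N\<^esub> (y \<oplus>\<^bsub>N\<^esub> w)" using u v t by (simp add: lm M.a_assoc)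
    next
      show "\<zero>\<^bsub>N\<^esub> \<in> carrier N" by (metis lm(1) M.zero_closed z)
    qed
  next
    fix a b :: 'k and x y assume "x \<in> carrier N" "y \<in> carrier N"
    then obtain u v where u: "u \<in> carrier M" "x = f u" and v: "v \<in> carrier M" "y = f v"
      using ex by meson
    show "a \<odot>\<^bsub>N\<^esub> (x \<oplus>\<^bsub>N\<^esub> y) = a \<odot>\<^bsub>N\<^esub> x \<oplus>\<^bsub>N\<^esub> a \<odot>\<^bsub>N\<^esub> y"
      using u v M.smult_closed[of a] by (simp add: lm M.smult_r_distr)
  next
    fix a b :: 'k and x assume "x \<in> carrier N"
    then obtain u where u: "u \<in> carrier M" "x = f u" using ex by meson
    note sc = M.smult_closed[of _ u, simplified]
    show "a \<odot>\<^bsub>N\<^esub> x \<in> carrier N" using u sc by (simp add: lm)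
    show "(a \<oplus>\<^bsub>scalars\<^esub> b) \<odot>\<^bsub>N\<^esub> x = a \<odot>\<^bsub>N\<^esub> x \<oplus>\<^bsub>N\<^esub> b \<odot>\<^bsub>N\<^esub> x"
      using u sc M.smult_l_distr[of a b u] by (simp add: lm)
    show "(a \<otimes>\<^bsub>scalars\<^esub> b) \<odot>\<^bsub>N\<^esub> x = a \<odot>\<^bsub>N\<^esub> (b \<odot>\<^bsub>N\<^esub> x)"
      using u sc M.smult_assoc1[of a b u] by (simp add: lm)
    show "\<one>\<^bsub>scalars\<^esub> \<odot>\<^bsub>N\<^esub> x = x" using u M.smult_one[of u] by (simp add: lm)
  qed
qed

text \<open>Only the source is assumed to be an operad. That the target is one is a conclusion,
  drawn for the free operad, for \<open>FG\<close> and for the quotient.\<close>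

locale operad_epimorphism =
  P: symmetric_operad P for P :: "('k::field, 'v) operad" +
  fixes Q :: "('k, 'w) operad" and \<phi> :: "nat set \<Rightarrow> 'v \<Rightarrow> 'w"
  assumes epi: "operad_epi P Q \<phi>"
begin

lemma lin: "finite L \<Longrightarrow> \<phi> L \<in> linear_maps (op_space P L) (op_space Q L)"
  and zero: "finite L \<Longrightarrow> \<phi> L \<zero>\<^bsub>op_space P L\<^esub> = \<zero>\<^bsub>op_space Q L\<^esub>"
  and onto: "finite L \<Longrightarrow> \<phi> L ` op_carrier P L = op_carrier Q L"
  and relabel: "finite L \<Longrightarrow> inj_on \<sigma> L \<Longrightarrow> p \<in> op_carrier P L \<Longrightarrow>
    op_relabel Q L \<sigma> (\<phi> L p) = \<phi> (\<sigma> ` L) (op_relabel P L \<sigma> p)"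
  and comp: "\<lbrakk>finite A; finite B; i \<notin> A; A \<inter> B = {}; p \<in> op_carrier P (insert i A); q \<in> op_carrier P B\<rbrakk>
    \<Longrightarrow> op_comp Q A i B (\<phi> (insert i A) p) (\<phi> B q) = \<phi> (A \<union> B) (op_comp P A i B p q)"
  and unit: "op_unit Q i = \<phi> {i} (op_unit P i)"
  using epi by (simp_all add: operad_epi_def)

lemmas mem = linear_maps_mem[OF lin] and add = linear_maps_add[OF lin] and smult = linear_maps_smult[OF lin]

lemma preimage: "finite L \<Longrightarrow> q \<in> op_carrier Q L \<Longrightarrow> \<exists>p\<in>op_carrier P L. q = \<phi> L p"
  using onto by blast

lemma P_add: "finite L \<Longrightarrow> u \<in> op_carrier P L \<Longrightarrow> v \<in> op_carrier P L \<Longrightarrow> u \<oplus>\<^bsub>op_space P L\<^esub> v \<in> op_carrier P L"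
  by (meson P.space_module Module.module.axioms(2) abelian_group.axioms(1) abelian_monoid.a_closed)

lemma P_smult: "finite L \<Longrightarrow> u \<in> op_carrier P L \<Longrightarrow> k \<odot>\<^bsub>op_space P L\<^esub> u \<in> op_carrier P L"
  using Module.module.smult_closed[OF P.space_module, of L k u] by simp

lemma P_relabel: "\<lbrakk>finite L; inj_on \<sigma> L; p \<in> op_carrier P L\<rbrakk> \<Longrightarrow> op_relabel P L \<sigma> p \<in> op_carrier P (\<sigma> ` L)"
  by (rule linear_maps_mem[OF P.relabel_linear])

lemma P_comp: "\<lbrakk>finite A; finite B; i \<notin> A; A \<inter> B = {}; p \<in> op_carrier P (insert i A); q \<in> op_carrier P B\<rbrakk>
  \<Longrightarrow> op_comp P A i B p q \<in> op_carrier P (A \<union> B)"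
  by (rule linear_maps_mem[OF P.comp_linear_right])

text \<open>Every axiom is an equation or a closure property of relabellings, compositions and
  units, so it can be checked on preimages. For \<open>FG\<close> this replaces a combinatorial
  proof that insertion is associative and equivariant.\<close>

theorem symmetric_operad_image: "symmetric_operad Q"
proof (rule symmetric_operad.intro)
  show "Module.module scalars (op_space Q L)" if "finite L" for L
    by (rule module_epi[OF P.space_module lin onto zero]) (rule that)+
  show "op_relabel Q L \<sigma> \<in> linear_maps (op_space Q L) (op_space Q (\<sigma> ` L))"
    if L: "finite L" "inj_on \<sigma> L" for L \<sigma>
    unfolding linear_maps_def
  proof (safe intro!: Pi_I)
    fix q assume "q \<in> op_carrier Q L"
    then obtain p where p: "p \<in> op_carrier P L" "q = \<phi> L p" using preimage[of L] L by blast
    show "op_relabel Q L \<sigma> q \<in> op_carrier Q (\<sigma> ` L)"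
      using p L by (simp add: relabel mem P_relabel)
    show "op_relabel Q L \<sigma> (k \<odot>\<^bsub>op_space Q L\<^esub> q) = k \<odot>\<^bsub>op_space Q (\<sigma> ` L)\<^esub> op_relabel Q L \<sigma> q" for k
      using p L by (simp add: relabel smult[symmetric] P_relabel P_smult linear_maps_smult[OF P.relabel_linear])
    fix q' assume "q' \<in> op_carrier Q L"
    then obtain p' where p': "p' \<in> op_carrier P L" "q' = \<phi> L p'" using preimage[of L] L by blast
    show "op_relabel Q L \<sigma> (q \<oplus>\<^bsub>op_space Q L\<^esub> q') = op_relabel Q L \<sigma> q \<oplus>\<^bsub>op_space Q (\<sigma> ` L)\<^esub> op_relabel Q L \<sigma> q'"
      using p p' L by (simp add: relabel add[symmetric] P_relabel P_add linear_maps_add[OF P.relabel_linear])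
  qed
  show "op_relabel Q L \<tau> q = op_relabel Q L \<sigma> q"
    if L: "finite L" "inj_on \<sigma> L" "\<And>l. l \<in> L \<Longrightarrow> \<tau> l = \<sigma> l" "q \<in> op_carrier Q L" for L \<sigma> \<tau> q
  proof -
    obtain p where p: "p \<in> op_carrier P L" "q = \<phi> L p" using preimage[of L] L by blast
    have "inj_on \<tau> L" "\<tau> ` L = \<sigma> ` L" using L by (auto simp: inj_on_def)
    then show ?thesis using p L P.relabel_cong[OF L(1-3), of p] by (simp add: relabel)
  qed
  show "op_relabel Q L id q = q" if L: "finite L" "q \<in> op_carrier Q L" for L q
    using preimage[OF L] P.relabel_id[OF L(1)] relabel[OF L(1), of id] by fastforce
  show "op_relabel Q L (\<tau> \<circ> \<sigma>) q = op_relabel Q (\<sigma> ` L) \<tau> (op_relabel Q L \<sigma> q)"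
    if L: "finite L" "inj_on \<sigma> L" "inj_on \<tau> (\<sigma> ` L)" "q \<in> op_carrier Q L" for L \<sigma> \<tau> q
  proof -
    obtain p where p: "p \<in> op_carrier P L" "q = \<phi> L p" using preimage[of L] L by blast
    have "op_relabel Q L (\<tau> \<circ> \<sigma>) q = \<phi> ((\<tau> \<circ> \<sigma>) ` L) (op_relabel P L (\<tau> \<circ> \<sigma>) p)"
      unfolding p(2) by (rule relabel) (use L p in \<open>auto intro: comp_inj_on\<close>)
    also have "\<dots> = \<phi> (\<tau> ` \<sigma> ` L) (op_relabel P (\<sigma> ` L) \<tau> (op_relabel P L \<sigma> p))"
      by (simp only: P.relabel_compose[OF L(1-3) p(1)] image_comp)
    also have "\<dots> = op_relabel Q (\<sigma> ` L) \<tau> (\<phi> (\<sigma> ` L) (op_relabel P L \<sigma> p))"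
      by (rule relabel[symmetric]) (use L p P_relabel in auto)
    finally show ?thesis using p L by (simp add: relabel)
  qed
  show "(\<lambda>p. op_comp Q A i B p q) \<in> linear_maps (op_space Q (insert i A)) (op_space Q (A \<union> B))"
    if H: "finite A" "finite B" "i \<notin> A" "A \<inter> B = {}" and qB: "q \<in> op_carrier Q B" for A B i q
  proof -
    obtain q0 where q: "q0 \<in> op_carrier P B" "q = \<phi> B q0" using preimage[OF H(2) qB] by blast
    note iA = finite.insertI[OF H(1), of i] and AB = finite_UnI[OF H(1,2)]
    note l = linear_maps_add[OF P.comp_linear_left[OF H q(1)]] linear_maps_smult[OF P.comp_linear_left[OF H q(1)]]
    show ?thesis unfolding linear_maps_def
    proof (safe intro!: Pi_I)
      fix p assume "p \<in> op_carrier Q (insert i A)"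
      then obtain p0 where p: "p0 \<in> op_carrier P (insert i A)" "p = \<phi> (insert i A) p0" using preimage[OF iA] by blast
      show "op_comp Q A i B p q \<in> op_carrier Q (A \<union> B)"
        using p q H by (simp add: comp mem P_comp)
      show "op_comp Q A i B (k \<odot>\<^bsub>op_space Q (insert i A)\<^esub> p) q = k \<odot>\<^bsub>op_space Q (A \<union> B)\<^esub> op_comp Q A i B p q" for k
        using p q H AB P_smult[OF iA] by (simp add: comp smult[symmetric] P_comp l)
      fix p' assume "p' \<in> op_carrier Q (insert i A)"
      then obtain p1 where p': "p1 \<in> op_carrier P (insert i A)" "p' = \<phi> (insert i A) p1" using preimage[OF iA] by blast
      show "op_comp Q A i B (p \<oplus>\<^bsub>op_space Q (insert i A)\<^esub> p') q = op_comp Q A i B p q \<oplus>\<^bsub>op_space Q (A \<union> B)\<^esub> op_comp Q A i B p' q"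
        using p p' q H AB P_add[OF iA] by (simp add: comp add[symmetric] P_comp l)
    qed
  qed
  show "op_comp Q A i B p \<in> linear_maps (op_space Q B) (op_space Q (A \<union> B))"
    if H: "finite A" "finite B" "i \<notin> A" "A \<inter> B = {}" and pA: "p \<in> op_carrier Q (insert i A)" for A B i p
  proof -
    note iA = finite.insertI[OF H(1), of i] and AB = finite_UnI[OF H(1,2)]
    obtain p0 where p: "p0 \<in> op_carrier P (insert i A)" "p = \<phi> (insert i A) p0" using preimage[OF iA pA] by blast
    note l = linear_maps_add[OF P.comp_linear_right[OF H p(1)]] linear_maps_smult[OF P.comp_linear_right[OF H p(1)]]
    show ?thesis unfolding linear_maps_def
    proof (safe intro!: Pi_I)
      fix q assume "q \<in> op_carrier Q B"
      then obtain q0 where q: "q0 \<in> op_carrier P B" "q = \<phi> B q0" using preimage[OF H(2)] by blast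
      show "op_comp Q A i B p q \<in> op_carrier Q (A \<union> B)"
        using p q H by (simp add: comp mem P_comp)
      show "op_comp Q A i B p (k \<odot>\<^bsub>op_space Q B\<^esub> q) = k \<odot>\<^bsub>op_space Q (A \<union> B)\<^esub> op_comp Q A i B p q" for k
        using p q H AB P_smult[OF H(2)] by (simp add: comp smult[symmetric] P_comp l)
      fix q' assume "q' \<in> op_carrier Q B"
      then obtain q1 where q': "q1 \<in> op_carrier P B" "q' = \<phi> B q1" using preimage[OF H(2)] by blast
      show "op_comp Q A i B p (q \<oplus>\<^bsub>op_space Q B\<^esub> q') = op_comp Q A i B p q \<oplus>\<^bsub>op_space Q (A \<union> B)\<^esub> op_comp Q A i B p q'"
        using p q q' H AB P_add[OF H(2)] by (simp add: comp add[symmetric] P_comp l)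
    qed
  qed
  show "op_relabel Q (A \<union> B) \<sigma> (op_comp Q A i B p q) =
      op_comp Q (\<sigma> ` A) i' (\<sigma> ` B) (op_relabel Q (insert i A) (\<sigma>(i := i')) p) (op_relabel Q B \<sigma> q)"
    if H: "finite A" "finite B" "i \<notin> A" "A \<inter> B = {}" and \<sigma>: "inj_on \<sigma> (A \<union> B)" "i' \<notin> \<sigma> ` A"
      and pq: "p \<in> op_carrier Q (insert i A)" "q \<in> op_carrier Q B" for A B i \<sigma> i' p q
  proof -
    have iA: "finite (insert i A)" using H by simp
    obtain p0 where p: "p0 \<in> op_carrier P (insert i A)" "p = \<phi> (insert i A) p0" using preimage[OF iA pq(1)] by blast
    obtain q0 where q: "q0 \<in> op_carrier P B" "q = \<phi> B q0" using preimage[OF H(2) pq(2)] by blast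
    have i: "inj_on (\<sigma>(i := i')) (insert i A)" "inj_on \<sigma> B"
      using \<sigma> H(3) by (auto simp: inj_on_def)
    have im: "(\<sigma>(i := i')) ` insert i A = insert i' (\<sigma> ` A)" using H(3) by (auto simp: image_iff)
    have d: "\<sigma> ` A \<inter> \<sigma> ` B = {}" using inj_on_image_Int[OF \<sigma>(1), of A B] H(4) by auto
    have c: "op_relabel P (insert i A) (\<sigma>(i := i')) p0 \<in> op_carrier P (insert i' (\<sigma> ` A))"
      using P_relabel[OF iA i(1) p(1)] im by simp
    have "op_relabel Q (A \<union> B) \<sigma> (op_comp Q A i B p q) = \<phi> (\<sigma> ` (A \<union> B)) (op_relabel P (A \<union> B) \<sigma> (op_comp P A i B p0 q0))"
      using p q H \<sigma> by (simp add: comp relabel P_comp)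
    also have "\<dots> = \<phi> (\<sigma> ` A \<union> \<sigma> ` B) (op_comp P (\<sigma> ` A) i' (\<sigma> ` B) (op_relabel P (insert i A) (\<sigma>(i := i')) p0) (op_relabel P B \<sigma> q0))"
      using P.comp_equivariant[OF H \<sigma> p(1) q(1)] by (simp add: image_Un)
    also have "\<dots> = op_comp Q (\<sigma> ` A) i' (\<sigma> ` B) (\<phi> (insert i' (\<sigma> ` A)) (op_relabel P (insert i A) (\<sigma>(i := i')) p0)) (\<phi> (\<sigma> ` B) (op_relabel P B \<sigma> q0))"
      using H \<sigma> d c P_relabel[OF H(2) i(2) q(1)] by (simp add: comp)
    also have "\<dots> = op_comp Q (\<sigma> ` A) i' (\<sigma> ` B) (op_relabel Q (insert i A) (\<sigma>(i := i')) p) (op_relabel Q B \<sigma> q)"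
      using p q relabel[OF iA i(1) p(1)] relabel[OF H(2) i(2) q(1)] by (simp add: im[simplified])
    finally show ?thesis .
  qed
  show "op_comp Q (A \<union> B) j C (op_comp Q A i (insert j B) p q) r = op_comp Q A i (B \<union> C) p (op_comp Q B j C q r)"
    if H: "finite A" "finite B" "finite C" "i \<notin> A" "j \<notin> A" "j \<notin> B" "A \<inter> B = {}" "A \<inter> C = {}" "B \<inter> C = {}"
      and pqr: "p \<in> op_carrier Q (insert i A)" "q \<in> op_carrier Q (insert j B)" "r \<in> op_carrier Q C"
    for A B C i j p q r
  proof -
    obtain p0 where p: "p0 \<in> op_carrier P (insert i A)" "p = \<phi> (insert i A) p0" by (metis preimage pqr(1,2) H(1,2) finite.insertI)
    obtain q0 where q: "q0 \<in> op_carrier P (insert j B)" "q = \<phi> (insert j B) q0" by (metis preimage pqr(1,2) H(1,2) finite.insertI)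
    obtain r0 where r: "r0 \<in> op_carrier P C" "r = \<phi> C r0" by (metis preimage pqr(2,3) H(2,3))
    have c1: "op_comp P A i (insert j B) p0 q0 \<in> op_carrier P (insert j (A \<union> B))"
      using P_comp[of A "insert j B" i p0 q0] H p q by simp
    have c2: "op_comp P B j C q0 r0 \<in> op_carrier P (B \<union> C)"
      using P_comp[of B C j q0 r0] H q r by simp
    have "op_comp Q A i (insert j B) p q = \<phi> (insert j (A \<union> B)) (op_comp P A i (insert j B) p0 q0)"
      using comp[of A "insert j B" i p0 q0] H p q by simp
    moreover have "op_comp Q B j C q r = \<phi> (B \<union> C) (op_comp P B j C q0 r0)"
      using comp[of B C j q0 r0] H q r by simp
    moreover have "op_comp Q (A \<union> B) j C (\<phi> (insert j (A \<union> B)) (op_comp P A i (insert j B) p0 q0)) r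
        = \<phi> (A \<union> B \<union> C) (op_comp P (A \<union> B) j C (op_comp P A i (insert j B) p0 q0) r0)"
      unfolding r(2) by (rule comp) (use H c1 r in auto)
    moreover have "op_comp Q A i (B \<union> C) p (\<phi> (B \<union> C) (op_comp P B j C q0 r0))
        = \<phi> (A \<union> (B \<union> C)) (op_comp P A i (B \<union> C) p0 (op_comp P B j C q0 r0))"
      unfolding p(2) by (rule comp) (use H c2 p in auto)
    ultimately show ?thesis using P.comp_sequential[OF H p(1) q(1) r(1)] by (simp add: Un_assoc)
  qed
  show "op_comp Q (A \<union> B) j C (op_comp Q (insert j A) i B p q) r = op_comp Q (A \<union> C) i B (op_comp Q (insert i A) j C p r) q"
    if H: "finite A" "finite B" "finite C" "i \<noteq> j" "i \<notin> A" "j \<notin> A" "j \<notin> B" "i \<notin> C" "A \<inter> B = {}" "A \<inter> C = {}" "B \<inter> C = {}"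
      and pqr: "p \<in> op_carrier Q (insert i (insert j A))" "q \<in> op_carrier Q B" "r \<in> op_carrier Q C"
    for A B C i j p q r
  proof -
    obtain p0 where p: "p0 \<in> op_carrier P (insert i (insert j A))" "p = \<phi> (insert i (insert j A)) p0" by (metis preimage pqr(1,2) H(1,2) finite.insertI)
    obtain q0 where q: "q0 \<in> op_carrier P B" "q = \<phi> B q0" by (metis preimage pqr(2,3) H(2,3))
    obtain r0 where r: "r0 \<in> op_carrier P C" "r = \<phi> C r0" by (metis preimage pqr(2,3) H(2,3))
    \<comment> \<open>The two inputs are listed in the other order so that \<open>p0\<close> can be
      composed at \<open>j\<close> first.\<close>
    have p': "p0 \<in> op_carrier P (insert j (insert i A))" "p = \<phi> (insert j (insert i A)) p0" using p by (simp_all add: insert_commute)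
    have c1: "op_comp P (insert j A) i B p0 q0 \<in> op_carrier P (insert j (A \<union> B))"
      using P_comp[of "insert j A" B i p0 q0] H p q by simp
    have c2: "op_comp P (insert i A) j C p0 r0 \<in> op_carrier P (insert i (A \<union> C))"
      using P_comp[of "insert i A" C j p0 r0] H p' r by simp
    have "op_comp Q (insert j A) i B p q = \<phi> (insert j (A \<union> B)) (op_comp P (insert j A) i B p0 q0)"
      using comp[of "insert j A" B i p0 q0] H p q by simp
    moreover have "op_comp Q (insert i A) j C p r = \<phi> (insert i (A \<union> C)) (op_comp P (insert i A) j C p0 r0)"
      using comp[of "insert i A" C j p0 r0] H p' r by simp
    moreover have "op_comp Q (A \<union> B) j C (\<phi> (insert j (A \<union> B)) (op_comp P (insert j A) i B p0 q0)) r
        = \<phi> (A \<union> B \<union> C) (op_comp P (A \<union> B) j C (op_comp P (insert j A) i B p0 q0) r0)"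
      unfolding r(2) by (rule comp) (use H c1 r in auto)
    moreover have "op_comp Q (A \<union> C) i B (\<phi> (insert i (A \<union> C)) (op_comp P (insert i A) j C p0 r0)) q
        = \<phi> (A \<union> C \<union> B) (op_comp P (A \<union> C) i B (op_comp P (insert i A) j C p0 r0) q0)"
      unfolding q(2) by (rule comp) (use H c2 q in auto)
    moreover have "A \<union> C \<union> B = A \<union> B \<union> C" by auto
    ultimately show ?thesis using P.comp_parallel[OF H p(1) q(1) r(1)] by simp
  qed
  show "op_unit Q i \<in> op_carrier Q {i}" for i using P.unit_closed by (simp add: unit mem)
  show "op_relabel Q {i} \<sigma> (op_unit Q i) = op_unit Q (\<sigma> i)" for i \<sigma>
    using P.unit_closed P.unit_relabel by (simp add: unit relabel)
  show "op_comp Q {} i B (op_unit Q i) q = q" if B: "finite B" "q \<in> op_carrier Q B" for B i q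
  proof -
    obtain q0 where q: "q0 \<in> op_carrier P B" "q = \<phi> B q0" using preimage[OF B] by blast
    then show ?thesis using comp[of "{}" B i "op_unit P i" q0] B P.unit_closed P.unit_left by (simp add: unit)
  qed
  show "op_comp Q A i {j} p (op_unit Q j) = op_relabel Q (insert i A) (id(i := j)) p"
    if H: "finite A" "i \<notin> A" "j \<notin> A" and p: "p \<in> op_carrier Q (insert i A)" for A i j p
  proof -
    have iA: "finite (insert i A)" using H by simp
    obtain p0 where p: "p0 \<in> op_carrier P (insert i A)" "p = \<phi> (insert i A) p0" using preimage[OF iA p] by blast
    have inj: "inj_on (id(i := j)) (insert i A)" using H by (auto simp: inj_on_def)
    have im: "(id(i := j)) ` insert i A = A \<union> {j}" using H by (auto simp: image_iff)
    have "op_comp Q A i {j} p (op_unit Q j) = \<phi> (A \<union> {j}) (op_comp P A i {j} p0 (op_unit P j))"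
      unfolding p unit by (rule comp) (use H p P.unit_closed in auto)
    also have "\<dots> = \<phi> ((id(i := j)) ` insert i A) (op_relabel P (insert i A) (id(i := j)) p0)"
      by (simp only: im P.unit_right[OF H p(1)])
    also have "\<dots> = op_relabel Q (insert i A) (id(i := j)) p"
      unfolding p by (rule relabel[OF iA inj p(1), symmetric])
    finally show ?thesis .
  qed
qed

end

text \<open>First isomorphism theorem: two images of one operad under morphisms with the same fibres
  are isomorphic. The map sends the image of \<open>p\<close> under \<open>\<phi>\<close> to its
  image under \<open>\<pi>\<close>, with \<open>p\<close> an arbitrary preimage.\<close>

lemma operad_isomorphic_of_epis:
  assumes P: "symmetric_operad P" and epi1: "operad_epi P Q1 \<phi>" and epi2: "operad_epi P Q2 \<pi>"
    and ker: "\<And>L p p'. finite L \<Longrightarrow> p \<in> op_carrier P L \<Longrightarrow> p' \<in> op_carrier P L \<Longrightarrow>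
      \<phi> L p = \<phi> L p' \<longleftrightarrow> \<pi> L p = \<pi> L p'"
  shows "operad_isomorphic Q1 Q2"
proof -
  interpret P: symmetric_operad P by (rule P)
  interpret E1: operad_epimorphism P Q1 \<phi> by unfold_locales (rule epi1)
  interpret E2: operad_epimorphism P Q2 \<pi> by unfold_locales (rule epi2)
  define \<Phi> where "\<Phi> L u = \<pi> L (SOME p. p \<in> op_carrier P L \<and> \<phi> L p = u)" for L u
  have \<Phi>: "\<Phi> L (\<phi> L p) = \<pi> L p" if "finite L" "p \<in> op_carrier P L" for L p
  proof -
    define p' where "p' = (SOME p'. p' \<in> op_carrier P L \<and> \<phi> L p' = \<phi> L p)"
    have "p' \<in> op_carrier P L \<and> \<phi> L p' = \<phi> L p"
      unfolding p'_def by (rule someI[of _ p]) (use that in simp)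
    then show ?thesis using ker[OF that(1) _ that(2), of p'] by (simp add: \<Phi>_def p'_def)
  qed
  have lin: "\<Phi> L \<in> linear_maps (op_space Q1 L) (op_space Q2 L)" if L: "finite L" for L
    unfolding linear_maps_def
  proof (safe intro!: Pi_I)
    fix u assume "u \<in> op_carrier Q1 L"
    then obtain p where p: "p \<in> op_carrier P L" "u = \<phi> L p" using E1.preimage[OF L] by blast
    show "\<Phi> L u \<in> op_carrier Q2 L" using p L by (simp add: \<Phi> E2.mem)
    show "\<Phi> L (k \<odot>\<^bsub>op_space Q1 L\<^esub> u) = k \<odot>\<^bsub>op_space Q2 L\<^esub> \<Phi> L u" for k
      using p L E1.P_smult[OF L p(1)] by (simp add: \<Phi> E1.smult[symmetric] E2.smult)
    fix v assume "v \<in> op_carrier Q1 L"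
    then obtain q where q: "q \<in> op_carrier P L" "v = \<phi> L q" using E1.preimage[OF L] by blast
    show "\<Phi> L (u \<oplus>\<^bsub>op_space Q1 L\<^esub> v) = \<Phi> L u \<oplus>\<^bsub>op_space Q2 L\<^esub> \<Phi> L v"
      using p q L E1.P_add[OF L p(1) q(1)] by (simp add: \<Phi> E1.add[symmetric] E2.add)
  qed
  have bij: "bij_betw (\<Phi> L) (op_carrier Q1 L) (op_carrier Q2 L)" if L: "finite L" for L
  proof (rule bij_betw_imageI)
    show "inj_on (\<Phi> L) (op_carrier Q1 L)"
      unfolding E1.onto[OF L, symmetric] using ker[OF L] by (auto simp: inj_on_def \<Phi> L)
    show "\<Phi> L ` op_carrier Q1 L = op_carrier Q2 L"
      unfolding E1.onto[OF L, symmetric] E2.onto[OF L, symmetric] image_image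
      by (rule image_cong) (simp_all add: \<Phi> L)
  qed
  have rel: "\<Phi> (\<sigma> ` L) (op_relabel Q1 L \<sigma> u) = op_relabel Q2 L \<sigma> (\<Phi> L u)"
    if H: "u \<in> op_carrier Q1 L" "finite L" "inj_on \<sigma> L" for L \<sigma> u
  proof -
    obtain p where "p \<in> op_carrier P L" "u = \<phi> L p" using E1.preimage[OF H(2,1)] by blast
    then show ?thesis using H by (simp add: \<Phi> E1.relabel E2.relabel E1.P_relabel)
  qed
  have cmp: "\<Phi> (A \<union> B) (op_comp Q1 A i B u v) = op_comp Q2 A i B (\<Phi> (insert i A) u) (\<Phi> B v)"
    if H: "u \<in> op_carrier Q1 (insert i A)" "v \<in> op_carrier Q1 B" "finite A \<and> finite B \<and> i \<notin> A \<and> A \<inter> B = {}"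
    for A i B u v
  proof -
    obtain p where "p \<in> op_carrier P (insert i A)" "u = \<phi> (insert i A) p"
      using E1.preimage[of "insert i A" u] H by auto
    moreover obtain q where "q \<in> op_carrier P B" "v = \<phi> B q" using E1.preimage[of B v] H by auto
    ultimately show ?thesis using H by (simp add: \<Phi> E1.comp E2.comp E1.P_comp)
  qed
  have unt: "\<Phi> {i} (op_unit Q1 i) = op_unit Q2 i" for i
    by (simp add: E1.unit E2.unit \<Phi> P.unit_closed)
  show ?thesis unfolding operad_isomorphic_def
    using lin bij rel cmp unt by (intro exI[of _ \<Phi>]) auto
qed

section \<open>Operadic ideals and quotients\<close>

text \<open>Closure under negation is dropped from the list, since negation is multiplication by the
  scalar -1. Kernels and intersections are then checked against the remaining closure
  conditions.\<close>

lemma (in symmetric_operad) submodule_iff: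
  assumes L: "finite L"
  shows "submodule N scalars (op_space P L) \<longleftrightarrow> N \<subseteq> op_carrier P L \<and> \<zero>\<^bsub>op_space P L\<^esub> \<in> N \<and>
    (\<forall>u\<in>N. \<forall>v\<in>N. u \<oplus>\<^bsub>op_space P L\<^esub> v \<in> N) \<and> (\<forall>k. \<forall>u\<in>N. k \<odot>\<^bsub>op_space P L\<^esub> u \<in> N)"
proof -
  interpret M: Module.module scalars "op_space P L" by (rule space_module[OF L])
  have inv: "(- 1) \<odot>\<^bsub>op_space P L\<^esub> u = \<ominus>\<^bsub>op_space P L\<^esub> u" if "u \<in> op_carrier P L" for u
  proof -
    have "\<ominus>\<^bsub>scalars\<^esub> (1::'k) = - 1"
      using M.R.minus_equality[of "- 1" 1] by simp
    then show ?thesis using M.smult_l_minus[of 1 u] M.smult_one[OF that] that by simp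
  qed
  show ?thesis (is "?l \<longleftrightarrow> ?r")
  proof
    assume ?l
    then show ?r using M.submoduleE[of N] subgroup.one_closed[OF submodule.axioms(1)] by fastforce
  next
    assume ?r
    then show ?l by (intro M.submoduleI) (auto simp: inv[symmetric] subset_iff)
  qed
qed

lemma (in symmetric_operad) operad_ideal_carrier: "operad_ideal P (op_carrier P)"
  unfolding operad_ideal_def
  by (auto intro: Module.module.carrier_is_submodule[OF space_module] linear_maps_mem[OF relabel_linear]
      linear_maps_mem[OF comp_linear_right])

lemma (in symmetric_operad) operad_ideal_generated:
  assumes "\<And>L. X L \<subseteq> op_carrier P L"
  shows "operad_ideal P (ideal_generated P X)"
proof -
  define F where "F = {I. operad_ideal P I \<and> (\<forall>L. X L \<subseteq> I L)}"
  have g: "u \<in> ideal_generated P X L \<longleftrightarrow> (\<forall>I\<in>F. u \<in> I L)" for u L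
    by (auto simp: ideal_generated_def F_def)
  \<comment> \<open>The family of all operations is an ideal containing \<open>X\<close>; hence the
    intersection is over a nonempty family and stays inside the carriers.\<close>
  have F: "op_carrier P \<in> F" using operad_ideal_carrier assms by (simp add: F_def)
  have id: "operad_ideal P I" if "I \<in> F" for I using that by (simp add: F_def)
  show ?thesis
    unfolding operad_ideal_def
  proof (intro conjI allI impI ballI)
    show "submodule (ideal_generated P X L) scalars (op_space P L)" if L: "finite L" for L
    proof -
      have "submodule (I L) scalars (op_space P L)" if "I \<in> F" for I
        using id[OF that] L by (simp add: operad_ideal_def)
      then have sm: "\<forall>I\<in>F. I L \<subseteq> op_carrier P L \<and> \<zero>\<^bsub>op_space P L\<^esub> \<in> I L \<and>
          (\<forall>u\<in>I L. \<forall>v\<in>I L. u \<oplus>\<^bsub>op_space P L\<^esub> v \<in> I L) \<and> (\<forall>k. \<forall>u\<in>I L. k \<odot>\<^bsub>op_space P L\<^esub> u \<in> I L)"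
        unfolding submodule_iff[OF L] by (rule ballI)
      show ?thesis unfolding submodule_iff[OF L]
      proof (intro conjI subsetI ballI allI)
        show "u \<in> op_carrier P L" if "u \<in> ideal_generated P X L" for u
          by (rule bspec[OF that[unfolded g] F])
      qed (use sm in \<open>simp_all add: g\<close>)
    qed
    show "op_relabel P L \<sigma> p \<in> ideal_generated P X (\<sigma> ` L)"
      if "p \<in> ideal_generated P X L" "finite L \<and> inj_on \<sigma> L" for L \<sigma> p
      unfolding g
    proof
      fix I assume "I \<in> F"
      with id[OF this] that show "op_relabel P L \<sigma> p \<in> I (\<sigma> ` L)"
        unfolding operad_ideal_def g by simp
    qed
    show "op_comp P A i B p q \<in> ideal_generated P X (A \<union> B)"
      if "p \<in> ideal_generated P X (insert i A)" "q \<in> op_carrier P B"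
        "finite A \<and> finite B \<and> i \<notin> A \<and> A \<inter> B = {}" for A i B p q
      unfolding g
    proof
      fix I assume "I \<in> F"
      with id[OF this] that show "op_comp P A i B p q \<in> I (A \<union> B)"
        unfolding operad_ideal_def g by simp
    qed
    show "op_comp P A i B p q \<in> ideal_generated P X (A \<union> B)"
      if "p \<in> op_carrier P (insert i A)" "q \<in> ideal_generated P X B"
        "finite A \<and> finite B \<and> i \<notin> A \<and> A \<inter> B = {}" for A i B p q
      unfolding g
    proof
      fix I assume "I \<in> F"
      with id[OF this] that show "op_comp P A i B p q \<in> I (A \<union> B)"
        unfolding operad_ideal_def g by simp
    qed
  qed
qed

lemma ideal_generated_incl: "X L \<subseteq> ideal_generated P X L"
  and ideal_generated_least: "operad_ideal P I \<Longrightarrow> (\<And>L. X L \<subseteq> I L) \<Longrightarrow> ideal_generated P X L \<subseteq> I L"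
  by (auto simp: ideal_generated_def)

section \<open>Quotients by an operadic ideal\<close>

locale operad_with_ideal = symmetric_operad P for P :: "('k::field, 'v) operad" +
  fixes I :: "nat set \<Rightarrow> 'v set"
  assumes ideal: "operad_ideal P I"
begin

definition coset :: "nat set \<Rightarrow> 'v \<Rightarrow> 'v set" where
  "coset L p = I L +>\<^bsub>op_space P L\<^esub> p"

lemma sub: "finite L \<Longrightarrow> submodule (I L) scalars (op_space P L)"
  using ideal by (simp add: operad_ideal_def)

lemma asub: "finite L \<Longrightarrow> abelian_subgroup (I L) (op_space P L)"
  using sub space_module
  by (auto intro!: abelian_subgroupI3 additive_subgroup.intro simp: submodule_def module_def)

lemma I_carrier: "finite L \<Longrightarrow> u \<in> I L \<Longrightarrow> u \<in> op_carrier P L"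
  and I_smult: "finite L \<Longrightarrow> u \<in> I L \<Longrightarrow> k \<odot>\<^bsub>op_space P L\<^esub> u \<in> I L"
  using submodule_iff[of L "I L"] sub[of L] by (simp_all add: subset_iff)

lemma mem_coset: "x \<in> coset L y \<longleftrightarrow> (\<exists>h\<in>I L. x = h \<oplus>\<^bsub>op_space P L\<^esub> y)"
  by (auto simp: coset_def a_r_coset_def')

lemma coset_self: "finite L \<Longrightarrow> x \<in> op_carrier P L \<Longrightarrow> x \<in> coset L x"
  unfolding coset_def by (rule abelian_subgroup.a_rcos_self[OF asub])

lemma coset_eq: "finite L \<Longrightarrow> y \<in> op_carrier P L \<Longrightarrow> x \<in> coset L y \<Longrightarrow> coset L x = coset L y"
  unfolding coset_def by (metis abelian_subgroup.a_repr_independence' asub)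

lemma coset_image:
  assumes "finite L" "f \<in> linear_maps (op_space P L) (op_space P L')" "\<And>h. h \<in> I L \<Longrightarrow> f h \<in> I L'"
    and "y \<in> op_carrier P L" "x \<in> coset L y"
  shows "f x \<in> coset L' (f y)"
  using assms I_carrier by (auto simp: mem_coset linear_maps_add[OF assms(2)])

lemma coset_mem_carrier: "finite L \<Longrightarrow> y \<in> op_carrier P L \<Longrightarrow> x \<in> coset L y \<Longrightarrow> x \<in> op_carrier P L"
  using space_module I_carrier
  by (metis mem_coset Module.module.axioms(2) abelian_group.axioms(1) abelian_monoid.a_closed)

lemma smult_linear:
  assumes "finite L" shows "smult (op_space P L) k \<in> linear_maps (op_space P L) (op_space P L)"
proof -
  interpret M: Module.module scalars "op_space P L" by (rule space_module[OF assms])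
  show ?thesis
    using M.smult_closed[of k] M.smult_r_distr[of k] M.smult_assoc1[of k] M.smult_assoc1[of _ k]
    by (simp add: linear_maps_def Pi_def) (metis mult.commute)
qed

text \<open>Quotient operations are unions over representatives. All members of the union coincide
  and there is at least one, so the union is the coset obtained from any single
  representative.\<close>

lemma UN_coset:
  assumes L: "finite L" "finite L'" and y: "y \<in> op_carrier P L"
    and f: "\<And>x. x \<in> coset L y \<Longrightarrow> f x \<in> coset L' (f y)" "f y \<in> op_carrier P L'"
  shows "(\<Union>x\<in>coset L y. coset L' (f x)) = coset L' (f y)"
proof -
  have "(\<Union>x\<in>coset L y. coset L' (f x)) = (\<Union>x\<in>coset L y. coset L' (f y))"
    by (rule SUP_cong[OF HOL.refl]) (rule coset_eq[OF L(2) f(2) f(1)])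
  also have "\<dots> = coset L' (f y)"
    using coset_self[OF L(1) y] by (intro SUP_const) auto
  finally show ?thesis .
qed

lemma linear_mapsI:
  assumes "\<And>u. u \<in> carrier M \<Longrightarrow> f u \<in> carrier N"
    and "\<And>u v. u \<in> carrier M \<Longrightarrow> v \<in> carrier M \<Longrightarrow> f (u \<oplus>\<^bsub>M\<^esub> v) = f u \<oplus>\<^bsub>N\<^esub> f v"
    and "\<And>k u. u \<in> carrier M \<Longrightarrow> f (k \<odot>\<^bsub>M\<^esub> u) = k \<odot>\<^bsub>N\<^esub> f u"
  shows "f \<in> linear_maps M N"
  using assms by (simp add: linear_maps_def)

text \<open>Compatibility of the projection with the coset operations is all that is shown here; the
  operad axioms for the quotient then follow from surjectivity.\<close>

lemma quotient_epi: "operad_epi P (operad_quotient P I) coset"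
  unfolding operad_epi_def
proof (intro conjI allI impI ballI)
  fix L :: "nat set" assume L: "finite L"
  interpret M: Module.module scalars "op_space P L" by (rule space_module[OF L])
  have IL: "I L \<subseteq> op_carrier P L" using I_carrier[OF L] by blast
  show im: "coset L ` op_carrier P L = op_carrier (operad_quotient P I) L"
    by (auto simp: operad_quotient_def quotient_module_def A_RCOSETS_def' coset_def)
  show "coset L \<zero>\<^bsub>op_space P L\<^esub> = \<zero>\<^bsub>op_space (operad_quotient P I) L\<^esub>"
    using M.a_coset_add_zero[OF IL] by (simp add: operad_quotient_def quotient_module_def coset_def)
  show "coset L \<in> linear_maps (op_space P L) (op_space (operad_quotient P I) L)"
  proof (rule linear_mapsI)
    fix u assume u: "u \<in> op_carrier P L"
    show "coset L u \<in> op_carrier (operad_quotient P I) L" using u im by blast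
    have "(\<Union>x\<in>coset L u. coset L (k \<odot>\<^bsub>op_space P L\<^esub> x)) = coset L (k \<odot>\<^bsub>op_space P L\<^esub> u)" for k
      by (rule UN_coset[where f = "\<lambda>x. k \<odot>\<^bsub>op_space P L\<^esub> x", OF L L u coset_image[OF L smult_linear[OF L] _ u]])
        (simp_all add: I_smult[OF L] linear_maps_mem[OF smult_linear[OF L] u])
    then show "coset L (k \<odot>\<^bsub>op_space P L\<^esub> u) = k \<odot>\<^bsub>op_space (operad_quotient P I) L\<^esub> coset L u" for k :: 'k
      by (simp add: operad_quotient_def quotient_module_def coset_def)
    fix v assume v: "v \<in> op_carrier P L"
    show "coset L (u \<oplus>\<^bsub>op_space P L\<^esub> v) = coset L u \<oplus>\<^bsub>op_space (operad_quotient P I) L\<^esub> coset L v"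
      using abelian_subgroup.a_rcos_sum[OF asub[OF L] u v]
      by (simp add: operad_quotient_def quotient_module_def coset_def)
  qed
next
  fix L and \<sigma> :: "nat \<Rightarrow> nat" and p assume p: "p \<in> op_carrier P L" and "finite L \<and> inj_on \<sigma> L"
  then have L: "finite L" "inj_on \<sigma> L" by auto
  have "(\<Union>x\<in>coset L p. coset (\<sigma> ` L) (op_relabel P L \<sigma> x)) = coset (\<sigma> ` L) (op_relabel P L \<sigma> p)"
    by (rule UN_coset[where f = "op_relabel P L \<sigma>", OF L(1) _ p coset_image[OF L(1) relabel_linear[OF L] _ p]])
      (use L ideal linear_maps_mem[OF relabel_linear[OF L] p] in \<open>auto simp: operad_ideal_def\<close>)
  then show "coset (\<sigma> ` L) (op_relabel P L \<sigma> p) = op_relabel (operad_quotient P I) L \<sigma> (coset L p)"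
    by (simp add: operad_quotient_def coset_def)
next
  fix A i B p q assume p: "p \<in> op_carrier P (insert i A)" and q: "q \<in> op_carrier P B"
    and "finite A \<and> finite B \<and> i \<notin> A \<and> A \<inter> B = {}"
  then have H: "finite A" "finite B" "i \<notin> A" "A \<inter> B = {}" by auto
  have fin: "finite (A \<union> B)" "finite (insert i A)" using H by auto
  have cl: "op_comp P A i B p q \<in> op_carrier P (A \<union> B)" if "p \<in> op_carrier P (insert i A)" for p
    by (rule linear_maps_mem[OF comp_linear_right[OF H that] q])
  \<comment> \<open>For each fixed first argument the second one is replaced by its representative;
    afterwards the same is done with the first argument.\<close>
  have "(\<Union>y\<in>coset B q. coset (A \<union> B) (op_comp P A i B x y)) = coset (A \<union> B) (op_comp P A i B x q)"
    if x: "x \<in> op_carrier P (insert i A)" for x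
    by (rule UN_coset[where f = "op_comp P A i B x", OF H(2) fin(1) q coset_image[OF H(2) comp_linear_right[OF H x] _ q]])
      (use x H ideal cl in \<open>auto simp: operad_ideal_def\<close>)
  then have "(\<Union>x\<in>coset (insert i A) p. \<Union>y\<in>coset B q. coset (A \<union> B) (op_comp P A i B x y)) =
     (\<Union>x\<in>coset (insert i A) p. coset (A \<union> B) (op_comp P A i B x q))"
    using coset_mem_carrier[OF fin(2) p] by simp
  also have "\<dots> = coset (A \<union> B) (op_comp P A i B p q)"
    by (rule UN_coset[where f = "\<lambda>x. op_comp P A i B x q", OF fin(2) fin(1) p coset_image[OF fin(2) comp_linear_left[OF H q] _ p]])
      (use H ideal cl p q in \<open>auto simp: operad_ideal_def\<close>)
  finally show "coset (A \<union> B) (op_comp P A i B p q) =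
      op_comp (operad_quotient P I) A i B (coset (insert i A) p) (coset B q)"
    by (simp add: operad_quotient_def coset_def)
next
  show "coset {i} (op_unit P i) = op_unit (operad_quotient P I) i" for i
    by (simp add: operad_quotient_def coset_def)
qed

lemma coset_eq_iff:
  assumes "finite L" "x \<in> op_carrier P L" "y \<in> op_carrier P L"
  shows "coset L x = coset L y \<longleftrightarrow> (\<exists>h\<in>I L. x = h \<oplus>\<^bsub>op_space P L\<^esub> y)"
  using assms coset_eq coset_self mem_coset by metis

end

section \<open>The free operad\<close>

text \<open>Trees before exchanges of subtrees are identified. The operad axioms hold here as
  equations between trees, and the free operad is an image of this operad.\<close>

definition tree_operad :: "('k::field, 'g tree \<Rightarrow>\<^sub>0 'k) operad" where
  "tree_operad =
    \<lparr>op_space = (\<lambda>L. free_space {t. distinct (leaves t) \<and> set (leaves t) = L}),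
     op_relabel = (\<lambda>L \<sigma>. lin_ext (\<lambda>t. basis_vec (map_leaves \<sigma> t))),
     op_comp = (\<lambda>A i B. bilin_ext (\<lambda>s t. basis_vec (graft s i t))),
     op_unit = (\<lambda>i. basis_vec (Leaf i))\<rparr>"

lemma pm_linear_eqI2:
  assumes "\<And>v. pm_linear (\<lambda>u. f u v)" "\<And>v. pm_linear (\<lambda>u. g u v)" "\<And>u. pm_linear (f u)" "\<And>u. pm_linear (g u)"
    and "u \<in> carrier (free_space X)" "v \<in> carrier (free_space Y)"
    and "\<And>a b. a \<in> X \<Longrightarrow> b \<in> Y \<Longrightarrow> f (basis_vec a) (basis_vec b) = g (basis_vec a) (basis_vec b)"
  shows "f u v = g u v"
  by (rule pm_linear_eqI[OF assms(1,2,5)], rule pm_linear_eqI[OF assms(3,4,6)]) (rule assms(7))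

lemma pm_linear_eqI3:
  assumes "\<And>v w. pm_linear (\<lambda>u. f u v w)" "\<And>v w. pm_linear (\<lambda>u. g u v w)"
    and "\<And>u w. pm_linear (\<lambda>v. f u v w)" "\<And>u w. pm_linear (\<lambda>v. g u v w)"
    and "\<And>u v. pm_linear (f u v)" "\<And>u v. pm_linear (g u v)"
    and "u \<in> carrier (free_space X)" "v \<in> carrier (free_space Y)" "w \<in> carrier (free_space Z)"
    and "\<And>a b c. a \<in> X \<Longrightarrow> b \<in> Y \<Longrightarrow> c \<in> Z \<Longrightarrow>
      f (basis_vec a) (basis_vec b) (basis_vec c) = g (basis_vec a) (basis_vec b) (basis_vec c)"
  shows "f u v w = g u v w"
  by (rule pm_linear_eqI[OF assms(1,2,7)], rule pm_linear_eqI[OF assms(3,4,8)],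
      rule pm_linear_eqI[OF assms(5,6,9)]) (rule assms(10))

section \<open>Grafting and relabelling of trees\<close>

lemma leaves_map_leaves [simp]: "leaves (map_leaves \<sigma> t) = map \<sigma> (leaves t)"
  by (induction t) auto

lemma map_leaves_cong: "(\<And>l. l \<in> set (leaves t) \<Longrightarrow> \<sigma> l = \<tau> l) \<Longrightarrow> map_leaves \<sigma> t = map_leaves \<tau> t"
  by (induction t) auto

lemma map_leaves_id: "map_leaves id t = t"
  by (induction t) auto

lemma map_leaves_comp: "map_leaves (\<tau> \<circ> \<sigma>) t = map_leaves \<tau> (map_leaves \<sigma> t)"
  by (induction t) auto

lemma graft_notin: "i \<notin> set (leaves s) \<Longrightarrow> graft s i u = s"
  by (induction s) auto

text \<open>Distinctness puts the leaf \<open>i\<close> into exactly one of the two subtrees, and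
  grafting does not change the other.\<close>

lemma leaves_graft:
  "distinct (leaves s) \<Longrightarrow> distinct (leaves u) \<Longrightarrow> i \<in> set (leaves s) \<Longrightarrow>
    (set (leaves s) - {i}) \<inter> set (leaves u) = {} \<Longrightarrow>
    distinct (leaves (graft s i u)) \<and> set (leaves (graft s i u)) = (set (leaves s) - {i}) \<union> set (leaves u)"
proof (induction s)
  case (Node a s t)
  consider "i \<in> set (leaves s)" "i \<notin> set (leaves t)" | "i \<in> set (leaves t)" "i \<notin> set (leaves s)"
    using Node.prems by auto
  then show ?case using Node by cases (auto simp: graft_notin)
qed auto

text \<open>The place \<open>i\<close> itself is excepted because it disappears when
  \<open>q\<close> is grafted; the case \<open>j = i\<close> occurs, since the inserted operation
  may reuse the label of the input it replaces.\<close>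

lemma graft_graft_sequential:
  "j \<notin> set (leaves p) - {i} \<Longrightarrow> graft (graft p i q) j r = graft p i (graft q j r)"
  by (induction p) auto

lemma graft_graft_parallel:
  "i \<noteq> j \<Longrightarrow> j \<notin> set (leaves q) \<Longrightarrow> i \<notin> set (leaves r) \<Longrightarrow>
    graft (graft p i q) j r = graft (graft p j r) i q"
  by (induction p) (auto simp: graft_notin)

lemma map_leaves_graft:
  "i' \<notin> \<sigma> ` (set (leaves p) - {i}) \<Longrightarrow>
    map_leaves \<sigma> (graft p i q) = graft (map_leaves (\<sigma>(i := i')) p) i' (map_leaves \<sigma> q)"
  by (induction p) auto

lemma graft_Leaf: "graft p i (Leaf j) = map_leaves (id(i := j)) p"
  by (induction p) auto

lemmas pm_linear_intros = pm_linear_lin_ext pm_linear_bilin_left pm_linear_bilin_right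
  pm_linear_compose[OF pm_linear_lin_ext] pm_linear_compose[OF pm_linear_bilin_left]
  pm_linear_compose[OF pm_linear_bilin_right] pm_linear_id

lemma symmetric_operad_tree_operad: "symmetric_operad (tree_operad :: ('k::field, 'g tree \<Rightarrow>\<^sub>0 'k) operad)"
proof (rule symmetric_operad.intro)
  let ?T = "tree_operad :: ('k::field, 'g tree \<Rightarrow>\<^sub>0 'k) operad"
  let ?X = "\<lambda>L. {t::'g tree. distinct (leaves t) \<and> set (leaves t) = L}"
  have sp: "op_space ?T L = free_space (?X L)" for L by (simp add: tree_operad_def)
  have rl: "op_relabel ?T L \<sigma> = lin_ext (\<lambda>t. basis_vec (map_leaves \<sigma> t))" for L \<sigma>
    by (simp add: tree_operad_def)
  have cm: "op_comp ?T A i B = bilin_ext (\<lambda>s t. basis_vec (graft s i t))" for A i B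
    by (simp add: tree_operad_def)
  have un: "op_unit ?T i = basis_vec (Leaf i)" for i by (simp add: tree_operad_def)
  show "Module.module scalars (op_space ?T L)" for L unfolding sp by (rule module_free_space)
  show "op_relabel ?T L \<sigma> \<in> linear_maps (op_space ?T L) (op_space ?T (\<sigma> ` L))" if "inj_on \<sigma> L" for L \<sigma>
    unfolding sp rl by (rule pm_linear_mapsI[OF pm_linear_lin_ext]) (use that in \<open>auto simp: distinct_map\<close>)
  show "op_relabel ?T L \<tau> p = op_relabel ?T L \<sigma> p"
    if "\<And>l. l \<in> L \<Longrightarrow> \<tau> l = \<sigma> l" "p \<in> op_carrier ?T L" for L \<sigma> \<tau> p
    unfolding rl by (rule pm_linear_eqI[OF _ _ that(2)[unfolded sp]])
      (use that in \<open>auto intro: pm_linear_intros intro!: arg_cong[of _ _ basis_vec] map_leaves_cong\<close>)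
  show "op_relabel ?T L id p = p" if "p \<in> op_carrier ?T L" for L p
    unfolding rl by (rule pm_linear_eqI[OF _ _ that[unfolded sp]])
      (auto intro: pm_linear_intros simp: map_leaves_id[unfolded id_def])
  show "op_relabel ?T L (\<tau> \<circ> \<sigma>) p = op_relabel ?T (\<sigma> ` L) \<tau> (op_relabel ?T L \<sigma> p)"
    if "p \<in> op_carrier ?T L" for L \<sigma> \<tau> p
    unfolding rl by (rule pm_linear_eqI[OF _ _ that[unfolded sp]])
      (auto intro: pm_linear_intros simp: map_leaves_comp[unfolded o_def])
  have cl: "graft s i t \<in> ?X (A \<union> B)"
    if "i \<notin> A" "A \<inter> B = {}" "s \<in> ?X (insert i A)" "t \<in> ?X B" for A B i s t
    using leaves_graft[of s t i] that by auto
  show "(\<lambda>p. op_comp ?T A i B p q) \<in> linear_maps (op_space ?T (insert i A)) (op_space ?T (A \<union> B))"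
    if "i \<notin> A" "A \<inter> B = {}" "q \<in> op_carrier ?T B" for A B i q
    unfolding sp cm
  proof (rule pm_linear_mapsI[OF pm_linear_bilin_left])
    fix s assume s: "s \<in> ?X (insert i A)"
    have "bilin_ext (\<lambda>s t. basis_vec (graft s i t)) (basis_vec s) \<in> linear_maps (free_space (?X B)) (free_space (?X (A \<union> B)))"
      by (rule pm_linear_mapsI[OF pm_linear_bilin_right]) (use cl[OF that(1,2) s] in simp)
    then show "bilin_ext (\<lambda>s t. basis_vec (graft s i t)) (basis_vec s) q \<in> carrier (free_space (?X (A \<union> B)))"
      using that(3) unfolding sp by (rule linear_maps_mem)
  qed
  show "op_comp ?T A i B p \<in> linear_maps (op_space ?T B) (op_space ?T (A \<union> B))"
    if "i \<notin> A" "A \<inter> B = {}" "p \<in> op_carrier ?T (insert i A)" for A B i p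
    unfolding sp cm
  proof (rule pm_linear_mapsI[OF pm_linear_bilin_right])
    fix t assume t: "t \<in> ?X B"
    have "(\<lambda>p. bilin_ext (\<lambda>s t. basis_vec (graft s i t)) p (basis_vec t)) \<in> linear_maps (free_space (?X (insert i A))) (free_space (?X (A \<union> B)))"
      by (rule pm_linear_mapsI[OF pm_linear_bilin_left]) (use cl[OF that(1,2) _ t] in simp)
    then show "bilin_ext (\<lambda>s t. basis_vec (graft s i t)) p (basis_vec t) \<in> carrier (free_space (?X (A \<union> B)))"
      using that(3) unfolding sp by (rule linear_maps_mem)
  qed
  show "op_relabel ?T (A \<union> B) \<sigma> (op_comp ?T A i B p q) =
      op_comp ?T (\<sigma> ` A) i' (\<sigma> ` B) (op_relabel ?T (insert i A) (\<sigma>(i := i')) p) (op_relabel ?T B \<sigma> q)"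
    if "i \<notin> A" "i' \<notin> \<sigma> ` A" "p \<in> op_carrier ?T (insert i A)" "q \<in> op_carrier ?T B" for A B i i' \<sigma> p q
    unfolding rl cm
    by (rule pm_linear_eqI2[OF _ _ _ _ that(3,4)[unfolded sp]]; (intro pm_linear_intros)?)
      (use that in \<open>simp add: map_leaves_graft[of i' \<sigma> _ i] fun_upd_def\<close>)
  show "op_comp ?T (A \<union> B) j C (op_comp ?T A i (insert j B) p q) r = op_comp ?T A i (B \<union> C) p (op_comp ?T B j C q r)"
    if "j \<notin> A" "p \<in> op_carrier ?T (insert i A)" "q \<in> op_carrier ?T (insert j B)" "r \<in> op_carrier ?T C"
    for A B C i j p q r
    unfolding cm
    by (rule pm_linear_eqI3[OF _ _ _ _ _ _ that(2-4)[unfolded sp]]; (intro pm_linear_intros)?)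
      (use that in \<open>auto simp: graft_graft_sequential\<close>)
  show "op_comp ?T (A \<union> B) j C (op_comp ?T (insert j A) i B p q) r = op_comp ?T (A \<union> C) i B (op_comp ?T (insert i A) j C p r) q"
    if "i \<noteq> j" "j \<notin> B" "i \<notin> C" "p \<in> op_carrier ?T (insert i (insert j A))" "q \<in> op_carrier ?T B" "r \<in> op_carrier ?T C"
    for A B C i j p q r
    unfolding cm
    by (rule pm_linear_eqI3[OF _ _ _ _ _ _ that(4-6)[unfolded sp]]; (intro pm_linear_intros)?)
      (use that in \<open>auto simp: graft_graft_parallel\<close>)
  show "op_unit ?T i \<in> op_carrier ?T {i}" for i by (simp add: un sp)
  show "op_relabel ?T {i} \<sigma> (op_unit ?T i) = op_unit ?T (\<sigma> i)" for i \<sigma> by (simp add: un rl)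
  show "op_comp ?T {} i B (op_unit ?T i) q = q" if "q \<in> op_carrier ?T B" for B i q
    unfolding cm un by (rule pm_linear_eqI[OF _ _ that[unfolded sp]]) (auto intro: pm_linear_intros)
  show "op_comp ?T A i {j} p (op_unit ?T j) = op_relabel ?T (insert i A) (id(i := j)) p"
    if "p \<in> op_carrier ?T (insert i A)" for A i j p
    unfolding cm un rl by (rule pm_linear_eqI[OF _ _ that[unfolded sp]])
      (auto intro: pm_linear_intros simp: graft_Leaf fun_upd_def id_def)
qed

section \<open>Passing to trees up to exchange of subtrees\<close>

lemma tree_class_eq: "tree_eq sw s t \<Longrightarrow> tree_class sw s = tree_class sw t"
  by (auto simp: tree_class_def intro: tree_eq.sym tree_eq.trans)

lemma tree_class_self: "t \<in> tree_class sw t"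
  by (simp add: tree_class_def tree_eq.refl)

lemma tree_eq_leaves:
  "tree_eq sw s t \<Longrightarrow> set (leaves s) = set (leaves t) \<and> (distinct (leaves s) \<longleftrightarrow> distinct (leaves t))"
  by (induction rule: tree_eq.induct) auto

lemma tree_eq_map_leaves: "tree_eq sw s t \<Longrightarrow> tree_eq sw (map_leaves \<sigma> s) (map_leaves \<sigma> t)"
  by (induction rule: tree_eq.induct) (auto intro: tree_eq.intros)

lemma tree_eq_graft_left: "tree_eq sw s t \<Longrightarrow> tree_eq sw (graft s i u) (graft t i u)"
  by (induction rule: tree_eq.induct) (auto intro: tree_eq.intros)

lemma tree_eq_graft_right: "tree_eq sw u v \<Longrightarrow> tree_eq sw (graft s i u) (graft s i v)"
  by (induction s) (auto intro: tree_eq.intros)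

lemma tree_class_map_leaves:
  "(\<Union>t\<in>tree_class sw s. tree_class sw (map_leaves \<sigma> t)) = tree_class sw (map_leaves \<sigma> s)"
  using tree_class_self tree_class_eq[OF tree_eq_map_leaves] by (fastforce simp: tree_class_def[of sw s])

lemma tree_class_graft:
  "(\<Union>a\<in>tree_class sw s. \<Union>b\<in>tree_class sw t. tree_class sw (graft a i b)) = tree_class sw (graft s i t)"
proof -
  have "tree_class sw (graft a i b) = tree_class sw (graft s i t)"
    if "a \<in> tree_class sw s" "b \<in> tree_class sw t" for a b
    using that tree_class_eq[of sw "graft s i t" "graft a i b"]
    by (metis tree_class_def mem_Collect_eq tree_eq.trans tree_eq_graft_left tree_eq_graft_right)
  then show ?thesis using tree_class_self[of s sw] tree_class_self[of t sw] by blast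
qed

lemma pm_linear_ontoI:
  assumes "pm_linear f" "f \<in> linear_maps (free_space X) (free_space Y)"
    and "\<And>b. b \<in> Y \<Longrightarrow> \<exists>u\<in>carrier (free_space X). f u = basis_vec b"
  shows "f ` carrier (free_space X) = carrier (free_space Y)"
proof
  show "carrier (free_space Y) \<subseteq> f ` carrier (free_space X)"
  proof
    fix v :: "'c \<Rightarrow>\<^sub>0 'b" assume "v \<in> carrier (free_space Y)"
    then show "v \<in> f ` carrier (free_space X)"
    proof (induction rule: free_space_induct)
      case zero
      show ?case using pm_linear_zero[OF assms(1)] by (metis free_space_closed(1) imageI)
    next
      case (add u v)
      then show ?case using pm_linear_add[OF assms(1)] by (metis (no_types, opaque_lifting) free_space_closed(2) image_iff)
    next
      case (scale k u)
      then show ?case using pm_linear_scale[OF assms(1)] by (metis (no_types, opaque_lifting) free_space_closed(4) image_iff)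
    next
      case (basis b)
      then show ?case using assms(3) by (metis image_iff)
    qed
  qed
qed (use assms(2) in \<open>auto simp: linear_maps_def\<close>)

lemma free_operad_epi:
  "operad_epi tree_operad (free_operad sw :: ('k::field, 'g tree set \<Rightarrow>\<^sub>0 'k) operad)
    (\<lambda>L. lin_ext (\<lambda>t. basis_vec (tree_class sw t)))"
  unfolding operad_epi_def tree_operad_def free_operad_def operad.simps
proof (intro conjI allI impI ballI)
  let ?f = "lin_ext (\<lambda>t. basis_vec (tree_class sw t)) :: ('g tree \<Rightarrow>\<^sub>0 'k) \<Rightarrow> _"
  let ?X = "\<lambda>L. {t::'g tree. distinct (leaves t) \<and> set (leaves t) = L}"
  fix L
  show l: "?f \<in> linear_maps (free_space (?X L)) (free_space (tree_basis sw L))"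
    by (rule pm_linear_mapsI[OF pm_linear_lin_ext]) (auto simp: tree_basis_def)
  show "?f ` carrier (free_space (?X L)) = carrier (free_space (tree_basis sw L))"
  proof (rule pm_linear_ontoI[OF pm_linear_lin_ext l])
    fix b assume "b \<in> tree_basis sw L"
    then obtain t where "b = tree_class sw t" "t \<in> ?X L" by (auto simp: tree_basis_def)
    then show "\<exists>u\<in>carrier (free_space (?X L)). ?f u = basis_vec b"
      by (intro bexI[of _ "basis_vec t"]) auto
  qed
  show "?f \<zero>\<^bsub>free_space (?X L)\<^esub> = \<zero>\<^bsub>free_space (tree_basis sw L)\<^esub>"
    by (simp add: pm_linear_zero pm_linear_lin_ext)
  fix \<sigma> p assume p: "p \<in> carrier (free_space (?X L) :: ('k, _) module)"
  show "?f (lin_ext (\<lambda>t. basis_vec (map_leaves \<sigma> t)) p) =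
      lin_ext (\<lambda>s. basis_vec (\<Union>t\<in>s. tree_class sw (map_leaves \<sigma> t))) (?f p)"
    by (rule pm_linear_eqI[OF _ _ p]; (intro pm_linear_intros)?) (simp add: tree_class_map_leaves)
next
  let ?f = "lin_ext (\<lambda>t. basis_vec (tree_class sw t)) :: ('g tree \<Rightarrow>\<^sub>0 'k) \<Rightarrow> _"
  let ?X = "\<lambda>L. {t::'g tree. distinct (leaves t) \<and> set (leaves t) = L}"
  fix A i B p q assume pq: "p \<in> carrier (free_space (?X (insert i A)) :: ('k, _) module)"
    "q \<in> carrier (free_space (?X B) :: ('k, _) module)"
  show "?f (bilin_ext (\<lambda>s t. basis_vec (graft s i t)) p q) =
      bilin_ext (\<lambda>s t. basis_vec (\<Union>a\<in>s. \<Union>b\<in>t. tree_class sw (graft a i b))) (?f p) (?f q)"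
    by (rule pm_linear_eqI2[OF _ _ _ _ pq]; (intro pm_linear_intros)?) (simp add: tree_class_graft)
qed simp

lemma symmetric_operad_free_operad:
  "symmetric_operad (free_operad sw :: ('k::field, 'g tree set \<Rightarrow>\<^sub>0 'k) operad)"
  by (rule operad_epimorphism.symmetric_operad_image[OF operad_epimorphism.intro,
        OF symmetric_operad_tree_operad operad_epimorphism_axioms.intro, OF free_operad_epi])

section \<open>Hypertree forests in terms of parents and depths\<close>

text \<open>\<open>p e\<close> is the parent vertex of the edge \<open>e\<close> and \<open>d v\<close> the distance of \<open>v\<close> from the root. In
  contrast to connectedness and acyclicity, these conditions are local, hence easily checked for
  forests assembled from smaller ones.\<close>

definition rooted :: "'v forest \<Rightarrow> ('v set \<Rightarrow> 'v) \<Rightarrow> ('v \<Rightarrow> nat) \<Rightarrow> bool" where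
  "rooted F p d \<longleftrightarrow> finite (verts F) \<and> roots F \<noteq> {} \<and> roots F \<subseteq> verts F \<and>
    (\<forall>r\<in>roots F. d r = 0) \<and>
    (\<forall>e\<in>edges F. e \<subseteq> verts F \<and> p e \<in> e \<and> e \<noteq> {p e} \<and> (\<forall>w\<in>e - {p e}. d w = Suc (d (p e)))) \<and>
    (\<forall>v\<in>verts F - roots F. \<exists>e\<in>edges F. v \<in> e - {p e}) \<and>
    (\<forall>e\<in>edges F. \<forall>e'\<in>edges F. (e - {p e}) \<inter> (e' - {p e'}) \<noteq> {} \<longrightarrow> e = e')"

lemma rootedD:
  assumes "rooted F p d"
  shows "finite (verts F)" "roots F \<noteq> {}" "roots F \<subseteq> verts F"
    "r \<in> roots F \<Longrightarrow> d r = 0"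
    "e \<in> edges F \<Longrightarrow> e \<subseteq> verts F" "e \<in> edges F \<Longrightarrow> p e \<in> e" "e \<in> edges F \<Longrightarrow> e \<noteq> {p e}"
    "e \<in> edges F \<Longrightarrow> w \<in> e \<Longrightarrow> w \<noteq> p e \<Longrightarrow> d w = Suc (d (p e))"
    "v \<in> verts F \<Longrightarrow> v \<notin> roots F \<Longrightarrow> \<exists>e\<in>edges F. v \<in> e \<and> v \<noteq> p e"
    "e \<in> edges F \<Longrightarrow> e' \<in> edges F \<Longrightarrow> w \<in> e \<Longrightarrow> w \<in> e' \<Longrightarrow> w \<noteq> p e \<Longrightarrow> w \<noteq> p e' \<Longrightarrow> e = e'"
proof -
  note * = assms[unfolded rooted_def]
  show "finite (verts F)" "roots F \<noteq> {}" "roots F \<subseteq> verts F" "r \<in> roots F \<Longrightarrow> d r = 0"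
    "e \<in> edges F \<Longrightarrow> e \<subseteq> verts F" "e \<in> edges F \<Longrightarrow> p e \<in> e" "e \<in> edges F \<Longrightarrow> e \<noteq> {p e}"
    "e \<in> edges F \<Longrightarrow> w \<in> e \<Longrightarrow> w \<noteq> p e \<Longrightarrow> d w = Suc (d (p e))"
    using * by simp_all
  have "\<forall>v\<in>verts F - roots F. \<exists>e\<in>edges F. v \<in> e - {p e}" using * by (elim conjE)
  then show "v \<in> verts F \<Longrightarrow> v \<notin> roots F \<Longrightarrow> \<exists>e\<in>edges F. v \<in> e \<and> v \<noteq> p e" by simp
  have "\<forall>e\<in>edges F. \<forall>e'\<in>edges F. (e - {p e}) \<inter> (e' - {p e'}) \<noteq> {} \<longrightarrow> e = e'" using * by (elim conjE)
  then show "e \<in> edges F \<Longrightarrow> e' \<in> edges F \<Longrightarrow> w \<in> e \<Longrightarrow> w \<in> e' \<Longrightarrow> w \<noteq> p e \<Longrightarrow> w \<noteq> p e' \<Longrightarrow> e = e'"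
    by fastforce
qed

lemma sym_adjacency: "sym (adjacency E)"
  by (auto simp: adjacency_def sym_def)

lemma adjacency_rtrancl_sym: "(u, v) \<in> (adjacency E)\<^sup>* \<Longrightarrow> (v, u) \<in> (adjacency E)\<^sup>*"
  by (meson sym_adjacency sym_rtrancl symD)

lemma adjacency_mono: "E \<subseteq> E' \<Longrightarrow> (adjacency E)\<^sup>* \<subseteq> (adjacency E')\<^sup>*"
  by (rule rtrancl_mono) (auto simp: adjacency_def)

lemma adjacencyI: "e \<in> E \<Longrightarrow> u \<in> e \<Longrightarrow> v \<in> e \<Longrightarrow> (u, v) \<in> adjacency E"
  by (auto simp: adjacency_def)

text \<open>Climbing from a vertex to the parent of the edge in which it is a child lowers
  \<open>d\<close> by one, and a vertex at which \<open>d\<close> vanishes cannot be a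
  child.\<close>

lemma rooted_reach:
  assumes R: "rooted F p d" and v: "v \<in> verts F"
  shows "\<exists>r\<in>roots F. (r, v) \<in> adjacency (edges F) ^^ d v"
  using v
proof (induction "d v" arbitrary: v)
  case 0
  then have "v \<in> roots F" using rootedD(8,9)[OF R] by (metis nat.distinct(1))
  then show ?case using 0 by (intro bexI[of _ v]) auto
next
  case (Suc n)
  then have "v \<notin> roots F" using rootedD(4)[OF R] by (metis nat.distinct(1))
  then obtain e where e: "e \<in> edges F" "v \<in> e" "v \<noteq> p e" using rootedD(9)[OF R Suc.prems] by auto
  have n: "n = d (p e)" using rootedD(8)[OF R e] Suc(2) by simp
  moreover have "p e \<in> verts F" using rootedD(5,6)[OF R e(1)] by auto
  ultimately obtain r where "r \<in> roots F" "(r, p e) \<in> adjacency (edges F) ^^ n" using Suc(1)[of "p e"] by auto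
  moreover have "(p e, v) \<in> adjacency (edges F)" using e rootedD(6)[OF R e(1)] by (intro adjacencyI)
  ultimately show ?case unfolding Suc(2)[symmetric] by auto
qed

text \<open>Along an adjacency \<open>d\<close> grows by at most one, so no walk from a root is
  shorter than \<open>d v\<close>. In particular the forest determines \<open>d\<close>.\<close>

lemma rooted_depth:
  assumes R: "rooted F p d" and v: "v \<in> verts F"
  shows "depth F v = d v"
  unfolding depth_def
proof (rule Least_equality)
  show "\<exists>r\<in>roots F. (r, v) \<in> adjacency (edges F) ^^ d v" by (rule rooted_reach[OF assms])
  have step: "d w \<le> Suc (d u)" if uw: "(u, w) \<in> adjacency (edges F)" for u w
  proof -
    obtain e where e: "e \<in> edges F" "u \<in> e" "w \<in> e" using uw by (auto simp: adjacency_def)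
    then show ?thesis using rootedD(8)[OF R e(1)] by (metis le_SucI le_refl Suc_n_not_le_n nat_le_linear)
  qed
  have le: "d w \<le> d u + n" if "(u, w) \<in> adjacency (edges F) ^^ n" for u w n
    using that
  proof (induction n arbitrary: w)
    case (Suc n)
    then obtain x where "(u, x) \<in> adjacency (edges F) ^^ n" "(x, w) \<in> adjacency (edges F)" by auto
    then show ?case using Suc.IH[of x] step[of x w] by simp
  qed simp
  fix n assume "\<exists>r\<in>roots F. (r, v) \<in> adjacency (edges F) ^^ n"
  then show "d v \<le> n" using le rootedD(4)[OF R] by fastforce
qed

lemma rooted_parent:
  assumes R: "rooted F p d" and e: "e \<in> edges F"
  shows "parent F e = p e"
  unfolding parent_def
proof (rule the_equality)
  have d: "depth F w = d w" if "w \<in> e" for w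
    using rooted_depth[OF R] rootedD(5)[OF R e] that by auto
  show *: "p e \<in> e \<and> (\<forall>w\<in>e. w \<noteq> p e \<longrightarrow> depth F (p e) < depth F w)"
    using rootedD(6,8)[OF R e] d by simp
  fix v assume "v \<in> e \<and> (\<forall>w\<in>e. w \<noteq> v \<longrightarrow> depth F v < depth F w)"
  then show "v = p e" using * by (metis less_asym)
qed

lemma rooted_cong:
  assumes R: "rooted F p d" and p: "\<And>e. e \<in> edges F \<Longrightarrow> p' e = p e" and d: "\<And>v. v \<in> verts F \<Longrightarrow> d' v = d v"
  shows "rooted F p' d'"
proof -
  have "d' r = 0" if "r \<in> roots F" for r using that d rootedD(3,4)[OF R] by auto
  moreover have "d' w = Suc (d' (p e))" if "e \<in> edges F" "w \<in> e - {p e}" for e w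
    using rootedD(5,6,8)[OF R that(1)] that d by (metis DiffD1 DiffD2 singletonI subsetD)
  ultimately show ?thesis
    using R p unfolding rooted_def by simp
qed

text \<open>The components are the fibres of \<open>\<rho>\<close>, which climbs from
  \<open>v\<close> to the root above it. It is constant on edges, hence on connected pieces, and
  fixes the roots.\<close>

lemma rooted_hypertree_forest:
  assumes R: "rooted F p d"
  shows "hypertree_forest F"
proof -
  \<comment> \<open>The description is meaningful only for vertices that are children; at a root
    \<open>d\<close> is 0, so \<open>\<rho>\<close> does not evaluate it there.\<close>
  define par where "par v = p (THE e. e \<in> edges F \<and> v \<in> e \<and> v \<noteq> p e)" for v
  define \<rho> where "\<rho> v = (par ^^ d v) v" for v
  have par: "par w = p e" if "e \<in> edges F" "w \<in> e" "w \<noteq> p e" for e w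
    unfolding par_def
    by (rule arg_cong[of _ _ p], rule the_equality) (use that rootedD(10)[OF R] in blast)+
  have \<rho>_edge: "\<rho> w = \<rho> (p e)" if "e \<in> edges F" "w \<in> e" for e w
  proof (cases "w = p e")
    case False
    then show ?thesis using rootedD(8)[OF R that] par[OF that] by (simp add: \<rho>_def funpow_swap1)
  qed simp
  have \<rho>_root: "\<rho> r = r" if "r \<in> roots F" for r using rootedD(4)[OF R that] by (simp add: \<rho>_def)
  have \<rho>_adj: "\<rho> u = \<rho> v" if "(u, v) \<in> adjacency (edges F) ^^ n" for u v n
    using that
  proof (induction n arbitrary: v)
    case (Suc n)
    then obtain x e where "(u, x) \<in> adjacency (edges F) ^^ n" "e \<in> edges F" "x \<in> e" "v \<in> e"
      by (auto simp: adjacency_def)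
    then show ?case using Suc.IH[of x] \<rho>_edge by metis
  qed simp
  have \<rho>_roots: "\<rho> v \<in> roots F" if "v \<in> verts F" for v
    using rooted_reach[OF R that] \<rho>_adj \<rho>_root by metis
  define Vr where "Vr r = {v \<in> verts F. \<rho> v = r}" for r
  define Er where "Er r = {e \<in> edges F. \<rho> (p e) = r}" for r
  have hyp: "hypergraph (Vr r) (Er r)" for r
    unfolding hypergraph_def
  proof (intro conjI ballI)
    show "finite (Vr r)" using rootedD(1)[OF R] by (simp add: Vr_def)
    fix e assume "e \<in> Er r"
    then have e: "e \<in> edges F" "\<rho> (p e) = r" by (auto simp: Er_def)
    show "e \<subseteq> Vr r" using rootedD(5)[OF R e(1)] \<rho>_edge[OF e(1)] e(2) by (auto simp: Vr_def)
    obtain w where "w \<in> e" "w \<noteq> p e" using rootedD(6,7)[OF R e(1)] by blast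
    then show "2 \<le> card e"
      using card_mono[of e "{p e, w}"] rootedD(6)[OF R e(1)] rootedD(1)[OF R] rootedD(5)[OF R e(1)]
      by (simp add: finite_subset)
  qed
  have conn: "(r, v) \<in> (adjacency (Er r))\<^sup>*" if "v \<in> Vr r" for r v
    using that
  proof (induction "d v" arbitrary: v)
    case 0
    then have "v \<in> roots F" using rootedD(8,9)[OF R] by (metis (no_types, lifting) Vr_def mem_Collect_eq nat.distinct(1))
    then show ?case using 0 \<rho>_root by (auto simp: Vr_def)
  next
    case (Suc n)
    then have "v \<in> verts F" "v \<notin> roots F" using rootedD(4)[OF R] by (auto simp: Vr_def)
    then obtain e where e: "e \<in> edges F" "v \<in> e" "v \<noteq> p e" using rootedD(9)[OF R] by blast
    have "n = d (p e)" using rootedD(8)[OF R e] Suc(2) by simp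
    moreover have r: "\<rho> (p e) = r" using \<rho>_edge[OF e(1,2)] Suc.prems by (auto simp: Vr_def)
    moreover have "p e \<in> Vr r" using r rootedD(5,6)[OF R e(1)] by (auto simp: Vr_def)
    ultimately have "(r, p e) \<in> (adjacency (Er r))\<^sup>*" using Suc(1) by blast
    moreover have "(p e, v) \<in> adjacency (Er r)"
      using e r rootedD(6)[OF R e(1)] by (auto simp: Er_def intro: adjacencyI)
    ultimately show ?case by simp
  qed
  text \<open>A vertex of maximal depth on a cycle would be a child in two different edges.\<close>
  have acyc: "\<not> hypergraph_cycle (Vr r) (Er r) vs es" for r vs es
  proof
    assume c: "hypergraph_cycle (Vr r) (Er r) vs es"
    define n where "n = length vs"
    have n: "2 \<le> n" "length es = n" "length vs = n" "distinct vs" "distinct es" "set es \<subseteq> edges F"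
      and cyc: "\<And>j. j < n \<Longrightarrow> vs ! j \<in> es ! (Suc j mod n) \<and> vs ! (Suc j mod n) \<in> es ! (Suc j mod n)"
      using c unfolding hypergraph_cycle_def by (auto simp: n_def Let_def Er_def)
    have "finite ((\<lambda>j. d (vs ! j)) ` {..<n})" "(\<lambda>j. d (vs ! j)) ` {..<n} \<noteq> {}" using n(1) by (auto simp: lessThan_empty_iff)
    note M = Max_in[OF this] Max_ge[OF this(1)]
    then obtain j where j: "j < n" "Max ((\<lambda>j. d (vs ! j)) ` {..<n}) = d (vs ! j)" by auto
    have max: "d (vs ! i) \<le> d (vs ! j)" if "i < n" for i using M(2)[of "d (vs ! i)"] that j(2) by simp
    note j = j(1)
    \<comment> \<open>In a cycle the edge with index \<open>l\<close> joins the vertices with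
      indices \<open>l - 1\<close> and \<open>l\<close> modulo \<open>n\<close>. The deepest vertex,
      with index \<open>j\<close>, thus lies on the edges with indices \<open>j\<close> and
      \<open>m\<close>, next to the vertices with indices \<open>k\<close> and
      \<open>m\<close>.\<close>
    define k where "k = (if j = 0 then n - 1 else j - 1)"
    define m where "m = Suc j mod n"
    have k: "k < n" "Suc k mod n = j" "k \<noteq> j" using j n(1) by (auto simp: k_def)
    have m: "m < n" "m \<noteq> j" using j n(1) by (auto simp: m_def mod_Suc)
    have child: "vs ! j \<noteq> p (es ! l)" if "l < n" "i < n" "i \<noteq> j" "vs ! i \<in> es ! l" for i l
    proof
      assume eq: "vs ! j = p (es ! l)"
      have "es ! l \<in> edges F" using n(2,6) that(1) nth_mem by blast
      moreover have "vs ! i \<noteq> vs ! j" using n(3,4) that j by (simp add: nth_eq_iff_index_eq)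
      ultimately have "d (vs ! i) = Suc (d (vs ! j))" using rootedD(8)[OF R, of "es ! l" "vs ! i"] that(4) eq by simp
      then show False using max[OF that(2)] by simp
    qed
    have "es ! m = es ! j"
    proof (rule rootedD(10)[OF R, of _ _ "vs ! j"])
      show "es ! m \<in> edges F" "es ! j \<in> edges F" using n(2,6) m j nth_mem by blast+
      show "vs ! j \<in> es ! m" using cyc[OF j] by (simp add: m_def)
      show "vs ! j \<in> es ! j" using cyc[OF k(1)] k(2) by simp
      show "vs ! j \<noteq> p (es ! m)" using child[OF m(1) m(1) m(2)] cyc[OF j] by (simp add: m_def)
      show "vs ! j \<noteq> p (es ! j)" using child[OF j k(1) k(3)] cyc[OF k(1)] k(2) by simp
    qed
    then show False using n(2,5) m j by (simp add: nth_eq_iff_index_eq)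
  qed
  have ht: "rooted_hypertree (Vr r) (Er r) r" if "r \<in> roots F" for r
    unfolding rooted_hypertree_def
  proof (intro conjI ballI)
    show "r \<in> Vr r" using that rootedD(3)[OF R] \<rho>_root by (auto simp: Vr_def)
    then show "Vr r \<noteq> {}" by auto
    show "(u, v) \<in> (adjacency (Er r))\<^sup>*" if "u \<in> Vr r" "v \<in> Vr r" for u v
      using conn[OF that(1)] conn[OF that(2)] adjacency_rtrancl_sym by (meson rtrancl_trans)
  qed (use hyp acyc in auto)
  show ?thesis
    unfolding hypertree_forest_def
  proof (intro exI[of _ "(\<lambda>r. (Vr r, Er r, r)) ` roots F"] conjI)
    show "finite ((\<lambda>r. (Vr r, Er r, r)) ` roots F)"
      using rootedD(1,3)[OF R] by (simp add: finite_subset)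
    show "(\<lambda>r. (Vr r, Er r, r)) ` roots F \<noteq> {}" using rootedD(2)[OF R] by simp
    show "\<forall>(V, E, r)\<in>(\<lambda>r. (Vr r, Er r, r)) ` roots F. rooted_hypertree V E r" using ht by auto
    show "\<forall>t\<in>(\<lambda>r. (Vr r, Er r, r)) ` roots F. \<forall>t'\<in>(\<lambda>r. (Vr r, Er r, r)) ` roots F. t \<noteq> t' \<longrightarrow> fst t \<inter> fst t' = {}"
      by (auto simp: Vr_def)
    show "verts F = (\<Union>(V, E, r)\<in>(\<lambda>r. (Vr r, Er r, r)) ` roots F. V)"
      using \<rho>_roots by (auto simp: Vr_def)
    show "edges F = (\<Union>(V, E, r)\<in>(\<lambda>r. (Vr r, Er r, r)) ` roots F. E)"
      using \<rho>_roots[OF subsetD[OF rootedD(5,6)[OF R]]] by (auto simp: Er_def)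
    show "roots F = (\<lambda>(V, E, r). r) ` (\<lambda>r. (Vr r, Er r, r)) ` roots F"
      by (simp add: image_image)
  qed
qed

text \<open>A shortest path between two vertices of \<open>e\<close> that avoids \<open>e\<close> closes up to a cycle.\<close>

lemma hypergraph_cycle_of_path:
  assumes path: "(u, w) \<in> (adjacency E')\<^sup>*" and uw: "u \<noteq> w" "u \<in> e" "w \<in> e"
    and e: "e \<in> E" "e \<notin> E'" and sub: "E' \<subseteq> E" "\<And>e. e \<in> E \<Longrightarrow> e \<subseteq> V"
  shows "\<exists>vs es. hypergraph_cycle V E vs es"
proof -
  define n where "n = (LEAST n. (u, w) \<in> adjacency E' ^^ n)"
  have n: "(u, w) \<in> adjacency E' ^^ n" unfolding n_def
    by (rule LeastI_ex) (use path in \<open>simp add: rtrancl_is_UN_relpow\<close>)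
  have min: "n \<le> m" if "(u, w) \<in> adjacency E' ^^ m" for m unfolding n_def by (rule Least_le) (rule that)
  have n0: "n \<noteq> 0" using n uw(1) by (cases n) auto
  obtain f where f: "f 0 = u" "f n = w" "\<And>i. i < n \<Longrightarrow> (f i, f (Suc i)) \<in> adjacency E'"
    using n unfolding relpow_fun_conv by blast
  then have "\<forall>i. \<exists>g. i < n \<longrightarrow> g \<in> E' \<and> f i \<in> g \<and> f (Suc i) \<in> g" by (fastforce simp: adjacency_def)
  then obtain g where g: "\<And>i. i < n \<Longrightarrow> g i \<in> E' \<and> f i \<in> g i \<and> f (Suc i) \<in> g i" by metis
  have seg: "(f i, f (i + k)) \<in> adjacency E' ^^ k" if "i + k \<le> n" for i k
    using that
  proof (induction k)
    case (Suc k)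
    then show ?case using f(3)[of "i + k"] by auto
  qed simp
  have injf: "f i \<noteq> f j" if "i < j" "j \<le> n" for i j
  proof
    assume eq: "f i = f j"
    have "(u, f i) \<in> adjacency E' ^^ i" using seg[of 0 i] that f(1) by simp
    moreover have "(f j, w) \<in> adjacency E' ^^ (n - j)" using seg[of j "n - j"] that f(2) by simp
    ultimately have "(u, w) \<in> adjacency E' ^^ (i + (n - j))" unfolding relpow_add using eq by auto
    from min[OF this] show False using that by simp
  qed
  \<comment> \<open>A repeated edge would lead from \<open>f i\<close> to \<open>f (Suc j)\<close>
    in one step and so shorten the path.\<close>
  have injg: "g i \<noteq> g j" if "i < j" "j < n" for i j
  proof
    assume eq: "g i = g j"
    have "(u, f i) \<in> adjacency E' ^^ i" using seg[of 0 i] that f(1) by simp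
    moreover have "(f i, f (Suc j)) \<in> adjacency E' ^^ 1"
      using g[of i] g[of j] that eq by (auto intro: adjacencyI)
    moreover have "(f (Suc j), w) \<in> adjacency E' ^^ (n - Suc j)" using seg[of "Suc j" "n - Suc j"] that f(2) by simp
    ultimately have "(u, w) \<in> adjacency E' ^^ (i + 1 + (n - Suc j))" unfolding relpow_add by blast
    from min[OF this] show False using that by simp
  qed
  define vs where "vs = map f [0..<Suc n]"
  \<comment> \<open>The closing edge comes first: index 0 of a cycle joins its last vertex
    \<open>w\<close> to its first vertex \<open>u\<close>.\<close>
  define es where "es = e # map g [0..<n]"
  have len: "length vs = Suc n" "length es = Suc n" by (simp_all add: vs_def es_def)
  have vs: "vs ! j = f j" if "j \<le> n" for j using that unfolding vs_def by (subst nth_map) (auto simp del: upt_Suc)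
  have es: "es ! Suc j = g j" if "j < n" for j using that by (simp add: es_def)
  have "hypergraph_cycle V E vs es"
    unfolding hypergraph_cycle_def
  proof (intro conjI allI impI)
    show "2 \<le> length vs" "length es = length vs" using n0 len by auto
    have "inj_on f (set [0..<Suc n])" using injf unfolding inj_on_def
      by (metis atLeastLessThan_iff less_Suc_eq_le linorder_neqE_nat set_upt)
    then show "distinct vs" unfolding vs_def by (simp add: distinct_map del: upt_Suc)
    have "inj_on g (set [0..<n])" using injg unfolding inj_on_def
      by (metis atLeastLessThan_iff linorder_neqE_nat set_upt)
    then show "distinct es" unfolding es_def using g e(2) by (auto simp: distinct_map)
    show "set es \<subseteq> E" unfolding es_def using e(1) sub(1) g by auto
    show "set vs \<subseteq> V"
    proof
      fix x assume "x \<in> set vs"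
      then obtain i where "i < Suc n" "x = f i" unfolding vs_def by (auto simp del: upt_Suc)
      then have i: "i \<le> n" "x = f i" by simp_all
      show "x \<in> V"
      proof (cases "i = n")
        case True then show ?thesis using i f(2) uw(3) sub(2)[OF e(1)] by auto
      next
        case False then show ?thesis using i g[of i] sub by (metis le_neq_implies_less subsetD)
      qed
    qed
    fix j assume "j < length vs"
    then have j: "j \<le> n" using len by simp
    show "let j' = Suc j mod length vs in vs ! j \<in> es ! j' \<and> vs ! j' \<in> es ! j'"
    proof (cases "j = n")
      case True
      then show ?thesis using vs f(1,2) uw by (simp add: Let_def len es_def)
    next
      case False
      then show ?thesis using vs es g[of j] j by (simp add: Let_def len)
    qed
  qed
  then show ?thesis by blast
qed

text \<open>The parent of \<open>e\<close> is the vertex of \<open>e\<close> that is still reachable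
  from a root when \<open>e\<close> is deleted. It exists because a path from a root towards
  \<open>e\<close> has a first contact with \<open>e\<close>. It is unique because, by acyclicity,
  two vertices of \<open>e\<close> are not connected without \<open>e\<close>; this is the fact
  \<open>K\<close>.\<close>

lemma hypertree_forest_rooted:
  fixes F :: "'v forest"
  assumes "hypertree_forest F"
  shows "\<exists>p. rooted F p (depth F)"
proof -
  obtain T :: "('v set \<times> 'v set set \<times> 'v) set" where T: "finite T" "T \<noteq> {}"
    and ht': "\<forall>(V, E, r)\<in>T. rooted_hypertree V E r"
    and disj': "\<forall>t\<in>T. \<forall>t'\<in>T. t \<noteq> t' \<longrightarrow> fst t \<inter> fst t' = {}"
    and vF: "verts F = (\<Union>(V, E, r)\<in>T. V)" and eF: "edges F = (\<Union>(V, E, r)\<in>T. E)"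
    and rF: "roots F = (\<lambda>(V, E, r). r) ` T"
    using assms unfolding hypertree_forest_def by metis
  have ht: "rooted_hypertree V E r" if "(V, E, r) \<in> T" for V E r using ht' that by fast
  have disj: "fst t \<inter> fst t' = {}" if "t \<in> T" "t' \<in> T" "t \<noteq> t'" for t t' using disj' that by simp
  define E where "E = edges F"
  define R where "R = roots F"
  let ?A = "\<lambda>X. (adjacency X)\<^sup>*"
  have fin: "finite (verts F)"
    using T(1) ht unfolding vF by (auto simp: rooted_hypertree_def hypergraph_def)
  have edge: "\<exists>V E r. (V, E, r) \<in> T \<and> e \<in> E \<and> e \<subseteq> V \<and> 2 \<le> card e" if "e \<in> edges F" for e
    using that ht unfolding eF by (fastforce simp: rooted_hypertree_def hypergraph_def)
  have eV: "e \<subseteq> verts F" if "e \<in> E" for e using edge that unfolding vF E_def by fast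
  have same: "(V, E, r) = (V', E', r')" if "(V, E, r) \<in> T" "(V', E', r') \<in> T" "x \<in> V" "x \<in> V'" for V E r V' E' r' x
    using disj[OF that(1,2)] that(3,4) by auto
  \<comment> \<open>Paths stay in the component in which they start, also after deletion of the
    edges in \<open>X\<close>; so acyclicity of a single hypertree can be applied to connections in
    the whole forest.\<close>
  have loc: "(u, w) \<in> ?A (Et - X) \<and> w \<in> V" if "(u, w) \<in> ?A (E - X)" "(V, Et, r) \<in> T" "u \<in> V" for u w X V Et r
    using that(1)
  proof (induction rule: rtrancl_induct)
    case (step y z)
    obtain e where e: "e \<in> E" "e \<notin> X" "y \<in> e" "z \<in> e" using step(2) by (auto simp: adjacency_def)
    obtain V' E' r' where t: "(V', E', r') \<in> T" "e \<in> E'" "e \<subseteq> V'" using edge e(1) unfolding E_def by blast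
    have "(V', E', r') = (V, Et, r)" using same[OF t(1) that(2), of y] t(3) e(3) step.IH by auto
    then have "e \<in> Et - X" "z \<in> V" using t e by auto
    then show ?case using step.IH e adjacencyI by (metis rtrancl.rtrancl_into_rtrancl)
  qed (use that in auto)
  have K: "u = w" if H: "e \<in> E" "u \<in> e" "w \<in> e" "(u, w) \<in> ?A (E - {e})" for e u w
  proof (rule ccontr)
    assume "u \<noteq> w"
    obtain V Et r where t: "(V, Et, r) \<in> T" "e \<in> Et" "e \<subseteq> V" using edge H(1) unfolding E_def by blast
    have "(u, w) \<in> ?A (Et - {e})" using loc[OF that(4) t(1)] t(3) that(2) by auto
    then have "\<exists>vs es. hypergraph_cycle V Et vs es"
      by (rule hypergraph_cycle_of_path[of u w _ e]) (use \<open>u \<noteq> w\<close> that t ht[OF t(1)] in \<open>auto simp: rooted_hypertree_def hypergraph_def\<close>)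
    then show False using ht[OF t(1)] by (simp add: rooted_hypertree_def)
  qed
  have roots_eq: "r = r'" if H: "r \<in> R" "r' \<in> R" "(r, r') \<in> ?A E" for r r'
  proof -
    obtain V Et where t: "(V, Et, r) \<in> T" using H(1) unfolding R_def rF by auto
    obtain V' Et' where t': "(V', Et', r') \<in> T" using H(2) unfolding R_def rF by auto
    have "r' \<in> V" using loc[of r r' "{}", OF _ t] that(3) ht[OF t] by (simp add: rooted_hypertree_def)
    moreover have "r' \<in> V'" using ht[OF t'] by (simp add: rooted_hypertree_def)
    ultimately show ?thesis using same[OF t t'] by auto
  qed
  have reach: "\<exists>r\<in>R. (r, v) \<in> ?A E" if v: "v \<in> verts F" for v
  proof -
    obtain V Et r where t: "(V, Et, r) \<in> T" "v \<in> V" using v unfolding vF by auto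
    then have "(r, v) \<in> ?A Et" using ht[OF t(1)] by (simp add: rooted_hypertree_def)
    moreover have "Et \<subseteq> E" using t(1) unfolding E_def eF by auto
    moreover have "r \<in> R" using t(1) unfolding R_def rF by force
    ultimately show ?thesis using adjacency_mono by blast
  qed
  let ?top = "\<lambda>e u. u \<in> e \<and> (\<exists>r\<in>R. (r, u) \<in> ?A (E - {e}))"
  define p where "p e = (SOME u. ?top e u)" for e
  have mono: "(u, v) \<in> ?A E" if "(u, v) \<in> ?A (E - {e})" for u v e
    using that adjacency_mono[of "E - {e}" E] by blast
  have contact: "(r, v) \<in> ?A (E - {e}) \<or> (\<exists>u\<in>e. (r, u) \<in> ?A (E - {e}))" if "(r, v) \<in> ?A E" for r v e
    using that
  proof (induction rule: rtrancl_induct)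
    case (step y z)
    obtain f where f: "f \<in> E" "y \<in> f" "z \<in> f" using step(2) by (auto simp: adjacency_def)
    show ?case
    proof (cases "f = e")
      case True then show ?thesis using step.IH f by blast
    next
      case False
      then have "(y, z) \<in> adjacency (E - {e})" using f by (intro adjacencyI[of f]) auto
      then show ?thesis using step.IH by (meson rtrancl.rtrancl_into_rtrancl)
    qed
  qed simp
  have p_top: "?top e (p e)" if e: "e \<in> E" for e
    unfolding p_def
  proof (rule someI_ex)
    obtain v where v: "v \<in> e" using edge e unfolding E_def by fastforce
    then obtain r where "r \<in> R" "(r, v) \<in> ?A E" using reach eV[OF e] by blast
    then show "\<exists>u. ?top e u" using contact[of r v e] v by blast
  qed
  have p_unique: "u = u'" if e: "e \<in> E" and H: "?top e u" "?top e u'" for e u u'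
  proof -
    obtain r r' where r: "r \<in> R" "(r, u) \<in> ?A (E - {e})" and r': "r' \<in> R" "(r', u') \<in> ?A (E - {e})"
      using H by blast
    have "(u, u') \<in> adjacency E" using that by (intro adjacencyI[of e]) auto
    then have "(r, r') \<in> ?A E"
      using mono[OF r(2)] adjacency_rtrancl_sym[OF mono[OF r'(2)]] by (meson rtrancl.rtrancl_into_rtrancl rtrancl_trans)
    then have "r = r'" by (rule roots_eq[OF r(1) r'(1)])
    then have "(u, u') \<in> ?A (E - {e})"
      using r(2) r'(2) adjacency_rtrancl_sym by (meson rtrancl_trans)
    then show ?thesis using K[OF e] that by blast
  qed
  define d where "d = depth F"
  have d_le: "d v \<le> n" if "r \<in> R" "(r, v) \<in> adjacency E ^^ n" for r v n
    unfolding d_def depth_def by (rule Least_le) (use that in \<open>auto simp: R_def E_def\<close>)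
  have d_ex: "\<exists>r\<in>R. (r, v) \<in> adjacency E ^^ d v" if "v \<in> verts F" for v
    unfolding d_def depth_def R_def[symmetric] E_def[symmetric]
    by (rule LeastI_ex) (use reach[OF that] in \<open>auto simp: rtrancl_is_UN_relpow\<close>)
  \<comment> \<open>A walk from a root either avoids \<open>e\<close> or enters \<open>e\<close> for
    the first time at its parent, strictly before its end; this bounds the depth of the
    parent.\<close>
  have D: "(r, w) \<in> ?A (E - {e}) \<or> d (p e) < n" if "r \<in> R" "e \<in> E" "(r, w) \<in> adjacency E ^^ n" for r w e n
    using that(3)
  proof (induction n arbitrary: w)
    case (Suc n)
    then obtain y f where y: "(r, y) \<in> adjacency E ^^ n" and f: "f \<in> E" "y \<in> f" "w \<in> f" by (auto simp: adjacency_def)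
    consider "d (p e) < n" | "(r, y) \<in> ?A (E - {e})" using Suc.IH[OF y] by blast
    then show ?case
    proof cases
      case 2
      show ?thesis
      proof (cases "f = e")
        case True
        then have "y = p e" using p_unique[OF that(2) _ p_top[OF that(2)]] 2 f that(1) by blast
        then show ?thesis using d_le[OF that(1) y] by simp
      next
        case False
        then have "(y, w) \<in> adjacency (E - {e})" using f by (intro adjacencyI[of f]) auto
        then show ?thesis using 2 by (meson rtrancl.rtrancl_into_rtrancl)
      qed
    qed simp
  qed simp
  have d_child: "d w = Suc (d (p e))" if e: "e \<in> E" and w: "w \<in> e" "w \<noteq> p e" for e w
  proof (rule antisym)
    obtain r where r: "r \<in> R" "(r, p e) \<in> adjacency E ^^ d (p e)" using d_ex p_top[OF e] eV[OF e] by blast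
    have "(p e, w) \<in> adjacency E" using e w p_top[OF e] by (intro adjacencyI[of e]) auto
    then show "d w \<le> Suc (d (p e))" using r by (intro d_le[OF r(1)]) auto
    obtain r where r: "r \<in> R" "(r, w) \<in> adjacency E ^^ d w" using d_ex w eV[OF e] by blast
    have "(r, w) \<notin> ?A (E - {e})" using p_unique[OF e _ p_top[OF e], of w] w r(1) by blast
    then show "Suc (d (p e)) \<le> d w" using D[OF r(1) e r(2)] by simp
  qed
  have "rooted F p d"
    unfolding rooted_def E_def[symmetric] R_def[symmetric]
  proof (intro conjI ballI impI)
    show "R \<noteq> {}" using T(2) unfolding R_def rF by simp
    show "R \<subseteq> verts F" using ht unfolding R_def rF vF by (auto simp: rooted_hypertree_def)
    show "d r = 0" if "r \<in> R" for r using d_le[OF that, of r 0] by simp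
    fix e assume e: "e \<in> E"
    show "e \<subseteq> verts F" by (rule eV[OF e])
    show "p e \<in> e" using p_top[OF e] by blast
    show "e \<noteq> {p e}"
    proof
      assume "e = {p e}"
      then have "card e = 1" by (metis is_singletonI is_singleton_altdef)
      then show False using edge e unfolding E_def by fastforce
    qed
    show "d w = Suc (d (p e))" if "w \<in> e - {p e}" for w using d_child[OF e] that by auto
    fix f assume f: "f \<in> E" and "(e - {p e}) \<inter> (f - {p f}) \<noteq> {}"
    then obtain w where w: "w \<in> e" "w \<noteq> p e" "w \<in> f" "w \<noteq> p f" by auto
    show "e = f"
    proof (rule ccontr)
      assume ef: "e \<noteq> f"
      obtain r where r: "r \<in> R" "(r, p f) \<in> adjacency E ^^ d (p f)" using d_ex p_top[OF f] eV[OF f] by blast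
      \<comment> \<open>The parents of \<open>e\<close> and \<open>f\<close> have equal depth, so a
        shortest walk to \<open>p f\<close> avoids \<open>e\<close>. Continuing through
        \<open>f\<close> reaches \<open>w\<close> without \<open>e\<close>, which would make
        \<open>w\<close> the parent of \<open>e\<close>.\<close>
      have "\<not> d (p e) < d (p f)" using d_child[OF e w(1,2)] d_child[OF f w(3,4)] by simp
      then have "(r, p f) \<in> ?A (E - {e})" using D[OF r(1) e r(2)] by simp
      moreover have "(p f, w) \<in> adjacency (E - {e})" using f ef w p_top[OF f] by (intro adjacencyI[of f]) auto
      ultimately have "(r, w) \<in> ?A (E - {e})" by simp
      then show False using p_unique[OF e _ p_top[OF e], of w] w r(1) by blast
    qed
  next
    fix v assume v: "v \<in> verts F - R"
    obtain r where r: "r \<in> R" "(r, v) \<in> adjacency E ^^ d v" using d_ex v by blast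
    have "d v \<noteq> 0" using r v by (cases "d v") auto
    then obtain m where m: "d v = Suc m" by (cases "d v") auto
    then obtain y e where y: "(r, y) \<in> adjacency E ^^ m" and e: "e \<in> E" "y \<in> e" "v \<in> e"
      using r(2) by (auto simp: adjacency_def)
    have "d y \<le> m" by (rule d_le[OF r(1) y])
    then have "v \<noteq> p e" using d_child[OF e(1,2)] m by (cases "y = v") auto
    then show "\<exists>e\<in>E. v \<in> e - {p e}" using e by blast
  qed (rule fin)
  then show ?thesis unfolding d_def by blast
qed

lemma hypertree_forest_iff: "hypertree_forest F \<longleftrightarrow> (\<exists>p d. rooted F p d)"
  using hypertree_forest_rooted rooted_hypertree_forest by blast

lemma rooted_parent_depth: "hypertree_forest F \<Longrightarrow> rooted F (parent F) (depth F)"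
  using hypertree_forest_rooted rooted_cong rooted_parent by metis

section \<open>Operations on forests\<close>

definition map_forest :: "('v \<Rightarrow> 'w) \<Rightarrow> 'v forest \<Rightarrow> 'w forest" where
  "map_forest h F = \<lparr>verts = h ` verts F, edges = (`) h ` edges F, roots = h ` roots F\<rparr>"

text \<open>\<open>attach\<close>, \<open>munion\<close> and \<open>join\<close> are the forests
  occurring in the values of \<open>GenX\<close>, \<open>GenC\<close> and \<open>GenG\<close>. Every
  \<open>valid\<close> forest is built by them from single white vertices.\<close>

definition attach :: "'v \<Rightarrow> 'v forest \<Rightarrow> 'v forest \<Rightarrow> 'v forest" where
  "attach v S T = \<lparr>verts = verts S \<union> verts T,
    edges = insert (insert v (roots T)) (edges S \<union> edges T), roots = roots S\<rparr>"

definition munion :: "'v forest \<Rightarrow> 'v forest \<Rightarrow> 'v forest" where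
  "munion S T = \<lparr>verts = verts S \<union> verts T, edges = edges S \<union> edges T, roots = roots S \<union> roots T\<rparr>"

definition join :: "'v \<Rightarrow> 'v forest \<Rightarrow> 'v forest \<Rightarrow> 'v forest" where
  "join b S T = \<lparr>verts = insert b (verts S \<union> verts T),
    edges = {insert b (roots S), insert b (roots T)} \<union> (edges S \<union> edges T), roots = {b}\<rparr>"

definition single :: "'v \<Rightarrow> 'v forest" where
  "single v = \<lparr>verts = {v}, edges = {}, roots = {v}\<rparr>"

lemma forest_simps [simp]:
  "verts (map_forest h F) = h ` verts F" "edges (map_forest h F) = (`) h ` edges F"
  "roots (map_forest h F) = h ` roots F"
  "verts (attach v S T) = verts S \<union> verts T"
  "edges (attach v S T) = insert (insert v (roots T)) (edges S \<union> edges T)" "roots (attach v S T) = roots S"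
  "verts (munion S T) = verts S \<union> verts T" "edges (munion S T) = edges S \<union> edges T"
  "roots (munion S T) = roots S \<union> roots T"
  "verts (join b S T) = insert b (verts S \<union> verts T)"
  "edges (join b S T) = {insert b (roots S), insert b (roots T)} \<union> (edges S \<union> edges T)"
  "roots (join b S T) = {b}"
  "verts (single v) = {v}" "edges (single v) = {}" "roots (single v) = {v}"
  by (simp_all add: map_forest_def attach_def munion_def join_def single_def)

lemma forest_eqI: "verts F = verts G \<Longrightarrow> edges F = edges G \<Longrightarrow> roots F = roots G \<Longrightarrow> F = (G :: 'v forest)"
  by simp

lemma map_forest_attach: "map_forest h (attach v S T) = attach (h v) (map_forest h S) (map_forest h T)"
  and map_forest_munion: "map_forest h (munion S T) = munion (map_forest h S) (map_forest h T)"
  and map_forest_join: "map_forest h (join b S T) = join (h b) (map_forest h S) (map_forest h T)"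
  and map_forest_single: "map_forest h (single v) = single (h v)"
  and map_forest_comp: "map_forest h (map_forest g F) = map_forest (h \<circ> g) F"
  by (rule forest_eqI; simp add: image_Un image_image)+

text \<open>Since vertices keep their names, these are equalities and not merely isomorphisms.
  \<open>attach_commute\<close> and \<open>attach_root_join\<close> are the symmetries behind the
  pre-Lie relation and the relation for g.\<close>

lemma munion_commute: "munion S T = munion T S"
  and munion_assoc: "munion (munion S T) U = munion S (munion T U)"
  and munion_left_commute: "munion S (munion T U) = munion T (munion S U)"
  and join_commute: "join b S T = join b T S"
  and attach_commute: "attach v (attach w S T) U = attach w (attach v S U) T"
  and attach_attach: "attach v S (attach w T U) = attach w (attach v S T) U"
  and attach_munion_left: "attach v (munion S T) U = munion (attach v S U) T"
  and attach_munion_right: "attach v (munion S T) U = munion S (attach v T U)"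
  and attach_join_left: "attach v (join b S T) U = join b (attach v S U) T"
  and attach_join_right: "attach v (join b S T) U = join b S (attach v T U)"
  and attach_root_join: "attach b (join b S T) U = attach b (join b S U) T"
  by (rule forest_eqI; auto)+

text \<open>Just enough for the image of a forest to depend only on the values of a map at the
  vertices. The operations on classes are well defined at this level, before acyclicity
  enters.\<close>

definition graph_wf :: "'v forest \<Rightarrow> bool" where
  "graph_wf F \<longleftrightarrow> finite (verts F) \<and> (\<forall>e\<in>edges F. e \<subseteq> verts F) \<and> roots F \<subseteq> verts F"

lemma map_forest_cong: "graph_wf F \<Longrightarrow> (\<And>v. v \<in> verts F \<Longrightarrow> h v = g v) \<Longrightarrow> map_forest h F = map_forest g F"
proof (rule forest_eqI)
  assume wf: "graph_wf F" and eq: "\<And>v. v \<in> verts F \<Longrightarrow> h v = g v"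
  have "h ` A = g ` A" if "A \<subseteq> verts F" for A using that eq by (auto intro!: image_cong)
  then show "verts (map_forest h F) = verts (map_forest g F)" "edges (map_forest h F) = edges (map_forest g F)"
    "roots (map_forest h F) = roots (map_forest g F)"
    using wf by (auto simp: graph_wf_def intro!: image_cong)
qed

lemma map_forest_id: "map_forest id F = F" "map_forest (\<lambda>v. v) F = F"
  by (rule forest_eqI; simp)+

lemma graph_wf_ops:
  "graph_wf S \<Longrightarrow> graph_wf T \<Longrightarrow> v \<in> verts S \<Longrightarrow> graph_wf (attach v S T)"
  "graph_wf S \<Longrightarrow> graph_wf T \<Longrightarrow> graph_wf (munion S T)"
  "graph_wf S \<Longrightarrow> graph_wf T \<Longrightarrow> graph_wf (join b S T)"
  "graph_wf S \<Longrightarrow> graph_wf (map_forest h S)"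
  by (auto simp: graph_wf_def)

lemma rooted_graph_wf: "rooted F p d \<Longrightarrow> graph_wf F"
  using rootedD unfolding graph_wf_def by metis

lemma hypertree_forest_wf: "hypertree_forest F \<Longrightarrow> graph_wf F"
  using hypertree_forest_iff rooted_graph_wf by blast

lemma rootedI:
  assumes "finite (verts F)" "roots F \<noteq> {}" "roots F \<subseteq> verts F" "\<And>r. r \<in> roots F \<Longrightarrow> d r = 0"
    and "\<And>e. e \<in> edges F \<Longrightarrow> e \<subseteq> verts F \<and> p e \<in> e \<and> e \<noteq> {p e}"
    and "\<And>e w. e \<in> edges F \<Longrightarrow> w \<in> e \<Longrightarrow> w \<noteq> p e \<Longrightarrow> d w = Suc (d (p e))"
    and "\<And>v. v \<in> verts F \<Longrightarrow> v \<notin> roots F \<Longrightarrow> \<exists>e\<in>edges F. v \<in> e \<and> v \<noteq> p e"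
    and "\<And>e e' w. e \<in> edges F \<Longrightarrow> e' \<in> edges F \<Longrightarrow> w \<in> e \<Longrightarrow> w \<in> e' \<Longrightarrow> w \<noteq> p e \<Longrightarrow> w \<noteq> p e' \<Longrightarrow> e = e'"
  shows "rooted F p d"
proof -
  have "\<exists>e\<in>edges F. v \<in> e - {p e}" if "v \<in> verts F - roots F" for v using assms(7)[of v] that by auto
  moreover have "e = e'" if "e \<in> edges F" "e' \<in> edges F" "(e - {p e}) \<inter> (e' - {p e'}) \<noteq> {}" for e e'
    using assms(8)[OF that(1,2)] that(3) by auto
  ultimately show ?thesis using assms(1-6) unfolding rooted_def by simp
qed

lemma rooted_single: "rooted (single v) p (\<lambda>_. 0)"
  by (rule rootedI) auto

lemma rooted_edge_neq:
  assumes "rooted S p d" "e \<in> edges S"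
  shows "e \<noteq> {}" "e \<subseteq> verts S"
  using rootedD(5,6)[OF assms] by auto

text \<open>Depths in \<open>T\<close> are shifted by \<open>d v + 1\<close>. The new edge meets
  both vertex sets, so it is an edge of neither part and its parent can be prescribed independently
  of \<open>p\<close> and \<open>p'\<close>.\<close>

lemma rooted_attach:
  assumes S: "rooted S p d" and T: "rooted T p' d'" and disj: "verts S \<inter> verts T = {}" and v: "v \<in> verts S"
  shows "rooted (attach v S T) (\<lambda>e. if e \<in> edges S then p e else if e \<in> edges T then p' e else v)
    (\<lambda>u. if u \<in> verts S then d u else Suc (d v + d' u))" (is "rooted ?F ?p ?d")
    and "insert v (roots T) \<notin> edges S" "insert v (roots T) \<notin> edges T"
proof -
  have eS: "e \<subseteq> verts S" "p e \<in> e" "e \<noteq> {p e}" if "e \<in> edges S" for e using rootedD(5,6,7)[OF S that] .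
  have eT: "e \<subseteq> verts T" "p' e \<in> e" "e \<noteq> {p' e}" if "e \<in> edges T" for e using rootedD(5,6,7)[OF T that] .
  have rT: "roots T \<subseteq> verts T" "roots T \<noteq> {}" using rootedD(3,2)[OF T] .
  show NS: "insert v (roots T) \<notin> edges S" using eS(1) rT disj by fast
  show NT: "insert v (roots T) \<notin> edges T" using eT(1) v disj by fast
  have ST: "e \<notin> edges S" if "e \<in> edges T" for e using eS(1,2)[of e] eT(1,2)[OF that] disj by fast
  have pS: "?p e = p e" if "e \<in> edges S" for e using that by simp
  have pT: "?p e = p' e" if "e \<in> edges T" for e using that ST by simp
  have pN: "?p (insert v (roots T)) = v" using NS NT by simp
  have dT: "?d u = Suc (d v + d' u)" if "u \<in> verts T" for u using that disj by auto
  have cases: "e \<in> edges S \<or> e \<in> edges T \<or> e = insert v (roots T)" if "e \<in> edges ?F" for e using that by auto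
  show "rooted ?F ?p ?d"
  proof (rule rootedI)
    show "finite (verts ?F)" using rootedD(1)[OF S] rootedD(1)[OF T] by simp
    show "roots ?F \<noteq> {}" "roots ?F \<subseteq> verts ?F" using rootedD(2,3)[OF S] by auto
    show "?d r = 0" if "r \<in> roots ?F" for r using that rootedD(3,4)[OF S] by auto
    show "e \<subseteq> verts ?F \<and> ?p e \<in> e \<and> e \<noteq> {?p e}" if "e \<in> edges ?F" for e
      using cases[OF that]
    proof (elim disjE)
      assume "e = insert v (roots T)"
      then show ?thesis using pN v rT disj by auto
    next
      assume e: "e \<in> edges S"
      show ?thesis using eS[OF e] unfolding pS[OF e] by auto
    next
      assume e: "e \<in> edges T"
      show ?thesis using eT[OF e] unfolding pT[OF e] by auto
    qed
    show "?d w = Suc (?d (?p e))" if "e \<in> edges ?F" "w \<in> e" "w \<noteq> ?p e" for e w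
      using cases[OF that(1)]
    proof (elim disjE)
      assume e: "e \<in> edges S"
      then show ?thesis using rootedD(8)[OF S e that(2)] that(3) eS[OF e] that(2) by auto
    next
      assume e: "e \<in> edges T"
      then have w: "w \<in> verts T" "p' e \<in> verts T" using eT[OF e] that(2) by auto
      have "d' w = Suc (d' (p' e))" using that(3) pT[OF e] by (intro rootedD(8)[OF T e that(2)]) simp
      then show ?thesis unfolding pT[OF e] dT[OF w(1)] dT[OF w(2)] by simp
    next
      assume e: "e = insert v (roots T)"
      then have w: "w \<in> roots T" using that pN by auto
      then have "?d w = Suc (d v + d' w)" using rT(1) by (intro dT) auto
      then show ?thesis unfolding e pN using rootedD(4)[OF T w] v by simp
    qed
    show "\<exists>e\<in>edges ?F. u \<in> e \<and> u \<noteq> ?p e" if "u \<in> verts ?F" "u \<notin> roots ?F" for u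
    proof -
      consider "u \<in> verts S" "u \<notin> roots S" | "u \<in> verts T" "u \<notin> roots T" | "u \<in> roots T" using \<open>u \<in> verts ?F\<close> \<open>u \<notin> roots ?F\<close> by auto
      then show ?thesis
      proof cases
        case 1
        then show ?thesis using rootedD(9)[OF S] pS by fastforce
      next
        case 2
        then obtain e where e: "e \<in> edges T" "u \<in> e" "u \<noteq> p' e" using rootedD(9)[OF T] by blast
        then show ?thesis using pT[OF e(1)] by (intro bexI[of _ e]) auto
      next
        case 3
        then have "u \<noteq> v" using rT v disj by auto
        then show ?thesis using 3 pN by (intro bexI[of _ "insert v (roots T)"]) auto
      qed
    qed
    have wh: "(e \<in> edges S \<and> w \<in> verts S \<and> w \<noteq> p e) \<or> (e \<in> edges T \<and> w \<in> verts T \<and> w \<noteq> p' e) \<or> (e = insert v (roots T) \<and> w \<in> roots T)"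
      if "e \<in> edges ?F" "w \<in> e" "w \<noteq> ?p e" for e w
      using cases[OF that(1)] that eS(1)[of e] eT(1)[of e] pS[of e] pT[of e] pN by auto
    show "e = e'" if H: "e \<in> edges ?F" "e' \<in> edges ?F" "w \<in> e" "w \<in> e'" "w \<noteq> ?p e" "w \<noteq> ?p e'" for e e' w
    proof -
      \<comment> \<open>A root of \<open>T\<close> has depth 0 in \<open>T\<close> and is therefore
        no child there, so it is a child in the new edge only.\<close>
      have rootT: "w \<noteq> p' f \<Longrightarrow> f \<in> edges T \<Longrightarrow> w \<in> f \<Longrightarrow> w \<notin> roots T" for f
        using rootedD(4)[OF T, of w] rootedD(8)[OF T, of f w] by auto
      from wh[OF H(1,3,5)] wh[OF H(2,4,6)] show ?thesis
        using rootedD(10)[OF S, of e e' w] rootedD(10)[OF T, of e e' w] H(3,4) disj rT(1) rootT[of e] rootT[of e'] by blast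
    qed
  qed
qed

lemma rooted_munion:
  assumes S: "rooted S p d" and T: "rooted T p' d'" and disj: "verts S \<inter> verts T = {}"
  shows "rooted (munion S T) (\<lambda>e. if e \<in> edges S then p e else p' e) (\<lambda>u. if u \<in> verts S then d u else d' u)"
    (is "rooted ?F ?p ?d")
proof -
  have eS: "e \<subseteq> verts S" "p e \<in> e" "e \<noteq> {p e}" if "e \<in> edges S" for e using rootedD(5,6,7)[OF S that] .
  have eT: "e \<subseteq> verts T" "p' e \<in> e" "e \<noteq> {p' e}" if "e \<in> edges T" for e using rootedD(5,6,7)[OF T that] .
  have rT: "roots T \<subseteq> verts T" "roots S \<subseteq> verts S" using rootedD(3)[OF T] rootedD(3)[OF S] by auto
  have ST: "e \<notin> edges S" if "e \<in> edges T" for e using eS(1,2)[of e] eT(1,2)[OF that] disj by fast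
  have pS: "?p e = p e" if "e \<in> edges S" for e using that by simp
  have pT: "?p e = p' e" if "e \<in> edges T" for e using that ST by simp
  have dT: "?d u = d' u" if "u \<in> verts T" for u using that disj by auto
  show "rooted ?F ?p ?d"
  proof (rule rootedI)
    show "finite (verts ?F)" using rootedD(1)[OF S] rootedD(1)[OF T] by simp
    show "roots ?F \<noteq> {}" "roots ?F \<subseteq> verts ?F" using rootedD(2)[OF S] rT by auto
    show "?d r = 0" if "r \<in> roots ?F" for r using that rT rootedD(4)[OF S] rootedD(4)[OF T] dT[of r] by auto
    show "e \<subseteq> verts ?F \<and> ?p e \<in> e \<and> e \<noteq> {?p e}" if "e \<in> edges ?F" for e
      using that eS[of e] eT[of e] pS[of e] pT[of e] by auto
    show "?d w = Suc (?d (?p e))" if "e \<in> edges ?F" "w \<in> e" "w \<noteq> ?p e" for e w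
    proof (cases "e \<in> edges S")
      case e: True
      then show ?thesis using rootedD(8)[OF S e that(2)] that(3) eS[OF e] that(2) by auto
    next
      case False
      then have e: "e \<in> edges T" using that by simp
      then have w: "w \<in> verts T" "p' e \<in> verts T" using eT[OF e] that(2) by auto
      have "d' w = Suc (d' (p' e))" using that(3) pT[OF e] by (intro rootedD(8)[OF T e that(2)]) simp
      then show ?thesis unfolding pT[OF e] dT[OF w(1)] dT[OF w(2)] by simp
    qed
    show "\<exists>e\<in>edges ?F. u \<in> e \<and> u \<noteq> ?p e" if H: "u \<in> verts ?F" "u \<notin> roots ?F" for u
    proof -
      consider "u \<in> verts S" "u \<notin> roots S" | "u \<in> verts T" "u \<notin> roots T" using H by auto
      then show ?thesis
      proof cases
        case 1
        then show ?thesis using rootedD(9)[OF S] pS by fastforce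
      next
        case 2
        then obtain e where e: "e \<in> edges T" "u \<in> e" "u \<noteq> p' e" using rootedD(9)[OF T] by blast
        then show ?thesis using pT[OF e(1)] by (intro bexI[of _ e]) auto
      qed
    qed
    have wh: "(e \<in> edges S \<and> w \<in> verts S \<and> w \<noteq> p e) \<or> (e \<in> edges T \<and> w \<in> verts T \<and> w \<noteq> p' e)"
      if "e \<in> edges ?F" "w \<in> e" "w \<noteq> ?p e" for e w
      using that eS(1)[of e] eT(1)[of e] pS[of e] pT[of e] by auto
    show "e = e'" if H: "e \<in> edges ?F" "e' \<in> edges ?F" "w \<in> e" "w \<in> e'" "w \<noteq> ?p e" "w \<noteq> ?p e'" for e e' w
      using wh[OF H(1,3,5)] wh[OF H(2,4,6)]
        rootedD(10)[OF S, of e e' w] rootedD(10)[OF T, of e e' w] H(3,4) disj by blast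
  qed
qed

text \<open>Reduces \<open>join\<close> to two attachments at an isolated vertex. For a black
  \<open>b\<close> the intermediate forests are hypertree forests but not \<open>valid\<close>,
  which is why the two notions are kept apart.\<close>

lemma join_attach: "join b S T = attach b (attach b (single b) S) T"
  by (rule forest_eqI; auto)

lemma hypertree_forest_attach:
  assumes "hypertree_forest S" "hypertree_forest T" "verts S \<inter> verts T = {}" "v \<in> verts S"
  shows "hypertree_forest (attach v S T)"
    and "e \<in> edges S \<Longrightarrow> parent (attach v S T) e = parent S e"
    and "e \<in> edges T \<Longrightarrow> parent (attach v S T) e = parent T e"
    and "parent (attach v S T) (insert v (roots T)) = v"
    and "insert v (roots T) \<notin> edges S" "insert v (roots T) \<notin> edges T"
proof -
  note S = rooted_parent_depth[OF assms(1)] and T = rooted_parent_depth[OF assms(2)]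
  note R = rooted_attach[OF S T assms(3,4)]
  show "hypertree_forest (attach v S T)" by (rule rooted_hypertree_forest[OF R(1)])
  show "insert v (roots T) \<notin> edges S" "insert v (roots T) \<notin> edges T" by (rule R(2,3))+
  note p = rooted_parent[OF R(1)]
  show "e \<in> edges S \<Longrightarrow> parent (attach v S T) e = parent S e" using p[of e] by simp
  show "e \<in> edges T \<Longrightarrow> parent (attach v S T) e = parent T e"
    using p[of e] rooted_edge_neq[OF S, of e] rooted_edge_neq[OF T, of e] assms(3) by auto
  show "parent (attach v S T) (insert v (roots T)) = v" using p[of "insert v (roots T)"] R(2,3) by simp
qed

lemma hypertree_forest_munion:
  assumes "hypertree_forest S" "hypertree_forest T" "verts S \<inter> verts T = {}"
  shows "hypertree_forest (munion S T)"
    and "e \<in> edges S \<Longrightarrow> parent (munion S T) e = parent S e"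
    and "e \<in> edges T \<Longrightarrow> parent (munion S T) e = parent T e"
proof -
  note S = rooted_parent_depth[OF assms(1)] and T = rooted_parent_depth[OF assms(2)]
  note R = rooted_munion[OF S T assms(3)]
  show "hypertree_forest (munion S T)" by (rule rooted_hypertree_forest[OF R(1)])
  note p = rooted_parent[OF R(1)]
  show "e \<in> edges S \<Longrightarrow> parent (munion S T) e = parent S e" using p[of e] by simp
  show "e \<in> edges T \<Longrightarrow> parent (munion S T) e = parent T e"
    using p[of e] rooted_edge_neq[OF S, of e] rooted_edge_neq[OF T, of e] assms(3) by auto
qed

lemma hypertree_forest_single: "hypertree_forest (single v)"
  using rooted_hypertree_forest[OF rooted_single] .

lemma parent_in: "hypertree_forest F \<Longrightarrow> e \<in> edges F \<Longrightarrow> parent F e \<in> e"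
  using rootedD(6)[OF rooted_parent_depth] .

lemma edge_verts: "hypertree_forest F \<Longrightarrow> e \<in> edges F \<Longrightarrow> e \<subseteq> verts F"
  using rootedD(5)[OF rooted_parent_depth] .

lemma roots_verts: "hypertree_forest F \<Longrightarrow> roots F \<subseteq> verts F"
  using rootedD(3)[OF rooted_parent_depth] .

lemma roots_nonempty: "hypertree_forest F \<Longrightarrow> roots F \<noteq> {}"
  using rootedD(2)[OF rooted_parent_depth] .

lemma finite_verts: "hypertree_forest F \<Longrightarrow> finite (verts F)"
  using rootedD(1)[OF rooted_parent_depth] .

lemma finite_edges: "hypertree_forest F \<Longrightarrow> finite (edges F)"
  by (rule finite_subset[of _ "Pow (verts F)"]) (auto dest: edge_verts finite_verts)

lemma incoming_eq: "hypertree_forest F \<Longrightarrow> incoming F v = {e \<in> edges F. parent F e = v}"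
  using parent_in by (fastforce simp: incoming_def)

lemma incoming_notin: "hypertree_forest F \<Longrightarrow> v \<notin> verts F \<Longrightarrow> incoming F v = {}"
  and outgoing_notin: "hypertree_forest F \<Longrightarrow> v \<notin> verts F \<Longrightarrow> outgoing F v = {}"
  using edge_verts by (fastforce simp: incoming_def outgoing_def)+

lemma incoming_attach:
  assumes "hypertree_forest S" "hypertree_forest T" "verts S \<inter> verts T = {}" "v \<in> verts S"
  shows "incoming (attach v S T) u = incoming S u \<union> incoming T u \<union> (if u = v then {insert v (roots T)} else {})"
  unfolding incoming_eq[OF hypertree_forest_attach(1)[OF assms]] incoming_eq[OF assms(1)] incoming_eq[OF assms(2)]
  using hypertree_forest_attach(2-4)[OF assms] by auto

lemma outgoing_attach:
  assumes "hypertree_forest S" "hypertree_forest T" "verts S \<inter> verts T = {}" "v \<in> verts S"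
  shows "outgoing (attach v S T) u = outgoing S u \<union> outgoing T u \<union> (if u \<in> roots T then {insert v (roots T)} else {})"
proof -
  have "v \<notin> roots T" using assms roots_verts by blast
  then show ?thesis
    unfolding outgoing_def using hypertree_forest_attach(2-4)[OF assms] by auto
qed

lemma incoming_munion:
  assumes "hypertree_forest S" "hypertree_forest T" "verts S \<inter> verts T = {}"
  shows "incoming (munion S T) u = incoming S u \<union> incoming T u"
    and "outgoing (munion S T) u = outgoing S u \<union> outgoing T u"
  unfolding incoming_def outgoing_def using hypertree_forest_munion(2,3)[OF assms] by auto

lemma incoming_single: "incoming (single v) u = {}" "outgoing (single v) u = {}"
  by (auto simp: incoming_def outgoing_def)

lemma hypertree_forest_join:
  assumes "hypertree_forest S" "hypertree_forest T" "verts S \<inter> verts T = {}" "b \<notin> verts S" "b \<notin> verts T"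
  shows "hypertree_forest (join b S T)"
    and "incoming (join b S T) u = incoming S u \<union> incoming T u \<union>
      (if u = b then {insert b (roots S), insert b (roots T)} else {})"
    and "outgoing (join b S T) u = outgoing S u \<union> outgoing T u \<union>
      (if u \<in> roots S then {insert b (roots S)} else {}) \<union> (if u \<in> roots T then {insert b (roots T)} else {})"
proof -
  have 1: "hypertree_forest (attach b (single b) S)"
    by (rule hypertree_forest_attach) (use assms hypertree_forest_single in auto)
  have i: "incoming (attach b (single b) S) u = incoming S u \<union> (if u = b then {insert b (roots S)} else {})"
    "outgoing (attach b (single b) S) u = outgoing S u \<union> (if u \<in> roots S then {insert b (roots S)} else {})" for u
    using incoming_attach[OF hypertree_forest_single assms(1), of b b] outgoing_attach[OF hypertree_forest_single assms(1), of b b] assms(4)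
    by (simp_all add: incoming_single)
  have d: "verts (attach b (single b) S) \<inter> verts T = {}" using assms by auto
  show "hypertree_forest (join b S T)" unfolding join_attach
    by (rule hypertree_forest_attach[OF 1 assms(2) d]) simp
  show "incoming (join b S T) u = incoming S u \<union> incoming T u \<union>
      (if u = b then {insert b (roots S), insert b (roots T)} else {})"
    unfolding join_attach by (subst incoming_attach[OF 1 assms(2) d]) (auto simp: i)
  show "outgoing (join b S T) u = outgoing S u \<union> outgoing T u \<union>
      (if u \<in> roots S then {insert b (roots S)} else {}) \<union> (if u \<in> roots T then {insert b (roots T)} else {})"
    unfolding join_attach by (subst outgoing_attach[OF 1 assms(2) d]) (auto simp: i)
qed

subsection \<open>Validity\<close>

definition labels :: "vertex forest \<Rightarrow> nat set" where
  "labels F = {l. White l \<in> verts F}"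

definition valid :: "vertex forest \<Rightarrow> bool" where
  "valid F \<longleftrightarrow> hypertree_forest F \<and> (\<forall>b. Black b \<in> verts F \<longrightarrow> 2 \<le> card (incoming F (Black b)))"

lemma greg_forest_iff: "greg_forest L F \<longleftrightarrow> valid F \<and> labels F = L"
  by (auto simp: greg_forest_def valid_def labels_def)

lemma validD: "valid F \<Longrightarrow> hypertree_forest F" "valid F \<Longrightarrow> graph_wf F"
  "valid F \<Longrightarrow> Black b \<in> verts F \<Longrightarrow> 2 \<le> card (incoming F (Black b))"
  by (auto simp: valid_def hypertree_forest_wf)

lemma finite_incoming: "hypertree_forest F \<Longrightarrow> finite (incoming F v)"
  using finite_edges[of F] by (simp add: incoming_def)

lemma labels_ops [simp]:
  "labels (attach v S T) = labels S \<union> labels T" "labels (munion S T) = labels S \<union> labels T"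
  "labels (join (Black b) S T) = labels S \<union> labels T" "labels (single (White l)) = {l}"
  by (auto simp: labels_def)

lemma labels_disjoint: "verts S \<inter> verts T = {} \<Longrightarrow> labels S \<inter> labels T = {}"
  by (auto simp: labels_def)

lemma finite_labels: "graph_wf F \<Longrightarrow> finite (labels F)"
  using finite_vimageI[of "verts F" White] by (simp add: labels_def graph_wf_def vimage_def inj_def)

lemma valid_attach:
  assumes "valid S" "valid T" "verts S \<inter> verts T = {}" "v \<in> verts S"
  shows "valid (attach v S T)"
  unfolding valid_def
proof (intro conjI allI impI)
  note a = validD(1)[OF assms(1)] validD(1)[OF assms(2)] assms(3,4)
  show "hypertree_forest (attach v S T)" by (rule hypertree_forest_attach[OF a])
  note f = finite_incoming[OF this]
  fix b assume "Black b \<in> verts (attach v S T)"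
  then consider "Black b \<in> verts S" | "Black b \<in> verts T" by auto
  moreover have m: "incoming S (Black b) \<subseteq> incoming (attach v S T) (Black b)" "incoming T (Black b) \<subseteq> incoming (attach v S T) (Black b)"
    unfolding incoming_attach[OF a] by auto
  moreover note order.trans[OF validD(3)[OF assms(1)] card_mono[OF f m(1)]] order.trans[OF validD(3)[OF assms(2)] card_mono[OF f m(2)]]
  ultimately show "2 \<le> card (incoming (attach v S T) (Black b))" by cases
qed

lemma valid_munion:
  assumes "valid S" "valid T" "verts S \<inter> verts T = {}"
  shows "valid (munion S T)"
  unfolding valid_def
proof (intro conjI allI impI)
  note a = validD(1)[OF assms(1)] validD(1)[OF assms(2)] assms(3)
  show "hypertree_forest (munion S T)" by (rule hypertree_forest_munion[OF a])
  note f = finite_incoming[OF this]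
  fix b assume "Black b \<in> verts (munion S T)"
  then consider "Black b \<in> verts S" | "Black b \<in> verts T" by auto
  moreover have m: "incoming S (Black b) \<subseteq> incoming (munion S T) (Black b)" "incoming T (Black b) \<subseteq> incoming (munion S T) (Black b)"
    unfolding incoming_munion[OF a] by auto
  moreover note order.trans[OF validD(3)[OF assms(1)] card_mono[OF f m(1)]] order.trans[OF validD(3)[OF assms(2)] card_mono[OF f m(2)]]
  ultimately show "2 \<le> card (incoming (munion S T) (Black b))" by cases
qed

lemma roots_neq: "hypertree_forest S \<Longrightarrow> hypertree_forest T \<Longrightarrow> verts S \<inter> verts T = {} \<Longrightarrow> roots S \<noteq> roots T"
  using roots_verts[of S] roots_verts[of T] roots_nonempty[of S] by blast

lemma valid_join:
  assumes "valid S" "valid T" "verts S \<inter> verts T = {}" "v \<notin> verts S" "v \<notin> verts T"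
  shows "valid (join v S T)"
  unfolding valid_def
proof (intro conjI allI impI)
  note a = validD(1)[OF assms(1)] validD(1)[OF assms(2)] assms(3-5)
  show "hypertree_forest (join v S T)" by (rule hypertree_forest_join[OF a])
  note f = finite_incoming[OF this]
  fix b assume b: "Black b \<in> verts (join v S T)"
  have m: "incoming S (Black b) \<subseteq> incoming (join v S T) (Black b)" "incoming T (Black b) \<subseteq> incoming (join v S T) (Black b)"
    unfolding hypertree_forest_join(2)[OF a] by auto
  show "2 \<le> card (incoming (join v S T) (Black b))"
  proof (cases "Black b = v")
    case True
    \<comment> \<open>Edges form a set, so the two edges at \<open>v\<close> count as two only
      because the root sets are nonempty and disjoint.\<close>
    have "insert v (roots S) \<noteq> insert v (roots T)"
      using roots_neq[OF a(1-3)] insert_ident[of v "roots S" "roots T"]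
        subsetD[OF roots_verts[OF a(1)], of v] subsetD[OF roots_verts[OF a(2)], of v] a(4,5) by auto
    then have "card {insert v (roots S), insert v (roots T)} = 2" by simp
    moreover have "{insert v (roots S), insert v (roots T)} \<subseteq> incoming (join v S T) (Black b)"
      unfolding hypertree_forest_join(2)[OF a] using True by auto
    ultimately show ?thesis using card_mono[OF f] by metis
  next
    case False
    then consider "Black b \<in> verts S" | "Black b \<in> verts T" using b by auto
    moreover note order.trans[OF validD(3)[OF assms(1)] card_mono[OF f m(1)]] order.trans[OF validD(3)[OF assms(2)] card_mono[OF f m(2)]]
    ultimately show ?thesis by cases
  qed
qed

lemma valid_single: "valid (single (White l))"
  by (auto simp: valid_def hypertree_forest_single)

subsection \<open>Renaming black vertices\<close>

definition colour_inj :: "(vertex \<Rightarrow> vertex) \<Rightarrow> vertex set \<Rightarrow> bool" where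
  "colour_inj h X \<longleftrightarrow> inj_on h X \<and> (\<forall>l. White l \<in> X \<longrightarrow> h (White l) = White l) \<and>
    (\<forall>b. Black b \<in> X \<longrightarrow> h (Black b) \<in> range Black)"

lemma greg_iso_iff: "greg_iso F G \<longleftrightarrow> (\<exists>h. colour_inj h (verts F) \<and> G = map_forest h F)"
  unfolding greg_iso_def colour_inj_def bij_betw_def by (auto simp: map_forest_def)

lemma colour_inj_subset: "colour_inj h X \<Longrightarrow> Y \<subseteq> X \<Longrightarrow> colour_inj h Y"
  unfolding colour_inj_def by (auto intro: inj_on_subset)

lemma colour_inj_cong: "(\<And>v. v \<in> X \<Longrightarrow> h v = g v) \<Longrightarrow> colour_inj h X \<longleftrightarrow> colour_inj g X"
  unfolding colour_inj_def by (auto cong: inj_on_cong)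

lemma colour_inj_White_iff:
  assumes "colour_inj h X" "v \<in> X" shows "h v = White l \<longleftrightarrow> v = White l"
  using assms unfolding colour_inj_def by (cases v) auto

lemma colour_inj_comp: "colour_inj h X \<Longrightarrow> colour_inj g (h ` X) \<Longrightarrow> colour_inj (g \<circ> h) X"
  unfolding colour_inj_def
  by (auto intro: comp_inj_on) (metis image_eqI rangeE rangeI)+

lemma colour_inj_inv:
  assumes "colour_inj h X" shows "colour_inj (inv_into X h) (h ` X)"
  unfolding colour_inj_def
proof (intro conjI allI impI)
  have inj: "inj_on h X" using assms by (simp add: colour_inj_def)
  show "inj_on (inv_into X h) (h ` X)" by (rule inj_on_inv_into) simp
  show "inv_into X h (White l) = White l" if "White l \<in> h ` X" for l
    using that colour_inj_White_iff[OF assms] inj by (metis imageE inv_into_f_f)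
  show "inv_into X h (Black b) \<in> range Black" if b: "Black b \<in> h ` X" for b
  proof -
    obtain v where v: "v \<in> X" "h v = Black b" using b by auto
    then have "v \<in> range Black" using assms by (cases v) (auto simp: colour_inj_def)
    then show ?thesis using v inj by (metis inv_into_f_f)
  qed
qed

lemma map_forest_inv:
  "graph_wf F \<Longrightarrow> inj_on h (verts F) \<Longrightarrow> map_forest (inv_into (verts F) h) (map_forest h F) = F"
  unfolding map_forest_comp
  by (subst map_forest_cong[of F _ id]) (auto simp: map_forest_id)

lemma greg_class_map:
  assumes "graph_wf F" "colour_inj h (verts F)"
  shows "greg_class (map_forest h F) = greg_class F"
proof -
  have inj: "inj_on h (verts F)" using assms(2) by (simp add: colour_inj_def)
  have "greg_iso (map_forest h F) G \<longleftrightarrow> greg_iso F G" for G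
  proof
    assume "greg_iso (map_forest h F) G"
    then show "greg_iso F G"
      using colour_inj_comp[OF assms(2)] unfolding greg_iso_iff map_forest_comp by auto
  next
    assume "greg_iso F G"
    then obtain g where g: "colour_inj g (verts F)" "G = map_forest g F" unfolding greg_iso_iff by auto
    have i: "inv_into (verts F) h ` h ` verts F = verts F" using inj by (simp add: inv_into_image_cancel)
    have "colour_inj (g \<circ> inv_into (verts F) h) (h ` verts F)"
      by (rule colour_inj_comp[OF colour_inj_inv[OF assms(2)]]) (simp add: i g)
    moreover have "G = map_forest (g \<circ> inv_into (verts F) h) (map_forest h F)"
      unfolding g(2) using map_forest_inv[OF assms(1) inj] map_forest_comp by metis
    ultimately show "greg_iso (map_forest h F) G" unfolding greg_iso_iff by auto
  qed
  then show ?thesis by (simp add: greg_class_def)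
qed

lemma greg_class_mem: "G \<in> greg_class F \<longleftrightarrow> (\<exists>h. colour_inj h (verts F) \<and> G = map_forest h F)"
  by (simp add: greg_class_def greg_iso_iff)

lemma colour_inj_id: "colour_inj (\<lambda>v. v) X"
  by (auto simp: colour_inj_def)

lemma greg_class_self: "F \<in> greg_class F"
  unfolding greg_class_mem using colour_inj_id map_forest_id(2) by metis

lemma colour_inj_labels: "colour_inj h (verts F) \<Longrightarrow> labels (map_forest h F) = labels F"
  unfolding labels_def using colour_inj_White_iff[of h "verts F"]
  by (auto simp: image_iff) metis+

lemma rooted_map:
  assumes R: "rooted F p d" and inj: "inj_on h (verts F)"
  shows "rooted (map_forest h F) (\<lambda>e. h (p (inv_into (verts F) h ` e))) (\<lambda>v. d (inv_into (verts F) h v))"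
    (is "rooted ?F ?p ?d")
proof -
  let ?g = "inv_into (verts F) h"
  have g: "?g (h v) = v" if "v \<in> verts F" for v using that inj by simp
  have gi: "?g ` h ` e = e" if "e \<in> edges F" for e
    using rootedD(5)[OF R that] inj by (simp add: inv_into_image_cancel)
  have pe: "p e \<in> e" "e \<subseteq> verts F" "p e \<in> verts F" if "e \<in> edges F" for e using rootedD(5,6)[OF R that] by auto
  have hp: "?p (h ` e) = h (p e)" if "e \<in> edges F" for e using gi[OF that] by simp
  have hn: "h w \<noteq> ?p (h ` e) \<longleftrightarrow> w \<noteq> p e" if "e \<in> edges F" "w \<in> e" for e w
    using inj_on_eq_iff[OF inj, of w "p e"] pe[OF that(1)] that hp by auto
  have he: "\<exists>e w. e' = h ` e \<and> w' = h w \<and> e \<in> edges F \<and> w \<in> e \<and> w \<noteq> p e"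
    if H: "e' \<in> edges ?F" "w' \<in> e'" "w' \<noteq> ?p e'" for e' w'
  proof -
    obtain e where e: "e' = h ` e" "e \<in> edges F" using H(1) by auto
    then obtain w where w: "w \<in> e" "w' = h w" using H(2) by auto
    have "w \<noteq> p e" using hn[OF e(2) w(1)] H(3) e(1) w(2) by simp
    then show ?thesis using e w by blast
  qed
  show ?thesis
  proof (rule rootedI)
    show "finite (verts ?F)" "roots ?F \<noteq> {}" "roots ?F \<subseteq> verts ?F" using rootedD(1,2,3)[OF R] by auto
    show "?d r = 0" if "r \<in> roots ?F" for r using that rootedD(3,4)[OF R] g by auto
    show "e \<subseteq> verts ?F \<and> ?p e \<in> e \<and> e \<noteq> {?p e}" if H: "e \<in> edges ?F" for e
    proof -
      obtain e0 where e0: "e = h ` e0" "e0 \<in> edges F" using H by auto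
      obtain w where "w \<in> e0" "w \<noteq> p e0" using rootedD(6,7)[OF R e0(2)] by blast
      then have "h w \<in> e" "h w \<noteq> ?p e" using hn[OF e0(2)] e0(1) by auto
      then show ?thesis using pe[OF e0(2)] hp[OF e0(2)] unfolding e0(1) by auto
    qed
    show "?d w = Suc (?d (?p e))" if H: "e \<in> edges ?F" "w \<in> e" "w \<noteq> ?p e" for e w
    proof -
      obtain e0 w0 where e0: "e = h ` e0" "w = h w0" "e0 \<in> edges F" "w0 \<in> e0" "w0 \<noteq> p e0" using he[OF H] by blast
      have "w0 \<in> verts F" using pe[OF e0(3)] e0(4) by auto
      then show ?thesis using rootedD(8)[OF R e0(3-5)] g pe[OF e0(3)] hp[OF e0(3)] unfolding e0(1,2) by simp
    qed
    show "\<exists>e\<in>edges ?F. v \<in> e \<and> v \<noteq> ?p e" if H: "v \<in> verts ?F" "v \<notin> roots ?F" for v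
    proof -
      obtain v0 where v0: "v = h v0" "v0 \<in> verts F" "v0 \<notin> roots F" using H by auto
      then obtain e where e: "e \<in> edges F" "v0 \<in> e" "v0 \<noteq> p e" using rootedD(9)[OF R] by blast
      then show ?thesis using hn[OF e(1,2)] v0(1) by (intro bexI[of _ "h ` e"]) auto
    qed
    show "e = e'" if H: "e \<in> edges ?F" "e' \<in> edges ?F" "w \<in> e" "w \<in> e'" "w \<noteq> ?p e" "w \<noteq> ?p e'" for e e' w
    proof -
      obtain e0 w0 where e0: "e = h ` e0" "w = h w0" "e0 \<in> edges F" "w0 \<in> e0" "w0 \<noteq> p e0" using he[OF H(1,3,5)] by blast
      obtain e1 w1 where e1: "e' = h ` e1" "w = h w1" "e1 \<in> edges F" "w1 \<in> e1" "w1 \<noteq> p e1" using he[OF H(2,4,6)] by blast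
      have "w0 \<in> verts F" "w1 \<in> verts F" using pe[OF e0(3)] pe[OF e1(3)] e0(4) e1(4) by auto
      then have "w0 = w1" using g e0(2) e1(2) by metis
      then show ?thesis using rootedD(10)[OF R e0(3) e1(3), of w0] e0 e1 by simp
    qed
  qed
qed

lemma parent_map:
  assumes "hypertree_forest F" "inj_on h (verts F)"
  shows "hypertree_forest (map_forest h F)" "e \<in> edges F \<Longrightarrow> parent (map_forest h F) (h ` e) = h (parent F e)"
proof -
  note R = rooted_map[OF rooted_parent_depth[OF assms(1)] assms(2)]
  show "hypertree_forest (map_forest h F)" by (rule rooted_hypertree_forest[OF R])
  assume e: "e \<in> edges F"
  show "parent (map_forest h F) (h ` e) = h (parent F e)"
    using rooted_parent[OF R, of "h ` e"] e edge_verts[OF assms(1) e] assms(2) by (simp add: inv_into_image_cancel)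
qed

lemma incoming_map:
  assumes F: "hypertree_forest F" and inj: "inj_on h (verts F)" and v: "v \<in> verts F"
  shows "incoming (map_forest h F) (h v) = (`) h ` incoming F v"
    and "outgoing (map_forest h F) (h v) = (`) h ` outgoing F v"
proof -
  have "h (parent F e) = h v \<longleftrightarrow> parent F e = v" if "e \<in> edges F" for e
    using inj_on_eq_iff[OF inj, of "parent F e" v] parent_in[OF F that] edge_verts[OF F that] v by auto
  moreover have "h v \<in> h ` e \<longleftrightarrow> v \<in> e" if "e \<in> edges F" for e
    using inj_on_image_mem_iff[OF inj v edge_verts[OF F that]] .
  moreover have "{e' \<in> (`) h ` edges F. Q e'} = (`) h ` {e \<in> edges F. Q (h ` e)}" for Q by auto
  ultimately show "incoming (map_forest h F) (h v) = (`) h ` incoming F v"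
    "outgoing (map_forest h F) (h v) = (`) h ` outgoing F v"
    unfolding incoming_def outgoing_def using parent_map(2)[OF F inj] by (simp_all cong: conj_cong)
qed

lemma inj_on_image_sets: "inj_on h V \<Longrightarrow> (\<And>e. e \<in> E \<Longrightarrow> e \<subseteq> V) \<Longrightarrow> inj_on ((`) h) E"
  by (meson inj_onI inj_on_image_eq_iff)

lemma valid_map:
  assumes "valid F" "colour_inj h (verts F)"
  shows "valid (map_forest h F)"
  unfolding valid_def
proof (intro conjI allI impI)
  have inj: "inj_on h (verts F)" using assms(2) by (simp add: colour_inj_def)
  note hF = validD(1)[OF assms(1)]
  show "hypertree_forest (map_forest h F)" by (rule parent_map[OF hF inj])
  fix b assume "Black b \<in> verts (map_forest h F)"
  then obtain v where v: "v \<in> verts F" "Black b = h v" by auto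
  then obtain c where c: "v = Black c" using assms(2) by (cases v) (auto simp: colour_inj_def)
  have "inj_on ((`) h) (incoming F v)"
    by (rule inj_on_image_sets[OF inj]) (use edge_verts[OF hF] in \<open>auto simp: incoming_def\<close>)
  then show "2 \<le> card (incoming (map_forest h F) (Black b))"
    using validD(3)[OF assms(1)] v c unfolding v(2) incoming_map[OF hF inj v(1)] by (simp add: card_image)
qed

section \<open>Insertion and the generating operations\<close>

lemma insert_along_simps:
  "verts (insert_along S i T f) = (verts S - {White i}) \<union> verts T"
  "edges (insert_along S i T f) = edges T \<union> {e \<in> edges S. White i \<notin> e}
     \<union> (\<lambda>e. (e - {White i}) \<union> {f e}) ` incoming S (White i)
     \<union> (\<lambda>e. (e - {White i}) \<union> roots T) ` outgoing S (White i)"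
  "roots (insert_along S i T f) = (if White i \<in> roots S then (roots S - {White i}) \<union> roots T else roots S)"
  by (simp_all add: insert_along_def Let_def)

lemma insert_along_wf:
  assumes S: "graph_wf S" and T: "graph_wf T" and f: "f \<in> incoming S (White i) \<rightarrow>\<^sub>E verts T"
  shows "graph_wf (insert_along S i T f)"
proof -
  have "e \<subseteq> (verts S - {White i}) \<union> verts T" if "e \<in> edges (insert_along S i T f)" for e
  proof -
    have "e0 \<subseteq> verts S" if "e0 \<in> edges S" for e0 using S that by (simp add: graph_wf_def)
    then have S: "e0 - {White i} \<subseteq> verts S - {White i}" if "e0 \<in> edges S" for e0 using that by (meson Diff_mono order_refl)
    have T: "roots T \<subseteq> verts T" "e0 \<in> edges T \<Longrightarrow> e0 \<subseteq> verts T" for e0 using T by (simp_all add: graph_wf_def)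
    from that consider "e \<in> edges T" | "e \<in> edges S" "White i \<notin> e"
      | e0 where "e0 \<in> incoming S (White i)" "e = (e0 - {White i}) \<union> {f e0}"
      | e0 where "e0 \<in> outgoing S (White i)" "e = (e0 - {White i}) \<union> roots T"
      unfolding insert_along_simps by blast
    then show ?thesis
    proof cases
      case 1 then show ?thesis using T(2) by blast
    next
      case 2 then show ?thesis using S[of e] by blast
    next
      case (3 e0)
      then have "e0 \<in> edges S" by (simp add: incoming_def)
      then show ?thesis using S[of e0] PiE_mem[OF f 3(1)] unfolding 3(2) by (intro Un_least) auto
    next
      case (4 e0)
      then have "e0 \<in> edges S" by (simp add: outgoing_def)
      then show ?thesis using S[of e0] T(1) unfolding 4(2) by (intro Un_least) auto
    qed
  qed
  then show ?thesis using S T unfolding graph_wf_def insert_along_simps by auto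
qed

lemma insert_along_cong:
  "(\<And>e. e \<in> incoming S (White i) \<Longrightarrow> f e = g e) \<Longrightarrow> insert_along S i T f = insert_along S i T g"
  by (rule forest_eqI) (simp_all add: insert_along_simps cong: image_cong)

text \<open>The new edge is affected only if \<open>White i\<close> is a root of \<open>S'\<close>.
  It is then the edge in which \<open>White i\<close> is a child, and replacing this child by the
  roots of \<open>T\<close> gives the edge to the new set of roots.\<close>

lemma insert_along_attach_right:
  assumes S: "hypertree_forest S" and S': "hypertree_forest S'" and disj: "verts S \<inter> verts S' = {}"
    and v: "v \<in> verts S" and i: "White i \<in> verts S'"
  shows "insert_along (attach v S S') i T f = attach v S (insert_along S' i T f)"
    and "incoming (attach v S S') (White i) = incoming S' (White i)"
proof -
  let ?w = "White i" and ?N = "insert v (roots S')"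
  have w: "?w \<notin> verts S" "?w \<noteq> v" using disj v i by auto
  have inc: "incoming (attach v S S') ?w = incoming S' ?w"
    unfolding incoming_attach[OF S S' disj v] incoming_notin[OF S w(1)] using w by simp
  have out: "outgoing (attach v S S') ?w = outgoing S' ?w \<union> (if ?w \<in> roots S' then {?N} else {})"
    unfolding outgoing_attach[OF S S' disj v] outgoing_notin[OF S w(1)] by simp
  have "?w \<notin> e" if "e \<in> edges S" for e using edge_verts[OF S that] w by auto
  then have kept: "{e \<in> edges (attach v S S'). ?w \<notin> e} =
      edges S \<union> {e \<in> edges S'. ?w \<notin> e} \<union> (if ?w \<in> roots S' then {} else {?N})"
    using w by auto
  have N: "?N - {?w} \<union> roots T = insert v (roots S' - {?w} \<union> roots T)" using w by auto
  show "incoming (attach v S S') ?w = incoming S' ?w" by (rule inc)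
  show "insert_along (attach v S S') i T f = attach v S (insert_along S' i T f)"
  proof (rule forest_eqI)
    show "verts (insert_along (attach v S S') i T f) = verts (attach v S (insert_along S' i T f))"
      using w by (auto simp: insert_along_simps)
    show "roots (insert_along (attach v S S') i T f) = roots (attach v S (insert_along S' i T f))"
      using w roots_verts[OF S] by (auto simp: insert_along_simps)
    show "edges (insert_along (attach v S S') i T f) = edges (attach v S (insert_along S' i T f))"
      unfolding insert_along_simps(2)[of "attach v S S'"] inc out kept
      unfolding forest_simps(5) insert_along_simps(2,3)
      by (cases "?w \<in> roots S'"; simp add: image_Un N; blast)
  qed
qed

text \<open>If \<open>S'\<close> hangs at the replaced vertex, the new edge is one more incoming
  edge there, and the value of \<open>f\<close> on it is the vertex of \<open>T\<close> that
  receives \<open>S'\<close>. Otherwise \<open>S'\<close> stays where it is.\<close>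

lemma insert_along_attach_left:
  assumes S: "hypertree_forest S" and S': "hypertree_forest S'" and disj: "verts S \<inter> verts S' = {}"
    and v: "v \<in> verts S" and i: "White i \<in> verts S"
  shows "v \<noteq> White i \<Longrightarrow> insert_along (attach v S S') i T f = attach v (insert_along S i T f) S'"
    and "v = White i \<Longrightarrow> insert_along (attach v S S') i T f = attach (f (insert v (roots S'))) (insert_along S i T f) S'"
    and "incoming (attach v S S') (White i) =
      (if v = White i then insert (insert v (roots S')) (incoming S (White i)) else incoming S (White i))"
    and "insert v (roots S') \<notin> incoming S (White i)"
proof -
  let ?w = "White i" and ?N = "insert v (roots S')"
  have w: "?w \<notin> verts S'" "?w \<notin> roots S'" using disj i roots_verts[OF S'] by auto
  have inc: "incoming (attach v S S') ?w = (if v = ?w then insert ?N (incoming S ?w) else incoming S ?w)"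
    unfolding incoming_attach[OF S S' disj v] incoming_notin[OF S' w(1)] by simp
  have out: "outgoing (attach v S S') ?w = outgoing S ?w"
    unfolding outgoing_attach[OF S S' disj v] outgoing_notin[OF S' w(1)] using w by simp
  have "?w \<notin> e" if "e \<in> edges S'" for e using edge_verts[OF S' that] w by auto
  then have kept: "{e \<in> edges (attach v S S'). ?w \<notin> e} =
      {e \<in> edges S. ?w \<notin> e} \<union> edges S' \<union> (if v = ?w then {} else {?N})"
    using w by auto
  have N: "v = ?w \<Longrightarrow> ?N - {?w} = roots S'" using w by auto
  show "incoming (attach v S S') ?w = (if v = ?w then insert ?N (incoming S ?w) else incoming S ?w)" by (rule inc)
  show "?N \<notin> incoming S (White i)" using hypertree_forest_attach(5)[OF S S' disj v] by (auto simp: incoming_def)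
  show "insert_along (attach v S S') i T f = attach v (insert_along S i T f) S'" if "v \<noteq> ?w"
  proof (rule forest_eqI)
    show "verts (insert_along (attach v S S') i T f) = verts (attach v (insert_along S i T f) S')"
      using w by (auto simp: insert_along_simps)
    show "roots (insert_along (attach v S S') i T f) = roots (attach v (insert_along S i T f) S')"
      by (auto simp: insert_along_simps)
    show "edges (insert_along (attach v S S') i T f) = edges (attach v (insert_along S i T f) S')"
      unfolding insert_along_simps(2)[of "attach v S S'"] inc out kept
      unfolding forest_simps(5) insert_along_simps(2,3) using that by (simp; blast)
  qed
  show "insert_along (attach v S S') i T f = attach (f ?N) (insert_along S i T f) S'" if v: "v = ?w"
  proof (rule forest_eqI)
    show "verts (insert_along (attach v S S') i T f) = verts (attach (f ?N) (insert_along S i T f) S')"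
      using w by (auto simp: insert_along_simps)
    show "roots (insert_along (attach v S S') i T f) = roots (attach (f ?N) (insert_along S i T f) S')"
      by (auto simp: insert_along_simps)
    have "insert (f ?N) (?N - {?w}) = insert (f ?N) (roots S')" using N[OF v] by simp
    then show "edges (insert_along (attach v S S') i T f) = edges (attach (f ?N) (insert_along S i T f) S')"
      unfolding insert_along_simps(2)[of "attach v S S'"] inc out kept
      unfolding forest_simps(5) insert_along_simps(2,3) using v by (simp; blast)
  qed
qed

text \<open>Here and for \<open>join\<close> the label is in the first forest; the other case is
  reduced to this one by symmetry of the operations, through \<open>gop_swap\<close>.\<close>

lemma insert_along_munion:
  assumes S: "hypertree_forest S" and S': "hypertree_forest S'" and disj: "verts S \<inter> verts S' = {}"
    and i: "White i \<in> verts S"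
  shows "insert_along (munion S S') i T f = munion (insert_along S i T f) S'"
    and "incoming (munion S S') (White i) = incoming S (White i)"
proof -
  let ?w = "White i"
  have w: "?w \<notin> verts S'" "?w \<notin> roots S'" using disj i roots_verts[OF S'] by auto
  have inc: "incoming (munion S S') ?w = incoming S ?w" "outgoing (munion S S') ?w = outgoing S ?w"
    unfolding incoming_munion[OF S S' disj] incoming_notin[OF S' w(1)] outgoing_notin[OF S' w(1)] by simp_all
  have "?w \<notin> e" if "e \<in> edges S'" for e using edge_verts[OF S' that] w by auto
  then have kept: "{e \<in> edges (munion S S'). ?w \<notin> e} = {e \<in> edges S. ?w \<notin> e} \<union> edges S'" by auto
  show "incoming (munion S S') ?w = incoming S ?w" by (rule inc)
  show "insert_along (munion S S') i T f = munion (insert_along S i T f) S'"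
  proof (rule forest_eqI)
    show "verts (insert_along (munion S S') i T f) = verts (munion (insert_along S i T f) S')"
      using w by (auto simp: insert_along_simps)
    show "roots (insert_along (munion S S') i T f) = roots (munion (insert_along S i T f) S')"
      using w by (auto simp: insert_along_simps)
    show "edges (insert_along (munion S S') i T f) = edges (munion (insert_along S i T f) S')"
      unfolding insert_along_simps(2)[of "munion S S'"] inc kept
      unfolding forest_simps(8) insert_along_simps(2,3) by blast
  qed
qed

lemma insert_along_join:
  assumes S: "hypertree_forest S" and S': "hypertree_forest S'" and disj: "verts S \<inter> verts S' = {}"
    and b: "b \<notin> verts S" "b \<notin> verts S'" and i: "White i \<in> verts S"
  shows "insert_along (join b S S') i T f = join b (insert_along S i T f) S'"
    and "incoming (join b S S') (White i) = incoming S (White i)"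
proof -
  let ?w = "White i"
  have w: "?w \<notin> verts S'" "?w \<notin> roots S'" "?w \<noteq> b" using disj i roots_verts[OF S'] b by auto
  note J = hypertree_forest_join[OF S S' disj b]
  have inc: "incoming (join b S S') ?w = incoming S ?w"
    unfolding J(2) incoming_notin[OF S' w(1)] using w by simp
  have out: "outgoing (join b S S') ?w = outgoing S ?w \<union> (if ?w \<in> roots S then {insert b (roots S)} else {})"
    unfolding J(3) outgoing_notin[OF S' w(1)] using w by simp
  have "?w \<notin> e" if "e \<in> edges S'" for e using edge_verts[OF S' that] w by auto
  then have kept: "{e \<in> edges (join b S S'). ?w \<notin> e} = insert (insert b (roots S'))
      ({e \<in> edges S. ?w \<notin> e} \<union> edges S' \<union> (if ?w \<in> roots S then {} else {insert b (roots S)}))"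
    using w by auto
  have N: "insert b (roots S) - {?w} \<union> roots T = insert b (roots S - {?w} \<union> roots T)" using w by auto
  show "incoming (join b S S') ?w = incoming S ?w" by (rule inc)
  show "insert_along (join b S S') i T f = join b (insert_along S i T f) S'"
  proof (rule forest_eqI)
    show "verts (insert_along (join b S S') i T f) = verts (join b (insert_along S i T f) S')"
      using w by (auto simp: insert_along_simps)
    show "roots (insert_along (join b S S') i T f) = roots (join b (insert_along S i T f) S')"
      using w by (auto simp: insert_along_simps)
    show "edges (insert_along (join b S S') i T f) = edges (join b (insert_along S i T f) S')"
      unfolding insert_along_simps(2)[of "join b S S'"] inc out kept
      unfolding forest_simps(11) insert_along_simps(2,3)
      by (cases "?w \<in> roots S"; simp add: image_Un N; blast)
  qed
qed

section \<open>Isomorphism classes and independence of representatives\<close>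

abbreviation cls :: "vertex forest \<Rightarrow> (vertex forest set \<Rightarrow>\<^sub>0 'k::field)" where
  "cls F \<equiv> basis_vec (greg_class F)"

text \<open>Separates the choice made on one edge from all the others; it is applied to the edge
  that is new when a forest is attached at the replaced vertex.\<close>

lemma sum_PiE_insert:
  assumes "x \<notin> I"
  shows "(\<Sum>f\<in>insert x I \<rightarrow>\<^sub>E V. g f) = (\<Sum>y\<in>V. \<Sum>f\<in>I \<rightarrow>\<^sub>E V. g (f(x := y)))"
proof -
  have inj: "inj_on (\<lambda>(y, f). f(x := y)) (V \<times> (I \<rightarrow>\<^sub>E V))"
  proof (rule inj_onI, clarify)
    fix y f y' f' assume f: "f \<in> I \<rightarrow>\<^sub>E V" "f' \<in> I \<rightarrow>\<^sub>E V" and eq: "f(x := y) = f'(x := y')"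
    have "f z = f' z" for z
    proof (cases "z = x")
      case True
      then show ?thesis using f assms by (metis PiE_arb)
    next
      case False
      then show ?thesis using eq by (metis fun_upd_other)
    qed
    then show "y = y' \<and> f = f'" using eq by (metis ext fun_upd_same)
  qed
  have "(\<Sum>f\<in>insert x I \<rightarrow>\<^sub>E V. g f) = (\<Sum>f\<in>(\<lambda>(y, f). f(x := y)) ` (V \<times> (I \<rightarrow>\<^sub>E V)). g f)"
    by (simp add: PiE_insert_eq)
  also have "\<dots> = (\<Sum>z\<in>V \<times> (I \<rightarrow>\<^sub>E V). g (case z of (y, f) \<Rightarrow> f(x := y)))"
    by (simp add: sum.reindex[OF inj] o_def)
  also have "\<dots> = (\<Sum>y\<in>V. \<Sum>f\<in>I \<rightarrow>\<^sub>E V. g (f(x := y)))"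
    by (simp add: sum.cartesian_product case_prod_unfold)
  finally show ?thesis .
qed

text \<open>The two isomorphisms glue because vertices common to both forests, before or after, are
  white and hence fixed by both. An overlap must be allowed: the inserted forest may itself have the
  label \<open>i\<close>.\<close>

lemma merge_isos:
  assumes wf: "graph_wf S" "graph_wf T" and S': "S' \<in> greg_class S" and T': "T' \<in> greg_class T"
    and W: "verts S \<inter> verts T \<subseteq> range White" and W': "verts S' \<inter> verts T' \<subseteq> range White"
  shows "\<exists>h. colour_inj h (verts S \<union> verts T) \<and> S' = map_forest h S \<and> T' = map_forest h T"
proof -
  obtain g k where g: "colour_inj g (verts S)" "S' = map_forest g S" and k: "colour_inj k (verts T)" "T' = map_forest k T"
    using S' T' unfolding greg_class_mem by blast
  define h where "h v = (if v \<in> verts S then g v else k v)" for v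
  have hS: "h v = g v" if "v \<in> verts S" for v using that by (simp add: h_def)
  have hT: "h v = k v" if vT: "v \<in> verts T" for v
  proof (cases "v \<in> verts S")
    case True
    then obtain l where "v = White l" using W vT by auto
    then show ?thesis using True vT g(1) k(1) by (simp add: h_def colour_inj_def)
  qed (simp add: h_def)
  have cross: "u = v" if u: "u \<in> verts S" and v: "v \<in> verts T" and eq: "g u = k v" for u v
  proof -
    have "g u \<in> verts S' \<inter> verts T'" using imageI[OF u, of g] imageI[OF v, of k] eq g(2) k(2) by simp
    then obtain l where "g u = White l" using W' by auto
    then show ?thesis using colour_inj_White_iff[OF g(1) u] colour_inj_White_iff[OF k(1) v] eq by auto
  qed
  have "inj_on h (verts S \<union> verts T)"
  proof (rule inj_onI)
    fix u v assume u: "u \<in> verts S \<union> verts T" and v: "v \<in> verts S \<union> verts T" and eq: "h u = h v"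
    have ig: "inj_on g (verts S)" "inj_on k (verts T)" using g(1) k(1) by (auto simp: colour_inj_def)
    show "u = v"
      using u v
    proof (elim UnE)
      assume "u \<in> verts S" "v \<in> verts S" then show ?thesis using ig(1) eq hS by (metis inj_onD)
    next
      assume "u \<in> verts S" "v \<in> verts T" then show ?thesis using cross[of u v] eq hS hT by metis
    next
      assume "u \<in> verts T" "v \<in> verts S" then show ?thesis using cross[of v u] eq hS hT by metis
    next
      assume "u \<in> verts T" "v \<in> verts T" then show ?thesis using ig(2) eq hT by (metis inj_onD)
    qed
  qed
  then have "colour_inj h (verts S \<union> verts T)"
    using g(1) k(1) hS hT unfolding colour_inj_def by auto
  moreover have "S' = map_forest h S" unfolding g(2) by (rule map_forest_cong[OF wf(1)]) (simp add: hS)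
  moreover have "T' = map_forest h T" unfolding k(2) by (rule map_forest_cong[OF wf(2)]) (simp add: hT)
  ultimately show ?thesis by blast
qed

text \<open>Black vertices carry names here, so two classes must be represented by disjoint forests before
  combining them; \<open>lift2\<close> is only meaningful when this is possible.\<close>

definition lift2 :: "(vertex forest \<Rightarrow> vertex forest \<Rightarrow> 'a) \<Rightarrow> vertex forest set \<Rightarrow> vertex forest set \<Rightarrow> 'a" where
  "lift2 op s t = (let (S, T) = SOME (S, T). S \<in> s \<and> T \<in> t \<and> verts S \<inter> verts T = {} in op S T)"

lemma lift2_greg_class:
  assumes wf: "graph_wf S" "graph_wf T" and disj: "verts S \<inter> verts T = {}"
    and op: "\<And>h. colour_inj h (verts S \<union> verts T) \<Longrightarrow> op (map_forest h S) (map_forest h T) = op S T"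
  shows "lift2 op (greg_class S) (greg_class T) = op S T"
proof -
  define P where "P = (\<lambda>(S', T'). S' \<in> greg_class S \<and> T' \<in> greg_class T \<and> verts S' \<inter> verts T' = {})"
  obtain S' T' where e: "(SOME x. P x) = (S', T')" by (cases "SOME x. P x") auto
  have "P (S, T)" using disj greg_class_self by (simp add: P_def)
  then have "P (S', T')" unfolding e[symmetric] by (rule someI)
  then have st: "S' \<in> greg_class S" "T' \<in> greg_class T" "verts S' \<inter> verts T' = {}" by (auto simp: P_def)
  obtain h where "colour_inj h (verts S \<union> verts T)" "S' = map_forest h S" "T' = map_forest h T"
    using merge_isos[OF wf st(1,2)] disj st(3) by auto
  then have "op S' T' = op S T" using op by simp
  then show ?thesis using e by (simp add: lift2_def P_def)
qed

text \<open>The glued isomorphism carries incoming edges to incoming edges and vertices of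
  \<open>T\<close> to vertices of \<open>T'\<close>, so it matches the choice functions on both
  sides, and matching choices give isomorphic forests.\<close>

lemma class_insertion_greg_class:
  assumes S: "valid S" and T: "valid T" and disj: "(verts S - {White i}) \<inter> verts T = {}" and i: "White i \<in> verts S"
  shows "class_insertion (greg_class S) i (greg_class T) = (insertion S i T :: vertex forest set \<Rightarrow>\<^sub>0 'k::field)"
proof -
  note hS = validD(1)[OF S] and wf = validD(2)[OF S] validD(2)[OF T]
  define P where "P = (\<lambda>(S', T'). S' \<in> greg_class S \<and> T' \<in> greg_class T \<and> (verts S' - {White i}) \<inter> verts T' = {})"
  obtain S' T' where e: "(SOME x. P x) = (S', T')" by (cases "SOME x. P x") auto
  have "P (S, T)" using disj greg_class_self by (simp add: P_def)
  then have "P (S', T')" unfolding e[symmetric] by (rule someI)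
  then have st: "S' \<in> greg_class S" "T' \<in> greg_class T" "(verts S' - {White i}) \<inter> verts T' = {}" by (auto simp: P_def)
  obtain h where h: "colour_inj h (verts S \<union> verts T)" "S' = map_forest h S" "T' = map_forest h T"
    using merge_isos[OF wf st(1,2)] disj st(3) by auto
  let ?w = "White i"
  let ?I = "incoming S ?w"
  have inj: "inj_on h (verts S \<union> verts T)" and hw: "h ?w = ?w" using h(1) i by (auto simp: colour_inj_def)
  have injS: "inj_on h (verts S)" and injT: "inj_on h (verts T)" using inj by (auto intro: inj_on_subset)
  have hwiff: "h v = ?w \<longleftrightarrow> v = ?w" if "v \<in> verts S" for v using colour_inj_White_iff[OF h(1)] that by simp
  have I': "incoming S' ?w = (`) h ` ?I" "outgoing S' ?w = (`) h ` outgoing S ?w"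
    using incoming_map[OF hS injS i] unfolding h(2) hw by auto
  have IV: "e \<subseteq> verts S" if "e \<in> edges S" for e using edge_verts[OF hS] that by auto
  have injI: "inj_on ((`) h) ?I" by (rule inj_on_image_sets[OF injS]) (auto simp: incoming_def dest: IV)
  \<comment> \<open>\<open>?k\<close> conjugates a choice function by \<open>h\<close>, turning one
    for \<open>S\<close> and \<open>T\<close> into one for \<open>S'\<close> and \<open>T'\<close>;
    \<open>?m\<close> goes back.\<close>
  let ?k = "\<lambda>f. \<lambda>e\<in>(`) h ` ?I. h (f (inv_into ?I ((`) h) e))"
  let ?m = "\<lambda>f'. \<lambda>e\<in>?I. inv_into (verts T) h (f' (h ` e))"
  have minus: "h ` (e - {?w}) = h ` e - {?w}" if "e \<subseteq> verts S" for e
    using that hwiff by auto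
  have hmem: "?w \<in> h ` A \<longleftrightarrow> ?w \<in> A" if "A \<subseteq> verts S" for A
    using inj_on_image_mem_iff[OF injS i that] hw by simp
  have map: "insert_along S' i T' (?k f) = map_forest h (insert_along S i T f)" if f: "f \<in> ?I \<rightarrow>\<^sub>E verts T" for f
  proof (rule forest_eqI)
    have kf: "?k f (h ` e) = h (f e)" if "e \<in> ?I" for e using that by (simp add: inv_into_f_f[OF injI])
    show "verts (insert_along S' i T' (?k f)) = verts (map_forest h (insert_along S i T f))"
      using minus[of "verts S"] unfolding h(2,3) forest_simps insert_along_simps by (simp add: image_Un)
    have "h ` roots S - {?w} = h ` (roots S - {?w})" using minus[OF roots_verts[OF hS]] by simp
    moreover have "?w \<in> h ` roots S \<longleftrightarrow> ?w \<in> roots S" by (rule hmem[OF roots_verts[OF hS]])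
    ultimately show "roots (insert_along S' i T' (?k f)) = roots (map_forest h (insert_along S i T f))"
      unfolding h(2,3) forest_simps insert_along_simps by (simp add: image_Un)
    have "{e \<in> edges S'. ?w \<notin> e} = (`) h ` {e \<in> edges S. ?w \<notin> e}"
    proof -
      have "?w \<in> h ` e \<longleftrightarrow> ?w \<in> e" if "e \<in> edges S" for e by (rule hmem[OF IV[OF that]])
      then show ?thesis unfolding h(2) by auto
    qed
    moreover have "(\<lambda>e. (e - {?w}) \<union> {?k f e}) ` incoming S' ?w = (`) h ` (\<lambda>e. (e - {?w}) \<union> {f e}) ` ?I"
      unfolding I' image_image
    proof (rule image_cong[OF HOL.refl])
      fix e assume e: "e \<in> ?I"
      then have "e \<subseteq> verts S" using IV by (auto simp: incoming_def)
      then show "h ` e - {?w} \<union> {?k f (h ` e)} = h ` (e - {?w} \<union> {f e})"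
        using kf[OF e] by (simp add: minus)
    qed
    moreover have "(\<lambda>e. (e - {?w}) \<union> roots T') ` outgoing S' ?w = (`) h ` (\<lambda>e. (e - {?w}) \<union> roots T) ` outgoing S ?w"
      unfolding I' image_image h(3) using IV by (intro image_cong) (auto simp: outgoing_def image_Un minus[symmetric])
    ultimately show "edges (insert_along S' i T' (?k f)) = edges (map_forest h (insert_along S i T f))"
      unfolding insert_along_simps forest_simps by (simp only: image_Un h(3) forest_simps)
  qed
  have eq: "insertion S' i T' = (insertion S i T :: vertex forest set \<Rightarrow>\<^sub>0 'k)"
    unfolding insertion_def
  proof (rule sum.reindex_bij_witness[of _ ?k ?m])
    fix f' assume f': "f' \<in> incoming S' ?w \<rightarrow>\<^sub>E verts T'"
    then have f'1: "f' \<in> ((`) h ` ?I) \<rightarrow>\<^sub>E h ` verts T" unfolding I' h(3) by simp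
    have v: "f' (h ` e) \<in> h ` verts T" if "e \<in> ?I" for e using PiE_mem[OF f'1] that by auto
    show "?k (?m f') = f'"
    proof
      fix e show "?k (?m f') e = f' e"
      proof (cases "e \<in> (`) h ` ?I")
        case True
        then obtain e0 where e0: "e = h ` e0" "e0 \<in> ?I" by auto
        then show ?thesis using v[OF e0(2)] by (simp add: inv_into_f_f[OF injI] f_inv_into_f)
      next
        case False
        then show ?thesis using PiE_arb[OF f'1] by simp
      qed
    qed
    show m: "?m f' \<in> ?I \<rightarrow>\<^sub>E verts T" using v by (auto intro: inv_into_into)
    have "insert_along S' i T' f' = map_forest h (insert_along S i T (?m f'))"
      using map[OF m] \<open>?k (?m f') = f'\<close> by simp
    moreover have "graph_wf (insert_along S i T (?m f'))" by (rule insert_along_wf[OF wf m])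
    moreover have "colour_inj h (verts (insert_along S i T (?m f')))"
      by (rule colour_inj_subset[OF h(1)]) (auto simp: insert_along_simps)
    ultimately show "(cls (insert_along S i T (?m f')) :: vertex forest set \<Rightarrow>\<^sub>0 'k) = cls (insert_along S' i T' f')"
      by (simp add: greg_class_map)
  next
    fix f assume f: "f \<in> ?I \<rightarrow>\<^sub>E verts T"
    show "?k f \<in> incoming S' ?w \<rightarrow>\<^sub>E verts T'"
      unfolding I' h(3) using PiE_mem[OF f] by (auto simp: inv_into_f_f[OF injI])
    show "?m (?k f) = f"
    proof
      fix e show "?m (?k f) e = f e"
        using PiE_mem[OF f] PiE_arb[OF f] by (cases "e \<in> ?I") (simp_all add: inv_into_f_f[OF injI] inv_into_f_f[OF injT])
    qed
  qed
  show ?thesis using e eq by (simp add: class_insertion_def P_def)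
qed

section \<open>The generating operations on classes\<close>

definition fgX ::
  "(vertex forest set \<Rightarrow>\<^sub>0 'k) \<Rightarrow> (vertex forest set \<Rightarrow>\<^sub>0 'k) \<Rightarrow> (vertex forest set \<Rightarrow>\<^sub>0 'k::field)" where
  "fgX = bilin_ext (lift2 (\<lambda>S T. \<Sum>v\<in>verts S. cls (attach v S T)))"

definition fgC ::
  "(vertex forest set \<Rightarrow>\<^sub>0 'k) \<Rightarrow> (vertex forest set \<Rightarrow>\<^sub>0 'k) \<Rightarrow> (vertex forest set \<Rightarrow>\<^sub>0 'k::field)" where
  "fgC = bilin_ext (lift2 (\<lambda>S T. cls (munion S T)))"

text \<open>The name of the new black root has to be fresh for both representatives; by
  \<open>greg_class_join\<close> any fresh name gives the same class.\<close>

definition fgG ::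
  "(vertex forest set \<Rightarrow>\<^sub>0 'k) \<Rightarrow> (vertex forest set \<Rightarrow>\<^sub>0 'k) \<Rightarrow> (vertex forest set \<Rightarrow>\<^sub>0 'k::field)" where
  "fgG = bilin_ext (lift2 (\<lambda>S T. cls (join (Black (SOME b. Black b \<notin> verts S \<union> verts T)) S T)))"

lemma ex_fresh_Black: "finite V \<Longrightarrow> \<exists>b. Black b \<notin> V"
proof -
  assume "finite V"
  then have "finite (Black -` V)" by (rule finite_vimageI) (simp add: inj_def)
  then show ?thesis using ex_new_if_finite[of "Black -` V"] by auto
qed

lemma fgX_cls:
  assumes "graph_wf S" "graph_wf T" "verts S \<inter> verts T = {}"
  shows "fgX (cls S) (cls T) = (\<Sum>v\<in>verts S. cls (attach v S T))"
  unfolding fgX_def bilin_ext_basis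
proof (rule lift2_greg_class[OF assms])
  fix h assume h: "colour_inj h (verts S \<union> verts T)"
  then have "inj_on h (verts S)" by (auto simp: colour_inj_def intro: inj_on_subset)
  then have "(\<Sum>v\<in>verts (map_forest h S). cls (attach v (map_forest h S) (map_forest h T)))
      = (\<Sum>v\<in>verts S. cls (map_forest h (attach v S T)))"
    by (simp add: sum.reindex map_forest_attach)
  also have "\<dots> = (\<Sum>v\<in>verts S. cls (attach v S T))"
    by (intro sum.cong HOL.refl arg_cong[of _ _ basis_vec] greg_class_map) (use assms graph_wf_ops h in auto)
  finally show "(\<Sum>v\<in>verts (map_forest h S). cls (attach v (map_forest h S) (map_forest h T)))
      = (\<Sum>v\<in>verts S. cls (attach v S T))" .
qed

lemma fgC_cls:
  assumes "graph_wf S" "graph_wf T" "verts S \<inter> verts T = {}"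
  shows "fgC (cls S) (cls T) = cls (munion S T)"
  unfolding fgC_def bilin_ext_basis
  by (rule lift2_greg_class[OF assms])
    (simp add: map_forest_munion[symmetric] greg_class_map[OF graph_wf_ops(2)[OF assms(1,2)]])

lemma greg_class_join:
  assumes wf: "graph_wf S" "graph_wf T" and b: "Black b \<notin> verts S \<union> verts T" and c: "Black c \<notin> verts S \<union> verts T"
  shows "greg_class (join (Black b) S T) = greg_class (join (Black c) S T)"
proof -
  define h where "h = (\<lambda>v. v)(Black b := Black c)"
  have "h v = v" if "v \<in> verts S \<union> verts T" for v using that b by (auto simp: h_def)
  then have "map_forest h S = S" "map_forest h T = T"
    using map_forest_cong[OF wf(1), of h "\<lambda>v. v"] map_forest_cong[OF wf(2), of h "\<lambda>v. v"] by (auto simp: map_forest_id)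
  then have "map_forest h (join (Black b) S T) = join (Black c) S T" by (simp add: map_forest_join h_def)
  moreover have "colour_inj h (verts (join (Black b) S T))"
    using b c by (auto simp: colour_inj_def h_def inj_on_def)
  ultimately show ?thesis using greg_class_map[OF graph_wf_ops(3)[OF wf]] by metis
qed

lemma fgG_cls:
  assumes wf: "graph_wf S" "graph_wf T" and disj: "verts S \<inter> verts T = {}" and b: "Black b \<notin> verts S \<union> verts T"
  shows "fgG (cls S) (cls T) = cls (join (Black b) S T)"
proof -
  let ?fr = "\<lambda>S T. SOME b. Black b \<notin> verts S \<union> verts T"
  have fr: "Black (?fr S T) \<notin> verts S \<union> verts T" if "graph_wf S" "graph_wf T" for S T
    by (rule someI_ex) (rule ex_fresh_Black, use that in \<open>simp add: graph_wf_def\<close>)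
  have "lift2 (\<lambda>S T. cls (join (Black (?fr S T)) S T)) (greg_class S) (greg_class T) = cls (join (Black (?fr S T)) S T)"
  proof (rule lift2_greg_class[OF wf disj])
    fix h assume h: "colour_inj h (verts S \<union> verts T)"
    let ?S = "map_forest h S" and ?T = "map_forest h T"
    have wf': "graph_wf ?S" "graph_wf ?T" by (rule graph_wf_ops(4)[OF wf(1)], rule graph_wf_ops(4)[OF wf(2)])
    \<comment> \<open>The isomorphism \<open>h\<close> says nothing about the fresh names picked on
      the two sides, so it is redirected to take one to the other.\<close>
    define g where "g = h(Black (?fr S T) := Black (?fr ?S ?T))"
    have g: "g v = h v" if "v \<in> verts S \<union> verts T" for v using that fr[OF wf] by (auto simp: g_def)
    have "map_forest g S = ?S" "map_forest g T = ?T" using g by (auto intro!: map_forest_cong wf)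
    then have "map_forest g (join (Black (?fr S T)) S T) = join (Black (?fr ?S ?T)) ?S ?T"
      by (simp add: map_forest_join g_def)
    moreover have "colour_inj g (verts (join (Black (?fr S T)) S T))"
    proof -
      have "inj_on g (insert (Black (?fr S T)) (verts S \<union> verts T))"
      proof (subst inj_on_insert, intro conjI)
        show "inj_on g (verts S \<union> verts T)" using h colour_inj_cong[of "verts S \<union> verts T" g h, OF g] by (simp add: colour_inj_def)
        have "g ` (verts S \<union> verts T) = verts ?S \<union> verts ?T" using g by (auto simp: image_iff)
        moreover have "g (Black (?fr S T)) = Black (?fr ?S ?T)" by (simp add: g_def)
        ultimately show "g (Black (?fr S T)) \<notin> g ` (verts S \<union> verts T - {Black (?fr S T)})" using fr[OF wf'] by auto
      qed
      then show ?thesis using h g unfolding colour_inj_def by (auto simp: g_def)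
    qed
    ultimately have "greg_class (join (Black (?fr ?S ?T)) ?S ?T) = greg_class (join (Black (?fr S T)) S T)"
      using greg_class_map[OF graph_wf_ops(3)[OF wf]] by metis
    then show "cls (join (Black (?fr ?S ?T)) ?S ?T) = cls (join (Black (?fr S T)) S T)" by simp
  qed
  also have "\<dots> = cls (join (Black b) S T)" using greg_class_join[OF wf fr[OF wf] b] by simp
  finally show ?thesis by (simp add: fgG_def)
qed

lemma greg_basis_iff: "s \<in> greg_basis L \<longleftrightarrow> (\<exists>F. valid F \<and> labels F = L \<and> s = greg_class F)"
  by (auto simp: greg_basis_def greg_forest_iff)

lemma greg_basis_rep:
  assumes "s \<in> greg_basis L" "finite Z"
  shows "\<exists>F. valid F \<and> labels F = L \<and> s = greg_class F \<and> verts F \<inter> Z \<subseteq> range White"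
proof -
  obtain F where F: "valid F" "labels F = L" "s = greg_class F" using assms(1) greg_basis_iff by auto
  have "finite (Black -` Z)" by (rule finite_vimageI[OF assms(2)]) (simp add: inj_def)
  \<comment> \<open>Adding \<open>N\<close> to the names of all black vertices moves them beyond
    every black vertex in \<open>Z\<close>.\<close>
  then obtain N where N: "\<And>b. b \<in> Black -` Z \<Longrightarrow> b < N" using finite_nat_set_iff_bounded[of "Black -` Z"] by blast
  define h where "h v = (case v of White l \<Rightarrow> White l | Black b \<Rightarrow> Black (b + N))" for v
  have h: "colour_inj h X" for X by (auto simp: colour_inj_def h_def inj_on_def split: vertex.splits)
  have "verts (map_forest h F) \<inter> Z \<subseteq> range White"
  proof
    fix v assume v: "v \<in> verts (map_forest h F) \<inter> Z"
    then obtain u where u: "v = h u" by auto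
    show "v \<in> range White"
    proof (cases u)
      case (Black b)
      then have "b + N \<in> Black -` Z" using u v by (simp add: h_def)
      then show ?thesis using N[of "b + N"] by simp
    qed (simp add: u h_def)
  qed
  then show ?thesis
    using valid_map[OF F(1) h] colour_inj_labels[OF h] greg_class_map[OF validD(2)[OF F(1)] h] F by metis
qed

lemma disjoint_labels: "verts S \<inter> verts T \<subseteq> range White \<Longrightarrow> labels S \<inter> labels T = {} \<Longrightarrow> verts S \<inter> verts T = {}"
  by (fastforce simp: labels_def)

lemma greg_basis_rep2:
  assumes "s \<in> greg_basis A" "t \<in> greg_basis B" "A \<inter> B = {}"
  obtains S T where "valid S" "valid T" "labels S = A" "labels T = B" "s = greg_class S" "t = greg_class T"
    "verts S \<inter> verts T = {}"
proof -
  obtain S where S: "valid S" "labels S = A" "s = greg_class S" using assms(1) greg_basis_iff by auto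
  have "finite (verts S)" using validD(2)[OF S(1)] by (simp add: graph_wf_def)
  then obtain T where T: "valid T" "labels T = B" "t = greg_class T" "verts T \<inter> verts S \<subseteq> range White"
    using greg_basis_rep[OF assms(2)] by blast
  have "verts S \<inter> verts T = {}" by (rule disjoint_labels) (use T(4) S(2) T(2) assms(3) in auto)
  then show ?thesis using S T that by blast
qed

text \<open>The set \<open>B\<close> may contain \<open>i\<close>, as in a partial composition;
  accordingly \<open>S\<close> and \<open>T\<close> may share \<open>White i\<close> and nothing
  else.\<close>

lemma greg_basis_rep3:
  assumes "s \<in> greg_basis A" "s' \<in> greg_basis A'" "t \<in> greg_basis B"
    and "A \<inter> A' = {}" "(A - {i}) \<inter> B = {}" "A' \<inter> B = {}"
  obtains S S' T where "valid S" "valid S'" "valid T" "labels S = A" "labels S' = A'" "labels T = B"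
    "s = greg_class S" "s' = greg_class S'" "t = greg_class T"
    "verts S \<inter> verts S' = {}" "(verts S - {White i}) \<inter> verts T = {}" "verts S' \<inter> verts T = {}"
proof -
  obtain S S' where S: "valid S" "valid S'" "labels S = A" "labels S' = A'" "s = greg_class S" "s' = greg_class S'"
    "verts S \<inter> verts S' = {}" using greg_basis_rep2[OF assms(1,2,4)] by blast
  have "finite (verts S \<union> verts S')" using validD(2)[OF S(1)] validD(2)[OF S(2)] by (simp add: graph_wf_def)
  then obtain T where T: "valid T" "labels T = B" "t = greg_class T" "verts T \<inter> (verts S \<union> verts S') \<subseteq> range White"
    using greg_basis_rep[OF assms(3)] by blast
  have "verts S' \<inter> verts T = {}" by (rule disjoint_labels) (use T(2,4) S(4) assms(6) in auto)
  moreover have "(verts S - {White i}) \<inter> verts T = {}"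
  proof (rule ccontr)
    assume "(verts S - {White i}) \<inter> verts T \<noteq> {}"
    then obtain v where v: "v \<in> verts S" "v \<noteq> White i" "v \<in> verts T" by auto
    then obtain l where "v = White l" using T(4) by blast
    then have "l \<in> A - {i}" "l \<in> B" using v S(3) T(2) by (auto simp: labels_def)
    then show False using assms(5) by auto
  qed
  ultimately show ?thesis using S T that by blast
qed

definition fgI :: "nat \<Rightarrow> (vertex forest set \<Rightarrow>\<^sub>0 'k) \<Rightarrow> (vertex forest set \<Rightarrow>\<^sub>0 'k) \<Rightarrow> (vertex forest set \<Rightarrow>\<^sub>0 'k::field)" where
  "fgI i = bilin_ext (\<lambda>s t. class_insertion s i t)"

definition fgR :: "(nat \<Rightarrow> nat) \<Rightarrow> (vertex forest set \<Rightarrow>\<^sub>0 'k) \<Rightarrow> (vertex forest set \<Rightarrow>\<^sub>0 'k::field)" where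
  "fgR \<sigma> = lin_ext (\<lambda>s. basis_vec (\<Union>F\<in>s. greg_class (relabel_forest \<sigma> F)))"

fun gop :: "greg_gen \<Rightarrow> (vertex forest set \<Rightarrow>\<^sub>0 'k) \<Rightarrow> (vertex forest set \<Rightarrow>\<^sub>0 'k) \<Rightarrow> (vertex forest set \<Rightarrow>\<^sub>0 'k::field)" where
  "gop GenX u v = fgX u v"
| "gop GenY u v = fgX v u"
| "gop GenC u v = fgC u v"
| "gop GenG u v = fgG u v"

lemma pm_linear_fg:
  "pm_linear (\<lambda>u. fgX u v)" "pm_linear (fgX u)" "pm_linear (\<lambda>u. fgC u v)" "pm_linear (fgC u)"
  "pm_linear (\<lambda>u. fgG u v)" "pm_linear (fgG u)" "pm_linear (\<lambda>u. fgI i u v)" "pm_linear (fgI i u)" "pm_linear (fgR \<sigma>)"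
  unfolding fgX_def fgC_def fgG_def fgI_def fgR_def
  by (rule pm_linear_bilin_left pm_linear_bilin_right pm_linear_lin_ext)+

lemma pm_linear_gop: "pm_linear (\<lambda>u. gop a u v)" "pm_linear (gop a u)"
proof -
  show "pm_linear (\<lambda>u. gop a u v)" by (cases a) (simp_all add: pm_linear_fg)
  have "pm_linear (\<lambda>v. gop a u v)" by (cases a) (simp_all add: pm_linear_fg)
  then show "pm_linear (gop a u)" .
qed

abbreviation fg_carrier :: "nat set \<Rightarrow> (vertex forest set \<Rightarrow>\<^sub>0 'k::field) set" where
  "fg_carrier L \<equiv> carrier (free_space (greg_basis L))"

lemma cls_carrier: "valid F \<Longrightarrow> labels F = L \<Longrightarrow> cls F \<in> fg_carrier L"
  by (auto simp: greg_basis_iff)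

section \<open>Insertion passes through the generating operations\<close>

lemma insertion_eq:
  assumes "valid S" "valid T" "(verts S - {White i}) \<inter> verts T = {}" "White i \<in> verts S"
  shows "fgI i (cls S) (cls T) = insertion S i T"
  unfolding fgI_def bilin_ext_basis by (rule class_insertion_greg_class[OF assms])

lemma labels_iff: "l \<in> labels F \<longleftrightarrow> White l \<in> verts F"
  by (simp add: labels_def)

text \<open>Graftings of \<open>S'\<close> at \<open>White i\<close> are spread by insertion over
  all vertices of \<open>T\<close>; graftings at other vertices of \<open>S\<close> stay in place.
  Together these are the graftings at all vertices of the forest obtained from \<open>S\<close> by
  insertion.\<close>

lemma fgI_fgX_left:
  assumes u: "u \<in> fg_carrier A" and u': "u' \<in> fg_carrier A'" and v: "v \<in> fg_carrier B"
    and d: "A \<inter> A' = {}" "(A - {i}) \<inter> B = {}" "A' \<inter> B = {}" and i: "i \<in> A"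
  shows "fgI i (fgX u u') v = fgX (fgI i u v) (u' :: vertex forest set \<Rightarrow>\<^sub>0 'k::field)"
proof (rule pm_linear_eqI3[OF _ _ _ _ _ _ u u' v])
  fix s s' t assume "s \<in> greg_basis A" "s' \<in> greg_basis A'" "t \<in> greg_basis B"
  then obtain S S' T where S: "valid S" "valid S'" "valid T" and L: "labels S = A" "labels S' = A'" "labels T = B"
    and st: "s = greg_class S" "s' = greg_class S'" "t = greg_class T"
    and disj: "verts S \<inter> verts S' = {}" "(verts S - {White i}) \<inter> verts T = {}" "verts S' \<inter> verts T = {}"
    by (rule greg_basis_rep3[OF _ _ _ d])
  let ?w = "White i"
  have w: "?w \<in> verts S" "?w \<notin> verts S'" using i L d by (auto simp: labels_iff[symmetric])
  note h = validD(1)[OF S(1)] validD(1)[OF S(2)] and wf = validD(2)[OF S(1)] validD(2)[OF S(2)] validD(2)[OF S(3)]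
  let ?I = "incoming S ?w" and ?V = "verts T"
  let ?ins = "insert_along S i T"
  have fin: "finite (verts S)" "finite ?V" using wf by (auto simp: graph_wf_def)
  have "fgI i (fgX (cls S) (cls S')) (cls T) = (\<Sum>x\<in>verts S. insertion (attach x S S') i T :: vertex forest set \<Rightarrow>\<^sub>0 'k)"
    unfolding fgX_cls[OF wf(1,2) disj(1)] pm_linear_sum[OF pm_linear_fg(7)]
  proof (rule sum.cong[OF HOL.refl], rule insertion_eq)
    fix x assume x: "x \<in> verts S"
    show "valid (attach x S S')" by (rule valid_attach[OF S(1,2) disj(1) x])
    show "(verts (attach x S S') - {?w}) \<inter> ?V = {}" using disj by auto
    show "?w \<in> verts (attach x S S')" using w by simp
  qed (rule S)
  also have "\<dots> = (\<Sum>x\<in>verts S - {?w}. \<Sum>f\<in>?I \<rightarrow>\<^sub>E ?V. cls (attach x (?ins f) S')) +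
      (\<Sum>y\<in>?V. \<Sum>f\<in>?I \<rightarrow>\<^sub>E ?V. cls (attach y (?ins f) S'))"
  proof -
    have "insertion (attach x S S') i T = (\<Sum>f\<in>?I \<rightarrow>\<^sub>E ?V. cls (attach x (?ins f) S') :: vertex forest set \<Rightarrow>\<^sub>0 'k)"
      if x: "x \<in> verts S - {?w}" for x
      unfolding insertion_def
      using insert_along_attach_left(1)[OF h disj(1) _ w(1), where v = x] insert_along_attach_left(3)[OF h disj(1) _ w(1), where v = x] x by simp
    moreover have "insertion (attach ?w S S') i T = (\<Sum>y\<in>?V. \<Sum>f\<in>?I \<rightarrow>\<^sub>E ?V. cls (attach y (?ins f) S') :: vertex forest set \<Rightarrow>\<^sub>0 'k)"
    proof -
      let ?N = "insert ?w (roots S')"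
      note a = insert_along_attach_left[OF h disj(1) w(1) w(1)]
      have "insert_along (attach ?w S S') i T (f(?N := y)) = attach y (?ins f) S'" for f y
      proof -
        have "?ins (f(?N := y)) = ?ins f" by (rule insert_along_cong) (use a(4) in auto)
        then show ?thesis using a(2)[OF HOL.refl, where T = T and f = "f(?N := y)"] by simp
      qed
      then show ?thesis
        unfolding insertion_def a(3) by (simp add: sum_PiE_insert[OF a(4)])
    qed
    ultimately show ?thesis using sum.remove[OF fin(1) w(1), of "\<lambda>x. insertion (attach x S S') i T :: vertex forest set \<Rightarrow>\<^sub>0 'k"]
      by (simp add: add.commute)
  qed
  also have "\<dots> = (\<Sum>f\<in>?I \<rightarrow>\<^sub>E ?V. \<Sum>x\<in>verts (?ins f). cls (attach x (?ins f) S'))"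
  proof -
    have "(\<Sum>x\<in>verts (?ins f). g x) = (\<Sum>x\<in>verts S - {?w}. g x) + (\<Sum>x\<in>?V. g x)" for f and g :: "vertex \<Rightarrow> vertex forest set \<Rightarrow>\<^sub>0 'k"
      unfolding insert_along_simps by (rule sum.union_disjoint) (use fin disj in auto)
    then show ?thesis by (simp add: sum.distrib sum.swap[of _ _ "?I \<rightarrow>\<^sub>E ?V"])
  qed
  also have "\<dots> = fgX (insertion S i T) (cls S')"
    unfolding insertion_def pm_linear_sum[OF pm_linear_fg(1)]
    by (intro sum.cong HOL.refl fgX_cls[symmetric] insert_along_wf wf)
      (use disj in \<open>auto simp: insert_along_simps\<close>)
  finally show "fgI i (fgX (basis_vec s) (basis_vec s')) (basis_vec t) = fgX (fgI i (basis_vec s) (basis_vec t)) (basis_vec s' :: vertex forest set \<Rightarrow>\<^sub>0 'k)"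
    unfolding st insertion_eq[OF S(1,3) disj(2) w(1)] .
qed (intro pm_linear_fg pm_linear_compose[OF pm_linear_fg(7) pm_linear_fg(1)] pm_linear_compose[OF pm_linear_fg(7) pm_linear_fg(2)]
  pm_linear_compose[OF pm_linear_fg(1) pm_linear_fg(7)] pm_linear_compose[OF pm_linear_fg(1) pm_linear_fg(8)])+

text \<open>The place of grafting and the choice of vertices of \<open>T\<close> are independent
  here, so the two sums are simply exchanged.\<close>

lemma fgI_fgX_right:
  assumes u: "u \<in> fg_carrier A'" and u': "u' \<in> fg_carrier A" and v: "v \<in> fg_carrier B"
    and d: "A \<inter> A' = {}" "(A - {i}) \<inter> B = {}" "A' \<inter> B = {}" and i: "i \<in> A"
  shows "fgI i (fgX u u') v = fgX u (fgI i u' v :: vertex forest set \<Rightarrow>\<^sub>0 'k::field)"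
proof (rule pm_linear_eqI3[OF _ _ _ _ _ _ u u' v])
  fix s s' t assume "s \<in> greg_basis A'" "s' \<in> greg_basis A" "t \<in> greg_basis B"
  then obtain S S' T where S: "valid S'" "valid S" "valid T" and L: "labels S' = A" "labels S = A'" "labels T = B"
    and st: "s' = greg_class S'" "s = greg_class S" "t = greg_class T"
    and disj: "verts S' \<inter> verts S = {}" "(verts S' - {White i}) \<inter> verts T = {}" "verts S \<inter> verts T = {}"
    using greg_basis_rep3[OF _ _ _ d, of s' s t] by metis
  let ?w = "White i"
  have w: "?w \<in> verts S'" using i L by (auto simp: labels_iff[symmetric])
  note h = validD(1)[OF S(1)] validD(1)[OF S(2)] and wf = validD(2)[OF S(1)] validD(2)[OF S(2)] validD(2)[OF S(3)]
  let ?I = "incoming S' ?w" and ?V = "verts T"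
  let ?ins = "insert_along S' i T"
  have disj': "verts S \<inter> verts S' = {}" using disj by auto
  have "fgI i (fgX (cls S) (cls S')) (cls T) = (\<Sum>x\<in>verts S. insertion (attach x S S') i T :: vertex forest set \<Rightarrow>\<^sub>0 'k)"
    unfolding fgX_cls[OF wf(2,1) disj'] pm_linear_sum[OF pm_linear_fg(7)]
  proof (rule sum.cong[OF HOL.refl], rule insertion_eq)
    fix x assume x: "x \<in> verts S"
    show "valid (attach x S S')" by (rule valid_attach[OF S(2,1) disj' x])
    show "(verts (attach x S S') - {?w}) \<inter> ?V = {}" using disj by auto
    show "?w \<in> verts (attach x S S')" using w by simp
  qed (rule S)
  also have "\<dots> = (\<Sum>x\<in>verts S. \<Sum>f\<in>?I \<rightarrow>\<^sub>E ?V. cls (attach x S (?ins f)))"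
    unfolding insertion_def using insert_along_attach_right[OF h(2,1) disj' _ w] by (intro sum.cong HOL.refl) simp_all
  also have "\<dots> = (\<Sum>f\<in>?I \<rightarrow>\<^sub>E ?V. \<Sum>x\<in>verts S. cls (attach x S (?ins f)))" by (rule sum.swap)
  also have "\<dots> = fgX (cls S) (insertion S' i T)"
    unfolding insertion_def pm_linear_sum[OF pm_linear_fg(2)]
    by (intro sum.cong HOL.refl fgX_cls[symmetric] insert_along_wf wf)
      (use disj in \<open>auto simp: insert_along_simps\<close>)
  finally show "fgI i (fgX (basis_vec s) (basis_vec s')) (basis_vec t) = fgX (basis_vec s) (fgI i (basis_vec s') (basis_vec t) :: vertex forest set \<Rightarrow>\<^sub>0 'k)"
    unfolding st insertion_eq[OF S(1,3) disj(2) w(1)] .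
qed (intro pm_linear_fg pm_linear_compose[OF pm_linear_fg(7) pm_linear_fg(1)] pm_linear_compose[OF pm_linear_fg(7) pm_linear_fg(2)]
  pm_linear_compose[OF pm_linear_fg(2) pm_linear_fg(7)] pm_linear_compose[OF pm_linear_fg(2) pm_linear_fg(8)])+

lemma fgI_fgC_left:
  assumes u: "u \<in> fg_carrier A" and u': "u' \<in> fg_carrier A'" and v: "v \<in> fg_carrier B"
    and d: "A \<inter> A' = {}" "(A - {i}) \<inter> B = {}" "A' \<inter> B = {}" and i: "i \<in> A"
  shows "fgI i (fgC u u') v = fgC (fgI i u v) (u' :: vertex forest set \<Rightarrow>\<^sub>0 'k::field)"
proof (rule pm_linear_eqI3[OF _ _ _ _ _ _ u u' v])
  fix s s' t assume "s \<in> greg_basis A" "s' \<in> greg_basis A'" "t \<in> greg_basis B"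
  then obtain S S' T where S: "valid S" "valid S'" "valid T" and L: "labels S = A" "labels S' = A'" "labels T = B"
    and st: "s = greg_class S" "s' = greg_class S'" "t = greg_class T"
    and disj: "verts S \<inter> verts S' = {}" "(verts S - {White i}) \<inter> verts T = {}" "verts S' \<inter> verts T = {}"
    by (rule greg_basis_rep3[OF _ _ _ d])
  let ?w = "White i"
  have w: "?w \<in> verts S" "?w \<notin> verts S'" using i L d by (auto simp: labels_iff[symmetric])
  note h = validD(1)[OF S(1)] validD(1)[OF S(2)] and wf = validD(2)[OF S(1)] validD(2)[OF S(2)] validD(2)[OF S(3)]
  note m = insert_along_munion[OF h disj(1) w(1)]
  have "fgI i (fgC (cls S) (cls S')) (cls T) = (insertion (munion S S') i T :: vertex forest set \<Rightarrow>\<^sub>0 'k)"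
    unfolding fgC_cls[OF wf(1,2) disj(1)]
  proof (rule insertion_eq)
    show "valid (munion S S')" by (rule valid_munion[OF S(1,2) disj(1)])
    show "(verts (munion S S') - {?w}) \<inter> verts T = {}" using disj by auto
    show "?w \<in> verts (munion S S')" using w by simp
  qed (rule S)
  also have "\<dots> = fgC (insertion S i T) (cls S')"
    unfolding insertion_def m pm_linear_sum[OF pm_linear_fg(3)]
    by (intro sum.cong HOL.refl fgC_cls[symmetric] insert_along_wf wf)
      (use disj in \<open>auto simp: insert_along_simps\<close>)
  finally show "fgI i (fgC (basis_vec s) (basis_vec s')) (basis_vec t) = fgC (fgI i (basis_vec s) (basis_vec t)) (basis_vec s' :: vertex forest set \<Rightarrow>\<^sub>0 'k)"
    unfolding st insertion_eq[OF S(1,3) disj(2) w(1)] .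
qed (intro pm_linear_fg pm_linear_compose[OF pm_linear_fg(7) pm_linear_fg(3)] pm_linear_compose[OF pm_linear_fg(7) pm_linear_fg(4)]
  pm_linear_compose[OF pm_linear_fg(3) pm_linear_fg(7)] pm_linear_compose[OF pm_linear_fg(3) pm_linear_fg(8)])+

lemma fgI_fgG_left:
  assumes u: "u \<in> fg_carrier A" and u': "u' \<in> fg_carrier A'" and v: "v \<in> fg_carrier B"
    and d: "A \<inter> A' = {}" "(A - {i}) \<inter> B = {}" "A' \<inter> B = {}" and i: "i \<in> A"
  shows "fgI i (fgG u u') v = fgG (fgI i u v) (u' :: vertex forest set \<Rightarrow>\<^sub>0 'k::field)"
proof (rule pm_linear_eqI3[OF _ _ _ _ _ _ u u' v])
  fix s s' t assume "s \<in> greg_basis A" "s' \<in> greg_basis A'" "t \<in> greg_basis B"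
  then obtain S S' T where S: "valid S" "valid S'" "valid T" and L: "labels S = A" "labels S' = A'" "labels T = B"
    and st: "s = greg_class S" "s' = greg_class S'" "t = greg_class T"
    and disj: "verts S \<inter> verts S' = {}" "(verts S - {White i}) \<inter> verts T = {}" "verts S' \<inter> verts T = {}"
    by (rule greg_basis_rep3[OF _ _ _ d])
  let ?w = "White i"
  have w: "?w \<in> verts S" "?w \<notin> verts S'" using i L d by (auto simp: labels_iff[symmetric])
  note h = validD(1)[OF S(1)] validD(1)[OF S(2)] and wf = validD(2)[OF S(1)] validD(2)[OF S(2)] validD(2)[OF S(3)]
  have "finite (verts S \<union> verts S' \<union> verts T)" using wf by (simp add: graph_wf_def)
  from ex_fresh_Black[OF this] obtain b where "Black b \<notin> verts S \<union> verts S' \<union> verts T" by auto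
  then have b: "Black b \<notin> verts S" "Black b \<notin> verts S'" "Black b \<notin> verts T" by auto
  have bu: "Black b \<notin> verts S \<union> verts S'" using b by simp
  note m = insert_along_join[OF h disj(1) b(1,2) w(1)]
  have "fgI i (fgG (cls S) (cls S')) (cls T) = (insertion (join (Black b) S S') i T :: vertex forest set \<Rightarrow>\<^sub>0 'k)"
    unfolding fgG_cls[OF wf(1,2) disj(1) bu]
  proof (rule insertion_eq)
    show "valid (join (Black b) S S')" by (rule valid_join[OF S(1,2) disj(1) b(1,2)])
    show "(verts (join (Black b) S S') - {?w}) \<inter> verts T = {}" using disj b by auto
    show "?w \<in> verts (join (Black b) S S')" using w by simp
  qed (rule S)
  also have "\<dots> = fgG (insertion S i T) (cls S')"
    unfolding insertion_def m pm_linear_sum[OF pm_linear_fg(5)]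
    by (intro sum.cong HOL.refl fgG_cls[symmetric] insert_along_wf wf)
      (use disj b in \<open>auto simp: insert_along_simps\<close>)
  finally show "fgI i (fgG (basis_vec s) (basis_vec s')) (basis_vec t) = fgG (fgI i (basis_vec s) (basis_vec t)) (basis_vec s' :: vertex forest set \<Rightarrow>\<^sub>0 'k)"
    unfolding st insertion_eq[OF S(1,3) disj(2) w(1)] .
qed (intro pm_linear_fg pm_linear_compose[OF pm_linear_fg(7) pm_linear_fg(5)] pm_linear_compose[OF pm_linear_fg(7) pm_linear_fg(6)]
  pm_linear_compose[OF pm_linear_fg(5) pm_linear_fg(7)] pm_linear_compose[OF pm_linear_fg(5) pm_linear_fg(8)])+

lemma gop_cls:
  assumes "valid S" "valid T" "verts S \<inter> verts T = {}"
  shows "gop GenX (cls S) (cls T) = (\<Sum>v\<in>verts S. cls (attach v S T))"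
    and "gop GenC (cls S) (cls T) = cls (munion S T)"
    and "Black b \<notin> verts S \<Longrightarrow> Black b \<notin> verts T \<Longrightarrow> gop GenG (cls S) (cls T) = cls (join (Black b) S T)"
proof -
  note wf = validD(2)[OF assms(1)] validD(2)[OF assms(2)]
  show "gop GenX (cls S) (cls T) = (\<Sum>v\<in>verts S. cls (attach v S T))" by (simp add: fgX_cls[OF wf assms(3)])
  show "gop GenC (cls S) (cls T) = cls (munion S T)" by (simp add: fgC_cls[OF wf assms(3)])
  show "Black b \<notin> verts S \<Longrightarrow> Black b \<notin> verts T \<Longrightarrow> gop GenG (cls S) (cls T) = cls (join (Black b) S T)"
    by (simp add: fgG_cls[OF wf assms(3), of b])
qed

text \<open>This makes the evaluation of a tree invariant under exchanging two subtrees. For x and y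
  it holds by definition, for c and g because \<open>munion\<close> and \<open>join\<close> are
  symmetric.\<close>

lemma gop_swap:
  assumes u: "u \<in> fg_carrier A" and v: "v \<in> fg_carrier B" and d: "A \<inter> B = {}"
  shows "gop (greg_swap a) v u = (gop a u v :: vertex forest set \<Rightarrow>\<^sub>0 'k::field)"
proof -
  have "gop a v u = gop a u v" if a: "a = GenC \<or> a = GenG"
  proof (rule pm_linear_eqI2[OF pm_linear_gop(2) pm_linear_gop(1) pm_linear_gop(1) pm_linear_gop(2) u v])
    fix s t assume "s \<in> greg_basis A" "t \<in> greg_basis B"
    then obtain S T where S: "valid S" "valid T" "s = greg_class S" "t = greg_class T" "verts S \<inter> verts T = {}"
      by (rule greg_basis_rep2[OF _ _ d])
    have "finite (verts S \<union> verts T)" using validD(2)[OF S(1)] validD(2)[OF S(2)] by (simp add: graph_wf_def)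
    from ex_fresh_Black[OF this] obtain b where b: "Black b \<notin> verts S" "Black b \<notin> verts T" by auto
    have S': "verts T \<inter> verts S = {}" using S(5) by auto
    show "gop a (basis_vec t) (basis_vec s) = (gop a (basis_vec s) (basis_vec t) :: vertex forest set \<Rightarrow>\<^sub>0 'k)"
      using a
    proof
      assume a: "a = GenC"
      show ?thesis unfolding S(3,4) a gop_cls(2)[OF S(1,2,5)] gop_cls(2)[OF S(2,1) S'] munion_commute[of S T] ..
    next
      assume a: "a = GenG"
      show ?thesis unfolding S(3,4) a gop_cls(3)[OF S(1,2,5) b] gop_cls(3)[OF S(2,1) S' b(2,1)] join_commute[of "Black b" S T] ..
    qed
  qed
  then show ?thesis by (cases a) auto
qed

lemma bilinear_closed:
  assumes "\<And>v. pm_linear (\<lambda>u. f u v)" "\<And>u. pm_linear (f u)"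
    and "u \<in> carrier (free_space X)" "v \<in> carrier (free_space Y)"
    and "\<And>a b. a \<in> X \<Longrightarrow> b \<in> Y \<Longrightarrow> f (basis_vec a) (basis_vec b) \<in> carrier (free_space Z)"
  shows "f u v \<in> carrier (free_space Z)"
  using linear_maps_mem[OF pm_linear_mapsI[OF assms(1) linear_maps_mem[OF pm_linear_mapsI[OF assms(2,5)] assms(4)]] assms(3)] .

lemma gop_closed:
  assumes u: "u \<in> fg_carrier A" and v: "v \<in> fg_carrier B" and d: "A \<inter> B = {}"
  shows "gop a u v \<in> (fg_carrier (A \<union> B) :: (vertex forest set \<Rightarrow>\<^sub>0 'k::field) set)"
proof -
  have *: "gop a u v \<in> (fg_carrier (A \<union> B) :: (vertex forest set \<Rightarrow>\<^sub>0 'k::field) set)"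
    if "a \<noteq> GenY" and u: "u \<in> fg_carrier A" and v: "v \<in> fg_carrier B" and d: "A \<inter> B = {}" for a u v A B
  proof (rule bilinear_closed[OF pm_linear_gop(1) pm_linear_gop(2) u v])
    fix s t assume "s \<in> greg_basis A" "t \<in> greg_basis B"
    then obtain S T where S: "valid S" "valid T" "labels S = A" "labels T = B" "s = greg_class S" "t = greg_class T" "verts S \<inter> verts T = {}"
      by (rule greg_basis_rep2[OF _ _ d])
    have "finite (verts S \<union> verts T)" using validD(2)[OF S(1)] validD(2)[OF S(2)] by (simp add: graph_wf_def)
    from ex_fresh_Black[OF this] obtain b where b: "Black b \<notin> verts S" "Black b \<notin> verts T" by auto
    show "gop a (basis_vec s) (basis_vec t) \<in> (fg_carrier (A \<union> B) :: (vertex forest set \<Rightarrow>\<^sub>0 'k) set)"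
      unfolding S(5,6)
    proof (cases a)
      case GenX
      then show "gop a (cls S) (cls T) \<in> (fg_carrier (A \<union> B) :: (vertex forest set \<Rightarrow>\<^sub>0 'k) set)"
        unfolding GenX gop_cls(1)[OF S(1,2,7)]
        by (intro free_space_sum cls_carrier valid_attach) (use S in auto)
    next
      case GenC
      then show "gop a (cls S) (cls T) \<in> (fg_carrier (A \<union> B) :: (vertex forest set \<Rightarrow>\<^sub>0 'k) set)"
        unfolding GenC gop_cls(2)[OF S(1,2,7)]
        by (intro cls_carrier valid_munion) (use S in auto)
    next
      case GenG
      then show "gop a (cls S) (cls T) \<in> (fg_carrier (A \<union> B) :: (vertex forest set \<Rightarrow>\<^sub>0 'k) set)"
        unfolding GenG gop_cls(3)[OF S(1,2,7) b]
        by (intro cls_carrier valid_join) (use S b in auto)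
    qed (use that in simp)
  qed
  show ?thesis
  proof (cases "a = GenY")
    case True
    then show ?thesis using *[of GenX v B u A] u v d by (simp add: Un_commute Int_commute)
  qed (rule *[OF _ u v d])
qed

lemma fgI_gop_left:
  assumes "u \<in> fg_carrier A" "u' \<in> fg_carrier A'" "v \<in> fg_carrier B"
    and "A \<inter> A' = {}" "(A - {i}) \<inter> B = {}" "A' \<inter> B = {}" "i \<in> A"
  shows "fgI i (gop a u u') v = gop a (fgI i u v) u'"
  using fgI_fgX_left[OF assms] fgI_fgX_right[OF assms(2,1,3-7)] fgI_fgC_left[OF assms] fgI_fgG_left[OF assms]
  by (cases a) auto

lemma fgI_unit:
  assumes v: "v \<in> fg_carrier B"
  shows "fgI i (cls (single (White i))) v = (v :: vertex forest set \<Rightarrow>\<^sub>0 'k::field)"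
proof (rule pm_linear_eqI[OF pm_linear_fg(8) pm_linear_id v])
  fix t assume "t \<in> greg_basis B"
  then obtain T where T: "valid T" "t = greg_class T" using greg_basis_iff by auto
  have "insert_along (single (White i)) i T f = T" for f
    by (rule forest_eqI) (simp_all add: insert_along_simps incoming_single)
  then have "insertion (single (White i)) i T = (cls T :: vertex forest set \<Rightarrow>\<^sub>0 'k)"
    by (simp add: insertion_def incoming_single)
  then show "fgI i (cls (single (White i))) (basis_vec t) = (basis_vec t :: vertex forest set \<Rightarrow>\<^sub>0 'k)"
    unfolding T(2) by (subst insertion_eq) (auto simp: T valid_single)
qed

section \<open>Relabelling of classes\<close>

lemma relabel_forest_map: "relabel_forest \<sigma> F = map_forest (map_label \<sigma>) F"
  by (simp add: relabel_forest_def map_forest_def)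

lemma fgR_cls:
  assumes wf: "graph_wf F"
  shows "fgR \<sigma> (cls F) = cls (map_forest (map_label \<sigma>) F)"
proof -
  let ?m = "map_label \<sigma>"
  have "greg_class (map_forest ?m F') = greg_class (map_forest ?m F)" if F': "F' \<in> greg_class F" for F'
  proof -
    obtain h where h: "colour_inj h (verts F)" "F' = map_forest h F" using F' greg_class_mem by auto
    \<comment> \<open>After relabelling, white vertices carry labels on which \<open>h\<close> need
      not be the identity. \<open>g\<close> keeps the action of \<open>h\<close> on black vertices
      and fixes all white ones.\<close>
    define g where "g v = (case v of White l \<Rightarrow> White l | Black b \<Rightarrow> h (Black b))" for v
    have gb: "h v = g v \<and> h v \<in> range Black" if "v \<in> verts F" "v \<in> range Black" for v
      using that h(1) by (auto simp: g_def colour_inj_def)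
    have gm: "?m (h v) = g (?m v)" if v: "v \<in> verts F" for v
    proof (cases v)
      case (White l) then show ?thesis using v h(1) by (simp add: g_def colour_inj_def)
    next
      case (Black b) then show ?thesis using gb[OF v] by (auto simp: g_def)
    qed
    have "map_forest ?m F' = map_forest g (map_forest ?m F)"
      unfolding h(2) map_forest_comp by (rule map_forest_cong[OF wf]) (simp add: gm)
    moreover have "colour_inj g (verts (map_forest ?m F))"
    proof -
      have im: "v \<in> verts F" if v: "v \<in> ?m ` verts F" "v \<in> range Black" for v
      proof -
        obtain u where "u \<in> verts F" "v = ?m u" using v(1) by auto
        then show ?thesis using v(2) by (cases u) auto
      qed
      have "u = v" if u: "u \<in> ?m ` verts F" and v: "v \<in> ?m ` verts F" and eq: "g u = g v" for u v
      proof (cases u)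
        case (White l)
        then show ?thesis using eq gb[OF im[OF v]] by (cases v) (auto simp: g_def)
      next
        case u': (Black b)
        then have ub: "u \<in> verts F" using im[OF u] by simp
        show ?thesis
        proof (cases v)
          case (White l) then show ?thesis using eq gb[OF ub] u' by (auto simp: g_def)
        next
          case (Black c)
          then have "v \<in> verts F" using im[OF v] by simp
          moreover have "h u = h v" using eq u' Black by (simp add: g_def)
          ultimately show ?thesis using ub h(1) unfolding colour_inj_def by (metis inj_onD)
        qed
      qed
      then have "inj_on g (?m ` verts F)" by (auto intro: inj_onI)
      moreover have "g (Black b) \<in> range Black" if "Black b \<in> ?m ` verts F" for b
        using gb[OF im[OF that rangeI] rangeI] by metis
      ultimately show ?thesis by (simp add: colour_inj_def) (simp add: g_def)
    qed
    ultimately show ?thesis using greg_class_map[OF graph_wf_ops(4)[OF wf]] by metis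
  qed
  then have "(\<Union>F'\<in>greg_class F. greg_class (map_forest ?m F')) = (\<Union>F'\<in>greg_class F. greg_class (map_forest ?m F))"
    by (intro SUP_cong HOL.refl)
  also have "\<dots> = greg_class (map_forest ?m F)" using greg_class_self by (intro SUP_const) auto
  finally show ?thesis by (simp add: fgR_def relabel_forest_map)
qed

lemma fgR_gop:
  assumes u: "u \<in> fg_carrier A" and v: "v \<in> fg_carrier B" and d: "A \<inter> B = {}" and \<sigma>: "inj_on \<sigma> (A \<union> B)"
  shows "fgR \<sigma> (gop a u v) = gop a (fgR \<sigma> u) (fgR \<sigma> v :: vertex forest set \<Rightarrow>\<^sub>0 'k::field)"
proof -
  have *: "fgR \<sigma> (gop a u v) = gop a (fgR \<sigma> u) (fgR \<sigma> v :: vertex forest set \<Rightarrow>\<^sub>0 'k::field)"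
    if "a \<noteq> GenY" and u: "u \<in> fg_carrier A" and v: "v \<in> fg_carrier B" and d: "A \<inter> B = {}" and \<sigma>: "inj_on \<sigma> (A \<union> B)" for a u v A B
  proof (rule pm_linear_eqI2[OF _ _ _ _ u v])
    fix s t assume "s \<in> greg_basis A" "t \<in> greg_basis B"
    then obtain S T where S: "valid S" "valid T" "labels S = A" "labels T = B" "s = greg_class S" "t = greg_class T" "verts S \<inter> verts T = {}"
      by (rule greg_basis_rep2[OF _ _ d])
    let ?m = "map_label \<sigma>"
    note wf = validD(2)[OF S(1)] validD(2)[OF S(2)]
    have m: "inj_on ?m (verts S \<union> verts T)"
    proof (rule inj_onI)
      fix x y assume "x \<in> verts S \<union> verts T" "y \<in> verts S \<union> verts T" "?m x = ?m y"
      then show "x = y" using S(3,4) \<sigma> by (cases x; cases y) (auto simp: labels_def inj_on_def)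
    qed
    have wf': "graph_wf (map_forest ?m S)" "graph_wf (map_forest ?m T)"
      by (rule graph_wf_ops(4)[OF wf(1)], rule graph_wf_ops(4)[OF wf(2)])
    have d': "verts (map_forest ?m S) \<inter> verts (map_forest ?m T) = {}"
      using inj_on_image_Int[OF m, of "verts S" "verts T"] S(7) by simp
    have mS: "inj_on ?m (verts S)" using m by (rule inj_on_subset) simp
    have "finite (verts S \<union> verts T)" using wf by (simp add: graph_wf_def)
    from ex_fresh_Black[OF this] obtain b where b: "Black b \<notin> verts S \<union> verts T" by auto
    have b': "Black b \<notin> verts (map_forest ?m S) \<union> verts (map_forest ?m T)"
    proof
      assume "Black b \<in> verts (map_forest ?m S) \<union> verts (map_forest ?m T)"
      then obtain x where "x \<in> verts S \<union> verts T" "Black b = ?m x" by auto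
      then show False using b by (cases x) auto
    qed
    show "fgR \<sigma> (gop a (basis_vec s) (basis_vec t)) = gop a (fgR \<sigma> (basis_vec s)) (fgR \<sigma> (basis_vec t) :: vertex forest set \<Rightarrow>\<^sub>0 'k)"
      unfolding S(5,6) fgR_cls[OF wf(1)] fgR_cls[OF wf(2)]
    proof (cases a)
      case GenX
      have "fgR \<sigma> (gop a (cls S) (cls T)) = (\<Sum>x\<in>verts S. fgR \<sigma> (cls (attach x S T)))"
        by (simp add: GenX fgX_cls[OF wf S(7)] pm_linear_sum[OF pm_linear_fg(9)])
      also have "\<dots> = (\<Sum>x\<in>verts S. cls (attach (?m x) (map_forest ?m S) (map_forest ?m T)))"
        by (intro sum.cong HOL.refl) (simp add: fgR_cls[OF graph_wf_ops(1)[OF wf]] map_forest_attach)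
      also have "\<dots> = gop a (cls (map_forest ?m S)) (cls (map_forest ?m T))"
        by (simp add: GenX fgX_cls[OF wf' d'] sum.reindex[OF mS])
      finally show "fgR \<sigma> (gop a (cls S) (cls T)) = gop a (cls (map_forest ?m S)) (cls (map_forest ?m T) :: vertex forest set \<Rightarrow>\<^sub>0 'k)" .
    next
      case GenC
      then show "fgR \<sigma> (gop a (cls S) (cls T)) = gop a (cls (map_forest ?m S)) (cls (map_forest ?m T) :: vertex forest set \<Rightarrow>\<^sub>0 'k)"
        by (simp add: fgC_cls[OF wf S(7)] fgC_cls[OF wf' d'] fgR_cls[OF graph_wf_ops(2)[OF wf]] map_forest_munion)
    next
      case GenG
      then show "fgR \<sigma> (gop a (cls S) (cls T)) = gop a (cls (map_forest ?m S)) (cls (map_forest ?m T) :: vertex forest set \<Rightarrow>\<^sub>0 'k)"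
        by (simp add: fgG_cls[OF wf S(7) b] fgG_cls[OF wf' d' b'] fgR_cls[OF graph_wf_ops(3)[OF wf]] map_forest_join)
    qed (use that in simp)
  qed (intro pm_linear_fg pm_linear_gop pm_linear_compose[OF pm_linear_fg(9) pm_linear_gop(1)] pm_linear_compose[OF pm_linear_fg(9) pm_linear_gop(2)]
      pm_linear_compose[OF pm_linear_gop(1) pm_linear_fg(9)] pm_linear_compose[OF pm_linear_gop(2) pm_linear_fg(9)])+
  show ?thesis
  proof (cases "a = GenY")
    case True
    then show ?thesis using *[of GenX v B u A] u v d \<sigma> by (simp add: Un_commute Int_commute)
  qed (rule *[OF _ u v d \<sigma>])
qed

section \<open>The morphism from the free operad to forests\<close>

abbreviation FT :: "('k::field, greg_gen tree set \<Rightarrow>\<^sub>0 'k) operad" where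
  "FT \<equiv> free_operad greg_swap"

abbreviation tb :: "greg_gen tree \<Rightarrow> (greg_gen tree set \<Rightarrow>\<^sub>0 'k::field)" where
  "tb t \<equiv> basis_vec (tree_class greg_swap t)"

abbreviation t_carrier :: "nat set \<Rightarrow> (greg_gen tree set \<Rightarrow>\<^sub>0 'k::field) set" where
  "t_carrier L \<equiv> carrier (free_space (tree_basis greg_swap L))"

lemma FT_space [simp]: "op_space FT L = free_space (tree_basis greg_swap L)"
  by (simp add: free_operad_def)

lemma FT_relabel [simp]: "op_relabel FT L \<sigma> (tb t) = tb (map_leaves \<sigma> t)"
  by (simp add: free_operad_def tree_class_map_leaves)

lemma FT_comp [simp]: "op_comp FT A i B (tb s) (tb t) = tb (graft s i t)"
  by (simp add: free_operad_def tree_class_graft)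

lemma FT_unit [simp]: "op_unit FT i = tb (Leaf i)"
  by (simp add: free_operad_def)

lemma pm_linear_FT:
  "pm_linear (op_relabel FT L \<sigma>)" "pm_linear (\<lambda>p. op_comp FT A i B p q)" "pm_linear (op_comp FT A i B p)"
  by (simp_all add: free_operad_def pm_linear_lin_ext pm_linear_bilin_left pm_linear_bilin_right)

lemma tree_basis_iff: "s \<in> tree_basis sw L \<longleftrightarrow> (\<exists>t. s = tree_class sw t \<and> distinct (leaves t) \<and> set (leaves t) = L)"
  by (auto simp: tree_basis_def)

fun ev :: "greg_gen tree \<Rightarrow> (vertex forest set \<Rightarrow>\<^sub>0 'k::field)" where
  "ev (Leaf l) = cls (single (White l))"
| "ev (Node a s t) = gop a (ev s) (ev t)"

lemma ev_closed: "distinct (leaves t) \<Longrightarrow> ev t \<in> fg_carrier (set (leaves t))"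
proof (induction t)
  case (Leaf l)
  then show ?case using cls_carrier[OF valid_single, of l "{l}"] by simp
next
  case (Node a s t)
  then show ?case using gop_closed[of "ev s" "set (leaves s)" "ev t" "set (leaves t)" a] by simp
qed

lemma ev_tree_eq: "tree_eq greg_swap s t \<Longrightarrow> distinct (leaves s) \<Longrightarrow> ev s = (ev t :: vertex forest set \<Rightarrow>\<^sub>0 'k::field)"
proof (induction rule: tree_eq.induct)
  case (sym s t)
  then show ?case using tree_eq_leaves by metis
next
  case (trans s t u)
  then show ?case using tree_eq_leaves by metis
next
  case (swap a s t)
  then show ?case by (simp add: gop_swap[OF ev_closed[of s] ev_closed[of t], of a])
qed simp_all

text \<open>Insertion moves down the tree into the subtree that contains \<open>i\<close>. If this
  is the right subtree, the node is first turned around, so that only insertion into the first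
  argument is used.\<close>

lemma ev_graft:
  "distinct (leaves s) \<Longrightarrow> distinct (leaves u) \<Longrightarrow> i \<in> set (leaves s) \<Longrightarrow>
    (set (leaves s) - {i}) \<inter> set (leaves u) = {} \<Longrightarrow>
    ev (graft s i u) = fgI i (ev s) (ev u :: vertex forest set \<Rightarrow>\<^sub>0 'k::field)"
proof (induction s)
  case (Leaf l)
  then show ?case by (auto simp: fgI_unit[OF ev_closed[of u]])
next
  case (Node a s t)
  have d: "distinct (leaves s)" "distinct (leaves t)" "set (leaves s) \<inter> set (leaves t) = {}" using Node.prems by auto
  consider "i \<in> set (leaves s)" "i \<notin> set (leaves t)" | "i \<in> set (leaves t)" "i \<notin> set (leaves s)"
    using Node.prems by auto
  then show ?case
  proof cases
    case 1
    have "ev (graft s i u) = fgI i (ev s) (ev u :: vertex forest set \<Rightarrow>\<^sub>0 'k)"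
      by (rule Node.IH(1)) (use Node.prems d 1 in auto)
    moreover have "fgI i (gop a (ev s) (ev t)) (ev u) = gop a (fgI i (ev s) (ev u)) (ev t :: vertex forest set \<Rightarrow>\<^sub>0 'k)"
      by (rule fgI_gop_left[OF ev_closed[OF d(1)] ev_closed[OF d(2)] ev_closed[OF Node.prems(2)] d(3)])
        (use Node.prems 1 in auto)
    ultimately show ?thesis using 1 by (simp add: graft_notin)
  next
    case 2
    have IH: "ev (graft t i u) = fgI i (ev t) (ev u :: vertex forest set \<Rightarrow>\<^sub>0 'k)"
      by (rule Node.IH(2)) (use Node.prems d 2 in auto)
    have lg: "distinct (leaves (graft t i u))" "set (leaves (graft t i u)) = (set (leaves t) - {i}) \<union> set (leaves u)"
      using leaves_graft[OF d(2) Node.prems(2) 2(1)] Node.prems by auto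
    have "fgI i (gop a (ev s) (ev t)) (ev u) = fgI i (gop (greg_swap a) (ev t) (ev s)) (ev u :: vertex forest set \<Rightarrow>\<^sub>0 'k)"
      by (subst gop_swap[OF ev_closed[OF d(1)] ev_closed[OF d(2)] d(3)]) simp
    also have "\<dots> = gop (greg_swap a) (fgI i (ev t) (ev u)) (ev s)"
      by (rule fgI_gop_left[OF ev_closed[OF d(2)] ev_closed[OF d(1)] ev_closed[OF Node.prems(2)]])
        (use Node.prems 2 d in auto)
    also have "\<dots> = gop a (ev s) (ev (graft t i u))"
      unfolding IH[symmetric] by (rule gop_swap[OF ev_closed[OF d(1)] ev_closed[OF lg(1)]])
        (use Node.prems 2 d lg in auto)
    finally show ?thesis using 2 by (simp add: graft_notin)
  qed
qed

lemma ev_map_leaves: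
  "distinct (leaves t) \<Longrightarrow> inj_on \<sigma> (set (leaves t)) \<Longrightarrow>
    fgR \<sigma> (ev t) = (ev (map_leaves \<sigma> t) :: vertex forest set \<Rightarrow>\<^sub>0 'k::field)"
proof (induction t)
  case (Leaf l)
  then show ?case using validD(2)[OF valid_single] by (simp add: fgR_cls map_forest_single)
next
  case (Node a s t)
  then show ?case
    by (auto simp: inj_on_Un fgR_gop[OF ev_closed[of s] ev_closed[of t], of \<sigma> a])
qed

text \<open>Evaluation of a representative tree; the choice is harmless for classes of trees with
  distinct leaves, on which \<open>ev\<close> is constant.\<close>

definition phi :: "(greg_gen tree set \<Rightarrow>\<^sub>0 'k) \<Rightarrow> (vertex forest set \<Rightarrow>\<^sub>0 'k::field)" where
  "phi = lin_ext (\<lambda>c. ev (SOME t. t \<in> c))"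

lemma pm_linear_phi: "pm_linear phi"
  unfolding phi_def by (rule pm_linear_lin_ext)

lemma phi_tb: "distinct (leaves t) \<Longrightarrow> phi (tb t) = (ev t :: vertex forest set \<Rightarrow>\<^sub>0 'k::field)"
proof -
  assume t: "distinct (leaves t)"
  have "(SOME s. s \<in> tree_class greg_swap t) \<in> tree_class greg_swap t"
    by (rule someI[of _ t]) (rule tree_class_self)
  then have "ev t = (ev (SOME s. s \<in> tree_class greg_swap t) :: vertex forest set \<Rightarrow>\<^sub>0 'k)"
    by (intro ev_tree_eq[OF _ t]) (simp add: tree_class_def)
  then show ?thesis by (simp add: phi_def)
qed

text \<open>The counterpart of \<open>gop\<close> in the free operad: two combinations of trees
  placed under a root decorated with \<open>a\<close>. All later calculations in the free operad are
  written with it instead of partial compositions.\<close>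

definition bin :: "greg_gen \<Rightarrow> (greg_gen tree set \<Rightarrow>\<^sub>0 'k) \<Rightarrow> (greg_gen tree set \<Rightarrow>\<^sub>0 'k) \<Rightarrow> (greg_gen tree set \<Rightarrow>\<^sub>0 'k::field)" where
  "bin a = bilin_ext (\<lambda>s t. basis_vec (\<Union>s'\<in>s. \<Union>t'\<in>t. tree_class greg_swap (Node a s' t')))"

lemma pm_linear_bin: "pm_linear (\<lambda>p. bin a p q)" "pm_linear (bin a p)"
  unfolding bin_def by (rule pm_linear_bilin_left pm_linear_bilin_right)+

lemma bin_tb [simp]: "bin a (tb s) (tb t) = tb (Node a s t)"
proof -
  have "tree_class greg_swap (Node a s' t') = tree_class greg_swap (Node a s t)"
    if "s' \<in> tree_class greg_swap s" "t' \<in> tree_class greg_swap t" for s' t'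
    using that tree_class_eq[OF tree_eq.cong[of greg_swap s s' t t' a]] by (simp add: tree_class_def)
  then have "(\<Union>s'\<in>tree_class greg_swap s. \<Union>t'\<in>tree_class greg_swap t. tree_class greg_swap (Node a s' t')) =
      (\<Union>s'\<in>tree_class greg_swap s. \<Union>t'\<in>tree_class greg_swap t. tree_class greg_swap (Node a s t))"
    by (intro SUP_cong HOL.refl)
  also have "\<dots> = tree_class greg_swap (Node a s t)"
    using tree_class_self[of s greg_swap] tree_class_self[of t greg_swap] by auto
  finally show ?thesis by (simp add: bin_def)
qed

lemma bin_closed:
  assumes p: "p \<in> t_carrier A" and q: "q \<in> t_carrier B" and d: "A \<inter> B = {}"
  shows "bin a p q \<in> t_carrier (A \<union> B)"
proof (rule bilinear_closed[OF pm_linear_bin p q])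
  fix s t assume "s \<in> tree_basis greg_swap A" "t \<in> tree_basis greg_swap B"
  then obtain s' t' where st: "s = tree_class greg_swap s'" "t = tree_class greg_swap t'"
    "distinct (leaves (Node a s' t'))" "set (leaves (Node a s' t')) = A \<union> B"
    using d by (auto simp: tree_basis_iff)
  show "bin a (basis_vec s) (basis_vec t) \<in> t_carrier (A \<union> B)"
    unfolding st(1,2) bin_tb free_space_closed tree_basis_iff using st(3,4) by blast
qed

lemma phi_closed: "p \<in> t_carrier L \<Longrightarrow> phi p \<in> fg_carrier L"
proof (rule linear_maps_mem[OF pm_linear_mapsI[OF pm_linear_phi]])
  fix s assume "s \<in> tree_basis greg_swap L"
  then show "phi (basis_vec s) \<in> (fg_carrier L :: (vertex forest set \<Rightarrow>\<^sub>0 'a) set)"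
    using ev_closed by (auto simp: tree_basis_iff phi_tb)
qed

lemma phi_bin:
  assumes p: "p \<in> t_carrier A" and q: "q \<in> t_carrier B" and d: "A \<inter> B = {}"
  shows "phi (bin a p q) = gop a (phi p) (phi q :: vertex forest set \<Rightarrow>\<^sub>0 'k::field)"
proof (rule pm_linear_eqI2[OF _ _ _ _ p q])
  fix s t assume "s \<in> tree_basis greg_swap A" "t \<in> tree_basis greg_swap B"
  then show "phi (bin a (basis_vec s) (basis_vec t)) = gop a (phi (basis_vec s)) (phi (basis_vec t) :: vertex forest set \<Rightarrow>\<^sub>0 'k)"
    using d by (auto simp: tree_basis_iff phi_tb)
qed (intro pm_linear_compose[OF pm_linear_phi pm_linear_bin(1)] pm_linear_compose[OF pm_linear_phi pm_linear_bin(2)]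
    pm_linear_compose[OF pm_linear_gop(1) pm_linear_phi] pm_linear_compose[OF pm_linear_gop(2) pm_linear_phi])+

lemma phi_comp:
  assumes p: "p \<in> t_carrier (insert i A)" and q: "q \<in> t_carrier B" and d: "i \<notin> A" "A \<inter> B = {}"
  shows "phi (op_comp FT A i B p q) = fgI i (phi p) (phi q :: vertex forest set \<Rightarrow>\<^sub>0 'k::field)"
proof (rule pm_linear_eqI2[OF _ _ _ _ p q])
  fix s t assume "s \<in> tree_basis greg_swap (insert i A)" "t \<in> tree_basis greg_swap B"
  then obtain s' t' where st: "s = tree_class greg_swap s'" "t = tree_class greg_swap t'"
    "distinct (leaves s')" "distinct (leaves t')" "set (leaves s') = insert i A" "set (leaves t') = B"
    by (auto simp: tree_basis_iff)
  have h: "i \<in> set (leaves s')" "(set (leaves s') - {i}) \<inter> set (leaves t') = {}" using st d by auto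
  show "phi (op_comp FT A i B (basis_vec s) (basis_vec t)) = fgI i (phi (basis_vec s)) (phi (basis_vec t) :: vertex forest set \<Rightarrow>\<^sub>0 'k)"
    unfolding st(1,2) FT_comp phi_tb[OF st(3)] phi_tb[OF st(4)]
    using leaves_graft[OF st(3,4) h] ev_graft[OF st(3,4) h] by (simp add: phi_tb)
qed (intro pm_linear_compose[OF pm_linear_phi pm_linear_FT(2)] pm_linear_compose[OF pm_linear_phi pm_linear_FT(3)]
    pm_linear_compose[OF pm_linear_fg(7) pm_linear_phi] pm_linear_compose[OF pm_linear_fg(8) pm_linear_phi])+

lemma phi_relabel:
  assumes p: "p \<in> t_carrier L" and \<sigma>: "inj_on \<sigma> L"
  shows "phi (op_relabel FT L \<sigma> p) = fgR \<sigma> (phi p :: vertex forest set \<Rightarrow>\<^sub>0 'k::field)"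
proof (rule pm_linear_eqI[OF _ _ p])
  fix s assume "s \<in> tree_basis greg_swap L"
  then show "phi (op_relabel FT L \<sigma> (basis_vec s)) = fgR \<sigma> (phi (basis_vec s) :: vertex forest set \<Rightarrow>\<^sub>0 'k)"
    using \<sigma> by (auto simp: tree_basis_iff phi_tb ev_map_leaves distinct_map)
qed (intro pm_linear_compose[OF pm_linear_phi pm_linear_FT(1)] pm_linear_compose[OF pm_linear_fg(9) pm_linear_phi])+

section \<open>The relators\<close>

text \<open>The relators with arbitrary arguments and operations, so that the same formulas can be
  read in the free operad, in forests and after substitution. The action of the transposition (2 3)
  becomes the exchange of \<open>q\<close> and \<open>r\<close>.\<close>

definition relations ::
  "(greg_gen \<Rightarrow> 'a \<Rightarrow> 'a \<Rightarrow> 'a) \<Rightarrow> 'a \<Rightarrow> 'a \<Rightarrow> 'a \<Rightarrow> 'a::ab_group_add set" where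
  "relations f p q r =
    {(f GenX (f GenX p q) r - f GenX p (f GenX q r)) - (f GenX (f GenX p r) q - f GenX p (f GenX r q)),
     f GenX (f GenC p q) r - f GenC (f GenX p r) q - f GenC p (f GenX q r),
     f GenC (f GenC p q) r - f GenC p (f GenC q r),
     (f GenX (f GenG p q) r - f GenG (f GenX p r) q - f GenG p (f GenX q r)) -
     (f GenX (f GenG p r) q - f GenG (f GenX p q) r - f GenG p (f GenX r q))}"

lemma circ_generators:
  "circ FT 2 1 2 (generator greg_swap a) (generator greg_swap b) = tb (Node a (Node b (Leaf 1) (Leaf 2)) (Leaf 3))"
  "circ FT 2 2 2 (generator greg_swap a) (generator greg_swap b) = tb (Node a (Leaf 1) (Node b (Leaf 2) (Leaf 3)))"
  by (simp_all add: circ_def generator_def numeral_2_eq_2 numeral_3_eq_3)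

lemma comgreg_relators_eq:
  "comgreg_relators = (relations bin (tb (Leaf 1)) (tb (Leaf 2)) (tb (Leaf 3)) :: (greg_gen tree set \<Rightarrow>\<^sub>0 'k::field) set)"
  unfolding comgreg_relators_def relations_def Let_def circ_generators
  by (simp add: pm_linear_diff[OF pm_linear_FT(1)] transpose_def)

lemma relations_image:
  assumes lin: "pm_linear f"
    and hom: "\<And>a p q A B. p \<in> t_carrier A \<Longrightarrow> q \<in> t_carrier B \<Longrightarrow> A \<inter> B = {} \<Longrightarrow> f (bin a p q) = g a (f p) (f q)"
    and pqr: "p \<in> t_carrier A" "q \<in> t_carrier B" "r \<in> t_carrier C" "A \<inter> B = {}" "A \<inter> C = {}" "B \<inter> C = {}"
  shows "f ` relations bin p q r = relations g (f p) (f q) (f r)"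
proof -
  have d: "C \<inter> B = {}" "(A \<union> B) \<inter> C = {}" "(A \<union> C) \<inter> B = {}" "A \<inter> (B \<union> C) = {}" "A \<inter> (C \<union> B) = {}" using pqr by auto
  note h = hom[OF pqr(1,2,4)] hom[OF pqr(1,3,5)] hom[OF pqr(2,3,6)] hom[OF pqr(3,2) d(1)]
    hom[OF bin_closed[OF pqr(1,2,4)] pqr(3) d(2)] hom[OF bin_closed[OF pqr(1,3,5)] pqr(2) d(3)]
    hom[OF pqr(1) bin_closed[OF pqr(2,3,6)] d(4)] hom[OF pqr(1) bin_closed[OF pqr(3,2) d(1)] d(5)]
  show ?thesis unfolding relations_def by (simp add: pm_linear_diff[OF lin] h)
qed

text \<open>In the pre-Lie relator only \<open>b\<close> and \<open>c\<close> attached to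
  \<open>a\<close> by separate edges survives, and in the relator for g only the black root with
  three edges; both forests are symmetric in \<open>b\<close> and \<open>c\<close>. In the other two
  relators everything cancels.\<close>

lemma relations_fg:
  fixes a b c :: nat
  assumes "a \<noteq> b" "a \<noteq> c" "b \<noteq> c"
  shows "relations gop (cls (single (White a))) (cls (single (White b))) (cls (single (White c))) \<subseteq> {0 :: vertex forest set \<Rightarrow>\<^sub>0 'k::field}"
proof -
  let ?s = "\<lambda>l. single (White l)"
  have xx: "gop GenX (cls (?s a)) (cls (?s b)) = (cls (attach (White a) (?s a) (?s b)) :: vertex forest set \<Rightarrow>\<^sub>0 'k)"
    and cc: "gop GenC (cls (?s a)) (cls (?s b)) = (cls (munion (?s a) (?s b)) :: vertex forest set \<Rightarrow>\<^sub>0 'k)"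
    and gg: "gop GenG (cls (?s a)) (cls (?s b)) = (cls (join (Black 0) (?s a) (?s b)) :: vertex forest set \<Rightarrow>\<^sub>0 'k)"
    and v: "valid (attach (White a) (?s a) (?s b))" "valid (munion (?s a) (?s b))" "valid (join (Black 0) (?s a) (?s b))"
    if "a \<noteq> b" for a b
  proof -
    show v: "valid (attach (White a) (?s a) (?s b))" by (rule valid_attach[OF valid_single valid_single]) (use that in auto)
    show "valid (munion (?s a) (?s b))" by (rule valid_munion[OF valid_single valid_single]) (use that in auto)
    show "valid (join (Black 0) (?s a) (?s b))" by (rule valid_join[OF valid_single valid_single]) (use that in auto)
    show "gop GenX (cls (?s a)) (cls (?s b)) = (cls (attach (White a) (?s a) (?s b)) :: vertex forest set \<Rightarrow>\<^sub>0 'k)"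
      by (subst gop_cls(1)[OF valid_single valid_single]) (use that in auto)
    show "gop GenC (cls (?s a)) (cls (?s b)) = (cls (munion (?s a) (?s b)) :: vertex forest set \<Rightarrow>\<^sub>0 'k)"
      by (subst gop_cls(2)[OF valid_single valid_single]) (use that in auto)
    show "gop GenG (cls (?s a)) (cls (?s b)) = (cls (join (Black 0) (?s a) (?s b)) :: vertex forest set \<Rightarrow>\<^sub>0 'k)"
      by (subst gop_cls(3)[OF valid_single valid_single, of _ _ 0]) (use that in auto)
  qed
  have xxx: "gop GenX (cls (attach (White a) (?s a) (?s b))) (cls (?s c)) =
      (cls (attach (White a) (attach (White a) (?s a) (?s b)) (?s c)) + cls (attach (White b) (attach (White a) (?s a) (?s b)) (?s c)) :: vertex forest set \<Rightarrow>\<^sub>0 'k)"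
    and xcx: "gop GenX (cls (munion (?s a) (?s b))) (cls (?s c)) =
      (cls (attach (White a) (munion (?s a) (?s b)) (?s c)) + cls (attach (White b) (munion (?s a) (?s b)) (?s c)) :: vertex forest set \<Rightarrow>\<^sub>0 'k)"
    and xgx: "gop GenX (cls (join (Black 0) (?s a) (?s b))) (cls (?s c)) =
      (cls (attach (Black 0) (join (Black 0) (?s a) (?s b)) (?s c)) + cls (attach (White a) (join (Black 0) (?s a) (?s b)) (?s c))
       + cls (attach (White b) (join (Black 0) (?s a) (?s b)) (?s c)) :: vertex forest set \<Rightarrow>\<^sub>0 'k)"
    and xxr: "gop GenX (cls (?s a)) (cls (attach (White b) (?s b) (?s c))) =
      (cls (attach (White b) (attach (White a) (?s a) (?s b)) (?s c)) :: vertex forest set \<Rightarrow>\<^sub>0 'k)"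
    and cxl: "gop GenC (cls (attach (White a) (?s a) (?s c))) (cls (?s b)) = (cls (attach (White a) (munion (?s a) (?s b)) (?s c)) :: vertex forest set \<Rightarrow>\<^sub>0 'k)"
    and cxr: "gop GenC (cls (?s a)) (cls (attach (White b) (?s b) (?s c))) = (cls (attach (White b) (munion (?s a) (?s b)) (?s c)) :: vertex forest set \<Rightarrow>\<^sub>0 'k)"
    and gxl: "gop GenG (cls (attach (White a) (?s a) (?s c))) (cls (?s b)) = (cls (attach (White a) (join (Black 0) (?s a) (?s b)) (?s c)) :: vertex forest set \<Rightarrow>\<^sub>0 'k)"
    and gxr: "gop GenG (cls (?s a)) (cls (attach (White b) (?s b) (?s c))) = (cls (attach (White b) (join (Black 0) (?s a) (?s b)) (?s c)) :: vertex forest set \<Rightarrow>\<^sub>0 'k)"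
    and ccl: "gop GenC (cls (munion (?s a) (?s b))) (cls (?s c)) = (cls (munion (?s a) (munion (?s b) (?s c))) :: vertex forest set \<Rightarrow>\<^sub>0 'k)"
    and ccr: "gop GenC (cls (?s a)) (cls (munion (?s b) (?s c))) = (cls (munion (?s a) (munion (?s b) (?s c))) :: vertex forest set \<Rightarrow>\<^sub>0 'k)"
    if d: "a \<noteq> b" "a \<noteq> c" "b \<noteq> c" for a b c
    subgoal by (subst gop_cls(1)[OF v(1)[OF d(1)] valid_single]) (use d in \<open>auto simp: add.commute\<close>)
    subgoal by (subst gop_cls(1)[OF v(2)[OF d(1)] valid_single]) (use d in \<open>auto simp: add.commute\<close>)
    subgoal by (subst gop_cls(1)[OF v(3)[OF d(1)] valid_single]) (use d in \<open>auto simp: ac_simps\<close>)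
    subgoal by (subst gop_cls(1)[OF valid_single v(1)[OF d(3)]]) (use d in \<open>auto simp: attach_attach\<close>)
    subgoal by (subst gop_cls(2)[OF v(1)[OF d(2)] valid_single]) (use d in \<open>auto simp: attach_munion_left\<close>)
    subgoal by (subst gop_cls(2)[OF valid_single v(1)[OF d(3)]]) (use d in \<open>auto simp: attach_munion_right\<close>)
    subgoal by (subst gop_cls(3)[OF v(1)[OF d(2)] valid_single, of _ 0]) (use d in \<open>auto simp: attach_join_left\<close>)
    subgoal by (subst gop_cls(3)[OF valid_single v(1)[OF d(3)], of _ 0]) (use d in \<open>auto simp: attach_join_right\<close>)
    subgoal by (subst gop_cls(2)[OF v(2)[OF d(1)] valid_single]) (use d in \<open>auto simp: munion_assoc\<close>)
    subgoal by (subst gop_cls(2)[OF valid_single v(2)[OF d(3)]]) (use d in auto)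
    done
  note d = assms assms[symmetric]
  show ?thesis unfolding relations_def
    by (simp del: gop.simps add: xx cc gg xxx xcx xgx xxr cxl cxr gxl gxr ccl ccr d
        attach_commute[of "White a" "White a" "single (White a)" "single (White c)" "single (White b)"]
        attach_root_join[of "Black 0" "single (White a)" "single (White c)" "single (White b)"])
qed

lemma phi_relators: "p \<in> comgreg_relators \<Longrightarrow> phi p = (0 :: vertex forest set \<Rightarrow>\<^sub>0 'k::field)"
proof -
  have c: "tb (Leaf l) \<in> (t_carrier {l} :: (greg_gen tree set \<Rightarrow>\<^sub>0 'k) set)" for l
    unfolding free_space_closed tree_basis_iff by (intro exI[of _ "Leaf l"]) simp
  have "phi ` relations bin (tb (Leaf 1)) (tb (Leaf 2)) (tb (Leaf 3)) =
      (relations gop (phi (tb (Leaf 1))) (phi (tb (Leaf 2))) (phi (tb (Leaf 3))) :: (vertex forest set \<Rightarrow>\<^sub>0 'k) set)"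
    by (rule relations_image[OF pm_linear_phi phi_bin c[of 1] c[of 2] c[of 3]]) auto
  also have "\<dots> \<subseteq> {0}"
    using relations_fg[of 1 2 3, where 'k = 'k] by (simp add: phi_tb)
  finally have "phi ` comgreg_relators \<subseteq> {0 :: vertex forest set \<Rightarrow>\<^sub>0 'k}"
    unfolding comgreg_relators_eq .
  then show "p \<in> comgreg_relators \<Longrightarrow> phi p = (0 :: vertex forest set \<Rightarrow>\<^sub>0 'k)" by auto
qed

lemma comgreg_relators_closed: "comgreg_relators \<subseteq> t_carrier {1..3}"
proof -
  have *: "tree_class greg_swap t \<in> tree_basis greg_swap {1..3}" if "distinct (leaves t)" "set (leaves t) = {1,2,3}" for t
  proof -
    have "{1..3} = {1,2,3::nat}" by auto
    then show ?thesis unfolding tree_basis_iff using that by auto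
  qed
  show ?thesis
    unfolding comgreg_relators_eq relations_def by (auto intro!: free_space_closed(3) *[simplified])
qed

section \<open>The ideal generated by the relators\<close>

definition rel_ideal :: "nat set \<Rightarrow> (greg_gen tree set \<Rightarrow>\<^sub>0 'k::field) set" where
  "rel_ideal = ideal_generated FT (\<lambda>L. if L = {1..3} then comgreg_relators else {})"

lemma operad_ideal_rel_ideal: "operad_ideal FT (rel_ideal :: nat set \<Rightarrow> (greg_gen tree set \<Rightarrow>\<^sub>0 'k::field) set)"
proof -
  interpret symmetric_operad "FT :: ('k, _) operad" by (rule symmetric_operad_free_operad)
  show ?thesis unfolding rel_ideal_def by (rule operad_ideal_generated) (use comgreg_relators_closed in auto)
qed

text \<open>The kernels of a morphism form an operadic ideal; since it contains the relators, it
  contains what they generate.\<close>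

lemma rel_ideal_kernel:
  assumes "finite L" "p \<in> rel_ideal L"
  shows "phi p = (0 :: vertex forest set \<Rightarrow>\<^sub>0 'k::field)"
proof -
  interpret T: symmetric_operad "FT :: ('k, _) operad" by (rule symmetric_operad_free_operad)
  let ?K = "\<lambda>L. {p \<in> t_carrier L. phi p = (0 :: vertex forest set \<Rightarrow>\<^sub>0 'k)}"
  note z = pm_linear_zero[OF pm_linear_fg(7)] pm_linear_zero[OF pm_linear_fg(8)] pm_linear_zero[OF pm_linear_fg(9)]
  have "operad_ideal FT ?K"
    unfolding operad_ideal_def
  proof (intro conjI allI impI ballI)
    show "submodule (?K L) scalars (op_space FT L)" if "finite L" for L
      unfolding T.submodule_iff[OF that]
      by (auto simp: pm_linear_zero[OF pm_linear_phi] pm_linear_add[OF pm_linear_phi] pm_linear_scale[OF pm_linear_phi])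
    show "op_relabel FT L \<sigma> p \<in> ?K (\<sigma> ` L)" if p: "p \<in> ?K L" and L: "finite L \<and> inj_on \<sigma> L" for L \<sigma> p
      using linear_maps_mem[OF T.relabel_linear, of L \<sigma> p] phi_relabel[of p L \<sigma>] p L by (simp add: z)
    show "op_comp FT A i B p q \<in> ?K (A \<union> B)"
      if p: "p \<in> ?K (insert i A)" and q: "q \<in> op_carrier FT B" and H: "finite A \<and> finite B \<and> i \<notin> A \<and> A \<inter> B = {}" for A i B p q
      using linear_maps_mem[OF T.comp_linear_right, of A B i p q] phi_comp[of p i A q B] p q H by (simp add: z)
    show "op_comp FT A i B p q \<in> ?K (A \<union> B)"
      if p: "p \<in> op_carrier FT (insert i A)" and q: "q \<in> ?K B" and H: "finite A \<and> finite B \<and> i \<notin> A \<and> A \<inter> B = {}" for A i B p q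
      using linear_maps_mem[OF T.comp_linear_right, of A B i p q] phi_comp[of p i A q B] p q H by (simp add: z)
  qed
  moreover have "(if L = {1..3} then comgreg_relators else {}) \<subseteq> ?K L" for L
    using comgreg_relators_closed phi_relators by auto
  ultimately have "rel_ideal L \<subseteq> ?K L" unfolding rel_ideal_def by (rule ideal_generated_least)
  from subsetD[OF this assms(2)] show ?thesis by simp
qed

section \<open>Calculating modulo the ideal\<close>

definition eqv :: "nat set \<Rightarrow> (greg_gen tree set \<Rightarrow>\<^sub>0 'k) \<Rightarrow> (greg_gen tree set \<Rightarrow>\<^sub>0 'k::field) \<Rightarrow> bool" where
  "eqv L p q \<longleftrightarrow> p - q \<in> rel_ideal L"

lemma rel_ideal_subspace:
  assumes L: "finite L"
  shows "(rel_ideal L :: (greg_gen tree set \<Rightarrow>\<^sub>0 'k::field) set) \<subseteq> t_carrier L"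
    and "(0 :: greg_gen tree set \<Rightarrow>\<^sub>0 'k) \<in> rel_ideal L"
    and "p \<in> rel_ideal L \<Longrightarrow> q \<in> rel_ideal L \<Longrightarrow> p + q \<in> (rel_ideal L :: (greg_gen tree set \<Rightarrow>\<^sub>0 'k) set)"
    and "p \<in> rel_ideal L \<Longrightarrow> pm_scale k p \<in> (rel_ideal L :: (greg_gen tree set \<Rightarrow>\<^sub>0 'k) set)"
    and "p \<in> rel_ideal L \<Longrightarrow> q \<in> rel_ideal L \<Longrightarrow> p - q \<in> (rel_ideal L :: (greg_gen tree set \<Rightarrow>\<^sub>0 'k) set)"
proof -
  interpret T: symmetric_operad "FT :: ('k, _) operad" by (rule symmetric_operad_free_operad)
  have "submodule (rel_ideal L) scalars (op_space (FT :: ('k, _) operad) L)"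
    using operad_ideal_rel_ideal[where 'k = 'k] L by (simp add: operad_ideal_def)
  note s = this[unfolded T.submodule_iff[OF L], unfolded FT_space free_space_simps]
  show "(rel_ideal L :: (greg_gen tree set \<Rightarrow>\<^sub>0 'k) set) \<subseteq> t_carrier L" "(0 :: greg_gen tree set \<Rightarrow>\<^sub>0 'k) \<in> rel_ideal L"
    using s by simp_all
  have a: "p + q \<in> (rel_ideal L :: (greg_gen tree set \<Rightarrow>\<^sub>0 'k) set)" if "p \<in> rel_ideal L" "q \<in> rel_ideal L" for p q
    using s that by simp
  have m: "pm_scale k p \<in> (rel_ideal L :: (greg_gen tree set \<Rightarrow>\<^sub>0 'k) set)" if "p \<in> rel_ideal L" for p k
    using s that by simp
  show "p \<in> rel_ideal L \<Longrightarrow> q \<in> rel_ideal L \<Longrightarrow> p + q \<in> (rel_ideal L :: (greg_gen tree set \<Rightarrow>\<^sub>0 'k) set)" by (rule a)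
  show "p \<in> rel_ideal L \<Longrightarrow> pm_scale k p \<in> (rel_ideal L :: (greg_gen tree set \<Rightarrow>\<^sub>0 'k) set)" by (rule m)
  show "p \<in> rel_ideal L \<Longrightarrow> q \<in> rel_ideal L \<Longrightarrow> p - q \<in> (rel_ideal L :: (greg_gen tree set \<Rightarrow>\<^sub>0 'k) set)"
    using a[OF _ m[of q "- 1"]] by (simp add: pm_scale_uminus)
qed

lemma rel_ideal_comp:
  assumes "finite A" "finite B" "i \<notin> A" "A \<inter> B = {}"
  shows "p \<in> rel_ideal (insert i A) \<Longrightarrow> q \<in> t_carrier B \<Longrightarrow> op_comp FT A i B p q \<in> (rel_ideal (A \<union> B) :: (greg_gen tree set \<Rightarrow>\<^sub>0 'k::field) set)"
    and "p \<in> t_carrier (insert i A) \<Longrightarrow> q \<in> rel_ideal B \<Longrightarrow> op_comp FT A i B p q \<in> (rel_ideal (A \<union> B) :: (greg_gen tree set \<Rightarrow>\<^sub>0 'k::field) set)"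
  using operad_ideal_rel_ideal[where 'k = 'k] assms by (simp_all add: operad_ideal_def)

lemma FT_comp_closed:
  assumes "finite A" "finite B" "i \<notin> A" "A \<inter> B = {}"
  shows "p \<in> t_carrier (insert i A) \<Longrightarrow> q \<in> t_carrier B \<Longrightarrow> op_comp FT A i B p q \<in> (t_carrier (A \<union> B) :: (greg_gen tree set \<Rightarrow>\<^sub>0 'k::field) set)"
  using linear_maps_mem[OF symmetric_operad.comp_linear_right[OF symmetric_operad_free_operad[of greg_swap] assms]] by simp

lemma fresh_labels:
  assumes "finite (L :: nat set)"
  obtains i j k where "i \<notin> L" "j \<notin> L" "k \<notin> L" "i \<noteq> j" "i \<noteq> k" "j \<noteq> k"
proof -
  obtain N where N: "\<And>l. l \<in> L \<Longrightarrow> l < N" using finite_nat_set_iff_bounded[of L] assms by blast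
  have "N \<notin> L" "N + 1 \<notin> L" "N + 2 \<notin> L" using N[of N] N[of "N + 1"] N[of "N + 2"] by auto
  then show ?thesis using that[of N "N + 1" "N + 2"] by simp
qed

text \<open>A product under \<open>a\<close> is a tree with two fresh leaves into which both factors
  are composed. In this way the closure of an ideal under partial composition is inherited by
  \<open>bin\<close>.\<close>

lemma bin_comp:
  assumes p: "p \<in> t_carrier A" and q: "q \<in> t_carrier B" and ij: "j \<notin> A" "i \<noteq> j"
  shows "op_comp FT A j B (op_comp FT {j} i A (tb (Node a (Leaf i) (Leaf j))) p) q = (bin a p q :: greg_gen tree set \<Rightarrow>\<^sub>0 'k::field)"
proof (rule pm_linear_eqI2[OF _ _ _ _ p q])
  fix s t assume "s \<in> tree_basis greg_swap A" "t \<in> tree_basis greg_swap B"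
  then show "op_comp FT A j B (op_comp FT {j} i A (tb (Node a (Leaf i) (Leaf j))) (basis_vec s)) (basis_vec t) =
      (bin a (basis_vec s) (basis_vec t) :: greg_gen tree set \<Rightarrow>\<^sub>0 'k)"
    using ij by (auto simp: tree_basis_iff graft_notin)
qed (intro pm_linear_bin pm_linear_FT pm_linear_compose[OF pm_linear_FT(2) pm_linear_FT(3)])+

lemma tb_closed: "distinct (leaves t) \<Longrightarrow> set (leaves t) = L \<Longrightarrow> tb t \<in> t_carrier L"
  by (auto simp: tree_basis_iff)

lemma rel_ideal_bin:
  assumes fin: "finite A" "finite B" and d: "A \<inter> B = {}"
  shows "p \<in> rel_ideal A \<Longrightarrow> q \<in> t_carrier B \<Longrightarrow> bin a p q \<in> (rel_ideal (A \<union> B) :: (greg_gen tree set \<Rightarrow>\<^sub>0 'k::field) set)"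
    and "p \<in> t_carrier A \<Longrightarrow> q \<in> rel_ideal B \<Longrightarrow> bin a p q \<in> (rel_ideal (A \<union> B) :: (greg_gen tree set \<Rightarrow>\<^sub>0 'k::field) set)"
proof -
  have "finite (A \<union> B)" using fin by simp
  then obtain i j where ij: "i \<notin> A \<union> B" "j \<notin> A \<union> B" "i \<noteq> j" by (rule fresh_labels)
  let ?g = "tb (Node a (Leaf i) (Leaf j)) :: greg_gen tree set \<Rightarrow>\<^sub>0 'k"
  have g: "?g \<in> t_carrier (insert i {j})" by (rule tb_closed) (use ij in auto)
  have 1: "finite {j}" "i \<notin> {j}" "{j} \<inter> A = {}" and jA: "j \<notin> A" using ij by auto
  have u: "{j} \<union> A = insert j A" by simp
  {
    assume p: "p \<in> rel_ideal A" and q: "q \<in> t_carrier B"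
    have "op_comp FT {j} i A ?g p \<in> rel_ideal (insert j A)"
      using rel_ideal_comp(2)[OF 1(1) fin(1) 1(2,3) g p] unfolding u .
    from rel_ideal_comp(1)[OF fin jA d this q] show "bin a p q \<in> rel_ideal (A \<union> B)"
      unfolding bin_comp[OF subsetD[OF rel_ideal_subspace(1)[OF fin(1)] p] q jA ij(3)] .
  }
  {
    assume p: "p \<in> t_carrier A" and q: "q \<in> rel_ideal B"
    have "op_comp FT {j} i A ?g p \<in> t_carrier (insert j A)"
      using FT_comp_closed[OF 1(1) fin(1) 1(2,3) g p] unfolding u .
    from rel_ideal_comp(2)[OF fin jA d this q] show "bin a p q \<in> rel_ideal (A \<union> B)"
      unfolding bin_comp[OF p subsetD[OF rel_ideal_subspace(1)[OF fin(2)] q] jA ij(3)] .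
  }
qed

text \<open>The inputs 1, 2, 3 of a relator are renamed to fresh labels, since they might occur in
  \<open>A\<close>, \<open>B\<close> or \<open>C\<close>; then \<open>p\<close>, \<open>q\<close>,
  \<open>r\<close> are substituted in turn. Each step stays in the ideal, and by trilinearity the
  result is identified on trees.\<close>

lemma relations_rel_ideal:
  assumes p: "p \<in> t_carrier A" and q: "q \<in> t_carrier B" and r: "r \<in> t_carrier C"
    and fin: "finite A" "finite B" "finite C" and d: "A \<inter> B = {}" "A \<inter> C = {}" "B \<inter> C = {}"
  shows "relations bin p q r \<subseteq> (rel_ideal (A \<union> B \<union> C) :: (greg_gen tree set \<Rightarrow>\<^sub>0 'k::field) set)"
proof -
  have "finite (A \<union> B \<union> C)" using fin by simp
  then obtain i j k where f: "i \<notin> A \<union> B \<union> C" "j \<notin> A \<union> B \<union> C" "k \<notin> A \<union> B \<union> C" and ne: "i \<noteq> j" "i \<noteq> k" "j \<noteq> k"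
    by (rule fresh_labels)
  define \<sigma> where "\<sigma> l = (if l = 1 then i else if l = 2 then j else k)" for l :: nat
  define \<Theta> where "\<Theta> p q r u = op_comp FT (A \<union> B) k C (op_comp FT (insert k A) j B (op_comp FT {j, k} i A (op_relabel FT {1..3} \<sigma> u) p) q) r"
    for p q r u :: "greg_gen tree set \<Rightarrow>\<^sub>0 'k"
  have three: "{1..3} = {1, 2, 3 :: nat}" by auto
  have \<sigma>: "inj_on \<sigma> {1..3}" "\<sigma> ` {1..3} = insert i {j, k}" using ne unfolding three \<sigma>_def inj_on_def by auto
  have lin: "pm_linear (\<Theta> p q r)" for p q r
    unfolding \<Theta>_def by (intro pm_linear_compose[OF pm_linear_FT(2)] pm_linear_FT)
  have lp: "pm_linear (\<lambda>p. \<Theta> p q r u)" and lq: "pm_linear (\<lambda>q. \<Theta> p q r u)" and lr: "pm_linear (\<lambda>r. \<Theta> p q r u)" for p q r u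
    unfolding \<Theta>_def by (intro pm_linear_compose[OF pm_linear_FT(2)] pm_linear_FT)+
  \<comment> \<open>With \<open>M\<close> left open, one argument covers both bracketings and both
    orders of \<open>q\<close> and \<open>r\<close>; only values on trees remain to be
    compared.\<close>
  have tri: "\<Theta> p q r (tb t) = M p q r"
    if lM: "\<And>q r. pm_linear (\<lambda>p. M p q r)" "\<And>p r. pm_linear (\<lambda>q. M p q r)" "\<And>p q. pm_linear (M p q)"
      and M: "\<And>a b c. set (leaves a) = A \<Longrightarrow> set (leaves b) = B \<Longrightarrow> set (leaves c) = C \<Longrightarrow>
        M (tb a) (tb b) (tb c) = tb (graft (graft (graft (map_leaves \<sigma> t) i a) j b) k c)" for M t
  proof (rule pm_linear_eqI3[OF lp lM(1) lq lM(2) lr lM(3) p q r])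
    fix a b c assume "a \<in> tree_basis greg_swap A" "b \<in> tree_basis greg_swap B" "c \<in> tree_basis greg_swap C"
    then show "\<Theta> (basis_vec a) (basis_vec b) (basis_vec c) (tb t) = M (basis_vec a) (basis_vec b) (basis_vec c)"
      by (auto simp: tree_basis_iff \<Theta>_def M)
  qed
  note pc = pm_linear_compose[OF pm_linear_bin(1)] pm_linear_compose[OF pm_linear_bin(2)]
  have M: "\<Theta> p q r (tb (Node a (Node b (Leaf 1) (Leaf 2)) (Leaf 3))) = bin a (bin b p q) r"
    "\<Theta> p q r (tb (Node a (Leaf 1) (Node b (Leaf 2) (Leaf 3)))) = bin a p (bin b q r)"
    "\<Theta> p q r (tb (Node a (Node b (Leaf 1) (Leaf 3)) (Leaf 2))) = bin a (bin b p r) q"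
    "\<Theta> p q r (tb (Node a (Leaf 1) (Node b (Leaf 3) (Leaf 2)))) = bin a p (bin b r q)" for a b
    by (rule tri; (intro pm_linear_bin pc[OF pm_linear_bin(1)] pc[OF pm_linear_bin(2)])?;
        use f ne in \<open>auto simp: \<sigma>_def graft_notin\<close>)+
  have img: "\<Theta> p q r ` comgreg_relators = relations bin p q r"
    unfolding comgreg_relators_eq relations_def by (simp add: pm_linear_diff[OF lin] M[simplified])
  have "\<Theta> p q r u \<in> rel_ideal (A \<union> B \<union> C)" if u: "u \<in> comgreg_relators" for u
  proof -
    have "u \<in> rel_ideal {1..3}" unfolding rel_ideal_def using ideal_generated_incl[of "\<lambda>L. if L = {1..3} then comgreg_relators else {}" "{1..3}" FT] u by auto
    then have "op_relabel FT {1..3} \<sigma> u \<in> rel_ideal (insert i {j, k})"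
      using operad_ideal_rel_ideal[where 'k = 'k] \<sigma> unfolding operad_ideal_def by (metis finite_atLeastAtMost)
    then have "op_comp FT {j, k} i A (op_relabel FT {1..3} \<sigma> u) p \<in> rel_ideal ({j, k} \<union> A)"
      by (rule rel_ideal_comp(1)[rotated 4]) (use f ne fin p in auto)
    moreover have "{j, k} \<union> A = insert j (insert k A)" by auto
    ultimately have "op_comp FT {j, k} i A (op_relabel FT {1..3} \<sigma> u) p \<in> rel_ideal (insert j (insert k A))" by simp
    then have "op_comp FT (insert k A) j B (op_comp FT {j, k} i A (op_relabel FT {1..3} \<sigma> u) p) q \<in> rel_ideal (insert k A \<union> B)"
      by (rule rel_ideal_comp(1)[rotated 4]) (use f ne fin q d in auto)
    then have "op_comp FT (insert k A) j B (op_comp FT {j, k} i A (op_relabel FT {1..3} \<sigma> u) p) q \<in> rel_ideal (insert k (A \<union> B))"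
      by simp
    then show ?thesis unfolding \<Theta>_def
      by (rule rel_ideal_comp(1)[rotated 4]) (use f ne fin r d in auto)
  qed
  then show ?thesis unfolding img[symmetric] by auto
qed

lemma eqv_refl: "finite L \<Longrightarrow> eqv L p p"
  and eqv_sym: "finite L \<Longrightarrow> eqv L p q \<Longrightarrow> eqv L q p"
  and eqv_trans: "finite L \<Longrightarrow> eqv L p q \<Longrightarrow> eqv L q r \<Longrightarrow> eqv L p r"
  and eqv_add: "finite L \<Longrightarrow> eqv L p q \<Longrightarrow> eqv L p' q' \<Longrightarrow> eqv L (p + p') (q + q')"
  and eqv_diff: "finite L \<Longrightarrow> eqv L p q \<Longrightarrow> eqv L p' q' \<Longrightarrow> eqv L (p - p') (q - q')"
  and eqv_scale: "finite L \<Longrightarrow> eqv L p q \<Longrightarrow> eqv L (pm_scale k p) (pm_scale k q)"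
proof -
  note s = rel_ideal_subspace(2-5)
  show "finite L \<Longrightarrow> eqv L p p" using s(1) by (simp add: eqv_def)
  show "finite L \<Longrightarrow> eqv L p q \<Longrightarrow> eqv L q p" unfolding eqv_def using s(4)[OF _ s(1), of L "p - q"] by simp
  show "finite L \<Longrightarrow> eqv L p q \<Longrightarrow> eqv L q r \<Longrightarrow> eqv L p r" unfolding eqv_def using s(2)[of L "p - q" "q - r"] by simp
  show "finite L \<Longrightarrow> eqv L p q \<Longrightarrow> eqv L p' q' \<Longrightarrow> eqv L (p + p') (q + q')"
    unfolding eqv_def using s(2)[of L "p - q" "p' - q'"] by (simp add: algebra_simps)
  show "finite L \<Longrightarrow> eqv L p q \<Longrightarrow> eqv L p' q' \<Longrightarrow> eqv L (p - p') (q - q')"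
    unfolding eqv_def using s(4)[of L "p - q" "p' - q'"] by (simp add: algebra_simps)
  show "finite L \<Longrightarrow> eqv L p q \<Longrightarrow> eqv L (pm_scale k p) (pm_scale k q)"
    unfolding eqv_def using s(3)[of L "p - q" k] by (simp add: pm_linear_diff[OF pm_linear_pm_scale])
qed

lemma eqv_sum: "finite L \<Longrightarrow> (\<And>x. x \<in> X \<Longrightarrow> eqv L (f x) (g x)) \<Longrightarrow> eqv L (sum f X) (sum g X)"
  by (induction X rule: infinite_finite_induct) (simp_all add: eqv_refl eqv_add)

lemma eqv_bin:
  assumes fin: "finite A" "finite B" and d: "A \<inter> B = {}"
    and p: "eqv A p p'" and q: "eqv B q q'" and c: "p' \<in> t_carrier A" "q \<in> t_carrier B"
  shows "eqv (A \<union> B) (bin a p q) (bin a p' q')"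
proof (rule eqv_trans)
  show "finite (A \<union> B)" using fin by simp
  show "eqv (A \<union> B) (bin a p q) (bin a p' q)"
    using rel_ideal_bin(1)[OF fin d p[unfolded eqv_def] c(2), of a] unfolding eqv_def pm_linear_diff[OF pm_linear_bin(1)] .
  show "eqv (A \<union> B) (bin a p' q) (bin a p' q')"
    using rel_ideal_bin(2)[OF fin d c(1) q[unfolded eqv_def], of a] unfolding eqv_def pm_linear_diff[OF pm_linear_bin(2)] .
qed

lemma eqv_relations:
  assumes "p \<in> t_carrier A" "q \<in> t_carrier B" "r \<in> t_carrier C"
    "finite A" "finite B" "finite C" "A \<inter> B = {}" "A \<inter> C = {}" "B \<inter> C = {}"
  shows "eqv (A \<union> B \<union> C) (bin GenX (bin GenX p q) r - bin GenX p (bin GenX q r))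
      (bin GenX (bin GenX p r) q - bin GenX p (bin GenX r q))"
    and "eqv (A \<union> B \<union> C) (bin GenX (bin GenC p q) r) (bin GenC (bin GenX p r) q + bin GenC p (bin GenX q r))"
    and "eqv (A \<union> B \<union> C) (bin GenC (bin GenC p q) r) (bin GenC p (bin GenC q r))"
    and "eqv (A \<union> B \<union> C) (bin GenX (bin GenG p q) r - bin GenG (bin GenX p r) q - bin GenG p (bin GenX q r))
      (bin GenX (bin GenG p r) q - bin GenG (bin GenX p q) r - bin GenG p (bin GenX r q))"
  using relations_rel_ideal[OF assms] unfolding relations_def eqv_def by (simp_all add: diff_diff_eq)

lemma bin_commute:
  assumes p: "p \<in> t_carrier A" and q: "q \<in> t_carrier B"
  shows "bin GenC p q = bin GenC q (p :: greg_gen tree set \<Rightarrow>\<^sub>0 'k::field)" "bin GenG p q = bin GenG q p"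
proof -
  have "tree_class greg_swap (Node a s t) = tree_class greg_swap (Node a t s)" if "greg_swap a = a" for a s t
    by (rule tree_class_eq) (use tree_eq.swap[of greg_swap a s t] that in simp)
  from this[of GenC] this[of GenG]
  have "tree_class greg_swap (Node GenC s t) = tree_class greg_swap (Node GenC t s)"
    "tree_class greg_swap (Node GenG s t) = tree_class greg_swap (Node GenG t s)" for s t by simp_all
  then show "bin GenC p q = bin GenC q p" "bin GenG p q = bin GenG q p"
    by (intro pm_linear_eqI2[OF pm_linear_bin(1) pm_linear_bin(2) pm_linear_bin(2) pm_linear_bin(1) p q],
        auto simp: tree_basis_iff)+
qed

section \<open>Decomposing forests\<close>

text \<open>The subforest generated by \<open>R\<close> is cut off at the set \<open>X\<close> of edges: \<open>X = {}\<close> if \<open>R\<close> consists of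
  roots, and \<open>X = {e}\<close> if \<open>R\<close> is the set of children of \<open>e\<close>.\<close>

lemma cut_rooted:
  fixes F :: "'v forest"
  assumes R: "rooted F p d" and R0: "R \<noteq> {}" "R \<subseteq> verts F" and k: "\<And>r. r \<in> R \<Longrightarrow> d r = k"
    and c2: "\<And>e w. e \<in> edges F \<Longrightarrow> w \<in> e \<Longrightarrow> w \<noteq> p e \<Longrightarrow> w \<in> R \<Longrightarrow> e \<in> X"
    and X: "\<And>e. e \<in> X \<Longrightarrow> e \<in> edges F \<and> d (p e) < k \<and> e - {p e} \<subseteq> R"
    and ne: "roots F - R \<noteq> {}"
  shows "\<exists>S T. hypertree_forest S \<and> hypertree_forest T \<and> verts S \<inter> verts T = {} \<and> verts F = verts S \<union> verts T \<and>
    edges F = X \<union> (edges S \<union> edges T) \<and> roots S = roots F - R \<and> roots T = R \<and> (\<forall>e\<in>X. p e \<in> verts S)"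
proof -
  define ch where "ch = {(p e, w) | e w. e \<in> edges F \<and> w \<in> e \<and> w \<noteq> p e}"
  define U where "U = ch\<^sup>* `` R"
  have chD: "d w = Suc (d u) \<and> w \<in> verts F" if "(u, w) \<in> ch" for u w
    using that rootedD(5,8)[OF R] unfolding ch_def by blast
  have RU: "R \<subseteq> U" unfolding U_def by auto
  have UV: "u \<in> verts F \<and> k \<le> d u" if u: "u \<in> U" for u
  proof -
    obtain r where r: "r \<in> R" "(r, u) \<in> ch\<^sup>*" using u unfolding U_def by auto
    from r(2) show ?thesis
    proof (induction rule: rtrancl_induct)
      case base then show ?case using r R0 k by auto
    next
      case (step y z) then show ?case using chD[of y z] by auto
    qed
  qed
  have down: "w \<in> U" if "e \<in> edges F" "p e \<in> U" "w \<in> e" for e w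
  proof (cases "w = p e")
    case False
    then have "(p e, w) \<in> ch" using that unfolding ch_def by auto
    then show ?thesis using that(2) unfolding U_def by (meson Image_iff rtrancl.rtrancl_into_rtrancl)
  qed (use that in simp)
  \<comment> \<open>A vertex of \<open>U\<close> outside \<open>R\<close> was reached through a
    parent in \<open>U\<close>. As it is a child in only one edge, that parent is
    \<open>p e\<close>.\<close>
  have up: "p e \<in> U" if e: "e \<in> edges F" "w \<in> e" "w \<noteq> p e" and w: "w \<in> U" "w \<notin> R" for e w
  proof -
    obtain r where r: "r \<in> R" "(r, w) \<in> ch\<^sup>*" using w unfolding U_def by auto
    then have "r \<noteq> w" using w by auto
    then obtain u where u: "(r, u) \<in> ch\<^sup>*" "(u, w) \<in> ch" using r(2) by (metis rtranclE)
    then obtain f where f: "f \<in> edges F" "u = p f" "w \<in> f" "w \<noteq> p f" unfolding ch_def by auto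
    have "e = f" using rootedD(10)[OF R e(1) f(1) e(2) f(3) e(3) f(4)] .
    then show ?thesis using u(1) f(2) r(1) unfolding U_def by auto
  qed
  have rU: "r \<in> R" if H: "r \<in> roots F" "r \<in> U" for r
  proof (rule ccontr)
    assume "r \<notin> R"
    then obtain q where q: "q \<in> R" "(q, r) \<in> ch\<^sup>*" "q \<noteq> r" using H(2) unfolding U_def by auto
    then obtain u where "(u, r) \<in> ch" by (metis rtranclE)
    then show False using chD rootedD(4)[OF R H(1)] by auto
  qed
  have XU: "p e \<notin> U" if "e \<in> X" for e using UV[of "p e"] X[OF that] by auto
  \<comment> \<open>Edges are distributed according to their parents. An edge with parent in
    \<open>U\<close> lies wholly in \<open>U\<close>, and the edges that lead into \<open>U\<close>
    from outside are in \<open>X\<close>, so no edge of \<open>S\<close> meets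
    \<open>U\<close>.\<close>
  define T where "T = \<lparr>verts = U, edges = {e \<in> edges F. p e \<in> U}, roots = R\<rparr>"
  define S where "S = \<lparr>verts = verts F - U, edges = {e \<in> edges F. p e \<notin> U} - X, roots = roots F - R\<rparr>"
  have Tr: "rooted T p (\<lambda>u. d u - k)"
  proof (rule rootedI)
    have "U \<subseteq> verts F" using UV by auto
    then show "finite (verts T)" using rootedD(1)[OF R] unfolding T_def by (simp add: finite_subset)
    show "roots T \<noteq> {}" "roots T \<subseteq> verts T" using R0 RU unfolding T_def by auto
    show "d r - k = 0" if "r \<in> roots T" for r using that k unfolding T_def by simp
    show "e \<subseteq> verts T \<and> p e \<in> e \<and> e \<noteq> {p e}" if "e \<in> edges T" for e
      using that down rootedD(6,7)[OF R, of e] unfolding T_def by auto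
    show "d w - k = Suc (d (p e) - k)" if "e \<in> edges T" "w \<in> e" "w \<noteq> p e" for e w
    proof -
      have e: "e \<in> edges F" "p e \<in> U" using that(1) unfolding T_def by auto
      show ?thesis using rootedD(8)[OF R e(1) that(2,3)] UV[OF e(2)] by (simp add: Suc_diff_le)
    qed
    show "\<exists>e\<in>edges T. v \<in> e \<and> v \<noteq> p e" if v: "v \<in> verts T" "v \<notin> roots T" for v
    proof -
      have v: "v \<in> U" "v \<notin> R" using v unfolding T_def by auto
      then have "v \<notin> roots F" using rU by auto
      then obtain e where e: "e \<in> edges F" "v \<in> e" "v \<noteq> p e" using rootedD(9)[OF R] UV[OF v(1)] by blast
      then show ?thesis using up[OF e v] unfolding T_def by auto
    qed
    show "e = e'" if "e \<in> edges T" "e' \<in> edges T" "w \<in> e" "w \<in> e'" "w \<noteq> p e" "w \<noteq> p e'" for e e' w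
      using that rootedD(10)[OF R] unfolding T_def by auto
  qed
  have Sr: "rooted S p d"
  proof (rule rootedI)
    show "finite (verts S)" using rootedD(1)[OF R] unfolding S_def by simp
    show "roots S \<noteq> {}" using ne unfolding S_def by simp
    show "roots S \<subseteq> verts S" using rootedD(3)[OF R] rU unfolding S_def by auto
    show "d r = 0" if "r \<in> roots S" for r using that rootedD(4)[OF R] unfolding S_def by simp
    show "e \<subseteq> verts S \<and> p e \<in> e \<and> e \<noteq> {p e}" if "e \<in> edges S" for e
    proof -
      have e: "e \<in> edges F" "p e \<notin> U" "e \<notin> X" using that unfolding S_def by auto
      have "w \<notin> U" if w: "w \<in> e" for w
      proof
        assume wU: "w \<in> U"
        then have wp: "w \<noteq> p e" using e(2) by auto
        then have "w \<notin> R" using c2[OF e(1) w] e(3) by auto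
        then show False using up[OF e(1) w wp wU] e(2) by simp
      qed
      then show ?thesis using rootedD(5,6,7)[OF R e(1)] unfolding S_def by auto
    qed
    show "d w = Suc (d (p e))" if "e \<in> edges S" "w \<in> e" "w \<noteq> p e" for e w
      using that rootedD(8)[OF R] unfolding S_def by simp
    show "\<exists>e\<in>edges S. v \<in> e \<and> v \<noteq> p e" if v: "v \<in> verts S" "v \<notin> roots S" for v
    proof -
      have v: "v \<in> verts F" "v \<notin> U" "v \<notin> roots F" using v RU unfolding S_def by auto
      then obtain e where e: "e \<in> edges F" "v \<in> e" "v \<noteq> p e" using rootedD(9)[OF R] by blast
      moreover have "p e \<notin> U" using down[OF e(1) _ e(2)] v(2) by auto
      moreover have "e \<notin> X" using X[of e] e v(2) RU by auto
      ultimately show ?thesis unfolding S_def by auto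
    qed
    show "e = e'" if "e \<in> edges S" "e' \<in> edges S" "w \<in> e" "w \<in> e'" "w \<noteq> p e" "w \<noteq> p e'" for e e' w
      using that rootedD(10)[OF R] unfolding S_def by simp
  qed
  show ?thesis
  proof (rule exI[of _ S], rule exI[of _ T], intro conjI ballI)
    show "hypertree_forest S" by (rule rooted_hypertree_forest[OF Sr])
    show "hypertree_forest T" by (rule rooted_hypertree_forest[OF Tr])
    show "edges F = X \<union> (edges S \<union> edges T)" using X XU unfolding S_def T_def by auto
    show "verts F = verts S \<union> verts T" using UV unfolding S_def T_def by auto
    show "verts S \<inter> verts T = {}" unfolding S_def T_def by auto
    show "roots S = roots F - R" unfolding S_def by simp
    show "roots T = R" unfolding T_def by simp
    show "p e \<in> verts S" if "e \<in> X" for e using XU[OF that] X[OF that] rootedD(5,6)[OF R, of e] unfolding S_def by auto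
  qed
qed

section \<open>Cutting off a component or an edge\<close>

lemma root_not_child: "hypertree_forest F \<Longrightarrow> r \<in> roots F \<Longrightarrow> e \<in> edges F \<Longrightarrow> r \<in> e \<Longrightarrow> parent F e = r"
  using rootedD(4,8)[OF rooted_parent_depth] by (metis nat.distinct(1))

text \<open>Nothing is deleted when components are separated, so each black vertex keeps all its
  incoming edges and both parts remain \<open>valid\<close>.\<close>

lemma cut_munion:
  assumes F: "valid F" and r: "r \<in> roots F" "roots F \<noteq> {r}"
  obtains S T where "F = munion S T" "verts S \<inter> verts T = {}" "roots S = {r}" "valid S" "valid T"
proof -
  note h = validD(1)[OF F] and Ro = rooted_parent_depth[OF validD(1)[OF F]]
  let ?R = "roots F - {r}"
  have "\<exists>S T. hypertree_forest S \<and> hypertree_forest T \<and> verts S \<inter> verts T = {} \<and> verts F = verts S \<union> verts T \<and>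
    edges F = {} \<union> (edges S \<union> edges T) \<and> roots S = roots F - ?R \<and> roots T = ?R \<and> (\<forall>e\<in>{}. parent F e \<in> verts S)"
  proof (rule cut_rooted[OF Ro, where k = 0])
    show "?R \<noteq> {}" "?R \<subseteq> verts F" "roots F - ?R \<noteq> {}" using r rootedD(3)[OF Ro] by auto
    show "depth F q = 0" if "q \<in> ?R" for q using that rootedD(4)[OF Ro] by simp
    show "e \<in> {}" if "e \<in> edges F" "w \<in> e" "w \<noteq> parent F e" "w \<in> ?R" for e w
      using root_not_child[OF h, of w e] that by auto
  qed simp
  then obtain S T where ST: "hypertree_forest S" "hypertree_forest T" "verts S \<inter> verts T = {}" "verts F = verts S \<union> verts T"
    "edges F = edges S \<union> edges T" "roots S = roots F - ?R" "roots T = ?R" by auto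
  have rS: "roots S = {r}" using ST(6) r by auto
  have FST: "F = munion S T" by (rule forest_eqI) (use ST r rS in auto)
  note inc = incoming_munion(1)[OF ST(1-3), folded FST]
  have "valid S" unfolding valid_def
  proof (intro conjI allI impI ST(1))
    fix b assume b: "Black b \<in> verts S"
    then have "Black b \<notin> verts T" "Black b \<in> verts F" using ST by auto
    then show "2 \<le> card (incoming S (Black b))" using validD(3)[OF F, of b] inc[of "Black b"] incoming_notin[OF ST(2)] by simp
  qed
  moreover have "valid T" unfolding valid_def
  proof (intro conjI allI impI ST(2))
    fix b assume b: "Black b \<in> verts T"
    then have "Black b \<notin> verts S" "Black b \<in> verts F" using ST by auto
    then show "2 \<le> card (incoming T (Black b))" using validD(3)[OF F, of b] inc[of "Black b"] incoming_notin[OF ST(1)] by simp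
  qed
  ultimately show ?thesis using that FST ST(3) rS by blast
qed

text \<open>Colours are ignored: \<open>S\<close> may be left with a black vertex \<open>v\<close>
  that has a single incoming edge. \<open>cut_attach\<close> excludes this case, and
  \<open>cut_join\<close> resolves it by removing the second edge as well.\<close>

lemma cut_attach_forest:
  assumes h: "hypertree_forest F" and e: "e \<in> incoming F v"
  obtains S T where "F = attach v S T" "verts S \<inter> verts T = {}" "v \<in> verts S" "insert v (roots T) = e"
    "hypertree_forest S" "hypertree_forest T" "roots S = roots F"
proof -
  note Ro = rooted_parent_depth[OF h]
  have e: "e \<in> edges F" "parent F e = v" using e incoming_eq[OF h] by auto
  let ?R = "e - {v}"
  have rR: "w \<notin> ?R" if "w \<in> roots F" for w using root_not_child[OF h that e(1)] e(2) by auto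
  have "\<exists>S T. hypertree_forest S \<and> hypertree_forest T \<and> verts S \<inter> verts T = {} \<and> verts F = verts S \<union> verts T \<and>
    edges F = {e} \<union> (edges S \<union> edges T) \<and> roots S = roots F - ?R \<and> roots T = ?R \<and> (\<forall>e'\<in>{e}. parent F e' \<in> verts S)"
  proof (rule cut_rooted[OF Ro, where k = "Suc (depth F v)"])
    show "?R \<noteq> {}" using rootedD(6,7)[OF Ro e(1)] e(2) by auto
    show "?R \<subseteq> verts F" using rootedD(5)[OF Ro e(1)] by auto
    show "roots F - ?R \<noteq> {}" using rR rootedD(2)[OF Ro] by auto
    show "depth F q = Suc (depth F v)" if "q \<in> ?R" for q using that rootedD(8)[OF Ro e(1)] e(2) by auto
    show "e' \<in> {e}" if "e' \<in> edges F" "w \<in> e'" "w \<noteq> parent F e'" "w \<in> ?R" for e' w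
      using rootedD(10)[OF Ro that(1) e(1) that(2) _ that(3)] that(4) e(2) by auto
    show "e' \<in> edges F \<and> depth F (parent F e') < Suc (depth F v) \<and> e' - {parent F e'} \<subseteq> ?R" if "e' \<in> {e}" for e'
      using that e by auto
  qed
  then obtain S T where ST: "hypertree_forest S" "hypertree_forest T" "verts S \<inter> verts T = {}" "verts F = verts S \<union> verts T"
    "edges F = insert e (edges S \<union> edges T)" "roots S = roots F - ?R" "roots T = ?R" "v \<in> verts S" using e(2) by auto
  have rS: "roots S = roots F" using ST(6) rR by auto
  have ve: "insert v (roots T) = e" using ST(7) parent_in[OF h e(1)] e(2) by auto
  have FST: "F = attach v S T" by (rule forest_eqI) (use ST rS ve in auto)
  show ?thesis using that[OF FST ST(3,8) ve ST(1,2) rS] .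
qed

lemma valid_cut:
  assumes F: "valid (attach v S T)" and S: "hypertree_forest S" and T: "hypertree_forest T"
    and disj: "verts S \<inter> verts T = {}" and v: "v \<in> verts S"
  shows "valid T" and "\<And>b. Black b \<in> verts S \<Longrightarrow> Black b \<noteq> v \<Longrightarrow> 2 \<le> card (incoming S (Black b))"
    and "card (incoming (attach v S T) v) = Suc (card (incoming S v))"
proof -
  note inc = incoming_attach[OF S T disj v]
  show "valid T" unfolding valid_def
  proof (intro conjI allI impI T)
    fix b assume b: "Black b \<in> verts T"
    then have "Black b \<notin> verts S" "Black b \<noteq> v" using disj v by auto
    then show "2 \<le> card (incoming T (Black b))" using validD(3)[OF F, of b] b inc[of "Black b"] incoming_notin[OF S] by simp
  qed
  show "2 \<le> card (incoming S (Black b))" if b: "Black b \<in> verts S" "Black b \<noteq> v" for b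
  proof -
    have "Black b \<notin> verts T" using disj b by auto
    then show ?thesis using validD(3)[OF F, of b] b inc[of "Black b"] incoming_notin[OF T] by simp
  qed
  have "v \<notin> verts T" using disj v by auto
  then have "incoming (attach v S T) v = insert (insert v (roots T)) (incoming S v)" using inc[of v] incoming_notin[OF T] by simp
  moreover have "insert v (roots T) \<notin> incoming S v" using hypertree_forest_attach(5)[OF S T disj v] by (auto simp: incoming_def)
  ultimately show "card (incoming (attach v S T) v) = Suc (card (incoming S v))" using finite_incoming[OF S] by simp
qed

text \<open>Three edges at a black \<open>v\<close> guarantee that two are left after the
  cut.\<close>

lemma cut_attach:
  assumes F: "valid F" and e: "e \<in> incoming F v" and v: "v \<in> range Black \<Longrightarrow> 3 \<le> card (incoming F v)"
  obtains S T where "F = attach v S T" "verts S \<inter> verts T = {}" "v \<in> verts S" "insert v (roots T) = e"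
    "valid S" "valid T" "roots S = roots F"
proof -
  obtain S T where ST: "F = attach v S T" "verts S \<inter> verts T = {}" "v \<in> verts S" "insert v (roots T) = e"
    "hypertree_forest S" "hypertree_forest T" "roots S = roots F"
    by (rule cut_attach_forest[OF validD(1)[OF F] e])
  note c = valid_cut[OF F[unfolded ST(1)] ST(5,6,2,3), folded ST(1)]
  have "2 \<le> card (incoming S (Black b))" if "Black b \<in> verts S" for b
    using c(2)[OF that] c(3) v by (cases "Black b = v") auto
  then have "valid S" using ST(5) by (simp add: valid_def)
  then show ?thesis using that[OF ST(1-4) _ c(1) ST(7)] by blast
qed

lemma tree_without_edges:
  assumes h: "hypertree_forest F" and r: "roots F = {r}" and inc: "incoming F r = {}"
  shows "F = single r"
proof -
  note Ro = rooted_parent_depth[OF h]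
  have v: "v = r" if "v \<in> verts F" for v
    using that
  proof (induction "depth F v" arbitrary: v rule: less_induct)
    case less
    show ?case
    proof (rule ccontr)
      assume "v \<noteq> r"
      then obtain e where e: "e \<in> edges F" "v \<in> e" "v \<noteq> parent F e" using rootedD(9)[OF Ro less.prems] r by auto
      have "parent F e \<in> verts F" using rootedD(5,6)[OF Ro e(1)] by auto
      then have "parent F e = r" using less.hyps[of "parent F e"] rootedD(8)[OF Ro e] by simp
      then show False using e(1) inc incoming_eq[OF h] by auto
    qed
  qed
  have "verts F \<subseteq> {r}" by (rule subsetI) (simp only: v insert_iff simp_thms)
  then have V: "verts F = {r}" using roots_verts[OF h] r by auto
  have "edges F = {}"
  proof (rule ccontr)
    assume "edges F \<noteq> {}"
    then obtain e where e: "e \<in> edges F" by auto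
    then have "parent F e = r" using V parent_in[OF h e] edge_verts[OF h e] by auto
    then show False using e inc incoming_eq[OF h] by auto
  qed
  then show ?thesis using V r by (intro forest_eqI) simp_all
qed

text \<open>Cutting both edges leaves the black root isolated, so the forest is the
  \<open>join\<close> of the two parts below it. The given edge \<open>e\<close> is the one leading
  to \<open>T\<close>, which fixes the order of the parts.\<close>

lemma cut_join:
  assumes F: "valid F" and r: "roots F = {Black b}" and two: "card (incoming F (Black b)) = 2" and e: "e \<in> incoming F (Black b)"
  obtains S T where "F = join (Black b) S T" "verts S \<inter> verts T = {}" "Black b \<notin> verts S" "Black b \<notin> verts T"
    "insert (Black b) (roots T) = e" "valid S" "valid T"
proof -
  let ?b = "Black b"
  obtain S' T where ST: "F = attach ?b S' T" "verts S' \<inter> verts T = {}" "?b \<in> verts S'" "insert ?b (roots T) = e"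
    "hypertree_forest S'" "hypertree_forest T" "roots S' = roots F"
    by (rule cut_attach_forest[OF validD(1)[OF F] e])
  note c = valid_cut[OF F[unfolded ST(1)] ST(5,6,2,3), folded ST(1)]
  have "card (incoming S' ?b) = 1" using c(3) two by simp
  then obtain e' where e': "incoming S' ?b = {e'}" by (auto simp: card_1_singleton_iff)
  then have "e' \<in> incoming S' ?b" by simp
  then obtain S'' S where "S' = attach ?b S'' S" "verts S'' \<inter> verts S = {}" "?b \<in> verts S''" "insert ?b (roots S) = e'"
    "hypertree_forest S''" "hypertree_forest S" "roots S'' = roots S'"
    by (rule cut_attach_forest[OF ST(5)])
  note S = this(1-3,5-7)
  have bS: "?b \<notin> verts S" using S by auto
  have inc: "incoming S' u = incoming S'' u \<union> incoming S u \<union> (if u = ?b then {insert ?b (roots S)} else {})" for u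
    unfolding S(1) by (rule incoming_attach[OF S(4,5,2,3)])
  have "insert ?b (roots S) \<notin> incoming S'' ?b" using hypertree_forest_attach(5)[OF S(4,5,2,3)] by (auto simp: incoming_def)
  then have "incoming S'' ?b = {}" using inc[of ?b] e' by auto
  then have "S'' = single ?b" using tree_without_edges[OF S(4)] S(6) ST(7) r by simp
  then have FST: "F = join ?b S T" using ST(1) S(1) by (simp add: join_attach)
  have "valid S" unfolding valid_def
  proof (intro conjI allI impI S(5))
    fix c assume c': "Black c \<in> verts S"
    then have "Black c \<noteq> ?b" "Black c \<notin> verts S''" "Black c \<in> verts S'" using bS S(1,2) by auto
    then show "2 \<le> card (incoming S (Black c))" using c(2)[of c] inc[of "Black c"] incoming_notin[OF S(4)] by simp
  qed
  moreover have "verts S \<inter> verts T = {}" "?b \<notin> verts T" using ST(2,3) S(1) by auto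
  ultimately show ?thesis using that[OF FST _ bS _ ST(4) _ c(1)] by blast
qed

section \<open>The pieces are determined by the cut\<close>

lemma subforest_verts:
  assumes T: "hypertree_forest T" and R: "roots T \<subseteq> W" and W: "\<And>e. e \<in> edges T \<Longrightarrow> e \<inter> W \<noteq> {} \<Longrightarrow> e \<subseteq> W"
  shows "verts T \<subseteq> W"
proof
  note Ro = rooted_parent_depth[OF T]
  fix v assume "v \<in> verts T"
  then show "v \<in> W"
  proof (induction "depth T v" arbitrary: v rule: less_induct)
    case less
    show ?case
    proof (cases "v \<in> roots T")
      case False
      then obtain e where e: "e \<in> edges T" "v \<in> e" "v \<noteq> parent T e" using rootedD(9)[OF Ro less.prems] by auto
      have "parent T e \<in> verts T" using rootedD(5,6)[OF Ro e(1)] by auto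
      then have "parent T e \<in> W" using less.hyps[of "parent T e"] rootedD(8)[OF Ro e] by simp
      then show ?thesis using W[OF e(1)] parent_in[OF T e(1)] e(2) by auto
    qed (use R in auto)
  qed
qed

text \<open>Each piece consists of what can be reached from its roots, and neither piece can be left
  along an edge of the other; so equal roots force equal pieces.\<close>

lemma subforest_eq:
  assumes T: "hypertree_forest T" and T': "hypertree_forest T'" and R: "roots T = roots T'"
    and E: "edges T = {e \<in> E. e \<subseteq> verts T}" and E': "edges T' = {e \<in> E. e \<subseteq> verts T'}"
    and c: "\<And>e. e \<in> edges T \<Longrightarrow> e \<inter> verts T' \<noteq> {} \<Longrightarrow> e \<subseteq> verts T'"
    and c': "\<And>e. e \<in> edges T' \<Longrightarrow> e \<inter> verts T \<noteq> {} \<Longrightarrow> e \<subseteq> verts T"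
  shows "T = T'"
proof -
  have "verts T = verts T'"
    using subforest_verts[OF T _ c] subforest_verts[OF T' _ c'] R roots_verts[OF T] roots_verts[OF T'] by auto
  then show ?thesis using E E' R by (intro forest_eqI) auto
qed

lemma edges_of_part:
  assumes "hypertree_forest S" "hypertree_forest T" "verts S \<inter> verts T = {}"
    and N: "\<And>e. e \<in> X \<Longrightarrow> \<not> e \<subseteq> verts T"
  shows "edges T = {e \<in> X \<union> (edges S \<union> edges T). e \<subseteq> verts T}"
proof -
  have "\<not> e \<subseteq> verts T" if "e \<in> edges S" for e
    using edge_verts[OF assms(1) that] parent_in[OF assms(1) that] assms(3) by auto
  then show ?thesis using edge_verts[OF assms(2)] N by auto
qed

text \<open>The part cut off is determined by its roots, and the rest is its complement. Two normal
  forms that cut the same edge therefore start from the same decomposition.\<close>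

lemma attach_inject:
  assumes S: "hypertree_forest S" "hypertree_forest T" "verts S \<inter> verts T = {}" "v \<in> verts S"
    and S': "hypertree_forest S'" "hypertree_forest T'" "verts S' \<inter> verts T' = {}" "v \<in> verts S'"
    and eq: "attach v S T = attach v S' T'" and R: "roots T = roots T'"
  shows "S = S' \<and> T = T'"
proof -
  let ?N = "insert v (roots T)"
  define E where "E = edges (attach v S T)"
  have E: "E = {?N} \<union> (edges S \<union> edges T)" "E = {?N} \<union> (edges S' \<union> edges T')"
    unfolding E_def using arg_cong[OF eq, of edges] R by simp_all
  have V: "verts S \<union> verts T = verts S' \<union> verts T'" using arg_cong[OF eq, of verts] by simp
  have RS: "roots S = roots S'" using arg_cong[OF eq, of roots] by simp
  have vT: "v \<notin> verts T" "v \<notin> verts T'" using S S' by auto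
  have ET: "edges T = {e \<in> E. e \<subseteq> verts T}" unfolding E(1) by (rule edges_of_part[OF S(1-3)]) (use vT in auto)
  have ET': "edges T' = {e \<in> E. e \<subseteq> verts T'}" unfolding E(2) by (rule edges_of_part[OF S'(1-3)]) (use vT in auto)
  have "e \<subseteq> verts T'" if "e \<in> edges T" "e \<inter> verts T' \<noteq> {}" for e
  proof -
    have "e \<noteq> ?N" using edge_verts[OF S(2) that(1)] vT by auto
    then have "e \<in> edges S' \<union> edges T'" using that(1) E by auto
    then show ?thesis using edge_verts[OF S'(1), of e] edge_verts[OF S'(2), of e] that(2) S'(3) by auto
  qed
  moreover have "e \<subseteq> verts T" if "e \<in> edges T'" "e \<inter> verts T \<noteq> {}" for e
  proof -
    have "e \<noteq> ?N" using edge_verts[OF S'(2) that(1)] vT by auto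
    then have "e \<in> edges S \<union> edges T" using that(1) E by auto
    then show ?thesis using edge_verts[OF S(1), of e] edge_verts[OF S(2), of e] that(2) S(3) by auto
  qed
  ultimately have T: "T = T'" by (rule subforest_eq[OF S(2) S'(2) R ET ET'])
  have vS: "verts S = verts S'" using V S(3) S'(3) unfolding T by auto
  have N: "\<not> ?N \<subseteq> verts S" "\<not> ?N \<subseteq> verts S'"
    using roots_nonempty[OF S(2)] roots_verts[OF S(2)] S(3) S'(3) T by auto
  have E': "E = {?N} \<union> (edges T \<union> edges S)" "E = {?N} \<union> (edges T' \<union> edges S')" using E by auto
  have "edges S = {e \<in> E. e \<subseteq> verts S}"
    unfolding E'(1) by (rule edges_of_part[OF S(2,1)]) (use S(3) N in auto)
  moreover have "edges S' = {e \<in> E. e \<subseteq> verts S'}"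
    unfolding E'(2) by (rule edges_of_part[OF S'(2,1)]) (use S'(3) N in auto)
  ultimately have "edges S = edges S'" using vS by simp
  then show ?thesis using T vS RS by (auto intro: forest_eqI)
qed

lemma munion_inject:
  assumes S: "hypertree_forest S" "hypertree_forest T" "verts S \<inter> verts T = {}"
    and S': "hypertree_forest S'" "hypertree_forest T'" "verts S' \<inter> verts T' = {}"
    and eq: "munion S T = munion S' T'" and R: "roots S = roots S'"
  shows "S = S' \<and> T = T'"
proof -
  define E where "E = edges (munion S T)"
  have E: "E = {} \<union> (edges T \<union> edges S)" "E = {} \<union> (edges T' \<union> edges S')"
    unfolding E_def using arg_cong[OF eq, of edges] by auto
  have V: "verts S \<union> verts T = verts S' \<union> verts T'" using arg_cong[OF eq, of verts] by simp
  have RS: "roots S \<union> roots T = roots S' \<union> roots T'" using arg_cong[OF eq, of roots] by simp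
  have d: "verts T \<inter> verts S = {}" "verts T' \<inter> verts S' = {}" using S S' by auto
  have ES: "edges S = {e \<in> E. e \<subseteq> verts S}" unfolding E(1) by (rule edges_of_part[OF S(2,1) d(1)]) auto
  have ES': "edges S' = {e \<in> E. e \<subseteq> verts S'}" unfolding E(2) by (rule edges_of_part[OF S'(2,1) d(2)]) auto
  have "e \<subseteq> verts S'" if "e \<in> edges S" "e \<inter> verts S' \<noteq> {}" for e
  proof -
    have "e \<in> edges S' \<union> edges T'" using that(1) E by auto
    then show ?thesis using edge_verts[OF S'(1), of e] edge_verts[OF S'(2), of e] that(2) S'(3) by auto
  qed
  moreover have "e \<subseteq> verts S" if "e \<in> edges S'" "e \<inter> verts S \<noteq> {}" for e
  proof -
    have "e \<in> edges S \<union> edges T" using that(1) E by auto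
    then show ?thesis using edge_verts[OF S(1), of e] edge_verts[OF S(2), of e] that(2) S(3) by auto
  qed
  ultimately have SS: "S = S'" by (rule subforest_eq[OF S(1) S'(1) R ES ES'])
  have vT: "verts T = verts T'" using V S(3) S'(3) unfolding SS by auto
  have E': "E = {} \<union> (edges S \<union> edges T)" "E = {} \<union> (edges S' \<union> edges T')" using E by auto
  have "edges T = {e \<in> E. e \<subseteq> verts T}" unfolding E'(1) by (rule edges_of_part[OF S]) auto
  moreover have "edges T' = {e \<in> E. e \<subseteq> verts T'}" unfolding E'(2) by (rule edges_of_part[OF S']) auto
  ultimately have eT: "edges T = edges T'" using vT by simp
  have "roots T = roots T'"
    using RS SS roots_verts[OF S(1)] roots_verts[OF S(2)] roots_verts[OF S'(2)] S(3) S'(3) by blast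
  then show ?thesis using SS vT eT by (auto intro: forest_eqI)
qed

text \<open>The two new edges are recovered as the edges containing \<open>b\<close>, which
  determines the unordered pair of root sets.\<close>

lemma join_inject:
  assumes S: "hypertree_forest S" "hypertree_forest T" "verts S \<inter> verts T = {}" "b \<notin> verts S" "b \<notin> verts T"
    and S': "hypertree_forest S'" "hypertree_forest T'" "verts S' \<inter> verts T' = {}" "b \<notin> verts S'" "b \<notin> verts T'"
    and eq: "join b S T = join b S' T'"
  shows "S = S' \<and> T = T' \<or> S = T' \<and> T = S'"
proof -
  have hb: "hypertree_forest (single b)" by (rule hypertree_forest_single)
  have a: "hypertree_forest (attach b (single b) S)" "verts (attach b (single b) S) \<inter> verts T = {}" "b \<in> verts (attach b (single b) S)"
    if "hypertree_forest S" "verts S \<inter> verts T = {}" "b \<notin> verts S" "b \<notin> verts T" for S T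
    using hypertree_forest_attach(1)[OF hb that(1), of b] that by auto
  have i: "{insert b (roots S), insert b (roots T)} = {e \<in> edges (join b S T). b \<in> e}"
    if "hypertree_forest S" "hypertree_forest T" "b \<notin> verts S" "b \<notin> verts T" for S T
    using edge_verts[OF that(1)] edge_verts[OF that(2)] that(3,4) by auto
  have e: "{insert b (roots S), insert b (roots T)} = {insert b (roots S'), insert b (roots T')}"
    unfolding i[OF S(1,2,4,5)] i[OF S'(1,2,4,5)] eq ..
  have nb: "b \<notin> roots S" "b \<notin> roots T" "b \<notin> roots S'" "b \<notin> roots T'"
    using S S' roots_verts by blast+
  have core: "S = S' \<and> T = T'"
    if S': "hypertree_forest S'" "hypertree_forest T'" "verts S' \<inter> verts T' = {}" "b \<notin> verts S'" "b \<notin> verts T'"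
      and eq: "join b S T = join b S' T'" and R: "roots S = roots S'" "roots T = roots T'" for S' T'
  proof -
    have "attach b (single b) S = attach b (single b) S' \<and> T = T'"
      by (rule attach_inject[OF a(1)[OF S(1,3,4,5)] S(2) a(2,3)[OF S(1,3,4,5)] a(1)[OF S'(1,3,4,5)] S'(2) a(2,3)[OF S'(1,3,4,5)] eq[unfolded join_attach] R(2)])
    moreover have "single b = single b \<and> S = S'"
      if "attach b (single b) S = attach b (single b) S'"
      by (rule attach_inject[OF hb S(1) _ _ hb S'(1) _ _ that R(1)]) (use S S' in auto)
    ultimately show ?thesis by blast
  qed
  from e consider "roots S = roots S'" "roots T = roots T'" | "roots S = roots T'" "roots T = roots S'"
    using nb unfolding doubleton_eq_iff by (metis insert_ident)
  then show ?thesis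
  proof cases
    case 1
    then show ?thesis using core[OF S' eq] by simp
  next
    case 2
    have "verts T' \<inter> verts S' = {}" using S'(3) by auto
    then show ?thesis using core[OF S'(2,1) _ S'(5,4) _ 2] eq join_commute[of b S' T'] by simp
  qed
qed

text \<open>The number of edges at the roots. Attaching \<open>T\<close> elsewhere than at the root
  keeps the number of vertices and lowers this one, so the correction terms in
  \<open>rep_attach\<close> come from smaller forests.\<close>

definition rdeg :: "vertex forest \<Rightarrow> nat" where
  "rdeg F = (\<Sum>r\<in>roots F. card (incoming F r))"

definition smaller :: "(vertex forest \<times> vertex forest) set" where
  "smaller = measures [\<lambda>F. card (verts F), rdeg]"

lemma smaller_iff: "(F, G) \<in> smaller \<longleftrightarrow>
    card (verts F) < card (verts G) \<or> card (verts F) = card (verts G) \<and> rdeg F < rdeg G"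
  by (simp add: smaller_def)

lemma forest_induct:
  "(\<And>F. (\<And>G. (G, F) \<in> smaller \<Longrightarrow> Q G) \<Longrightarrow> Q F) \<Longrightarrow> Q F"
  using wf_induct_rule[of smaller Q F] by (simp add: smaller_def)

lemma rdeg_attach:
  assumes "hypertree_forest S" "hypertree_forest T" "verts S \<inter> verts T = {}" "v \<in> verts S" "roots S = {r}"
  shows "rdeg (attach v S T) = (if v = r then Suc (rdeg S) else rdeg S)"
proof -
  have r: "r \<notin> verts T" using roots_verts[OF assms(1)] assms(3,5) by auto
  have "incoming (attach v S T) r = (if v = r then insert (insert v (roots T)) (incoming S r) else incoming S r)"
    unfolding incoming_attach[OF assms(1-4)] incoming_notin[OF assms(2) r] by simp
  moreover have "insert v (roots T) \<notin> incoming S r" using hypertree_forest_attach(5)[OF assms(1-4)] by (auto simp: incoming_def)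
  ultimately show ?thesis using assms(5) finite_incoming[OF assms(1)] by (cases "v = r") (simp_all add: rdeg_def)
qed

lemma card_verts_ops:
  assumes "valid S" "valid T" "verts S \<inter> verts T = {}"
  shows "card (verts (attach v S T)) = card (verts S) + card (verts T)"
    "card (verts (munion S T)) = card (verts S) + card (verts T)"
    "b \<notin> verts S \<Longrightarrow> b \<notin> verts T \<Longrightarrow> card (verts (join b S T)) = Suc (card (verts S) + card (verts T))"
    "0 < card (verts S)"
proof -
  have fin: "finite (verts S)" "finite (verts T)" using validD(1)[OF assms(1)] validD(1)[OF assms(2)] finite_verts by auto
  show "card (verts (attach v S T)) = card (verts S) + card (verts T)"
    "card (verts (munion S T)) = card (verts S) + card (verts T)"
    using card_Un_disjoint[OF fin assms(3)] by simp_all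
  show "b \<notin> verts S \<Longrightarrow> b \<notin> verts T \<Longrightarrow> card (verts (join b S T)) = Suc (card (verts S) + card (verts T))"
    using card_Un_disjoint[OF fin assms(3)] fin by simp
  show "0 < card (verts S)"
    using roots_nonempty[OF validD(1)[OF assms(1)]] roots_verts[OF validD(1)[OF assms(1)]] fin(1) by (auto simp: card_gt_0_iff)
qed

section \<open>A normal form modulo the ideal\<close>

lemma card_incoming_join:
  assumes "hypertree_forest S" "hypertree_forest T" "verts S \<inter> verts T = {}" "b \<notin> verts S" "b \<notin> verts T"
  shows "card (incoming (join b S T) b) = 2"
proof -
  have "b \<notin> roots S" "b \<notin> roots T" using assms roots_verts by blast+
  then have "insert b (roots S) \<noteq> insert b (roots T)" using roots_neq[OF assms(1-3)] insert_ident by metis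
  then show ?thesis
    unfolding hypertree_forest_join(2)[OF assms] incoming_notin[OF assms(1,4)] incoming_notin[OF assms(2,5)] by simp
qed

lemma card_incoming_attach:
  assumes "hypertree_forest S" "hypertree_forest T" "verts S \<inter> verts T = {}" "v \<in> verts S"
  shows "card (incoming (attach v S T) v) = Suc (card (incoming S v))"
proof -
  have v: "v \<notin> verts T" using assms(3,4) by auto
  have "insert v (roots T) \<notin> incoming S v" using hypertree_forest_attach(5)[OF assms] by (auto simp: incoming_def)
  then show ?thesis
    unfolding incoming_attach[OF assms] incoming_notin[OF assms(2) v] using finite_incoming[OF assms(1)] by simp
qed

text \<open>\<open>K\<close> fixes the scalar field: the type of a predicate such as
  \<open>uniq\<close> does not mention it, although its meaning depends on it.\<close>

locale normal_form =
  fixes K :: "'k::field itself"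
begin

text \<open>\<open>rep F p\<close>: the operation \<open>p\<close> is obtained from the forest \<open>F\<close> by repeatedly splitting off a
  component or an edge at the root, the product of \<open>S\<close> and \<open>T\<close> under \<open>GenX\<close> being corrected by the
  graftings of \<open>T\<close> at the vertices of \<open>S\<close> other than the root.\<close>

inductive rep :: "vertex forest \<Rightarrow> (greg_gen tree set \<Rightarrow>\<^sub>0 'k) \<Rightarrow> bool" where
  rep_single: "rep (single (White l)) (tb (Leaf l))"
| rep_munion: "\<lbrakk>rep S p; rep T q; verts S \<inter> verts T = {}; roots S = {r}\<rbrakk> \<Longrightarrow> rep (munion S T) (bin GenC p q)"
| rep_join: "\<lbrakk>rep S p; rep T q; verts S \<inter> verts T = {}; Black b \<notin> verts S; Black b \<notin> verts T\<rbrakk>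
    \<Longrightarrow> rep (join (Black b) S T) (bin GenG p q)"
| rep_attach: "\<lbrakk>rep S p; rep T q; verts S \<inter> verts T = {}; roots S = {r};
    \<And>v. v \<in> verts S - {r} \<Longrightarrow> rep (attach v S T) (f v)\<rbrakk>
    \<Longrightarrow> rep (attach r S T) (bin GenX p q - (\<Sum>v\<in>verts S - {r}. f v))"

lemma root_in: "hypertree_forest S \<Longrightarrow> roots S = {r} \<Longrightarrow> r \<in> verts S"
  using roots_verts by blast

lemma rep_closed: "rep F p \<Longrightarrow> valid F \<and> p \<in> t_carrier (labels F)"
proof (induction rule: rep.induct)
  case (rep_single l)
  show ?case using valid_single tb_closed[of "Leaf l" "{l}"] by simp
next
  case (rep_munion S p T q r)
  then show ?case using valid_munion[of S T] bin_closed[of p "labels S" q "labels T" GenC] labels_disjoint[of S T] by simp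
next
  case (rep_join S p T q b)
  then show ?case using valid_join[of S T "Black b"] bin_closed[of p "labels S" q "labels T" GenG] labels_disjoint[of S T] by simp
next
  case (rep_attach S p T q r f)
  have "(\<Sum>v\<in>verts S - {r}. f v) \<in> t_carrier (labels S \<union> labels T)"
    by (rule free_space_sum) (use rep_attach.IH(3) in simp)
  moreover have "bin GenX p q \<in> t_carrier (labels S \<union> labels T)"
    using rep_attach labels_disjoint by (intro bin_closed) auto
  moreover have "valid (attach r S T)"
    using rep_attach root_in[OF validD(1)] by (intro valid_attach) auto
  ultimately show ?case by simp
qed

lemma rep_valid: "rep F p \<Longrightarrow> valid F"
  using rep_closed by blast

text \<open>For \<open>rep_attach\<close>, the product evaluates to the graftings at all vertices of
  \<open>S\<close>, and the correction removes exactly those away from the root.\<close>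

lemma phi_rep: "rep F p \<Longrightarrow> phi p = cls F"
proof (induction rule: rep.induct)
  case (rep_single l)
  show ?case by (simp add: phi_tb)
next
  case (rep_munion S p T q r)
  note c = rep_closed[OF rep_munion(1)] rep_closed[OF rep_munion(2)]
  have "phi (bin GenC p q) = gop GenC (phi p) (phi q)"
    by (rule phi_bin) (use c labels_disjoint[OF rep_munion(3)] in blast)+
  also have "\<dots> = cls (munion S T)" unfolding rep_munion.IH by (rule gop_cls(2)) (use c rep_munion(3) in blast)+
  finally show ?case .
next
  case (rep_join S p T q b)
  note c = rep_closed[OF rep_join(1)] rep_closed[OF rep_join(2)]
  have "phi (bin GenG p q) = gop GenG (phi p) (phi q)"
    by (rule phi_bin) (use c labels_disjoint[OF rep_join(3)] in blast)+
  also have "\<dots> = cls (join (Black b) S T)" unfolding rep_join.IH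
    by (rule gop_cls(3)) (use c rep_join(3-5) in blast)+
  finally show ?case .
next
  case (rep_attach S p T q r f)
  note c = rep_closed[OF rep_attach(1)] rep_closed[OF rep_attach(2)]
  have fin: "finite (verts S)" and r: "r \<in> verts S"
    using finite_verts root_in[OF _ rep_attach(4)] validD(1) c by blast+
  have "phi (bin GenX p q) = gop GenX (phi p) (phi q)"
    by (rule phi_bin) (use c labels_disjoint[OF rep_attach(3)] in blast)+
  also have "\<dots> = (\<Sum>v\<in>verts S. cls (attach v S T))" unfolding rep_attach.IH(1,2)
    by (rule gop_cls(1)) (use c rep_attach(3) in blast)+
  also have "\<dots> = cls (attach r S T) + (\<Sum>v\<in>verts S - {r}. phi (f v))"
    using sum.remove[OF fin r] rep_attach.IH(3) by simp
  finally show ?case by (simp add: pm_linear_diff[OF pm_linear_phi] pm_linear_sum[OF pm_linear_phi])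
qed

text \<open>The names of black vertices leave no trace in the combination of trees; this lets normal
  forms descend to isomorphism classes.\<close>

lemma rep_map: "rep F p \<Longrightarrow> colour_inj h (verts F) \<Longrightarrow> rep (map_forest h F) p"
proof (induction rule: rep.induct)
  case (rep_single l)
  then have "h (White l) = White l" by (simp add: colour_inj_def)
  then show ?case by (simp add: map_forest_single rep.rep_single)
next
  case (rep_munion S p T q r)
  have h: "colour_inj h (verts S)" "colour_inj h (verts T)"
    using colour_inj_subset[OF rep_munion.prems] by auto
  have inj: "inj_on h (verts S \<union> verts T)" using rep_munion.prems by (simp add: colour_inj_def)
  show ?case unfolding map_forest_munion
    by (rule rep.rep_munion[OF rep_munion.IH(1)[OF h(1)] rep_munion.IH(2)[OF h(2)], of "h r"])
      (use inj_on_image_Int[OF inj, of "verts S" "verts T"] rep_munion(3,4) in auto)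
next
  case (rep_join S p T q b)
  have h: "colour_inj h (verts S)" "colour_inj h (verts T)"
    using colour_inj_subset[OF rep_join.prems] by auto
  have inj: "inj_on h (verts (join (Black b) S T))" using rep_join.prems by (simp add: colour_inj_def)
  obtain c where c: "h (Black b) = Black c" using rep_join.prems by (auto simp: colour_inj_def)
  have n: "h (Black b) \<notin> h ` A" if "Black b \<notin> A" "A \<subseteq> verts S \<union> verts T" for A
    using inj_on_image_mem_iff[OF inj, of "Black b" A] that by auto
  show ?case unfolding map_forest_join c
    by (rule rep.rep_join[OF rep_join.IH(1)[OF h(1)] rep_join.IH(2)[OF h(2)]])
      (use inj_on_image_Int[OF inj, of "verts S" "verts T"] rep_join(3-5) n[of "verts S"] n[of "verts T"] c in auto)
next
  case (rep_attach S p T q r f)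
  have S: "valid S" using rep_valid[OF rep_attach(1)] .
  have r: "r \<in> verts S" by (rule root_in[OF validD(1)[OF S] rep_attach(4)])
  have hV: "colour_inj h (verts S \<union> verts T)" using rep_attach.prems by simp
  have h: "colour_inj h (verts S)" "colour_inj h (verts T)"
    using colour_inj_subset[OF hV] by auto
  have inj: "inj_on h (verts S \<union> verts T)" and injS: "inj_on h (verts S)" using hV h by (auto simp: colour_inj_def)
  let ?g = "inv_into (verts S) h"
  have V: "verts (map_forest h S) - {h r} = h ` (verts S - {r})"
    using inj_on_image_set_diff[OF injS, of "verts S" "{r}"] r by simp
  have "rep (attach (h r) (map_forest h S) (map_forest h T)) (bin GenX p q - (\<Sum>v\<in>verts (map_forest h S) - {h r}. f (?g v)))"
  proof (rule rep.rep_attach[OF rep_attach.IH(1)[OF h(1)] rep_attach.IH(2)[OF h(2)]])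
    show "verts (map_forest h S) \<inter> verts (map_forest h T) = {}"
      using inj_on_image_Int[OF inj, of "verts S" "verts T"] rep_attach(3) by auto
    show "roots (map_forest h S) = {h r}" using rep_attach(4) by simp
    fix v assume "v \<in> verts (map_forest h S) - {h r}"
    then obtain u where u: "u \<in> verts S - {r}" "v = h u" unfolding V by auto
    have "rep (map_forest h (attach u S T)) (f u)" by (rule rep_attach.IH(3)[OF u(1)]) (use hV in simp)
    then show "rep (attach v (map_forest h S) (map_forest h T)) (f (?g v))"
      using u injS by (simp add: map_forest_attach)
  qed
  moreover have "(\<Sum>v\<in>verts (map_forest h S) - {h r}. f (?g v)) = (\<Sum>v\<in>verts S - {r}. f v)"
    unfolding V using injS by (subst sum.reindex) (auto intro!: sum.cong intro: inj_on_subset)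
  ultimately show ?case unfolding map_forest_attach by simp
qed

lemma rep_exists: "valid F \<Longrightarrow> \<exists>p. rep F p"
proof (induction rule: forest_induct)
  case (1 F)
  note h = validD(1)[OF 1(2)]
  have IH: "\<exists>p. rep G p" if "valid G" "card (verts G) < card (verts F) \<or> card (verts G) = card (verts F) \<and> rdeg G < rdeg F" for G
    using 1(1)[of G] that by (simp add: smaller_iff)
  obtain r where r: "r \<in> roots F" using roots_nonempty[OF h] by auto
  show ?case
  proof (cases "roots F = {r}")
    case False
    obtain S T where ST: "F = munion S T" "verts S \<inter> verts T = {}" "roots S = {r}" "valid S" "valid T"
      by (rule cut_munion[OF 1(2) r False])
    have "card (verts S) < card (verts F)" "card (verts T) < card (verts F)"
      unfolding ST(1) using card_verts_ops[OF ST(4,5,2)] card_verts_ops(4)[OF ST(5,4)] ST(2) by auto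
    then show ?thesis using IH[OF ST(4)] IH[OF ST(5)] rep_munion[OF _ _ ST(2,3)] ST(1) by blast
  next
    case root: True
    \<comment> \<open>A single tree has no edge at its root, or a black root with exactly two edges,
      or a root from which an edge can be removed without violating the condition on black
      vertices.\<close>
    consider "incoming F r = {}" | b e where "r = Black b" "card (incoming F r) = 2" "e \<in> incoming F r"
      | e where "e \<in> incoming F r" "r \<in> range Black \<Longrightarrow> 3 \<le> card (incoming F r)"
    proof (cases "incoming F r = {}")
      case False
      then obtain e where e: "e \<in> incoming F r" by auto
      show ?thesis
      proof (cases "r \<in> range Black")
        case True
        then obtain b where b: "r = Black b" by auto
        have "2 \<le> card (incoming F r)" using validD(3)[OF 1(2), of b] roots_verts[OF h] r b by auto
        then show ?thesis using that(2)[OF b _ e] that(3)[OF e] by linarith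
      qed (use that(3)[OF e] in blast)
    qed (use that(1) in blast)
    then show ?thesis
    proof cases
      case 1: 1
      have F: "F = single r" by (rule tree_without_edges[OF h root 1])
      show ?thesis
      proof (cases r)
        case (White l) then show ?thesis using F rep_single by blast
      next
        case (Black b) then show ?thesis using validD(3)[OF \<open>valid F\<close>, of b] F by (simp add: incoming_single)
      qed
    next
      case (2 b e)
      obtain S T where ST: "F = join (Black b) S T" "verts S \<inter> verts T = {}" "Black b \<notin> verts S" "Black b \<notin> verts T"
        "insert (Black b) (roots T) = e" "valid S" "valid T"
        by (rule cut_join[OF \<open>valid F\<close> root[unfolded 2(1)] 2(2)[unfolded 2(1)] 2(3)[unfolded 2(1)]])
      have "card (verts S) < card (verts F)" "card (verts T) < card (verts F)"
        unfolding ST(1) using card_verts_ops(3)[OF ST(6,7,2,3,4)] by auto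
      then show ?thesis using IH[OF ST(6)] IH[OF ST(7)] rep_join[OF _ _ ST(2-4)] ST(1) by blast
    next
      case (3 e)
      obtain S T where ST: "F = attach r S T" "verts S \<inter> verts T = {}" "r \<in> verts S" "insert r (roots T) = e"
        "valid S" "valid T" "roots S = roots F"
        by (rule cut_attach[OF \<open>valid F\<close> 3])
      have rS: "roots S = {r}" using ST(7) root by simp
      have c: "card (verts S) < card (verts F)" "card (verts T) < card (verts F)"
        unfolding ST(1) using card_verts_ops[OF ST(5,6,2)] card_verts_ops(4)[OF ST(6,5)] ST(2) by auto
      obtain p q where pq: "rep S p" "rep T q" using IH[OF ST(5)] IH[OF ST(6)] c by blast
      have "\<exists>p. rep (attach v S T) p" if v: "v \<in> verts S - {r}" for v
      proof (rule IH)
        show "valid (attach v S T)" by (rule valid_attach[OF ST(5,6,2)]) (use v in simp)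
        have "rdeg (attach v S T) < rdeg F" unfolding ST(1)
          using rdeg_attach[OF validD(1)[OF ST(5)] validD(1)[OF ST(6)] ST(2) _ rS] v ST(3) by simp
        then show "card (verts (attach v S T)) < card (verts F) \<or> card (verts (attach v S T)) = card (verts F) \<and> rdeg (attach v S T) < rdeg F"
          unfolding ST(1) using card_verts_ops(1)[OF ST(5,6,2)] by simp
      qed
      then obtain f where "\<And>v. v \<in> verts S - {r} \<Longrightarrow> rep (attach v S T) (f v)" by metis
      from rep_attach[OF pq ST(2) rS this] show ?thesis using ST(1) by blast
    qed
  qed
qed

text \<open>An arbitrary choice among the normal forms of a forest, so identities for
  \<open>psi\<close> can be expected only modulo the ideal and as far as uniqueness is
  known.\<close>

definition psi :: "vertex forest \<Rightarrow> (greg_gen tree set \<Rightarrow>\<^sub>0 'k)" where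
  "psi F = (SOME p. rep F p)"

lemma psi_rep: "valid F \<Longrightarrow> rep F (psi F)"
  unfolding psi_def by (rule someI_ex) (rule rep_exists)

lemma psi_closed: "valid F \<Longrightarrow> psi F \<in> t_carrier (labels F)"
  using rep_closed[OF psi_rep] by blast

definition uniq :: "vertex forest \<Rightarrow> bool" where
  "uniq F \<longleftrightarrow> (\<forall>p q. rep F p \<longrightarrow> rep F q \<longrightarrow> eqv (labels F) p q)"

lemma uniqD: "uniq F \<Longrightarrow> rep F p \<Longrightarrow> eqv (labels F) p (psi F)"
  using psi_rep rep_valid unfolding uniq_def by blast

lemma fin_labels: "valid F \<Longrightarrow> finite (labels F)"
  using finite_labels validD(2) by blast

lemma eqv_binL:
  assumes "eqv A p p'" "eqv B q q'" "p' \<in> t_carrier A" "q \<in> t_carrier B"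
    "finite A" "finite B" "A \<inter> B = {}" "L = A \<union> B"
  shows "eqv L (bin a p q) (bin a p' q')"
  using eqv_bin assms by blast

section \<open>Expanding products of normal forms\<close>

lemma psi_relations:
  assumes v: "valid S" "valid T" "valid U" and d: "verts S \<inter> verts T = {}" "verts S \<inter> verts U = {}" "verts T \<inter> verts U = {}"
    and L: "L = labels S \<union> labels T \<union> labels U"
  shows "eqv L (bin GenX (bin GenX (psi S) (psi T)) (psi U) - bin GenX (psi S) (bin GenX (psi T) (psi U)))
      (bin GenX (bin GenX (psi S) (psi U)) (psi T) - bin GenX (psi S) (bin GenX (psi U) (psi T)))"
    and "eqv L (bin GenX (bin GenC (psi S) (psi T)) (psi U)) (bin GenC (bin GenX (psi S) (psi U)) (psi T) + bin GenC (psi S) (bin GenX (psi T) (psi U)))"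
    and "eqv L (bin GenC (bin GenC (psi S) (psi T)) (psi U)) (bin GenC (psi S) (bin GenC (psi T) (psi U)))"
    and "eqv L (bin GenX (bin GenG (psi S) (psi T)) (psi U) - bin GenG (bin GenX (psi S) (psi U)) (psi T) - bin GenG (psi S) (bin GenX (psi T) (psi U)))
      (bin GenX (bin GenG (psi S) (psi U)) (psi T) - bin GenG (bin GenX (psi S) (psi T)) (psi U) - bin GenG (psi S) (bin GenX (psi U) (psi T)))"
  unfolding L
  by (rule eqv_relations; use v d psi_closed fin_labels labels_disjoint in blast)+

lemma bin_psi_closed:
  assumes "valid S" "valid T" "verts S \<inter> verts T = {}" "L = labels S \<union> labels T"
  shows "bin a (psi S) (psi T) \<in> t_carrier L"
  unfolding assms(4) by (rule bin_closed) (use assms psi_closed labels_disjoint in blast)+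

text \<open>In \<open>rep_munion\<close> the first factor is a single tree. For general
  \<open>S\<close>, one tree is split off and the rest of \<open>S\<close> is moved to the other
  factor by associativity of c. The bound \<open>n\<close> limits how much uniqueness is
  presupposed.\<close>

lemma psi_munion:
  assumes H: "\<And>F. valid F \<Longrightarrow> card (verts F) \<le> n \<Longrightarrow> uniq F"
    and v: "valid S" "valid T" "verts S \<inter> verts T = {}" and n: "card (verts S) + card (verts T) \<le> n"
  shows "eqv (labels S \<union> labels T) (psi (munion S T)) (bin GenC (psi S) (psi T))"
  using v n
proof (induction "card (verts S)" arbitrary: S rule: less_induct)
  case less
  note v = less.prems(1-3)
  let ?L = "labels S \<union> labels T"
  have L: "finite ?L" using fin_labels v by simp
  note tr = eqv_trans[OF L] and sy = eqv_sym[OF L]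
  have uST: "uniq (munion S T)" by (rule H[OF valid_munion[OF v]]) (use less.prems(4) card_verts_ops(2)[OF v] in simp)
  obtain r where r: "r \<in> roots S" using roots_nonempty[OF validD(1)[OF v(1)]] by auto
  show ?case
  proof (cases "roots S = {r}")
    case True
    from uniqD[OF uST rep_munion[OF psi_rep[OF v(1)] psi_rep[OF v(2)] v(3) True]]
    show ?thesis using sy by simp
  next
    case False
    obtain S1 S2 where S: "S = munion S1 S2" "verts S1 \<inter> verts S2 = {}" "roots S1 = {r}" "valid S1" "valid S2"
      by (rule cut_munion[OF v(1) r False])
    have d: "verts S1 \<inter> verts T = {}" "verts S2 \<inter> verts T = {}" using S(1) v(3) by auto
    have c: "card (verts S) = card (verts S1) + card (verts S2)" "0 < card (verts S1)"
      unfolding S(1) using card_verts_ops[OF S(4,5,2)] by auto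
    have v2: "valid (munion S2 T)" "verts S1 \<inter> verts (munion S2 T) = {}" using valid_munion[OF S(5) v(2) d(2)] S(2) d by auto
    have IH: "eqv (labels S2 \<union> labels T) (psi (munion S2 T)) (bin GenC (psi S2) (psi T))"
      by (rule less.hyps) (use c S(5) v(2) d(2) less.prems(4) in auto)
    have "uniq S" by (rule H[OF v(1)]) (use less.prems(4) in simp)
    have eS: "eqv (labels S) (bin GenC (psi S1) (psi S2)) (psi S)"
      using uniqD[OF \<open>uniq S\<close>] rep_munion[OF psi_rep[OF S(4)] psi_rep[OF S(5)] S(2,3)] S(1) by simp
    have lS: "labels S = labels S1 \<union> labels S2" unfolding S(1) by simp
    note fl = fin_labels[OF S(4)] fin_labels[OF S(5)] fin_labels[OF v(2)] fin_labels[OF v(1)]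
    note ld = labels_disjoint[OF S(2)] labels_disjoint[OF d(1)] labels_disjoint[OF d(2)] labels_disjoint[OF v(3)]
    have "munion S T = munion S1 (munion S2 T)" unfolding S(1) by (rule munion_assoc)
    then have e1: "eqv ?L (psi (munion S T)) (bin GenC (psi S1) (psi (munion S2 T)))"
      using sy[of "bin GenC (psi S1) (psi (munion S2 T))" "psi (munion S T)"]
        uniqD[OF uST] rep_munion[OF psi_rep[OF S(4)] psi_rep[OF v2(1)] v2(2) S(3)] by (simp add: lS Un_assoc)
    have e2: "eqv ?L (bin GenC (psi S1) (psi (munion S2 T))) (bin GenC (psi S1) (bin GenC (psi S2) (psi T)))"
      by (rule eqv_binL[OF eqv_refl[OF fl(1)] IH psi_closed[OF S(4)]])
        (use psi_closed[OF v2(1)] fl ld lS in auto)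
    have e3: "eqv ?L (bin GenC (psi S1) (bin GenC (psi S2) (psi T))) (bin GenC (bin GenC (psi S1) (psi S2)) (psi T))"
      by (rule sy, rule psi_relations(3)[OF S(4,5) v(2) S(2) d]) (simp add: lS)
    have e4: "eqv ?L (bin GenC (bin GenC (psi S1) (psi S2)) (psi T)) (bin GenC (psi S) (psi T))"
      by (rule eqv_binL[OF eS eqv_refl[OF fl(3)] psi_closed[OF v(1)] psi_closed[OF v(2)] fl(4,3) ld(4)]) simp
    from tr[OF e1 tr[OF e2 tr[OF e3 e4]]] show ?thesis .
  qed
qed

text \<open>For a tree \<open>S\<close> this is the rule \<open>rep_attach\<close> with the
  correction moved to the other side; uniqueness is used for one forest only.\<close>

lemma psi_attach_root:
  assumes v: "valid S" "valid T" "verts S \<inter> verts T = {}" and r: "roots S = {r}" and u: "uniq (attach r S T)"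
    and L: "L = labels S \<union> labels T"
  shows "eqv L (bin GenX (psi S) (psi T)) (\<Sum>v\<in>verts S. psi (attach v S T))"
proof -
  have fin: "finite L" unfolding L using fin_labels v by simp
  let ?s = "\<Sum>v\<in>verts S - {r}. psi (attach v S T)"
  have "rep (attach r S T) (bin GenX (psi S) (psi T) - ?s)"
    by (rule rep_attach[OF psi_rep[OF v(1)] psi_rep[OF v(2)] v(3) r]) (use valid_attach[OF v] psi_rep in simp)
  from uniqD[OF u this] have "eqv L (bin GenX (psi S) (psi T) - ?s) (psi (attach r S T))" by (simp add: L)
  from eqv_add[OF fin this eqv_refl[OF fin, of ?s]]
  have "eqv L (bin GenX (psi S) (psi T)) (psi (attach r S T) + ?s)" by simp
  then show ?thesis
    using sum.remove[OF finite_verts[OF validD(1)[OF v(1)]] root_in[OF validD(1)[OF v(1)] r], of "\<lambda>v. psi (attach v S T)"] by simp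
qed

text \<open>If \<open>S\<close> has several components, one is split off and x is distributed over
  c. The two smaller products are expanded by induction, and \<open>psi_munion\<close> puts the
  components together again.\<close>

lemma psi_attach:
  assumes H: "\<And>F. valid F \<Longrightarrow> card (verts F) \<le> n \<Longrightarrow> uniq F"
    and v: "valid S" "valid T" "verts S \<inter> verts T = {}" and n: "card (verts S) + card (verts T) \<le> n"
  shows "eqv (labels S \<union> labels T) (bin GenX (psi S) (psi T)) (\<Sum>v\<in>verts S. psi (attach v S T))"
  using v n
proof (induction "card (verts S)" arbitrary: S rule: less_induct)
  case less
  note v = less.prems(1-3)
  let ?L = "labels S \<union> labels T"
  have L: "finite ?L" using fin_labels v by simp
  note tr = eqv_trans[OF L] and sy = eqv_sym[OF L]
  obtain r where r: "r \<in> roots S" using roots_nonempty[OF validD(1)[OF v(1)]] by auto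
  have rv: "r \<in> verts S" using r roots_verts[OF validD(1)[OF v(1)]] by auto
  show ?case
  proof (cases "roots S = {r}")
    case True
    have "uniq (attach r S T)" by (rule H[OF valid_attach[OF v rv]]) (use less.prems(4) card_verts_ops(1)[OF v] in simp)
    from psi_attach_root[OF v True this HOL.refl] show ?thesis .
  next
    case False
    obtain S1 S2 where S: "S = munion S1 S2" "verts S1 \<inter> verts S2 = {}" "roots S1 = {r}" "valid S1" "valid S2"
      by (rule cut_munion[OF v(1) r False])
    have d: "verts S1 \<inter> verts T = {}" "verts S2 \<inter> verts T = {}" using S(1) v(3) by auto
    have c: "card (verts S) = card (verts S1) + card (verts S2)" "0 < card (verts S1)" "0 < card (verts S2)"
      unfolding S(1) using card_verts_ops[OF S(4,5,2)] card_verts_ops(4)[OF S(5,4)] S(2) by auto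
    have lS: "labels S = labels S1 \<union> labels S2" unfolding S(1) by simp
    note fl = fin_labels[OF S(4)] fin_labels[OF S(5)] fin_labels[OF v(2)] fin_labels[OF v(1)]
    note ld = labels_disjoint[OF S(2)] labels_disjoint[OF d(1)] labels_disjoint[OF d(2)] labels_disjoint[OF v(3)]
    note va1 = valid_attach[OF S(4) v(2) d(1)] and va2 = valid_attach[OF S(5) v(2) d(2)]
    have fin: "finite (verts S1)" "finite (verts S2)" using finite_verts validD(1) S by blast+
    have IH1: "eqv (labels S1 \<union> labels T) (bin GenX (psi S1) (psi T)) (\<Sum>v\<in>verts S1. psi (attach v S1 T))"
      by (rule less.hyps) (use c S(4) v(2) d(1) less.prems(4) in auto)
    have IH2: "eqv (labels S2 \<union> labels T) (bin GenX (psi S2) (psi T)) (\<Sum>v\<in>verts S2. psi (attach v S2 T))"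
      by (rule less.hyps) (use c S(5) v(2) d(2) less.prems(4) in auto)
    have "eqv (labels S) (psi S) (bin GenC (psi S1) (psi S2))"
      unfolding S(1) labels_ops by (rule psi_munion[OF H S(4,5,2)]) (use c less.prems(4) in auto)
    then have e1: "eqv ?L (bin GenX (psi S) (psi T)) (bin GenX (bin GenC (psi S1) (psi S2)) (psi T))"
      by (rule eqv_binL[OF _ eqv_refl[OF fl(3)] bin_psi_closed[OF S(4,5,2) lS] psi_closed[OF v(2)] fl(4,3) ld(4)]) simp
    have e2: "eqv ?L (bin GenX (bin GenC (psi S1) (psi S2)) (psi T))
        (bin GenC (bin GenX (psi S1) (psi T)) (psi S2) + bin GenC (psi S1) (bin GenX (psi S2) (psi T)))"
      by (rule psi_relations(2)[OF S(4,5) v(2) S(2) d]) (simp add: lS)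
    have s1: "(\<Sum>v\<in>verts S1. psi (attach v S1 T)) \<in> t_carrier (labels S1 \<union> labels T)"
      by (rule free_space_sum) (use psi_closed[OF va1] in simp)
    have e3: "eqv ?L (bin GenC (bin GenX (psi S1) (psi T)) (psi S2)) (\<Sum>v\<in>verts S1. psi (attach v S T))"
    proof (rule tr)
      show "eqv ?L (bin GenC (bin GenX (psi S1) (psi T)) (psi S2)) (bin GenC (\<Sum>v\<in>verts S1. psi (attach v S1 T)) (psi S2))"
        by (rule eqv_binL[OF IH1 eqv_refl[OF fl(2)] s1 psi_closed[OF S(5)]]) (use fl ld lS in auto)
      show "eqv ?L (bin GenC (\<Sum>v\<in>verts S1. psi (attach v S1 T)) (psi S2)) (\<Sum>v\<in>verts S1. psi (attach v S T))"
        unfolding pm_linear_sum[OF pm_linear_bin(1)]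
      proof (rule eqv_sum[OF L])
        fix x assume x: "x \<in> verts S1"
        have dx: "verts (attach x S1 T) \<inter> verts S2 = {}" using S(2) d(2) by auto
        have "eqv (labels (attach x S1 T) \<union> labels S2) (psi (munion (attach x S1 T) S2)) (bin GenC (psi (attach x S1 T)) (psi S2))"
          by (rule psi_munion[OF H va1[OF x] S(5) dx]) (use c less.prems(4) card_verts_ops(1)[OF S(4) v(2) d(1)] in auto)
        moreover have "munion (attach x S1 T) S2 = attach x S T" unfolding S(1) by (rule attach_munion_left[symmetric])
        moreover have "labels (attach x S1 T) \<union> labels S2 = ?L" using lS by auto
        ultimately show "eqv ?L (bin GenC (psi (attach x S1 T)) (psi S2)) (psi (attach x S T))" using sy by simp
      qed
    qed
    have e4: "eqv ?L (bin GenC (psi S1) (bin GenX (psi S2) (psi T))) (\<Sum>v\<in>verts S2. psi (attach v S T))"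
    proof (rule tr)
      show "eqv ?L (bin GenC (psi S1) (bin GenX (psi S2) (psi T))) (bin GenC (psi S1) (\<Sum>v\<in>verts S2. psi (attach v S2 T)))"
        by (rule eqv_binL[OF eqv_refl[OF fl(1)] IH2 psi_closed[OF S(4)] bin_psi_closed[OF S(5) v(2) d(2) HOL.refl]]) (use fl ld lS in auto)
      show "eqv ?L (bin GenC (psi S1) (\<Sum>v\<in>verts S2. psi (attach v S2 T))) (\<Sum>v\<in>verts S2. psi (attach v S T))"
        unfolding pm_linear_sum[OF pm_linear_bin(2)]
      proof (rule eqv_sum[OF L])
        fix x assume x: "x \<in> verts S2"
        have dx: "verts S1 \<inter> verts (attach x S2 T) = {}" using S(2) d(1) by auto
        have "eqv (labels S1 \<union> labels (attach x S2 T)) (psi (munion S1 (attach x S2 T))) (bin GenC (psi S1) (psi (attach x S2 T)))"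
          by (rule psi_munion[OF H S(4) va2[OF x] dx]) (use c less.prems(4) card_verts_ops(1)[OF S(5) v(2) d(2)] in auto)
        moreover have "munion S1 (attach x S2 T) = attach x S T" unfolding S(1) by (rule attach_munion_right[symmetric])
        moreover have "labels S1 \<union> labels (attach x S2 T) = ?L" using lS by auto
        ultimately show "eqv ?L (bin GenC (psi S1) (psi (attach x S2 T))) (psi (attach x S T))" using sy by simp
      qed
    qed
    have "(\<Sum>v\<in>verts S. psi (attach v S T)) = (\<Sum>v\<in>verts S1. psi (attach v S T)) + (\<Sum>v\<in>verts S2. psi (attach v S T))"
      using sum.union_disjoint[OF fin S(2), of "\<lambda>v. psi (attach v S T)"] S(1) by simp
    then show ?thesis using tr[OF e1 tr[OF e2 eqv_add[OF L e3 e4]]] by simp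
  qed
qed

text \<open>The preimage of the forest obtained from \<open>S\<close> by attaching \<open>T\<close> and \<open>U\<close> at its root, written so
  that its symmetry in \<open>T\<close> and \<open>U\<close> is the pre-Lie relation.\<close>

definition brace :: "vertex forest \<Rightarrow> vertex \<Rightarrow> vertex forest \<Rightarrow> vertex forest \<Rightarrow> (greg_gen tree set \<Rightarrow>\<^sub>0 'k)" where
  "brace S r T U = (bin GenX (bin GenX (psi S) (psi T)) (psi U) - bin GenX (psi S) (bin GenX (psi T) (psi U)))
    - (\<Sum>v\<in>verts S - {r}. \<Sum>w\<in>verts S - {r}. psi (attach w (attach v S T) U))
    - (\<Sum>v\<in>verts S - {r}. psi (attach r (attach v S T) U) + psi (attach v (attach r S T) U))"

text \<open>The difference of the two bracketings is symmetric by the pre-Lie relation. The sums are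
  literally symmetric, since attachments of \<open>T\<close> and \<open>U\<close> commute and the
  two summation vertices can be exchanged.\<close>

lemma brace_commute:
  assumes v: "valid S" "valid T" "valid U" and d: "verts S \<inter> verts T = {}" "verts S \<inter> verts U = {}" "verts T \<inter> verts U = {}"
    and L: "L = labels S \<union> labels T \<union> labels U"
  shows "eqv L (brace S r T U) (brace S r U T)"
proof -
  have fin: "finite L" unfolding L using fin_labels v by simp
  have 1: "(\<Sum>v\<in>verts S - {r}. \<Sum>w\<in>verts S - {r}. psi (attach w (attach v S T) U)) =
      (\<Sum>v\<in>verts S - {r}. \<Sum>w\<in>verts S - {r}. psi (attach w (attach v S U) T))"
    by (subst sum.swap) (simp add: attach_commute[of _ _ S T U])
  have 2: "(\<Sum>v\<in>verts S - {r}. psi (attach r (attach v S T) U) + psi (attach v (attach r S T) U)) =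
      (\<Sum>v\<in>verts S - {r}. psi (attach r (attach v S U) T) + psi (attach v (attach r S U) T))"
    by (simp add: attach_commute[of _ _ S T U] add.commute)
  show ?thesis unfolding brace_def 1 2
    by (rule eqv_diff[OF fin eqv_diff[OF fin psi_relations(1)[OF v d L] eqv_refl[OF fin]] eqv_refl[OF fin]])
qed

text \<open>Expanding two successive cuts at \<open>r\<close> gives graftings of \<open>T\<close> in
  \<open>S\<close> and of \<open>U\<close> in \<open>S\<close> or \<open>T\<close>. Those with
  \<open>U\<close> inside \<open>T\<close> add up to the product of \<open>psi S\<close> with that
  of \<open>psi T\<close> and \<open>psi U\<close>; the others, with \<open>T\<close> and
  \<open>U\<close> in \<open>S\<close> and not both at \<open>r\<close>, are the sums in
  \<open>brace\<close>.\<close>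

lemma rep_brace:
  assumes v: "valid S" "valid T" "valid U" and d: "verts S \<inter> verts T = {}" "verts S \<inter> verts U = {}" "verts T \<inter> verts U = {}"
    and r: "roots S = {r}"
    and IH: "\<And>F. valid F \<Longrightarrow> (F, attach r (attach r S T) U) \<in> smaller \<Longrightarrow> uniq F"
    and p: "rep (attach r S T) p" and q: "rep U q"
    and f: "\<And>v. v \<in> verts (attach r S T) - {r} \<Longrightarrow> rep (attach v (attach r S T) U) (f v)"
    and L: "L = labels S \<union> labels T \<union> labels U"
  shows "eqv L (bin GenX p q - (\<Sum>v\<in>verts (attach r S T) - {r}. f v)) (brace S r T U)"
proof -
  note h = validD(1)[OF v(1)] validD(1)[OF v(2)] validD(1)[OF v(3)]
  let ?V = "verts S - {r}" and ?W = "verts T"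
  have rS: "r \<in> verts S" by (rule root_in[OF h(1) r])
  have rT: "r \<notin> ?W" using rS d by auto
  note fl = fin_labels[OF v(1)] fin_labels[OF v(2)] fin_labels[OF v(3)]
  note ld = labels_disjoint[OF d(1)] labels_disjoint[OF d(2)] labels_disjoint[OF d(3)]
  have fin: "finite L" unfolding L using fl by simp
  note tr = eqv_trans[OF fin] and sy = eqv_sym[OF fin] and rf = eqv_refl[OF fin]
  have fV: "finite ?V" "finite ?W" "finite (verts S)" using finite_verts[OF h(1)] finite_verts[OF h(2)] by auto
  have vST: "valid (attach x S T)" if "x \<in> verts S" for x by (rule valid_attach[OF v(1,2) d(1) that])
  have dST: "verts (attach x S T) \<inter> verts U = {}" for x using d by auto
  have rST: "roots (attach x S T) = {r}" for x using r by simp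
  have vTU: "valid (attach x T U)" if "x \<in> ?W" for x by (rule valid_attach[OF v(2,3) d(3) that])
  have dTU: "verts S \<inter> verts (attach x T U) = {}" for x using d by auto
  have cST: "card (verts (attach x S T)) = card (verts S) + card ?W" for x by (rule card_verts_ops(1)[OF v(1,2) d(1)])
  have cTU: "card (verts (attach x T U)) = card ?W + card (verts U)" for x by (rule card_verts_ops(1)[OF v(2,3) d(3)])
  have c3: "card (verts (attach y (attach x S T) U)) = card (verts S) + card ?W + card (verts U)" if "x \<in> verts S" for x y
    using card_verts_ops(1)[OF vST[OF that] v(3) dST] cST by simp
  have pos: "0 < card (verts S)" "0 < card ?W" "0 < card (verts U)"
    using card_verts_ops(4)[OF v(1,2) d(1)] card_verts_ops(4)[OF v(2,3) d(3)] card_verts_ops(4)[OF v(3,1)] d(2) by auto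
  have deg: "rdeg (attach r (attach r S T) U) = Suc (Suc (rdeg S))"
    using rdeg_attach[OF validD(1)[OF vST[OF rS]] h(3) dST _ rST] rdeg_attach[OF h(1,2) d(1) rS r] rS by simp
  \<comment> \<open>The induction hypothesis in its two uses: fewer vertices, or the same vertices
    with fewer root edges. The forest in question has two root edges more than \<open>S\<close>, so
    one more than \<open>S\<close> is still admissible.\<close>
  have small: "uniq F" if "valid F" "card (verts F) < card (verts S) + card ?W + card (verts U)" for F
    by (rule IH[OF that(1)]) (use that(2) c3[OF rS] in \<open>simp add: smaller_iff\<close>)
  have same: "uniq F" if "valid F" "card (verts F) = card (verts S) + card ?W + card (verts U)" "rdeg F \<le> Suc (rdeg S)" for F
    by (rule IH[OF that(1)]) (use that(2,3) c3[OF rS] deg in \<open>simp add: smaller_iff\<close>)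
  \<comment> \<open>\<open>P x y\<close> has \<open>T\<close> attached at \<open>x\<close> and
    \<open>U\<close> at \<open>y\<close>; \<open>R y\<close> is the case \<open>x = r\<close>, read
    for \<open>y\<close> in \<open>T\<close> as a single attachment at the root.\<close>
  define P where "P x y = psi (attach y (attach x S T) U)" for x y
  define R where "R y = psi (attach r S (attach y T U))" for y
  define X3 where "X3 = bin GenX (bin GenX (psi S) (psi T)) (psi U)"
  have PR: "psi (attach x S (attach y T U)) = P x y" for x y unfolding P_def by (simp add: attach_attach)
  have RP: "P r y = R y" for y unfolding R_def PR ..
  define s where "s = (\<Sum>x\<in>?V. psi (attach x S T))"
  have s: "s \<in> t_carrier (labels S \<union> labels T)" unfolding s_def
    by (rule free_space_sum) (use psi_closed[OF vST] in simp)
  have "rep (attach r S T) (bin GenX (psi S) (psi T) - s)" unfolding s_def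
    by (rule rep_attach[OF psi_rep[OF v(1)] psi_rep[OF v(2)] d(1) r]) (use psi_rep[OF vST] in simp)
  moreover have "uniq (attach r S T)" by (rule small[OF vST[OF rS]]) (use cST pos in simp)
  ultimately have "eqv (labels (attach r S T)) p (bin GenX (psi S) (psi T) - s)" using p unfolding uniq_def by blast
  then have s1: "eqv (labels S \<union> labels T) p (bin GenX (psi S) (psi T) - s)" by simp
  have "uniq U" by (rule small[OF v(3)]) (use pos in simp)
  then have s1': "eqv (labels U) q (psi U)" using q uniqD by blast
  have s2: "eqv L (bin GenX p q) (X3 - (\<Sum>x\<in>?V. bin GenX (psi (attach x S T)) (psi U)))"
  proof -
    have "eqv L (bin GenX p q) (bin GenX (bin GenX (psi S) (psi T) - s) (psi U))"
    proof (rule eqv_binL[OF s1 s1'])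
      show "bin GenX (psi S) (psi T) - s \<in> t_carrier (labels S \<union> labels T)"
        using bin_psi_closed[OF v(1,2) d(1) HOL.refl] s by simp
      show "q \<in> t_carrier (labels U)" using rep_closed[OF q] by simp
    qed (use fl ld L in auto)
    then show ?thesis unfolding s_def X3_def pm_linear_diff[OF pm_linear_bin(1)] pm_linear_sum[OF pm_linear_bin(1)] .
  qed
  have s3: "eqv L (bin GenX (psi (attach x S T)) (psi U)) (\<Sum>y\<in>verts S \<union> ?W. P x y)" if x: "x \<in> ?V" for x
  proof -
    have x': "x \<in> verts S" "x \<noteq> r" using x by auto
    have rx: "r \<in> verts (attach x S T)" using rS by simp
    have "uniq (attach r (attach x S T) U)"
    proof (rule same)
      show "valid (attach r (attach x S T) U)" by (rule valid_attach[OF vST[OF x'(1)] v(3) dST rx])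
      show "card (verts (attach r (attach x S T) U)) = card (verts S) + card ?W + card (verts U)" by (rule c3[OF x'(1)])
      show "rdeg (attach r (attach x S T) U) \<le> Suc (rdeg S)"
        using rdeg_attach[OF validD(1)[OF vST[OF x'(1)]] h(3) dST rx rST] rdeg_attach[OF h(1,2) d(1) x'(1) r] x'(2) by simp
    qed
    from psi_attach_root[OF vST[OF x'(1)] v(3) dST rST this, of L] show ?thesis unfolding P_def L by simp
  qed
  have s4: "eqv L (\<Sum>x\<in>verts (attach r S T) - {r}. f x) ((\<Sum>x\<in>?V. P r x) + (\<Sum>y\<in>?W. R y))"
  proof -
    have split: "verts (attach r S T) - {r} = ?V \<union> ?W" using rT by auto
    have "eqv L (f x) (P r x)" if x: "x \<in> ?V \<union> ?W" for x
    proof -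
      have x': "x \<in> verts (attach r S T)" "x \<noteq> r" using x rT by auto
      have "uniq (attach x (attach r S T) U)"
      proof (rule same)
        show "valid (attach x (attach r S T) U)" by (rule valid_attach[OF vST[OF rS] v(3) dST x'(1)])
        show "card (verts (attach x (attach r S T) U)) = card (verts S) + card ?W + card (verts U)" by (rule c3[OF rS])
        show "rdeg (attach x (attach r S T) U) \<le> Suc (rdeg S)"
          using rdeg_attach[OF validD(1)[OF vST[OF rS]] h(3) dST x'(1) rST] rdeg_attach[OF h(1,2) d(1) rS r] x'(2) by simp
      qed
      from uniqD[OF this f[of x]] x' show ?thesis unfolding P_def L by simp
    qed
    then have "eqv L (\<Sum>x\<in>?V \<union> ?W. f x) (\<Sum>x\<in>?V \<union> ?W. P r x)" by (rule eqv_sum[OF fin])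
    moreover have "(\<Sum>x\<in>?V \<union> ?W. P r x) = (\<Sum>x\<in>?V. P r x) + (\<Sum>y\<in>?W. P r y)"
      by (rule sum.union_disjoint) (use fV d in auto)
    ultimately show ?thesis unfolding split RP[symmetric] by simp
  qed
  have s5: "eqv L (bin GenX (psi S) (bin GenX (psi T) (psi U))) (\<Sum>y\<in>?W. R y + (\<Sum>x\<in>?V. P x y))"
  proof -
    have "eqv (labels T \<union> labels U) (bin GenX (psi T) (psi U)) (\<Sum>y\<in>?W. psi (attach y T U))"
      by (rule psi_attach[OF small v(2,3) d(3) order_refl]) (use pos in auto)
    then have "eqv L (bin GenX (psi S) (bin GenX (psi T) (psi U))) (bin GenX (psi S) (\<Sum>y\<in>?W. psi (attach y T U)))"
      by (rule eqv_binL[OF eqv_refl[OF fl(1)] _ psi_closed[OF v(1)] bin_psi_closed[OF v(2,3) d(3) HOL.refl]]) (use fl ld L in auto)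
    moreover have "eqv L (bin GenX (psi S) (\<Sum>y\<in>?W. psi (attach y T U))) (\<Sum>y\<in>?W. R y + (\<Sum>x\<in>?V. P x y))"
      unfolding pm_linear_sum[OF pm_linear_bin(2)]
    proof (rule eqv_sum[OF fin])
      fix y assume y: "y \<in> ?W"
      have "uniq (attach r S (attach y T U))"
      proof (rule same)
        show "valid (attach r S (attach y T U))" by (rule valid_attach[OF v(1) vTU[OF y] dTU rS])
        show "card (verts (attach r S (attach y T U))) = card (verts S) + card ?W + card (verts U)"
          using card_verts_ops(1)[OF v(1) vTU[OF y] dTU] cTU by simp
        show "rdeg (attach r S (attach y T U)) \<le> Suc (rdeg S)"
          using rdeg_attach[OF h(1) validD(1)[OF vTU[OF y]] dTU rS r] by simp
      qed
      from psi_attach_root[OF v(1) vTU[OF y] dTU r this, of L]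
      have "eqv L (bin GenX (psi S) (psi (attach y T U))) (\<Sum>x\<in>verts S. P x y)" unfolding L PR by (simp add: Un_assoc)
      then show "eqv L (bin GenX (psi S) (psi (attach y T U))) (R y + (\<Sum>x\<in>?V. P x y))"
        using sum.remove[OF fV(3) rS, of "\<lambda>x. P x y"] RP by simp
    qed
    ultimately show ?thesis by (rule tr)
  qed
  have "eqv L (bin GenX p q - (\<Sum>v\<in>verts (attach r S T) - {r}. f v))
      ((X3 - (\<Sum>x\<in>?V. \<Sum>y\<in>verts S \<union> ?W. P x y)) - ((\<Sum>x\<in>?V. P r x) + (\<Sum>y\<in>?W. R y)))"
    by (rule eqv_diff[OF fin tr[OF s2 eqv_diff[OF fin rf eqv_sum[OF fin s3]]] s4])
  \<comment> \<open>The vertices of \<open>attach x S T\<close> are divided into \<open>r\<close>,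
    the rest of \<open>S\<close>, and \<open>T\<close>; the last part combines with the
    \<open>R y\<close> to the expansion in \<open>s5\<close>.\<close>
  also have "(X3 - (\<Sum>x\<in>?V. \<Sum>y\<in>verts S \<union> ?W. P x y)) - ((\<Sum>x\<in>?V. P r x) + (\<Sum>y\<in>?W. R y)) =
      (X3 - (\<Sum>y\<in>?W. R y + (\<Sum>x\<in>?V. P x y))) - (\<Sum>x\<in>?V. \<Sum>y\<in>?V. P x y) - (\<Sum>x\<in>?V. P x r + P r x)"
  proof -
    have "(\<Sum>y\<in>verts S \<union> ?W. P x y) = P x r + (\<Sum>y\<in>?V. P x y) + (\<Sum>y\<in>?W. P x y)" for x
      using sum.union_disjoint[OF fV(3,2) d(1), of "P x"] sum.remove[OF fV(3) rS, of "P x"] by simp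
    then show ?thesis by (simp add: sum.distrib sum.swap[of _ ?V ?W] algebra_simps)
  qed
  finally have "eqv L (bin GenX p q - (\<Sum>v\<in>verts (attach r S T) - {r}. f v))
      ((X3 - (\<Sum>y\<in>?W. R y + (\<Sum>x\<in>?V. P x y))) - (\<Sum>x\<in>?V. \<Sum>y\<in>?V. P x y) - (\<Sum>x\<in>?V. P x r + P r x))" .
  moreover have "eqv L ((X3 - (\<Sum>y\<in>?W. R y + (\<Sum>x\<in>?V. P x y))) - (\<Sum>x\<in>?V. \<Sum>y\<in>?V. P x y) - (\<Sum>x\<in>?V. P x r + P r x)) (brace S r T U)"
    unfolding brace_def X3_def[symmetric] P_def[symmetric]
    by (rule eqv_diff[OF fin eqv_diff[OF fin eqv_diff[OF fin rf sy[OF s5]] rf] rf])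
  ultimately show ?thesis by (rule tr)
qed

text \<open>The analogue of \<open>rep_brace\<close> for a black root with three edges, where removing two of them
  does not leave a valid forest.\<close>

lemma rep_join_attach:
  assumes v: "valid S" "valid T" "valid U" and d: "verts S \<inter> verts T = {}" "verts S \<inter> verts U = {}" "verts T \<inter> verts U = {}"
    and b: "Black b \<notin> verts S" "Black b \<notin> verts T" "Black b \<notin> verts U"
    and IH: "\<And>F. valid F \<Longrightarrow> (F, attach (Black b) (join (Black b) S T) U) \<in> smaller \<Longrightarrow> uniq F"
    and p: "rep (join (Black b) S T) p" and q: "rep U q"
    and f: "\<And>v. v \<in> verts (join (Black b) S T) - {Black b} \<Longrightarrow> rep (attach v (join (Black b) S T) U) (f v)"
    and L: "L = labels S \<union> labels T \<union> labels U"
  shows "eqv L (bin GenX p q - (\<Sum>v\<in>verts (join (Black b) S T) - {Black b}. f v))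
    (bin GenX (bin GenG (psi S) (psi T)) (psi U) - bin GenG (bin GenX (psi S) (psi U)) (psi T)
      - bin GenG (psi S) (bin GenX (psi T) (psi U)))"
proof -
  note h = validD(1)[OF v(1)] validD(1)[OF v(2)] validD(1)[OF v(3)]
  let ?b = "Black b"
  let ?J = "join ?b S T"
  note fl = fin_labels[OF v(1)] fin_labels[OF v(2)] fin_labels[OF v(3)]
  note ld = labels_disjoint[OF d(1)] labels_disjoint[OF d(2)] labels_disjoint[OF d(3)]
  have fin: "finite L" unfolding L using fl by simp
  note tr = eqv_trans[OF fin] and sy = eqv_sym[OF fin] and rf = eqv_refl[OF fin]
  have fV: "finite (verts S)" "finite (verts T)" using finite_verts h by auto
  have dT: "verts T \<inter> verts S = {}" using d by auto
  have vJ: "valid ?J" by (rule valid_join[OF v(1,2) d(1) b(1,2)])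
  have dJ: "verts ?J \<inter> verts U = {}" using d b by auto
  have rJ: "roots ?J = {?b}" by simp
  have cJ: "card (verts ?J) = Suc (card (verts S) + card (verts T))" by (rule card_verts_ops(3)[OF v(1,2) d(1) b(1,2)])
  let ?c = "Suc (card (verts S) + card (verts T)) + card (verts U)"
  have c: "card (verts (attach x ?J U)) = ?c" for x using card_verts_ops(1)[OF vJ v(3) dJ] cJ by simp
  have deg: "rdeg (attach x ?J U) = (if x = ?b then Suc (rdeg ?J) else rdeg ?J)" if "x \<in> verts ?J" for x
    by (rule rdeg_attach[OF validD(1)[OF vJ] h(3) dJ that rJ])
  have pos: "0 < card (verts S)" "0 < card (verts T)" "0 < card (verts U)"
    using card_verts_ops(4)[OF v(1,2) d(1)] card_verts_ops(4)[OF v(2,3) d(3)] card_verts_ops(4)[OF v(3,1)] d(2) by auto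
  have small: "uniq F" if "valid F" "card (verts F) < ?c" for F
    by (rule IH[OF that(1)]) (use that(2) c in \<open>simp add: smaller_iff\<close>)
  have "rep ?J (bin GenG (psi S) (psi T))" by (rule rep_join[OF psi_rep[OF v(1)] psi_rep[OF v(2)] d(1) b(1,2)])
  moreover have "uniq ?J" by (rule small[OF vJ]) (use cJ pos in simp)
  ultimately have "eqv (labels ?J) p (bin GenG (psi S) (psi T))" using p unfolding uniq_def by blast
  then have s1: "eqv (labels S \<union> labels T) p (bin GenG (psi S) (psi T))" by simp
  have "uniq U" by (rule small[OF v(3)]) simp
  then have s1': "eqv (labels U) q (psi U)" using q uniqD by blast
  have s2: "eqv L (bin GenX p q) (bin GenX (bin GenG (psi S) (psi T)) (psi U))"
  proof (rule eqv_binL[OF s1 s1'])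
    show "bin GenG (psi S) (psi T) \<in> t_carrier (labels S \<union> labels T)" by (rule bin_psi_closed[OF v(1,2) d(1) HOL.refl])
    show "q \<in> t_carrier (labels U)" using rep_closed[OF q] by simp
  qed (use fl ld L in auto)
  have fu: "eqv L (f x) (psi (attach x ?J U))" and uf: "uniq (attach x ?J U)" if x: "x \<in> verts S \<union> verts T" for x
  proof -
    have x': "x \<in> verts ?J" "x \<noteq> ?b" using x b by auto
    show u: "uniq (attach x ?J U)"
      by (rule IH[OF valid_attach[OF vJ v(3) dJ x'(1)]]) (use deg[OF x'(1)] deg[of ?b] x'(2) c in \<open>simp add: smaller_iff\<close>)
    from uniqD[OF u f] x' show "eqv L (f x) (psi (attach x ?J U))" unfolding L by simp
  qed
  \<comment> \<open>With \<open>U\<close> grafted inside \<open>S\<close> the black root keeps just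
    two edges, so the product under \<open>GenG\<close> of the normal forms below it is itself a
    normal form, without corrections.\<close>
  have s3: "eqv L (\<Sum>x\<in>verts S. psi (attach x ?J U)) (bin GenG (bin GenX (psi S) (psi U)) (psi T))"
  proof (rule sy)
    have "eqv (labels S \<union> labels U) (bin GenX (psi S) (psi U)) (\<Sum>x\<in>verts S. psi (attach x S U))"
      by (rule psi_attach[OF small v(1,3) d(2) order_refl]) auto
    then have "eqv L (bin GenG (bin GenX (psi S) (psi U)) (psi T)) (bin GenG (\<Sum>x\<in>verts S. psi (attach x S U)) (psi T))"
    proof (rule eqv_binL[OF _ eqv_refl[OF fl(2)] _ psi_closed[OF v(2)]])
      show "(\<Sum>x\<in>verts S. psi (attach x S U)) \<in> t_carrier (labels S \<union> labels U)"
        by (rule free_space_sum) (use psi_closed[OF valid_attach[OF v(1,3) d(2)]] in simp)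
    qed (use fl ld L in auto)
    moreover have "eqv L (bin GenG (\<Sum>x\<in>verts S. psi (attach x S U)) (psi T)) (\<Sum>x\<in>verts S. psi (attach x ?J U))"
      unfolding pm_linear_sum[OF pm_linear_bin(1)]
    proof (rule eqv_sum[OF fin])
      fix x assume x: "x \<in> verts S"
      have "rep (join ?b (attach x S U) T) (bin GenG (psi (attach x S U)) (psi T))"
        by (rule rep_join[OF psi_rep[OF valid_attach[OF v(1,3) d(2) x]] psi_rep[OF v(2)]]) (use d b in auto)
      then have "rep (attach x ?J U) (bin GenG (psi (attach x S U)) (psi T))" by (simp add: attach_join_left)
      from uniqD[OF uf this] x show "eqv L (bin GenG (psi (attach x S U)) (psi T)) (psi (attach x ?J U))" unfolding L by simp
    qed
    ultimately show "eqv L (bin GenG (bin GenX (psi S) (psi U)) (psi T)) (\<Sum>x\<in>verts S. psi (attach x ?J U))" by (rule tr)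
  qed
  have s4: "eqv L (\<Sum>x\<in>verts T. psi (attach x ?J U)) (bin GenG (psi S) (bin GenX (psi T) (psi U)))"
  proof (rule sy)
    have "eqv (labels T \<union> labels U) (bin GenX (psi T) (psi U)) (\<Sum>x\<in>verts T. psi (attach x T U))"
      by (rule psi_attach[OF small v(2,3) d(3) order_refl]) auto
    then have "eqv L (bin GenG (psi S) (bin GenX (psi T) (psi U))) (bin GenG (psi S) (\<Sum>x\<in>verts T. psi (attach x T U)))"
      by (rule eqv_binL[OF eqv_refl[OF fl(1)] _ psi_closed[OF v(1)] bin_psi_closed[OF v(2,3) d(3) HOL.refl]]) (use fl ld L in auto)
    moreover have "eqv L (bin GenG (psi S) (\<Sum>x\<in>verts T. psi (attach x T U))) (\<Sum>x\<in>verts T. psi (attach x ?J U))"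
      unfolding pm_linear_sum[OF pm_linear_bin(2)]
    proof (rule eqv_sum[OF fin])
      fix x assume x: "x \<in> verts T"
      have "rep (join ?b S (attach x T U)) (bin GenG (psi S) (psi (attach x T U)))"
        by (rule rep_join[OF psi_rep[OF v(1)] psi_rep[OF valid_attach[OF v(2,3) d(3) x]]]) (use d b in auto)
      then have "rep (attach x ?J U) (bin GenG (psi S) (psi (attach x T U)))" by (simp add: attach_join_right)
      from uniqD[OF uf this] x show "eqv L (bin GenG (psi S) (psi (attach x T U))) (psi (attach x ?J U))" unfolding L by simp
    qed
    ultimately show "eqv L (bin GenG (psi S) (bin GenX (psi T) (psi U))) (\<Sum>x\<in>verts T. psi (attach x ?J U))" by (rule tr)
  qed
  have split: "verts ?J - {?b} = verts S \<union> verts T" using b by auto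
  have "eqv L (\<Sum>x\<in>verts ?J - {?b}. f x) (\<Sum>x\<in>verts S \<union> verts T. psi (attach x ?J U))"
    unfolding split by (rule eqv_sum[OF fin fu])
  moreover have "(\<Sum>x\<in>verts S \<union> verts T. psi (attach x ?J U)) = (\<Sum>x\<in>verts S. psi (attach x ?J U)) + (\<Sum>x\<in>verts T. psi (attach x ?J U))"
    by (rule sum.union_disjoint[OF fV d(1)])
  ultimately have "eqv L (\<Sum>x\<in>verts ?J - {?b}. f x) (bin GenG (bin GenX (psi S) (psi U)) (psi T) + bin GenG (psi S) (bin GenX (psi T) (psi U)))"
    using tr eqv_add[OF fin s3 s4] by simp
  from eqv_diff[OF fin s2 this] show ?thesis by (simp only: diff_diff_eq)
qed

subsection \<open>Uniqueness of the normal form\<close>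

lemma roots_munion_not_single:
  assumes "hypertree_forest S" "hypertree_forest T" "verts S \<inter> verts T = {}"
  shows "roots (munion S T) \<noteq> {r}"
proof -
  obtain a b where "a \<in> roots S" "b \<in> roots T" using roots_nonempty assms by blast
  moreover have "a \<noteq> b" using calculation roots_verts[OF assms(1)] roots_verts[OF assms(2)] assms(3) by auto
  ultimately show ?thesis by (metis UnI1 UnI2 forest_simps(9) singletonD)
qed

text \<open>Here and in the next three lemmas, the shape of the forest at its roots decides which
  rule for \<open>rep\<close> was applied last, so two normal forms of one forest end with the same
  rule.\<close>

lemma rep_munionE:
  assumes "rep F p" "\<And>r. roots F \<noteq> {r}"
  obtains S T p1 p2 r where "F = munion S T" "p = bin GenC p1 p2" "rep S p1" "rep T p2" "verts S \<inter> verts T = {}" "roots S = {r}"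
  using assms(1)
proof (cases rule: rep.cases)
  case (rep_munion S p T q r)
  then show ?thesis using that by blast
next
  case (rep_single l)
  then show ?thesis using assms(2)[of "White l"] by simp
next
  case (rep_join S p T q b)
  then show ?thesis using assms(2)[of "Black b"] by simp
next
  case (rep_attach S p T q r f)
  then show ?thesis using assms(2)[of r] by simp
qed

lemma rep_singleE:
  assumes "rep F p" "roots F = {r}" "incoming F r = {}"
  obtains l where "r = White l" "p = tb (Leaf l)"
  using assms(1)
proof (cases rule: rep.cases)
  case (rep_single l)
  then have "r = White l" using assms(2) by auto
  then show ?thesis using that rep_single by blast
next
  case (rep_munion S p T q r')
  then show ?thesis using roots_munion_not_single[of S T r] assms(2) validD(1)[OF rep_valid] by metis
next
  case (rep_join S p T q b)
  have "card (incoming F r) = 2" using card_incoming_join[of S T "Black b"] rep_join validD(1)[OF rep_valid] assms(2) by simp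
  then show ?thesis using assms(3) by simp
next
  case (rep_attach S p T q r' f)
  have "r' = r" using rep_attach(1,6) assms(2) by simp
  then have "card (incoming F r) = Suc (card (incoming S r))"
    unfolding rep_attach(1)
    using card_incoming_attach[of S T r] rep_attach(3-6) validD(1)[OF rep_valid] root_in[of S r] by blast
  then show ?thesis using assms(3) by simp
qed

lemma rep_joinE:
  assumes "rep F p" "roots F = {Black b}" "card (incoming F (Black b)) = 2"
  obtains S T p1 p2 where "F = join (Black b) S T" "p = bin GenG p1 p2" "rep S p1" "rep T p2" "verts S \<inter> verts T = {}"
    "Black b \<notin> verts S" "Black b \<notin> verts T"
  using assms(1)
proof (cases rule: rep.cases)
  case (rep_single l)
  then show ?thesis using assms(2) by simp
next
  case (rep_munion S p T q r')
  then show ?thesis using roots_munion_not_single[of S T "Black b"] assms(2) validD(1)[OF rep_valid] by metis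
next
  case (rep_join S p T q b')
  then show ?thesis using that assms(2) by auto
next
  case (rep_attach S p T q r f)
  have r: "r = Black b" using rep_attach(1,6) assms(2) by simp
  have S: "valid S" "valid T" using rep_valid rep_attach by auto
  have rS: "r \<in> verts S" by (rule root_in[OF validD(1)[OF S(1)] rep_attach(6)])
  have "card (incoming F r) = Suc (card (incoming S r))"
    unfolding rep_attach(1) by (rule card_incoming_attach[OF validD(1)[OF S(1)] validD(1)[OF S(2)] rep_attach(5) rS])
  \<comment> \<open>The forest \<open>S\<close> is \<open>valid\<close>, so its black root already
    has two edges, and the attached one would be a third.\<close>
  moreover have "2 \<le> card (incoming S r)" using validD(3)[OF S(1), of b] rS r by simp
  ultimately show ?thesis using assms(3) r by simp
qed

lemma rep_attachE:
  assumes "rep F p" "roots F = {r}" "incoming F r \<noteq> {}" "r \<in> range Black \<Longrightarrow> card (incoming F r) \<noteq> 2"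
  obtains S T p1 p2 f where "F = attach r S T" "p = bin GenX p1 p2 - (\<Sum>v\<in>verts S - {r}. f v)" "rep S p1" "rep T p2"
    "verts S \<inter> verts T = {}" "roots S = {r}" "\<And>v. v \<in> verts S - {r} \<Longrightarrow> rep (attach v S T) (f v)"
  using assms(1)
proof (cases rule: rep.cases)
  case (rep_single l)
  then show ?thesis using assms(2,3) by (simp add: incoming_single)
next
  case (rep_munion S p T q r')
  then show ?thesis using roots_munion_not_single[of S T r] assms(2) validD(1)[OF rep_valid] by metis
next
  case (rep_join S p T q b)
  have "card (incoming F r) = 2" using card_incoming_join[of S T "Black b"] rep_join validD(1)[OF rep_valid] assms(2) by simp
  moreover have "r = Black b" using assms(2) rep_join(1) by simp
  ultimately show ?thesis using assms(4) by simp
next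
  case (rep_attach S p T q r' f)
  have "r' = r" using rep_attach(1,6) assms(2) by simp
  then show ?thesis using that rep_attach by blast
qed

lemma rep_bin_eqv:
  assumes "rep S p" "rep T q" "verts S \<inter> verts T = {}" "uniq S" "uniq T" "L = labels S \<union> labels T"
  shows "eqv L (bin a p q) (bin a (psi S) (psi T))"
proof -
  have v: "valid S" "valid T" using assms rep_valid by auto
  show ?thesis
    by (rule eqv_binL[OF uniqD[OF assms(4,1)] uniqD[OF assms(5,2)] psi_closed[OF v(1)] _ fin_labels[OF v(1)] fin_labels[OF v(2)]
          labels_disjoint[OF assms(3)] assms(6)]) (use rep_closed[OF assms(2)] in simp)
qed

lemma psi_C_left_commute:
  assumes v: "valid S" "valid T" "valid U" and d: "verts S \<inter> verts T = {}" "verts S \<inter> verts U = {}" "verts T \<inter> verts U = {}"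
    and L: "L = labels S \<union> labels T \<union> labels U"
  shows "eqv L (bin GenC (psi S) (bin GenC (psi T) (psi U))) (bin GenC (psi T) (bin GenC (psi S) (psi U)))"
proof -
  have fin: "finite L" unfolding L using fin_labels v by simp
  have d': "verts T \<inter> verts S = {}" using d by auto
  have c: "bin GenC (psi S) (psi T) = bin GenC (psi T) (psi S)" by (rule bin_commute(1)[OF psi_closed[OF v(1)] psi_closed[OF v(2)]])
  have "eqv L (bin GenC (bin GenC (psi T) (psi S)) (psi U)) (bin GenC (psi T) (bin GenC (psi S) (psi U)))"
    by (rule psi_relations(3)[OF v(2,1,3) d' d(3,2)]) (simp add: L Un_ac)
  then show ?thesis
    using eqv_trans[OF fin eqv_sym[OF fin psi_relations(3)[OF v d L]]] unfolding c by blast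
qed

text \<open>If two normal forms begin with the same cut, their pieces agree and induction applies to
  these. Otherwise the part removed by the second cut lies untouched in what the first cut left, so
  both can be compared with one decomposition into three parts.\<close>

lemma uniq_valid: "valid F \<Longrightarrow> uniq F"
proof (induction rule: forest_induct)
  case (1 F)
  note h = validD(1)[OF 1(2)]
  have IH: "uniq G" if "valid G" "(G, F) \<in> smaller" for G using 1(1) that by blast
  have small: "uniq G" if "valid G" "card (verts G) < card (verts F)" for G
    by (rule IH[OF that(1)]) (use that(2) in \<open>simp add: smaller_iff\<close>)
  have fL: "finite (labels F)" by (rule fin_labels[OF 1(2)])
  note tr = eqv_trans[OF fL] and sy = eqv_sym[OF fL]
  obtain r where r: "r \<in> roots F" using roots_nonempty[OF h] by auto
  show ?case unfolding uniq_def
  proof (intro allI impI)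
    fix p q assume p: "rep F p" and q: "rep F q"
    show "eqv (labels F) p q"
    proof (cases "roots F = {r}")
      case False
      then have nr: "roots F \<noteq> {x}" for x using r by auto
      obtain S T p1 p2 s where S: "F = munion S T" "p = bin GenC p1 p2" "rep S p1" "rep T p2" "verts S \<inter> verts T = {}" "roots S = {s}"
        by (rule rep_munionE[OF p nr])
      obtain S' T' q1 q2 s' where S': "F = munion S' T'" "q = bin GenC q1 q2" "rep S' q1" "rep T' q2" "verts S' \<inter> verts T' = {}" "roots S' = {s'}"
        by (rule rep_munionE[OF q nr])
      have v: "valid S" "valid T" "valid S'" "valid T'" using rep_valid S S' by auto
      note hv = validD(1)[OF v(1)] validD(1)[OF v(2)] validD(1)[OF v(3)] validD(1)[OF v(4)]
      have dTS: "verts T \<inter> verts S = {}" using S(5) by auto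
      have dTS': "verts T' \<inter> verts S' = {}" using S'(5) by auto
      have cF: "card (verts F) = card (verts S) + card (verts T)" "card (verts F) = card (verts S') + card (verts T')"
        using card_verts_ops(2)[OF v(1,2) S(5), folded S(1)] card_verts_ops(2)[OF v(3,4) S'(5), folded S'(1)] .
      have c: "card (verts S) < card (verts F)" "card (verts T) < card (verts F)" "card (verts S') < card (verts F)" "card (verts T') < card (verts F)"
        using cF card_verts_ops(4)[OF v(1,2) S(5)] card_verts_ops(4)[OF v(2,1) dTS]
          card_verts_ops(4)[OF v(3,4) S'(5)] card_verts_ops(4)[OF v(4,3) dTS'] by linarith+
      note u = small[OF v(1) c(1)] small[OF v(2) c(2)] small[OF v(3) c(3)] small[OF v(4) c(4)]
      have L: "labels F = labels S \<union> labels T" "labels F = labels S' \<union> labels T'"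
        by (simp add: S(1), simp add: S'(1))
      have ep: "eqv (labels F) p (bin GenC (psi S) (psi T))" unfolding S(2) by (rule rep_bin_eqv[OF S(3,4,5) u(1,2) L(1)])
      have eq: "eqv (labels F) q (bin GenC (psi S') (psi T'))" unfolding S'(2) by (rule rep_bin_eqv[OF S'(3,4,5) u(3,4) L(2)])
      have "eqv (labels F) (bin GenC (psi S) (psi T)) (bin GenC (psi S') (psi T'))"
      proof (cases "s = s'")
        case True
        then have "S = S' \<and> T = T'" using munion_inject[OF hv(1,2) S(5) hv(3,4) S'(5)] S(1,6) S'(1,6) by simp
        then show ?thesis using eqv_refl[OF fL] by simp
      next
        case ne: False
        have "s' \<in> roots F" by (simp add: S'(1) S'(6))
        then have s': "s' \<in> roots T" using ne by (simp add: S(1) S(6))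
        show ?thesis
        \<comment> \<open>If \<open>T\<close> is a single tree, the forest has only two components
          and the cuts differ by the order of the factors; otherwise a third part is left
          over.\<close>
        proof (cases "roots T = {s'}")
          case True
          have "munion T S = munion S' T'" using S(1) S'(1) munion_commute[of S T] by simp
          then have "T = S' \<and> S = T'" using munion_inject[OF hv(2,1) dTS hv(3,4) S'(5)] True S'(6) by simp
          then show ?thesis using bin_commute(1)[OF psi_closed[OF v(1)] psi_closed[OF v(2)]] eqv_refl[OF fL] by simp
        next
          case False
          obtain S0 T0 where T: "T = munion S0 T0" "verts S0 \<inter> verts T0 = {}" "roots S0 = {s'}" "valid S0" "valid T0"
            by (rule cut_munion[OF v(2) s' False])
          have d: "verts S \<inter> verts S0 = {}" "verts S \<inter> verts T0 = {}" using S(5) T(1) by auto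
          have d': "verts S0 \<inter> verts (munion S T0) = {}" "verts S0 \<inter> verts S = {}" using d T(2) by auto
          have vm: "valid (munion S T0)" by (rule valid_munion[OF v(1) T(5) d(2)])
          have "munion S0 (munion S T0) = munion S' T'"
            using S(1) S'(1) T(1) munion_left_commute[of S S0 T0] by simp
          then have e: "S0 = S' \<and> munion S T0 = T'"
            using munion_inject[OF validD(1)[OF T(4)] validD(1)[OF vm] d'(1) hv(3,4) S'(5)] T(3) S'(6) by simp
          have lT: "labels T = labels S0 \<union> labels T0" unfolding T(1) by simp
          have e1: "eqv (labels T) (psi T) (bin GenC (psi S0) (psi T0))"
            using rep_bin_eqv[of S0 "psi S0" T0 "psi T0"] uniqD[OF u(2)] rep_munion[OF psi_rep[OF T(4)] psi_rep[OF T(5)] T(2,3)]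
              eqv_sym[OF fin_labels[OF v(2)]] unfolding T(1)[symmetric] by blast
          have e2: "eqv (labels T') (bin GenC (psi S) (psi T0)) (psi T')"
            using uniqD[OF u(4)] rep_munion[OF psi_rep[OF v(1)] psi_rep[OF T(5)] d(2) S(6)] e by simp
          have b1: "eqv (labels F) (bin GenC (psi S) (psi T)) (bin GenC (psi S) (bin GenC (psi S0) (psi T0)))"
            by (rule eqv_binL[OF eqv_refl[OF fin_labels[OF v(1)]] e1 psi_closed[OF v(1)] psi_closed[OF v(2)]
                  fin_labels[OF v(1)] fin_labels[OF v(2)] labels_disjoint[OF S(5)] L(1)])
          have b2: "eqv (labels F) (bin GenC (psi S) (bin GenC (psi S0) (psi T0))) (bin GenC (psi S0) (bin GenC (psi S) (psi T0)))"
            by (rule psi_C_left_commute[OF v(1) T(4,5) d T(2)]) (simp add: L(1) lT Un_ac)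
          have lT': "labels T' = labels S \<union> labels T0" by (simp add: e[THEN conjunct2, symmetric])
          have b3: "eqv (labels F) (bin GenC (psi S0) (bin GenC (psi S) (psi T0))) (bin GenC (psi S') (psi T'))"
            using eqv_binL[OF eqv_refl[OF fin_labels[OF v(3)]] e2 psi_closed[OF v(3)] bin_psi_closed[OF v(1) T(5) d(2) lT']
                  fin_labels[OF v(3)] fin_labels[OF v(4)] labels_disjoint[OF S'(5)] L(2)] e by simp
          show ?thesis by (rule tr[OF b1 tr[OF b2 b3]])
        qed
      qed
      then show ?thesis using tr[OF ep tr[OF _ sy[OF eq]]] by blast
    next
      case root: True
      have rF: "r \<in> verts F" using r roots_verts[OF h] by auto
      consider "incoming F r = {}" | b where "r = Black b" "card (incoming F r) = 2"
        | "incoming F r \<noteq> {}" "r \<in> range Black \<Longrightarrow> card (incoming F r) \<noteq> 2"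
        by blast
      then show ?thesis
      proof cases
        case 1: 1
        obtain l where l: "r = White l" "p = tb (Leaf l)" by (rule rep_singleE[OF p root 1])
        obtain m where m: "r = White m" "q = tb (Leaf m)" by (rule rep_singleE[OF q root 1])
        show ?thesis using l m eqv_refl[OF fL] by simp
      next
        case (2 b)
        obtain S T p1 p2 where S: "F = join (Black b) S T" "p = bin GenG p1 p2" "rep S p1" "rep T p2" "verts S \<inter> verts T = {}"
          "Black b \<notin> verts S" "Black b \<notin> verts T"
          using rep_joinE[OF p, of b] root 2 by metis
        obtain S' T' q1 q2 where S': "F = join (Black b) S' T'" "q = bin GenG q1 q2" "rep S' q1" "rep T' q2" "verts S' \<inter> verts T' = {}"
          "Black b \<notin> verts S'" "Black b \<notin> verts T'"
          using rep_joinE[OF q, of b] root 2 by metis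
        have v: "valid S" "valid T" "valid S'" "valid T'" using rep_valid S S' by auto
        note hv = validD(1)[OF v(1)] validD(1)[OF v(2)] validD(1)[OF v(3)] validD(1)[OF v(4)]
        have c: "card (verts S) < card (verts F)" "card (verts T) < card (verts F)" "card (verts S') < card (verts F)" "card (verts T') < card (verts F)"
          using card_verts_ops(3)[OF v(1,2) S(5-7), folded S(1)] card_verts_ops(3)[OF v(3,4) S'(5-7), folded S'(1)] by linarith+
        note u = small[OF v(1) c(1)] small[OF v(2) c(2)] small[OF v(3) c(3)] small[OF v(4) c(4)]
        have L: "labels F = labels S \<union> labels T" unfolding S(1) by simp
        have L': "labels F = labels S' \<union> labels T'" unfolding S'(1) by simp
        have ep: "eqv (labels F) p (bin GenG (psi S) (psi T))" unfolding S(2) by (rule rep_bin_eqv[OF S(3,4,5) u(1,2) L])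
        have eq: "eqv (labels F) q (bin GenG (psi S') (psi T'))" unfolding S'(2) by (rule rep_bin_eqv[OF S'(3,4,5) u(3,4) L'])
        have "S = S' \<and> T = T' \<or> S = T' \<and> T = S'"
          by (rule join_inject[OF hv(1,2) S(5-7) hv(3,4) S'(5-7)]) (use S(1) S'(1) in simp)
        then have "bin GenG (psi S) (psi T) = bin GenG (psi S') (psi T')"
          using bin_commute(2)[OF psi_closed[OF v(1)] psi_closed[OF v(2)]] by auto
        then show ?thesis using tr[OF ep] sy[OF eq] by simp
      next
        case 3
        obtain S T p1 p2 f where S: "F = attach r S T" "p = bin GenX p1 p2 - (\<Sum>v\<in>verts S - {r}. f v)" "rep S p1" "rep T p2"
          "verts S \<inter> verts T = {}" "roots S = {r}" "\<And>v. v \<in> verts S - {r} \<Longrightarrow> rep (attach v S T) (f v)"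
          by (rule rep_attachE[OF p root 3(1)]) (erule 3(2), (rule that; simp))
        obtain S' T' q1 q2 g where S': "F = attach r S' T'" "q = bin GenX q1 q2 - (\<Sum>v\<in>verts S' - {r}. g v)" "rep S' q1" "rep T' q2"
          "verts S' \<inter> verts T' = {}" "roots S' = {r}" "\<And>v. v \<in> verts S' - {r} \<Longrightarrow> rep (attach v S' T') (g v)"
          by (rule rep_attachE[OF q root 3(1)]) (erule 3(2), (rule that; simp))
        have v: "valid S" "valid T" "valid S'" "valid T'" using rep_valid S S' by auto
        note hv = validD(1)[OF v(1)] validD(1)[OF v(2)] validD(1)[OF v(3)] validD(1)[OF v(4)]
        have rS: "r \<in> verts S" "r \<in> verts S'" using root_in[OF hv(1) S(6)] root_in[OF hv(3) S'(6)] by auto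
        have rT: "r \<notin> verts T" "r \<notin> verts T'" using rS S(5) S'(5) by auto
        have eqF: "attach r S T = attach r S' T'" using S(1) S'(1) by simp
        show ?thesis
        proof (cases "roots T = roots T'")
          case True
          have ST: "S' = S" "T' = T" using attach_inject[OF hv(1,2) S(5) rS(1) hv(3,4) S'(5) rS(2) eqF True] by auto
          have dTS: "verts T \<inter> verts S = {}" using S(5) by auto
          have c: "card (verts S) < card (verts F)" "card (verts T) < card (verts F)"
            using card_verts_ops(1)[OF v(1,2) S(5), of r, folded S(1)] card_verts_ops(4)[OF v(1,2) S(5)] card_verts_ops(4)[OF v(2,1) dTS]
            by linarith+
          note u = small[OF v(1) c(1)] small[OF v(2) c(2)]
          have L: "labels F = labels S \<union> labels T" unfolding S(1) by simp
          have e1: "eqv (labels F) (bin GenX p1 p2) (bin GenX q1 q2)"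
            by (rule tr[OF rep_bin_eqv[OF S(3,4,5) u L] sy[OF rep_bin_eqv[OF S'(3,4)[unfolded ST] S(5) u L]]])
          have "eqv (labels F) (f x) (g x)" if x: "x \<in> verts S - {r}" for x
          proof -
            have xS: "x \<in> verts S" "x \<noteq> r" using x by auto
            have "uniq (attach x S T)"
            proof (rule IH)
              show "valid (attach x S T)" by (rule valid_attach[OF v(1,2) S(5) xS(1)])
              show "(attach x S T, F) \<in> smaller"
                unfolding smaller_iff S(1)
                using card_verts_ops(1)[OF v(1,2) S(5)] rdeg_attach[OF hv(1,2) S(5) xS(1) S(6)] rdeg_attach[OF hv(1,2) S(5) rS(1) S(6)] xS(2) by simp
            qed
            then have "eqv (labels (attach x S T)) (f x) (g x)" using S(7)[OF x] S'(7)[of x] x ST unfolding uniq_def by simp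
            then show ?thesis using L by simp
          qed
          then have "eqv (labels F) (\<Sum>x\<in>verts S - {r}. f x) (\<Sum>x\<in>verts S - {r}. g x)" by (rule eqv_sum[OF fL])
          then show ?thesis unfolding S(2) S'(2) ST(1) by (rule eqv_diff[OF fL e1])
        next
          case ne: False
          \<comment> \<open>The edge cut by the other normal form; differing from the one removed
            here, it is still an edge at the root of \<open>S\<close>.\<close>
          let ?e = "insert r (roots T')"
          have "?e \<noteq> insert r (roots T)"
            using ne insert_ident[of r "roots T" "roots T'"] rT roots_verts[OF hv(2)] roots_verts[OF hv(4)] by auto
          moreover have "?e \<in> incoming (attach r S T) r" unfolding eqF incoming_attach[OF hv(3,4) S'(5) rS(2)] by simp
          ultimately have e: "?e \<in> incoming S r"
            unfolding incoming_attach[OF hv(1,2) S(5) rS(1)] incoming_notin[OF hv(2) rT(1)] by simp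
          have cS: "2 \<le> card (incoming S r)" if "r \<in> range Black" using validD(3)[OF v(1)] that rS(1) by auto
          show ?thesis
          \<comment> \<open>The exceptional case is that of a black root with three edges in all:
            cutting \<open>?e\<close> from \<open>S\<close> would leave it with one.\<close>
          proof (cases "r \<in> range Black \<and> card (incoming S r) = 2")
            case False
            then have c3: "r \<in> range Black \<Longrightarrow> 3 \<le> card (incoming S r)" using cS by fastforce
            obtain S0 T0 where S0: "S = attach r S0 T0" "verts S0 \<inter> verts T0 = {}" "r \<in> verts S0" "insert r (roots T0) = ?e"
              "valid S0" "valid T0" "roots S0 = roots S"
              by (rule cut_attach[OF v(1) e c3])
            note h0 = validD(1)[OF S0(5)] validD(1)[OF S0(6)]
            have d: "verts S0 \<inter> verts T = {}" "verts T0 \<inter> verts T = {}" "verts T \<inter> verts T0 = {}" using S(5) S0(1) by auto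
            have rT0: "r \<notin> verts T0" using S0(2,3) by auto
            have RT: "roots T0 = roots T'"
              using S0(4) insert_ident[of r "roots T0" "roots T'"] rT(2) rT0 roots_verts[OF hv(4)] roots_verts[OF h0(2)] by auto
            have F: "F = attach r (attach r S0 T) T0" using S(1) S0(1) attach_commute[of r r S0 T0 T] by simp
            have va: "valid (attach r S0 T)" by (rule valid_attach[OF S0(5) v(2) d(1) S0(3)])
            have da: "verts (attach r S0 T) \<inter> verts T0 = {}" using S0(2) d by auto
            have ra: "r \<in> verts (attach r S0 T)" using S0(3) by simp
            have ST': "attach r S0 T = S' \<and> T0 = T'"
              by (rule attach_inject[OF validD(1)[OF va] h0(2) da ra hv(3,4) S'(5) rS(2) _ RT]) (use F S'(1) in simp)
            have r0: "roots S0 = {r}" using S0(7) S(6) by simp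
            have L: "labels F = labels S0 \<union> labels T0 \<union> labels T" "labels F = labels S0 \<union> labels T \<union> labels T0"
              by (simp add: S(1) S0(1), simp add: S(1) S0(1) Un_ac)
            have "eqv (labels F) p (brace S0 r T0 T)"
              unfolding S(2) S0(1)
              by (rule rep_brace[OF S0(5,6) v(2) S0(2) d(1,2) r0 _ _ S(4) _ L(1)]) (use IH S S0(1) in auto)
            moreover have "eqv (labels F) q (brace S0 r T T0)"
              unfolding S'(2) conjunct1[OF ST', symmetric]
              by (rule rep_brace[OF S0(5) v(2) S0(6) d(1) S0(2) d(3) r0 _ _ _ _ L(2)]) (use IH S' ST' in auto)
            moreover have "eqv (labels F) (brace S0 r T0 T) (brace S0 r T T0)"
              by (rule brace_commute[OF S0(5,6) v(2) S0(2) d(1,2) L(1)])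
            ultimately show ?thesis using tr sy by blast
          next
            case True
            then obtain b where b: "r = Black b" and two: "card (incoming S (Black b)) = 2" by auto
            obtain S0 T0 where S0: "S = join (Black b) S0 T0" "verts S0 \<inter> verts T0 = {}" "Black b \<notin> verts S0" "Black b \<notin> verts T0"
              "insert (Black b) (roots T0) = ?e" "valid S0" "valid T0"
              by (rule cut_join[OF v(1) S(6)[unfolded b] two e[unfolded b]]) (simp add: b)
            note h0 = validD(1)[OF S0(6)] validD(1)[OF S0(7)]
            have d: "verts S0 \<inter> verts T = {}" "verts T0 \<inter> verts T = {}" "verts T \<inter> verts T0 = {}" using S(5) S0(1) by auto
            have bT: "Black b \<notin> verts T" using rT(1) b by simp
            have RT: "roots T0 = roots T'"
              using S0(5) insert_ident[of r "roots T0" "roots T'"] rT(2) S0(4) roots_verts[OF hv(4)] roots_verts[OF h0(2)] b by auto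
            have F: "F = attach r (join (Black b) S0 T) T0" using S(1) S0(1) attach_root_join[of "Black b" S0 T0 T] b by simp
            have va: "valid (join (Black b) S0 T)" by (rule valid_join[OF S0(6) v(2) d(1) S0(3) bT])
            have da: "verts (join (Black b) S0 T) \<inter> verts T0 = {}" using S0(2,4) d by auto
            have ra: "r \<in> verts (join (Black b) S0 T)" using b by simp
            have ST': "join (Black b) S0 T = S' \<and> T0 = T'"
              by (rule attach_inject[OF validD(1)[OF va] h0(2) da ra hv(3,4) S'(5) rS(2) _ RT]) (use F S'(1) in simp)
            have L: "labels F = labels S0 \<union> labels T0 \<union> labels T" "labels F = labels S0 \<union> labels T \<union> labels T0"
              by (simp add: S(1) S0(1), simp add: S(1) S0(1) Un_ac)
            have "eqv (labels F) p (bin GenX (bin GenG (psi S0) (psi T0)) (psi T) - bin GenG (bin GenX (psi S0) (psi T)) (psi T0)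
                - bin GenG (psi S0) (bin GenX (psi T0) (psi T)))"
              unfolding S(2) S0(1) b
              by (rule rep_join_attach[OF S0(6,7) v(2) S0(2) d(1,2) S0(3,4) bT _ _ S(4) _ L(1)]) (use IH S S0(1) b in auto)
            moreover have "eqv (labels F) q (bin GenX (bin GenG (psi S0) (psi T)) (psi T0) - bin GenG (bin GenX (psi S0) (psi T0)) (psi T)
                - bin GenG (psi S0) (bin GenX (psi T) (psi T0)))"
              unfolding S'(2) conjunct1[OF ST', symmetric] b
              by (rule rep_join_attach[OF S0(6) v(2) S0(7) d(1) S0(2) d(3) S0(3) bT S0(4) _ _ _ _ L(2)]) (use IH S' ST' b in auto)
            moreover note psi_relations(4)[OF S0(6,7) v(2) S0(2) d(1,2) L(1)]
            ultimately show ?thesis using tr sy by blast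
          qed
        qed
      qed
    qed
  qed
qed

section \<open>The kernel of the morphism\<close>

lemma eqv_linear:
  assumes "pm_linear f" "pm_linear g" "finite L" "u \<in> carrier (free_space X)"
    and "\<And>b. b \<in> X \<Longrightarrow> eqv L (f (basis_vec b)) (g (basis_vec b) :: greg_gen tree set \<Rightarrow>\<^sub>0 'k)"
  shows "eqv L (f u) (g u)"
  using assms(4)
proof (induction rule: free_space_induct)
  case zero
  show ?case using pm_linear_zero[OF assms(1)] pm_linear_zero[OF assms(2)] eqv_refl[OF assms(3)] by simp
next
  case (add u v)
  then show ?case using pm_linear_add[OF assms(1)] pm_linear_add[OF assms(2)] eqv_add[OF assms(3)] by simp
next
  case (scale k u)
  then show ?case using pm_linear_scale[OF assms(1)] pm_linear_scale[OF assms(2)] eqv_scale[OF assms(3)] by simp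
qed (rule assms(5))

lemma uniq_psi: "rep F p \<Longrightarrow> eqv (labels F) p (psi F)"
  using uniqD uniq_valid rep_valid by blast

definition Psi :: "(vertex forest set \<Rightarrow>\<^sub>0 'k) \<Rightarrow> (greg_gen tree set \<Rightarrow>\<^sub>0 'k)" where
  "Psi = lin_ext (\<lambda>s. psi (SOME F. F \<in> s \<and> valid F))"

lemma pm_linear_Psi: "pm_linear Psi"
  unfolding Psi_def by (rule pm_linear_lin_ext)

text \<open>\<open>Psi\<close> uses a representative of its own choice. The normal form of
  \<open>F\<close> is also one of that representative, where uniqueness compares it with the chosen
  one.\<close>

lemma Psi_cls:
  assumes F: "valid F"
  shows "eqv (labels F) (Psi (cls F)) (psi F)" and "Psi (cls F) \<in> t_carrier (labels F)"
proof -
  define G where "G = (SOME G. G \<in> greg_class F \<and> valid G)"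
  have "G \<in> greg_class F \<and> valid G" unfolding G_def by (rule someI[of _ F]) (use F greg_class_self in simp)
  then obtain h where h: "colour_inj h (verts F)" "G = map_forest h F" "valid G" unfolding greg_class_mem by auto
  have l: "labels G = labels F" unfolding h(2) by (rule colour_inj_labels[OF h(1)])
  have "rep G (psi F)" unfolding h(2) by (rule rep_map[OF psi_rep[OF F] h(1)])
  from uniq_psi[OF this] have "eqv (labels F) (psi F) (psi G)" unfolding l .
  moreover have P: "Psi (cls F) = psi G" by (simp add: Psi_def G_def)
  ultimately show "eqv (labels F) (Psi (cls F)) (psi F)" using eqv_sym[OF fin_labels[OF F]] by simp
  show "Psi (cls F) \<in> t_carrier (labels F)" using psi_closed[OF h(3)] unfolding P l .
qed

lemma Psi_closed:
  assumes "u \<in> fg_carrier L" shows "Psi u \<in> t_carrier L"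
proof (rule linear_maps_mem[OF pm_linear_mapsI[OF pm_linear_Psi] assms])
  fix s assume "s \<in> greg_basis L"
  then show "Psi (basis_vec s) \<in> t_carrier L" using Psi_cls(2) unfolding greg_basis_iff by auto
qed

text \<open>With uniqueness available for all forests, the bounds in \<open>psi_munion\<close> and
  \<open>psi_attach\<close> can be met; for g the claim is \<open>rep_join\<close>. The generator y
  is reduced to x by exchanging the factors.\<close>

lemma Psi_gop:
  assumes u: "u \<in> fg_carrier A" and v: "v \<in> fg_carrier B" and d: "A \<inter> B = {}" and fin: "finite A" "finite B"
  shows "eqv (A \<union> B) (Psi (gop a u v)) (bin a (Psi u) (Psi v))"
proof -
  have *: "eqv (A \<union> B) (Psi (gop a u v)) (bin a (Psi u) (Psi v))"
    if a: "a \<noteq> GenY" and u: "u \<in> fg_carrier A" and v: "v \<in> fg_carrier B" and d: "A \<inter> B = {}" and fin: "finite A" "finite B"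
    for a u v A B
  proof (rule eqv_linear[OF _ _ _ u])
    have L: "finite (A \<union> B)" using fin by simp
    then show "finite (A \<union> B)" .
    fix s assume s: "s \<in> greg_basis A"
    show "eqv (A \<union> B) (Psi (gop a (basis_vec s) v)) (bin a (Psi (basis_vec s)) (Psi v))"
    proof (rule eqv_linear[OF _ _ L v])
      fix t assume "t \<in> greg_basis B"
      with s obtain S T where S: "valid S" "valid T" "labels S = A" "labels T = B" "s = greg_class S" "t = greg_class T" "verts S \<inter> verts T = {}"
        by (rule greg_basis_rep2[OF _ _ d])
      note hv = validD(1)[OF S(1)] validD(1)[OF S(2)]
      have "finite (verts S \<union> verts T)" using finite_verts[OF hv(1)] finite_verts[OF hv(2)] by simp
      from ex_fresh_Black[OF this] obtain b where b: "Black b \<notin> verts S" "Black b \<notin> verts T" by auto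
      have e: "eqv (A \<union> B) (bin a (Psi (cls S)) (Psi (cls T))) (bin a (psi S) (psi T))"
        by (rule eqv_binL[OF Psi_cls(1)[OF S(1)] Psi_cls(1)[OF S(2)] psi_closed[OF S(1)] Psi_cls(2)[OF S(2)]])
          (use S fin d in auto)
      have "eqv (A \<union> B) (Psi (gop a (cls S) (cls T))) (bin a (psi S) (psi T))"
      proof (cases a)
        case GenX
        have "Psi (gop a (cls S) (cls T)) = (\<Sum>x\<in>verts S. Psi (cls (attach x S T)))"
          unfolding GenX gop_cls(1)[OF S(1,2,7)] by (rule pm_linear_sum[OF pm_linear_Psi])
        moreover have "eqv (A \<union> B) (\<Sum>x\<in>verts S. Psi (cls (attach x S T))) (\<Sum>x\<in>verts S. psi (attach x S T))"
          by (rule eqv_sum[OF L]) (use Psi_cls(1)[OF valid_attach[OF S(1,2,7)]] S(3,4) in simp)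
        moreover have "eqv (A \<union> B) (bin a (psi S) (psi T)) (\<Sum>x\<in>verts S. psi (attach x S T))"
          unfolding GenX S(3,4)[symmetric] by (rule psi_attach[OF uniq_valid S(1,2,7) order_refl])
        ultimately show ?thesis using eqv_trans[OF L] eqv_sym[OF L] by metis
      next
        case GenC
        have "eqv (A \<union> B) (psi (munion S T)) (bin a (psi S) (psi T))"
          unfolding GenC S(3,4)[symmetric] by (rule psi_munion[OF uniq_valid S(1,2,7) order_refl])
        moreover have "eqv (A \<union> B) (Psi (gop a (cls S) (cls T))) (psi (munion S T))"
          unfolding GenC gop_cls(2)[OF S(1,2,7)] using Psi_cls(1)[OF valid_munion[OF S(1,2,7)]] S(3,4) by simp
        ultimately show ?thesis using eqv_trans[OF L] by blast
      next
        case GenG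
        have "eqv (A \<union> B) (bin a (psi S) (psi T)) (psi (join (Black b) S T))"
          using uniq_psi[OF rep_join[OF psi_rep[OF S(1)] psi_rep[OF S(2)] S(7) b]] S(3,4) GenG by simp
        moreover have "eqv (A \<union> B) (Psi (gop a (cls S) (cls T))) (psi (join (Black b) S T))"
          unfolding GenG gop_cls(3)[OF S(1,2,7) b] using Psi_cls(1)[OF valid_join[OF S(1,2,7) b]] S(3,4) by simp
        ultimately show ?thesis using eqv_trans[OF L] eqv_sym[OF L] by blast
      qed (use a in simp)
      then show "eqv (A \<union> B) (Psi (gop a (basis_vec s) (basis_vec t))) (bin a (Psi (basis_vec s)) (Psi (basis_vec t)))"
        unfolding S(5,6) using e eqv_trans[OF L] eqv_sym[OF L] by blast
    qed (intro pm_linear_compose[OF pm_linear_Psi pm_linear_gop(2)] pm_linear_compose[OF pm_linear_bin(2) pm_linear_Psi])+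
  qed (intro pm_linear_compose[OF pm_linear_Psi pm_linear_gop(1)] pm_linear_compose[OF pm_linear_bin(1) pm_linear_Psi])+
  show ?thesis
  proof (cases "a = GenY")
    case True
    have "tree_class greg_swap (Node GenY s t) = tree_class greg_swap (Node GenX t s)" for s t
      by (rule tree_class_eq) (use tree_eq.swap[of greg_swap GenY s t] in simp)
    then have "bin GenY (Psi u) (Psi v) = bin GenX (Psi v) (Psi u)"
      by (intro pm_linear_eqI2[OF pm_linear_bin(1) pm_linear_bin(2) pm_linear_bin(2) pm_linear_bin(1) Psi_closed[OF u] Psi_closed[OF v]])
        (auto simp: tree_basis_iff)
    then show ?thesis using *[of GenX v B u A] u v d fin True by (simp add: Un_commute Int_commute)
  qed (rule *[OF _ u v d fin])
qed

text \<open>\<open>Psi\<close> is a left inverse of \<open>phi\<close> modulo the ideal: node by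
  node, it turns the operation on forests back into the tree.\<close>

lemma Psi_ev: "distinct (leaves t) \<Longrightarrow> eqv (set (leaves t)) (Psi (ev t)) (tb t)"
proof (induction t)
  case (Leaf l)
  have "eqv {l} (Psi (cls (single (White l)))) (psi (single (White l)))"
    using Psi_cls(1)[OF valid_single, of l] by simp
  moreover have "eqv {l} (tb (Leaf l)) (psi (single (White l)))" using uniq_psi[OF rep_single, of l] by simp
  ultimately show ?case using eqv_trans[of "{l}"] eqv_sym[of "{l}"] by (metis ev.simps(1) finite.emptyI finite.insertI leaves.simps(1) list.set(1) list.simps(15))
next
  case (Node a s t)
  let ?A = "set (leaves s)" and ?B = "set (leaves t)"
  have d: "distinct (leaves s)" "distinct (leaves t)" "?A \<inter> ?B = {}" using Node.prems by auto
  have L: "finite (?A \<union> ?B)" by simp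
  have "eqv (?A \<union> ?B) (Psi (gop a (ev s) (ev t))) (bin a (Psi (ev s)) (Psi (ev t)))"
    by (rule Psi_gop[OF ev_closed[OF d(1)] ev_closed[OF d(2)] d(3)]) simp_all
  moreover have "eqv (?A \<union> ?B) (bin a (Psi (ev s)) (Psi (ev t))) (bin a (tb s) (tb t))"
    by (rule eqv_binL[OF Node.IH(1)[OF d(1)] Node.IH(2)[OF d(2)] _ Psi_closed[OF ev_closed[OF d(2)]] _ _ d(3)])
      (use d(1) tb_closed[OF d(1)] in auto)
  ultimately show ?case using eqv_trans[OF L] by simp
qed

lemma phi_kernel:
  assumes L: "finite L" and p: "p \<in> t_carrier L" and z: "phi p = (0 :: vertex forest set \<Rightarrow>\<^sub>0 'k)"
  shows "p \<in> rel_ideal L"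
proof -
  have "eqv L (Psi (phi p)) p"
  proof (rule eqv_linear[OF pm_linear_compose[OF pm_linear_Psi pm_linear_phi] pm_linear_id L p])
    fix s assume "s \<in> tree_basis greg_swap L"
    then show "eqv L (Psi (phi (basis_vec s))) (basis_vec s)" using Psi_ev by (auto simp: tree_basis_iff phi_tb)
  qed
  then have "eqv L p 0" using eqv_sym[OF L] unfolding z pm_linear_zero[OF pm_linear_Psi] by blast
  then show ?thesis by (simp add: eqv_def)
qed

lemma phi_surj: "valid F \<Longrightarrow> \<exists>p\<in>t_carrier (labels F). phi p = (cls F :: vertex forest set \<Rightarrow>\<^sub>0 'k)"
  using psi_closed phi_rep[OF psi_rep] by blast

end

section \<open>The isomorphism\<close>

lemma FG_simps:
  "op_space FG L = free_space (greg_basis L)" "op_relabel FG L \<sigma> = fgR \<sigma>" "op_comp FG A i B = fgI i"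
  "op_unit FG i = cls (single (White i))"
  by (simp_all add: FG_def fgR_def fgI_def single_def)

lemma phi_epi: "operad_epi FT (FG :: ('k::field, vertex forest set \<Rightarrow>\<^sub>0 'k) operad) (\<lambda>L. phi)"
  unfolding operad_epi_def FG_simps FT_space
proof (intro conjI allI impI ballI)
  interpret normal_form "TYPE('k)" .
  fix L :: "nat set"
  show l: "phi \<in> linear_maps (free_space (tree_basis greg_swap L)) (free_space (greg_basis L) :: ('k, vertex forest set \<Rightarrow>\<^sub>0 'k) module)"
    by (rule pm_linear_mapsI[OF pm_linear_phi], rule phi_closed) simp
  show "phi ` t_carrier L = (fg_carrier L :: (vertex forest set \<Rightarrow>\<^sub>0 'k) set)"
    by (rule pm_linear_ontoI[OF pm_linear_phi l]) (use phi_surj in \<open>auto simp: greg_basis_iff\<close>)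
  show "phi \<zero>\<^bsub>free_space (tree_basis greg_swap L)\<^esub> = \<zero>\<^bsub>free_space (greg_basis L) :: ('k, vertex forest set \<Rightarrow>\<^sub>0 'k) module\<^esub>"
    by (simp add: pm_linear_zero[OF pm_linear_phi])
next
  fix L and \<sigma> :: "nat \<Rightarrow> nat" and p :: "greg_gen tree set \<Rightarrow>\<^sub>0 'k" assume "p \<in> t_carrier L" "finite L \<and> inj_on \<sigma> L"
  then show "phi (op_relabel FT L \<sigma> p) = (fgR \<sigma> (phi p) :: vertex forest set \<Rightarrow>\<^sub>0 'k)" using phi_relabel by blast
next
  fix A i B and p q :: "greg_gen tree set \<Rightarrow>\<^sub>0 'k"
  assume "p \<in> t_carrier (insert i A)" "q \<in> t_carrier B" "finite A \<and> finite B \<and> i \<notin> A \<and> A \<inter> B = {}"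
  then show "phi (op_comp FT A i B p q) = (fgI i (phi p) (phi q) :: vertex forest set \<Rightarrow>\<^sub>0 'k)" using phi_comp by blast
next
  show "phi (op_unit FT i) = (cls (single (White i)) :: vertex forest set \<Rightarrow>\<^sub>0 'k)" for i by (simp add: phi_tb)
qed

theorem theorem27:
  shows "symmetric_operad (FG :: ('k::field_char_0, vertex forest set \<Rightarrow>\<^sub>0 'k) operad) \<and>
    symmetric_operad (ComGreg :: ('k, (greg_gen tree set \<Rightarrow>\<^sub>0 'k) set) operad) \<and>
    operad_isomorphic
      (FG :: ('k, vertex forest set \<Rightarrow>\<^sub>0 'k) operad)
      (ComGreg :: ('k, (greg_gen tree set \<Rightarrow>\<^sub>0 'k) set) operad)"
proof -
  interpret T: operad_with_ideal "FT :: ('k, greg_gen tree set \<Rightarrow>\<^sub>0 'k) operad" rel_ideal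
    by (intro operad_with_ideal.intro operad_with_ideal_axioms.intro symmetric_operad_free_operad operad_ideal_rel_ideal)
  interpret N: normal_form "TYPE('k)" .
  have C: "ComGreg = operad_quotient (FT :: ('k, greg_gen tree set \<Rightarrow>\<^sub>0 'k) operad) rel_ideal"
    by (simp add: ComGreg_def rel_ideal_def)
  note q = T.quotient_epi[folded C]
  interpret E1: operad_epimorphism FT "FG :: ('k, vertex forest set \<Rightarrow>\<^sub>0 'k) operad" "\<lambda>L. phi"
    by unfold_locales (rule phi_epi)
  interpret E2: operad_epimorphism FT "ComGreg :: ('k, (greg_gen tree set \<Rightarrow>\<^sub>0 'k) set) operad" T.coset
    by unfold_locales (rule q)
  have "operad_isomorphic (FG :: ('k, vertex forest set \<Rightarrow>\<^sub>0 'k) operad) (ComGreg :: ('k, (greg_gen tree set \<Rightarrow>\<^sub>0 'k) set) operad)"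
  \<comment> \<open>Both operads are images of the free one, so it remains to see that
    \<open>phi\<close> and the projection to cosets identify the same operations, that is, that the
    kernel of \<open>phi\<close> is the ideal.\<close>
  proof (rule operad_isomorphic_of_epis[OF T.symmetric_operad_axioms phi_epi q])
    fix L and p p' :: "greg_gen tree set \<Rightarrow>\<^sub>0 'k"
    assume L: "finite L" and "p \<in> op_carrier FT L" "p' \<in> op_carrier FT L"
    then have p: "p \<in> t_carrier L" "p' \<in> t_carrier L" by simp_all
    have "T.coset L p = T.coset L p' \<longleftrightarrow> (\<exists>h\<in>rel_ideal L. p = h + p')"
      using T.coset_eq_iff[OF L, of p p'] p by simp
    also have "\<dots> \<longleftrightarrow> p - p' \<in> rel_ideal L"
      by (metis add_diff_cancel_right' diff_add_cancel)
    also have "\<dots> \<longleftrightarrow> phi (p - p') = (0 :: vertex forest set \<Rightarrow>\<^sub>0 'k)"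
      using N.phi_kernel[OF L, of "p - p'"] rel_ideal_kernel[OF L, of "p - p'"] p by (metis free_space_closed(3))
    finally show "phi p = (phi p' :: vertex forest set \<Rightarrow>\<^sub>0 'k) \<longleftrightarrow> T.coset L p = T.coset L p'"
      by (simp add: pm_linear_diff[OF pm_linear_phi])
  qed
  then show ?thesis using E1.symmetric_operad_image E2.symmetric_operad_image by blast
qed

end
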